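(* Let $d$ be a non-zero natural number. If $a=b$ (equal parameters), then the algebra $Z_c$ (the center of the rational Cherednik algebra $H_c$ at $t=0$ of the dihedral group $W$ of order $2d$) admits the following presentation: $\bullet$ Generators: $q$, $Q$, $\boldsymbol{eu}$, $\boldsymbol{a}_0$, $\boldsymbol{a}_1$, \dots, $\boldsymbol{a}_d$. $\bullet$ Relations: $$\begin{cases}\boldsymbol{eu}\,\boldsymbol{a}_i = q\,\boldsymbol{a}_{i+1}+Q\,\boldsymbol{a}_{i-1} & \text{for } 1\le i\le d-1,\\ \boldsymbol{a}_{i-1}\boldsymbol{a}_{j+1}-\boldsymbol{a}_i\boldsymbol{a}_j=(\boldsymbol{eu}^2-4qQ-d^2a^2)\,q^{d-j-1}Q^{i-1}\,\Psi_{j-i}(\boldsymbol{eu},q,Q) & \text{for } 1\le i\le j\le d-1.\end{cases}$$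
   Context: Let $d$ be a non-zero natural number, $\zeta\in\mathbb{C}$ a primitive $d$-th root of unity, $V=\mathbb{C}^2$ with canonical basis $(x,y)$, and $(X,Y)$ the dual basis of $V^*$. For $i\in\mathbb{Z}/d\mathbb{Z}$ let $s_i=\begin{pmatrix}0&\zeta^i\\ \zeta^{-i}&0\end{pmatrix}\in \mathrm{GL}_2(\mathbb{C})$, $s=s_0$, $t=s_1$ and $W=\langle s,t\rangle$, the dihedral group of order $2d$, whose set of reflections is $\mathrm{Ref}(W)=\{s_i \mid i\in\mathbb{Z}/d\mathbb{Z}\}$. It acts by $s_i(x)=\zeta^{-i}y$, $s_i(y)=\zeta^i x$, $s_i(X)=\zeta^iY$, $s_i(Y)=\zeta^{-i}X$. Let $c:\mathrm{Ref}(W)\to\mathbb{C}$ be a map constant on conjugacy classes, and set $a=c_s$, $b=c_t$. The assumption $a=b$ means that $c$ is constant with value $a$ (this is automatic if $d$ is odd). Under this assumption, $H_c$ is the quotient of $T(V\oplus V^* )\rtimes W$ by the relations $[x,y]=[X,Y]=0$, $[x,X]=[y,Y]=-a\sum_i s_i$, $[x,Y]=a\sum_i\zeta^{-i}s_i$, $[y,X]=a\sum_i\zeta^i s_i$ (sums over $i\in\mathbb{Z}/d\mathbb{Z}$). Multiplication gives a vector space isomorphism $\mathbb{C}[x,y]\otimes\mathbb{C}[X,Y]\otimes\mathbb{C}W\simeq H_c$; identify $\mathbb{C}[x,y]\otimes\mathbb{C}[X,Y]$ with $\mathbb{C}[V\times V^*]$. $Z_c$ is the center of $H_c$. Let $\mathrm{Trunc}_c:H_c\to\mathbb{C}[V\times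 V^*]$ be the linear map with $\mathrm{Trunc}_c(fw)=f$ if $w=1$ and $0$ if $w\in W\setminus\{1\}$, for $f\in\mathbb{C}[V\times V^*]$. It is known that $\mathrm{Trunc}_c$ restricts to a linear isomorphism $Z_c\to\mathbb{C}[V\times V^*]^W$, linear over $\mathbb{C}[V]^W\otimes\mathbb{C}[V^*]^W\subset Z_c$. Set $q=xy$, $Q=XY$ (central in $H_c$). The elements $\boldsymbol{eu},\boldsymbol{a}_0,\dots,\boldsymbol{a}_d\in Z_c$ are the unique elements of $Z_c$ with $\mathrm{Trunc}_c(\boldsymbol{eu})=xX+yY$ and $\mathrm{Trunc}_c(\boldsymbol{a}_j)=x^{d-j}Y^j+y^{d-j}X^j$ for $0\le j\le d$. (Explicitly $\boldsymbol{eu}=xX+yY+a\sum_i s_i$.) For $i\ge0$, $\Psi_i\in\mathbb{C}[T,T',T'']$ is the unique polynomial such that, in the commutative ring $\mathbb{C}[x,y,X,Y]$, $\Psi_i(xX+yY,\,xy,\,XY)=\sum_{j=0}^i(xX)^{i-j}(yY)^j$; equivalently $\Psi_0=1$, $\Psi_1=T$, $\Psi_{i+1}=T\Psi_i-T'T''\Psi_{i-1}$ for $i\ge1$.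
   Formalization: The formal theorem assumes d ≥ 2 instead of d non-zero: for d = 1 both families of relations are empty, yet (2eu − a_0a_1)^2 = (a_0^2 − 4q)(a_1^2 − 4Q) + 4a^2 holds in Z_c, so the presentation is false there. *)

theory Defs
  imports
    "HOL-Analysis.Analysis"
    "HOL-Library.Poly_Mapping"
    "HOL-Algebra.QuotRing"
    "HOL-Algebra.Generated_Groups"
begin

section \<open>Free algebras and polynomial algebras over the complex numbers\<close>

text \<open>
  The type \<open>'m \<Rightarrow>\<^sub>0 complex\<close> of finitely supported functions carries the convolution
  product of the (additively written) monoid \<open>'m\<close>.  For \<open>'m = 'v \<Rightarrow>\<^sub>0 nat\<close> this is the
  polynomial algebra in commuting variables \<open>'v\<close>; for the free monoid \<open>'m = 'v fmon\<close> it is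
  the free algebra on \<open>'v\<close>, that is, the tensor algebra of the vector space with basis \<open>'v\<close>.
\<close>

datatype 'v fmon = FMon (letters: "'v list")

instantiation fmon :: (type) monoid_add
begin

definition zero_fmon :: "'a fmon" where
  "0 = FMon []"

definition plus_fmon :: "'a fmon \<Rightarrow> 'a fmon \<Rightarrow> 'a fmon" where
  "u + v = FMon (letters u @ letters v)"

instance
  by standard (auto simp: zero_fmon_def plus_fmon_def)

end

type_synonym 'v free_alg = "'v fmon \<Rightarrow>\<^sub>0 complex"
type_synonym 'v mpoly = "('v \<Rightarrow>\<^sub>0 nat) \<Rightarrow>\<^sub>0 complex"

definition pconst :: "complex \<Rightarrow> ('m::monoid_add \<Rightarrow>\<^sub>0 complex)" where
  "pconst z = Poly_Mapping.single 0 z"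

definition fvar :: "'v \<Rightarrow> 'v free_alg" where
  "fvar v = Poly_Mapping.single (FMon [v]) 1"

definition pvar :: "'v \<Rightarrow> 'v mpoly" where
  "pvar v = Poly_Mapping.single (Poly_Mapping.single v 1) 1"

definition mpoly_ring :: "'v set \<Rightarrow> 'v mpoly ring" where
  "mpoly_ring S =
    \<lparr>carrier = {p. \<forall>m\<in>Poly_Mapping.keys p. Poly_Mapping.keys m \<subseteq> S},
     mult = (*), one = 1, zero = 0, add = (+)\<rparr>"


section \<open>Presentations of complex algebras by commuting generators and relations\<close>

text \<open>
  A complex algebra is given as a ring \<open>A\<close> with its structure map \<open>\<eta>\<close> from the complex
  numbers.  The polynomials in \<open>R\<close> are understood as relations \<open>p = 0\<close>.
\<close>

definition admits_presentation ::
  "('b, 'm) ring_scheme \<Rightarrow> (complex \<Rightarrow> 'b) \<Rightarrow> 'v set \<Rightarrow> ('v \<Rightarrow> 'b) \<Rightarrow> 'v mpoly set \<Rightarrow> bool" where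
  "admits_presentation A \<eta> S g R \<longleftrightarrow>
    (\<exists>\<phi>\<in>ring_hom (mpoly_ring S) A.
      (\<forall>z. \<phi> (pconst z) = \<eta> z) \<and>
      (\<forall>v\<in>S. \<phi> (pvar v) = g v) \<and>
      \<phi> ` carrier (mpoly_ring S) = carrier A \<and>
      a_kernel (mpoly_ring S) A \<phi> = Idl\<^bsub>mpoly_ring S\<^esub> R)"

definition ring_center :: "('b, 'm) ring_scheme \<Rightarrow> ('b, 'm) ring_scheme" where
  "ring_center A =
    A\<lparr>carrier := {z \<in> carrier A. \<forall>h\<in>carrier A. z \<otimes>\<^bsub>A\<^esub> h = h \<otimes>\<^bsub>A\<^esub> z}\<rparr>"


section \<open>The dihedral group\<close>

type_synonym mat2 = "complex^2^2"

definition primitive_root_of_unity :: "nat \<Rightarrow> complex \<Rightarrow> bool" where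
  "primitive_root_of_unity d \<zeta> \<longleftrightarrow> 0 < d \<and> \<zeta> ^ d = 1 \<and> (\<forall>k. 0 < k \<and> k < d \<longrightarrow> \<zeta> ^ k \<noteq> 1)"

definition GL2 :: "mat2 monoid" where
  "GL2 = \<lparr>carrier = {A. invertible A}, mult = (**), one = mat 1\<rparr>"

definition refl_mat :: "complex \<Rightarrow> nat \<Rightarrow> mat2" where
  "refl_mat \<zeta> i = vector [vector [0, \<zeta> ^ i], vector [inverse \<zeta> ^ i, 0]]"

definition dihedral :: "complex \<Rightarrow> mat2 set" where
  "dihedral \<zeta> = generate GL2 {refl_mat \<zeta> 0, refl_mat \<zeta> 1}"

definition reflections :: "nat \<Rightarrow> complex \<Rightarrow> mat2 set" where
  "reflections d \<zeta> = refl_mat \<zeta> ` {..<d}"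

definition conj_invariant :: "nat \<Rightarrow> complex \<Rightarrow> (mat2 \<Rightarrow> complex) \<Rightarrow> bool" where
  "conj_invariant d \<zeta> c \<longleftrightarrow>
    (\<forall>r\<in>reflections d \<zeta>. \<forall>w\<in>dihedral \<zeta>. c (w ** r ** matrix_inv w) = c r)"


section \<open>The algebra \<open>T(V \<oplus> V\<^sup>*) \<rtimes> W\<close>\<close>

text \<open>\<open>(Vx, Vy)\<close> is the canonical basis of \<open>V\<close> and \<open>(VX, VY)\<close> the dual basis of \<open>V\<^sup>*\<close>.\<close>

datatype vgen = Vx | Vy | VX | VY

text \<open>The tautological action of a matrix on \<open>V\<close> and the contragredient action on \<open>V\<^sup>*\<close>.\<close>

fun gl_act_gen :: "mat2 \<Rightarrow> vgen \<Rightarrow> vgen free_alg" where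
  "gl_act_gen A Vx = pconst (A$1$1) * fvar Vx + pconst (A$2$1) * fvar Vy"
| "gl_act_gen A Vy = pconst (A$1$2) * fvar Vx + pconst (A$2$2) * fvar Vy"
| "gl_act_gen A VX = pconst (matrix_inv A$1$1) * fvar VX + pconst (matrix_inv A$1$2) * fvar VY"
| "gl_act_gen A VY = pconst (matrix_inv A$2$1) * fvar VX + pconst (matrix_inv A$2$2) * fvar VY"

definition gl_act :: "mat2 \<Rightarrow> vgen free_alg \<Rightarrow> vgen free_alg" where
  "gl_act A f = (\<Sum>m\<in>Poly_Mapping.keys f.
     pconst (Poly_Mapping.lookup f m) * prod_list (map (gl_act_gen A) (letters m)))"

text \<open>
  An element \<open>F\<close> of \<open>T(V \<oplus> V\<^sup>*) \<rtimes> W\<close> stands for the sum of the \<open>F(w) w\<close> over \<open>w\<close> in \<open>W\<close>.  Its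
  product is \<open>(f u) (g v) = f u(g) (u v)\<close>; it is not the convolution product which the type
  class instance of finitely supported functions would provide (via addition of matrices).
\<close>

type_synonym smash_elt = "mat2 \<Rightarrow>\<^sub>0 vgen free_alg"

definition smash_mult :: "smash_elt \<Rightarrow> smash_elt \<Rightarrow> smash_elt" where
  "smash_mult F G = (\<Sum>u\<in>Poly_Mapping.keys F. \<Sum>v\<in>Poly_Mapping.keys G.
     Poly_Mapping.single (u ** v) (Poly_Mapping.lookup F u * gl_act u (Poly_Mapping.lookup G v)))"

definition smash :: "complex \<Rightarrow> smash_elt ring" where
  "smash \<zeta> =
    \<lparr>carrier = {F. Poly_Mapping.keys F \<subseteq> dihedral \<zeta>},
     mult = smash_mult, one = Poly_Mapping.single (mat 1) 1, zero = 0, add = (+)\<rparr>"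

definition smash_poly :: "vgen free_alg \<Rightarrow> smash_elt" where
  "smash_poly f = Poly_Mapping.single (mat 1) f"

definition smash_comm :: "vgen \<Rightarrow> vgen \<Rightarrow> smash_elt" where
  "smash_comm u v =
     smash_mult (smash_poly (fvar u)) (smash_poly (fvar v))
     - smash_mult (smash_poly (fvar v)) (smash_poly (fvar u))"


section \<open>The rational Cherednik algebra at \<open>t = 0\<close>, its center and truncation\<close>

text \<open>The sum of the \<open>c(s\<^sub>i) z\<^sup>i s\<^sub>i\<close> over \<open>i\<close> modulo \<open>d\<close>, where \<open>z\<^sup>d = 1\<close>.\<close>

definition refl_sum :: "nat \<Rightarrow> complex \<Rightarrow> (mat2 \<Rightarrow> complex) \<Rightarrow> complex \<Rightarrow> smash_elt" where
  "refl_sum d \<zeta> c z =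
    (\<Sum>i<d. Poly_Mapping.single (refl_mat \<zeta> i) (pconst (c (refl_mat \<zeta> i) * z ^ i)))"

definition cherednik_rels :: "nat \<Rightarrow> complex \<Rightarrow> (mat2 \<Rightarrow> complex) \<Rightarrow> smash_elt set" where
  "cherednik_rels d \<zeta> c =
    {smash_comm Vx Vy,
     smash_comm VX VY,
     smash_comm Vx VX + refl_sum d \<zeta> c 1,
     smash_comm Vy VY + refl_sum d \<zeta> c 1,
     smash_comm Vx VY - refl_sum d \<zeta> c (inverse \<zeta>),
     smash_comm Vy VX - refl_sum d \<zeta> c \<zeta>}"

definition cherednik_ideal :: "nat \<Rightarrow> complex \<Rightarrow> (mat2 \<Rightarrow> complex) \<Rightarrow> smash_elt set" where
  "cherednik_ideal d \<zeta> c = Idl\<^bsub>smash \<zeta>\<^esub> (cherednik_rels d \<zeta> c)"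

definition cherednik :: "nat \<Rightarrow> complex \<Rightarrow> (mat2 \<Rightarrow> complex) \<Rightarrow> smash_elt set ring" where
  "cherednik d \<zeta> c = smash \<zeta> Quot cherednik_ideal d \<zeta> c"

definition cherednik_class ::
  "nat \<Rightarrow> complex \<Rightarrow> (mat2 \<Rightarrow> complex) \<Rightarrow> smash_elt \<Rightarrow> smash_elt set" where
  "cherednik_class d \<zeta> c F = cherednik_ideal d \<zeta> c +>\<^bsub>smash \<zeta>\<^esub> F"

definition cherednik_scalar ::
  "nat \<Rightarrow> complex \<Rightarrow> (mat2 \<Rightarrow> complex) \<Rightarrow> complex \<Rightarrow> smash_elt set" where
  "cherednik_scalar d \<zeta> c z = cherednik_class d \<zeta> c (smash_poly (pconst z))"

definition cherednik_center ::
  "nat \<Rightarrow> complex \<Rightarrow> (mat2 \<Rightarrow> complex) \<Rightarrow> smash_elt set ring" where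
  "cherednik_center d \<zeta> c = ring_center (cherednik d \<zeta> c)"

text \<open>
  The linear map sending a commutative monomial in \<open>x, y, X, Y\<close> to the word with the same
  letters in this order; it realises the multiplication map on
  \<open>\<complex>[x,y] \<otimes> \<complex>[X,Y]\<close>, identified with \<open>\<complex>[V \<times> V\<^sup>*]\<close>.
\<close>

definition normal_order :: "vgen mpoly \<Rightarrow> vgen free_alg" where
  "normal_order p = (\<Sum>m\<in>Poly_Mapping.keys p.
     pconst (Poly_Mapping.lookup p m) *
     (fvar Vx ^ Poly_Mapping.lookup m Vx * fvar Vy ^ Poly_Mapping.lookup m Vy *
      fvar VX ^ Poly_Mapping.lookup m VX * fvar VY ^ Poly_Mapping.lookup m VY))"

text \<open>
  The multiplication map from \<open>\<complex>[x,y] \<otimes> \<complex>[X,Y] \<otimes> \<complex>W\<close> to the Cherednik algebra, which is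
  bijective by the PBW theorem; its source consists of the finitely supported functions
  from \<open>W\<close> to \<open>\<complex>[V \<times> V\<^sup>*]\<close>.
\<close>

definition pbw_source :: "complex \<Rightarrow> (mat2 \<Rightarrow>\<^sub>0 vgen mpoly) set" where
  "pbw_source \<zeta> = {P. Poly_Mapping.keys P \<subseteq> dihedral \<zeta>}"

definition pbw ::
  "nat \<Rightarrow> complex \<Rightarrow> (mat2 \<Rightarrow> complex) \<Rightarrow> (mat2 \<Rightarrow>\<^sub>0 vgen mpoly) \<Rightarrow> smash_elt set" where
  "pbw d \<zeta> c P = cherednik_class d \<zeta> c
     (\<Sum>w\<in>Poly_Mapping.keys P. Poly_Mapping.single w (normal_order (Poly_Mapping.lookup P w)))"

definition Trunc ::
  "nat \<Rightarrow> complex \<Rightarrow> (mat2 \<Rightarrow> complex) \<Rightarrow> smash_elt set \<Rightarrow> vgen mpoly" where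
  "Trunc d \<zeta> c h = Poly_Mapping.lookup (the_inv_into (pbw_source \<zeta>) (pbw d \<zeta> c) h) (mat 1)"

definition central_lift ::
  "nat \<Rightarrow> complex \<Rightarrow> (mat2 \<Rightarrow> complex) \<Rightarrow> vgen mpoly \<Rightarrow> smash_elt set" where
  "central_lift d \<zeta> c p = (THE z. z \<in> carrier (cherednik_center d \<zeta> c) \<and> Trunc d \<zeta> c z = p)"


section \<open>Generators and relations\<close>

datatype zgen = Gq | GQ | Geu | Ga nat

definition zgens :: "nat \<Rightarrow> zgen set" where
  "zgens d = {Gq, GQ, Geu} \<union> Ga ` {..d}"

fun zgen_val :: "nat \<Rightarrow> complex \<Rightarrow> (mat2 \<Rightarrow> complex) \<Rightarrow> zgen \<Rightarrow> smash_elt set" where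
  "zgen_val d \<zeta> c Gq = cherednik_class d \<zeta> c (smash_poly (fvar Vx * fvar Vy))"
| "zgen_val d \<zeta> c GQ = cherednik_class d \<zeta> c (smash_poly (fvar VX * fvar VY))"
| "zgen_val d \<zeta> c Geu = central_lift d \<zeta> c (pvar Vx * pvar VX + pvar Vy * pvar VY)"
| "zgen_val d \<zeta> c (Ga j) =
     central_lift d \<zeta> c (pvar Vx ^ (d - j) * pvar VY ^ j + pvar Vy ^ (d - j) * pvar VX ^ j)"

text \<open>\<open>Psi i T T' T''\<close> is the value of the polynomial \<open>\<Psi>\<^sub>i\<close> at elements of a commutative ring.\<close>

fun Psi :: "nat \<Rightarrow> 'r::comm_ring_1 \<Rightarrow> 'r \<Rightarrow> 'r \<Rightarrow> 'r" where
  "Psi 0 T T' T'' = 1"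
| "Psi (Suc 0) T T' T'' = T"
| "Psi (Suc (Suc i)) T T' T'' = T * Psi (Suc i) T T' T'' - T' * T'' * Psi i T T' T''"

lemma Psi_characterization:
  fixes x y X Y :: "'r::comm_ring_1"
  shows "Psi i (x * X + y * Y) (x * y) (X * Y) = (\<Sum>j\<le>i. (x * X) ^ (i - j) * (y * Y) ^ j)"
proof -
  define u v where "u = x * X" and "v = y * Y"
  define S where "S n = (\<Sum>j\<le>n. u ^ (n - j) * v ^ j)" for n
  have S_Suc: "S (Suc n) = u * S n + v ^ Suc n" for n
    by (auto simp: S_def sum_distrib_left Suc_diff_le mult.assoc intro!: sum.cong)
  have "Psi i (u + v) (x * y) (X * Y) = S i \<and>
        Psi (Suc i) (u + v) (x * y) (X * Y) = S (Suc i)"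
  proof (induction i)
    case 0
    show ?case by (simp add: S_Suc) (simp add: S_def)
  next
    case (Suc i)
    have "x * y * (X * Y) = u * v"
      by (simp add: u_def v_def algebra_simps)
    with Suc show ?case
      by (simp add: S_Suc algebra_simps)
  qed
  then show ?thesis
    by (simp add: S_def u_def v_def)
qed

text \<open>
  Both families below are empty for \<open>d = 1\<close>.  In that case they do not present the center,
  which satisfies \<open>(2 eu - a\<^sub>0 a\<^sub>1)\<^sup>2 = (a\<^sub>0\<^sup>2 - 4 q) (a\<^sub>1\<^sup>2 - 4 Q) + 4 a\<^sup>2\<close>; the
  presentation is meant for \<open>d \<ge> 2\<close>.
\<close>

definition center_rels :: "nat \<Rightarrow> complex \<Rightarrow> zgen mpoly set" where
  "center_rels d a =
    {pvar Geu * pvar (Ga i) - (pvar Gq * pvar (Ga (i + 1)) + pvar GQ * pvar (Ga (i - 1)))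
      | i. 1 \<le> i \<and> i \<le> d - 1} \<union>
    {(pvar (Ga (i - 1)) * pvar (Ga (j + 1)) - pvar (Ga i) * pvar (Ga j))
      - (pvar Geu ^ 2 - 4 * pvar Gq * pvar GQ - pconst (of_nat d ^ 2 * a ^ 2))
        * pvar Gq ^ (d - j - 1) * pvar GQ ^ (i - 1) * Psi (j - i) (pvar Geu) (pvar Gq) (pvar GQ)
      | i j. 1 \<le> i \<and> i \<le> j \<and> j \<le> d - 1}"

end

theory Submission
  imports Defs
begin

text \<open>
  At \<open>t = 0\<close> the algebra \<open>H\<^sub>c\<close> acts faithfully on the functions on a set of generic points
  \<open>(u, v, p, r)\<close>: \<open>x\<close> and \<open>y\<close> act by multiplication with \<open>u\<close> and \<open>v\<close>, the group acts by
  substitution, and \<open>X\<close>, \<open>Y\<close> act by Dunkl operators without derivative.  Rescaling the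
  point turns the leading term of an operator into the corresponding polynomial symbol, which
  gives the PBW theorem, and a central element acts as multiplication by an invariant function.

  A central element congruent to \<open>a\<^sub>j\<close> is found among the coefficients of \<open>(x + t Y)\<^sup>d + (y + t X)\<^sup>d\<close>.
  The defect of a linear relation has lower order, and the automorphism \<open>s\<^sub>i \<mapsto> s\<^sub>i\<^sub>+\<^sub>1\<close>, available
  because \<open>a = b\<close>, changes its sign; this leaves no room for corrections.
  The quadratic relations follow from the linear ones and the case \<open>i = j = 1\<close>, which
  is a computation in the function representation.

  The generators generate because their symbols generate the invariant polynomials.  Modulo the relations,
  the polynomial ring is spanned over \<open>\<complex>[q, Q, a\<^sub>0, a\<^sub>d]\<close> by \<open>2 d\<close> elements whose symbols are
  linearly independent, so there are no further relations.
\<close>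

section \<open>Maps out of free algebras\<close>

text \<open>That no correction survives in a linear relation is a count of degrees. The defect has
  weight d + 2 if the Dunkl parameter b counts 2. Its part free of b is zero, as the relation holds
  for symbols. Multiplication by x^d - y^d, which every reflection negates, conjugates b into -b, so
  the function of a word that is central for all b is even in b. The term linear in b, which would
  have degree d, is therefore absent too, and the truncation of the defect has degree below d.
  Monomials on which the half turn acts by -1 have degree at least d, so nothing is left. The same
  bound removes all lower terms from the truncation of the candidates for a_j.

  The constant d^2 a^2 has one source: Q acts by pr plus a^2 times a sum over reflections, and this
  sum times (u^d - v^d)^2 equals d^2 (uv)^(d-1).

  The operators act on arbitrary functions, so indicators of points are available as test functions.
  They separate the group components of an operator because W acts freely on the chosen
  points.\<close>

definition pext :: "('m \<Rightarrow> 'c::zero \<Rightarrow> 'r::comm_monoid_add) \<Rightarrow> ('m \<Rightarrow>\<^sub>0 'c) \<Rightarrow> 'r" where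
  "pext g f = (\<Sum>m\<in>Poly_Mapping.keys f. g m (Poly_Mapping.lookup f m))"

lemma poly_mapping_sum_single:
  fixes f :: "'m \<Rightarrow>\<^sub>0 'c::comm_monoid_add"
  shows "f = (\<Sum>m\<in>Poly_Mapping.keys f. Poly_Mapping.single m (Poly_Mapping.lookup f m))"
proof (rule poly_mapping_eqI)
  fix k
  have "(\<Sum>m\<in>Poly_Mapping.keys f. Poly_Mapping.lookup (Poly_Mapping.single m (Poly_Mapping.lookup f m)) k)
      = (\<Sum>m\<in>Poly_Mapping.keys f. if m = k then Poly_Mapping.lookup f k else 0)"
    by (intro sum.cong) (auto simp: lookup_single)
  also have "\<dots> = Poly_Mapping.lookup f k"
    by (simp add: in_keys_iff)
  finally show "Poly_Mapping.lookup f k = Poly_Mapping.lookup (\<Sum>m\<in>Poly_Mapping.keys f. Poly_Mapping.single m (Poly_Mapping.lookup f m)) k"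
    by (simp add: lookup_sum)
qed

lemma poly_mapping_induct_keys [consumes 1, case_names zero single add]:
  fixes f :: "'m \<Rightarrow>\<^sub>0 'c::comm_monoid_add"
  assumes keys: "Poly_Mapping.keys f \<subseteq> S"
    and zero: "P 0"
    and single: "\<And>m z. m \<in> S \<Longrightarrow> P (Poly_Mapping.single m z)"
    and add: "\<And>f g. P f \<Longrightarrow> P g \<Longrightarrow> P (f + g)"
  shows "P f"
proof -
  have "A \<subseteq> S \<Longrightarrow> P (\<Sum>m\<in>A. Poly_Mapping.single m (Poly_Mapping.lookup f m))" if "finite A" for A
    using that by (induction A rule: finite_induct) (auto simp: zero single add)
  from this[of "Poly_Mapping.keys f"] show ?thesis
    using keys poly_mapping_sum_single[of f] by simp
qed

lemma poly_mapping_induct [case_names zero single add]: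
  fixes f :: "'m \<Rightarrow>\<^sub>0 'c::comm_monoid_add"
  assumes "P 0" and "\<And>m z. P (Poly_Mapping.single m z)"
    and "\<And>f g. P f \<Longrightarrow> P g \<Longrightarrow> P (f + g)"
  shows "P f"
  using poly_mapping_induct_keys[of f UNIV P] assms by auto

lemma pext_zero [simp]: "pext g 0 = 0"
  by (simp add: pext_def)

lemma pext_single [simp]: "g m 0 = 0 \<Longrightarrow> pext g (Poly_Mapping.single m z) = g m z"
  by (cases "z = 0") (simp_all add: pext_def)

text \<open>The coefficient is an argument of \<open>g\<close> and not a scalar factor, because it
  is a complex number for polynomials and words but an element of another algebra for the smash
  product and its normal forms. Additivity of \<open>g m\<close> takes the place of
  linearity.\<close>

lemma pext_add:
  assumes "\<And>m. g m 0 = 0" and "\<And>m x y. g m (x + y) = g m x + g m y"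
  shows "pext g (f + h) = pext g f + pext g h"
  unfolding pext_def by (rule setsum_keys_plus_distrib) (auto simp: assms)

lemma pext_diff:
  fixes g :: "'m \<Rightarrow> 'c::ab_group_add \<Rightarrow> 'r::ab_group_add"
  assumes "\<And>m. g m 0 = 0" and "\<And>m x y. g m (x + y) = g m x + g m y"
  shows "pext g (f - h) = pext g f - pext g h"
  using pext_add[of g "f - h" h] assms by (simp add: algebra_simps)

lemma pext_mult:
  fixes g :: "'m::monoid_add \<Rightarrow> 'c::semiring_0 \<Rightarrow> 'r::semiring_0"
  assumes zero: "\<And>m. g m 0 = 0" and add: "\<And>m x y. g m (x + y) = g m x + g m y"
    and mult: "\<And>m n x y. g (m + n) (x * y) = g m x * g n y"
  shows "pext g (f * h) = pext g f * pext g h"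
proof (induction f rule: poly_mapping_induct)
  case zero
  then show ?case by simp
next
  case (single m z)
  show ?case
    by (induction h rule: poly_mapping_induct)
       (simp_all add: zero mult mult_single pext_add[of g, OF zero add] distrib_left)
next
  case (add f1 f2)
  then show ?case by (simp add: pext_add[of g, OF zero assms(2)] distrib_right)
qed

lemma pext_add_fun: "pext (\<lambda>m z. g m z + h m z) f = pext g f + pext h f"
  by (simp add: pext_def sum.distrib)

lemma pext_superset:
  assumes "finite A" "Poly_Mapping.keys f \<subseteq> A" "\<And>m. g m 0 = 0"
  shows "pext g f = (\<Sum>m\<in>A. g m (Poly_Mapping.lookup f m))"
  unfolding pext_def using assms by (intro sum.mono_neutral_left) (auto simp: in_keys_iff)

lemma pconst_0 [simp]: "pconst 0 = 0"
  and pconst_1 [simp]: "pconst 1 = 1"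
  and pconst_add: "pconst (z + w) = pconst z + pconst w"
  and pconst_diff: "pconst (z - w) = pconst z - pconst w"
  and pconst_uminus: "pconst (- z) = - pconst z"
  and pconst_mult: "pconst (z * w) = pconst z * (pconst w :: 'm::monoid_add \<Rightarrow>\<^sub>0 complex)"
  by (simp_all add: pconst_def single_add mult_single single_diff single_uminus)

lemma pconst_times_single [simp]:
  "pconst z * Poly_Mapping.single m w = Poly_Mapping.single m (z * w)"
  by (simp add: pconst_def mult_single)

lemma pconst_commute: "pconst z * f = f * pconst z"
  by (induction f rule: poly_mapping_induct)
     (auto simp: pconst_def mult_single distrib_left distrib_right mult.commute)

lemma pconst_commute_left: "f * (pconst z * g) = pconst z * (f * g)"
  by (metis mult.assoc pconst_commute)

lemma pconst_collect: "pconst z * (pconst w * f) = pconst (z * w) * f"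
  by (simp add: pconst_mult mult.assoc)

lemma pconst_numeral: "pconst (numeral n) = numeral n"
  by (simp add: pconst_def)

abbreviation fword :: "'v list \<Rightarrow> 'v free_alg" where
  "fword ws \<equiv> prod_list (map fvar ws)"

lemma fword_eq: "fword ws = Poly_Mapping.single (FMon ws) 1"
  by (induction ws) (auto simp: fvar_def mult_single plus_fmon_def zero_fmon_def simp flip: single_one)

lemma single_eq_fword: "Poly_Mapping.single m z = pconst z * fword (letters m)"
  by (simp add: fword_eq)

lemma free_alg_induct [case_names zero const_word add]:
  assumes "P 0" and "\<And>ws z. P (pconst z * fword ws)"
    and "\<And>f g. P f \<Longrightarrow> P g \<Longrightarrow> P (f + g)"
  shows "P f"
  using assms by (induction f rule: poly_mapping_induct) (auto simp: single_eq_fword)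

definition fext :: "(complex \<Rightarrow> 'r::ring_1) \<Rightarrow> ('v \<Rightarrow> 'r) \<Rightarrow> 'v free_alg \<Rightarrow> 'r" where
  "fext \<kappa> g = pext (\<lambda>m z. \<kappa> z * prod_list (map g (letters m)))"

text \<open>Such a \<open>\<kappa>\<close> makes the target a complex algebra. Centrality of its
  values is what lets the scalars of two words be collected, so that \<open>fext\<close> is
  multiplicative.\<close>

locale scalar_map =
  fixes \<kappa> :: "complex \<Rightarrow> 'r::ring_1"
  assumes scalar_add: "\<kappa> (z + w) = \<kappa> z + \<kappa> w"
    and scalar_mult: "\<kappa> (z * w) = \<kappa> z * \<kappa> w"
    and scalar_one [simp]: "\<kappa> 1 = 1"
    and scalar_commute: "\<kappa> z * r = r * \<kappa> z"
begin

lemma scalar_zero [simp]: "\<kappa> 0 = 0"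
  using scalar_add[of 0 0] by simp

lemma fext_add: "fext \<kappa> g (f + h) = fext \<kappa> g f + fext \<kappa> g h"
  unfolding fext_def by (rule pext_add) (auto simp: scalar_add distrib_right)

lemma fext_diff: "fext \<kappa> g (f - h) = fext \<kappa> g f - fext \<kappa> g h"
  unfolding fext_def by (rule pext_diff) (auto simp: scalar_add distrib_right)

lemma fext_zero [simp]: "fext \<kappa> g 0 = 0"
  by (simp add: fext_def)

lemma fext_mult: "fext \<kappa> g (f * h) = fext \<kappa> g f * fext \<kappa> g h"
  unfolding fext_def
proof (rule pext_mult)
  fix m n :: "'a fmon" and x y
  let ?G = "\<lambda>m. prod_list (map g (letters m))"
  have "\<kappa> x * \<kappa> y * (?G m * ?G n) = \<kappa> x * (\<kappa> y * ?G m) * ?G n"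
    by (simp add: mult.assoc)
  also have "\<dots> = \<kappa> x * ?G m * (\<kappa> y * ?G n)"
    by (simp only: scalar_commute[of y "?G m"] mult.assoc)
  finally show "\<kappa> (x * y) * ?G (m + n) = \<kappa> x * ?G m * (\<kappa> y * ?G n)"
    by (simp add: scalar_mult plus_fmon_def)
qed (auto simp: scalar_add distrib_right)

lemma fext_pconst [simp]: "fext \<kappa> g (pconst z) = \<kappa> z"
  by (simp add: fext_def pconst_def zero_fmon_def)

lemma fext_one [simp]: "fext \<kappa> g 1 = 1"
  using fext_pconst[of g 1] by simp

lemma fext_fvar [simp]: "fext \<kappa> g (fvar v) = g v"
  by (simp add: fext_def fvar_def)

lemma fext_fword [simp]: "fext \<kappa> g (fword ws) = prod_list (map g ws)"
  by (induction ws) (auto simp: fext_mult)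

lemma fext_power: "fext \<kappa> g (f ^ n) = fext \<kappa> g f ^ n"
  by (induction n) (auto simp: fext_mult)

end

interpretation pconst: scalar_map "pconst :: complex \<Rightarrow> 'v::type free_alg"
  by standard (simp_all add: pconst_add pconst_mult, rule pconst_commute)

lemma gl_act_eq: "gl_act A = fext pconst (gl_act_gen A)"
  by (simp add: fun_eq_iff gl_act_def fext_def pext_def)

lemma gl_act_hom:
  "gl_act A 0 = 0" "gl_act A 1 = 1" "gl_act A (pconst z) = pconst z"
  "gl_act A (f + g) = gl_act A f + gl_act A g" "gl_act A (f - g) = gl_act A f - gl_act A g"
  "gl_act A (f * g) = gl_act A f * gl_act A g"
  "gl_act A (fvar v) = gl_act_gen A v"
  by (simp_all add: gl_act_eq pconst.fext_add pconst.fext_mult pconst.fext_diff)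

lemma gl_act_fword: "gl_act A (fword ws) = prod_list (map (gl_act_gen A) ws)"
  by (simp add: gl_act_eq)

lemma matrix_inv_unique:
  fixes A :: "'a::comm_ring_1^'n^'n"
  assumes "A ** B = mat 1" "B ** A = mat 1"
  shows "matrix_inv A = B"
proof -
  have "A ** matrix_inv A = mat 1 \<and> matrix_inv A ** A = mat 1"
    unfolding matrix_inv_def by (rule someI[of _ B]) (simp add: assms)
  then have inv: "A ** matrix_inv A = mat 1" by blast
  have "matrix_inv A = (B ** A) ** matrix_inv A"
    by (simp only: assms matrix_mul_lid)
  also have "\<dots> = B"
    by (simp only: matrix_mul_assoc[symmetric] inv matrix_mul_rid)
  finally show ?thesis .
qed

lemma matrix_inv_both:
  fixes A :: "'a::comm_ring_1^'n^'n"
  assumes "invertible A"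
  shows "A ** matrix_inv A = mat 1" "matrix_inv A ** A = mat 1"
proof -
  from assms obtain B where B: "A ** B = mat 1" "B ** A = mat 1"
    by (auto simp: invertible_def)
  have "matrix_inv A = B"
    using B by (rule matrix_inv_unique)
  with B show "A ** matrix_inv A = mat 1" "matrix_inv A ** A = mat 1"
    by simp_all
qed

lemma gl_act_mat_1 [simp]: "gl_act (mat 1) f = f"
proof -
  have inv: "matrix_inv (mat 1 :: mat2) = mat 1"
    by (rule matrix_inv_unique) auto
  have "gl_act_gen (mat 1) v = fvar v" for v
    by (cases v) (simp_all add: inv, simp_all add: mat_def)
  then have "gl_act_gen (mat 1) = fvar"
    by (rule ext)
  then show ?thesis
    by (induction f rule: free_alg_induct) (simp_all add: gl_act_hom gl_act_fword)
qed

lemma matrix_inv_mult: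
  fixes A B :: "'a::field^'n^'n"
  assumes "invertible A" "invertible B"
  shows "matrix_inv (A ** B) = matrix_inv B ** matrix_inv A"
proof -
  have inv: "A ** matrix_inv A = mat 1" "matrix_inv A ** A = mat 1" "B ** matrix_inv B = mat 1" "matrix_inv B ** B = mat 1"
    by (simp_all add: matrix_inv_both assms)
  have "(A ** B) ** (matrix_inv B ** matrix_inv A) = A ** ((B ** matrix_inv B) ** matrix_inv A)"
    and "(matrix_inv B ** matrix_inv A) ** (A ** B) = matrix_inv B ** ((matrix_inv A ** A) ** B)"
    by (simp_all only: matrix_mul_assoc)
  then have "(A ** B) ** (matrix_inv B ** matrix_inv A) = mat 1" "(matrix_inv B ** matrix_inv A) ** (A ** B) = mat 1"
    using inv by simp_all
  then show ?thesis
    by (rule matrix_inv_unique)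
qed

lemma matrix_mult_2:
  fixes A B :: mat2
  shows "(A ** B) $ i $ j = A $ i $ 1 * B $ 1 $ j + A $ i $ 2 * B $ 2 $ j"
  by (simp add: matrix_matrix_mult_def sum_2)

text \<open>On V the coefficients form the columns of the matrix, on the dual space the rows of its
  inverse. Transposition and inversion each reverse a product, so both are left actions.\<close>

lemma gl_act_mult:
  assumes "invertible A" "invertible B"
  shows "gl_act (A ** B) f = gl_act A (gl_act B f)"
proof -
  have gen: "gl_act_gen (A ** B) v = gl_act A (gl_act_gen B v)" for v
    by (cases v) (simp_all add: gl_act_hom matrix_mult_2 matrix_inv_mult[OF assms] pconst_add pconst_collect
        distrib_left distrib_right mult.commute[of "_ :: complex"])
  have "gl_act (A ** B) (fword ws) = gl_act A (gl_act B (fword ws))" for ws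
    by (induction ws) (simp_all add: gl_act_hom gen)
  then show ?thesis
    by (induction f rule: free_alg_induct) (simp_all add: gl_act_hom)
qed

section \<open>The dihedral group and its smash product\<close>

text \<open>Reflections and rotations are indexed by the root of unity and not by its exponent,
  which keeps the multiplication rules free of reduction modulo d.\<close>

definition reflm :: "complex \<Rightarrow> mat2" where
  "reflm \<eta> = vector [vector [0, \<eta>], vector [inverse \<eta>, 0]]"

definition rotm :: "complex \<Rightarrow> mat2" where
  "rotm \<eta> = vector [vector [\<eta>, 0], vector [0, inverse \<eta>]]"

lemma refl_mat_eq: "refl_mat \<zeta> i = reflm (\<zeta> ^ i)"
  by (simp add: refl_mat_def reflm_def power_inverse)

lemma reflm_nth [simp]:
  "reflm \<eta> $ 1 $ 1 = 0" "reflm \<eta> $ 1 $ 2 = \<eta>" "reflm \<eta> $ 2 $ 1 = inverse \<eta>" "reflm \<eta> $ 2 $ 2 = 0"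
  by (simp_all add: reflm_def)

lemma rotm_nth [simp]:
  "rotm \<eta> $ 1 $ 1 = \<eta>" "rotm \<eta> $ 1 $ 2 = 0" "rotm \<eta> $ 2 $ 1 = 0" "rotm \<eta> $ 2 $ 2 = inverse \<eta>"
  by (simp_all add: rotm_def)

lemma mat2_eq_iff:
  "A = B \<longleftrightarrow> A $ 1 $ 1 = B $ 1 $ 1 \<and> A $ 1 $ 2 = B $ 1 $ 2 \<and> A $ 2 $ 1 = B $ 2 $ 1 \<and> A $ 2 $ 2 = B $ 2 $ 2"
  for A B :: mat2
  by (auto simp: vec_eq_iff forall_2)

lemma mat_1_eq_rotm: "mat 1 = rotm 1"
  by (simp add: mat2_eq_iff) (simp add: mat_def)

lemma refl_rot_mult:
  "reflm \<eta> ** reflm \<theta> = rotm (\<eta> / \<theta>)"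
  "rotm \<eta> ** reflm \<theta> = reflm (\<eta> * \<theta>)"
  "reflm \<eta> ** rotm \<theta> = reflm (\<eta> / \<theta>)"
  "rotm \<eta> ** rotm \<theta> = rotm (\<eta> * \<theta>)"
  by (simp_all add: mat2_eq_iff matrix_mult_2 field_simps)

lemma reflm_rotm_inject [simp]:
  "reflm \<eta> = reflm \<theta> \<longleftrightarrow> \<eta> = \<theta>" "rotm \<eta> = rotm \<theta> \<longleftrightarrow> \<eta> = \<theta>"
  by (auto simp: mat2_eq_iff)

lemma reflm_neq_rotm: "\<theta> \<noteq> 0 \<Longrightarrow> reflm \<eta> \<noteq> rotm \<theta>"
  by (auto simp: mat2_eq_iff)

lemma matrix_inv_reflm: "\<eta> \<noteq> 0 \<Longrightarrow> matrix_inv (reflm \<eta>) = reflm \<eta>"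
  by (rule matrix_inv_unique) (simp_all add: refl_rot_mult mat_1_eq_rotm)

lemma matrix_inv_rotm: "\<eta> \<noteq> 0 \<Longrightarrow> matrix_inv (rotm \<eta>) = rotm (inverse \<eta>)"
  by (rule matrix_inv_unique) (simp_all add: refl_rot_mult mat_1_eq_rotm)

lemma invertible_refl_rot: "\<eta> \<noteq> 0 \<Longrightarrow> invertible (reflm \<eta>)" "\<eta> \<noteq> 0 \<Longrightarrow> invertible (rotm \<eta>)"
proof -
  assume "\<eta> \<noteq> 0"
  then have "reflm \<eta> ** reflm \<eta> = mat 1" "rotm \<eta> ** rotm (inverse \<eta>) = mat 1" "rotm (inverse \<eta>) ** rotm \<eta> = mat 1"
    by (simp_all add: refl_rot_mult mat_1_eq_rotm)
  then show "invertible (reflm \<eta>)" "invertible (rotm \<eta>)"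
    unfolding invertible_def by blast+
qed

lemma group_GL2: "group GL2"
proof (rule groupI)
  fix A assume "A \<in> carrier GL2"
  then have "A ** matrix_inv A = mat 1" "matrix_inv A ** A = mat 1"
    by (auto simp: GL2_def matrix_inv_both)
  then show "\<exists>B\<in>carrier GL2. B \<otimes>\<^bsub>GL2\<^esub> A = \<one>\<^bsub>GL2\<^esub>"
    unfolding GL2_def by (auto simp: invertible_def)
next
  fix A B assume "A \<in> carrier GL2" "B \<in> carrier GL2"
  then show "A \<otimes>\<^bsub>GL2\<^esub> B \<in> carrier GL2"
    by (simp add: GL2_def invertible_mult)
next
  have "invertible (mat 1 :: mat2)"
    unfolding invertible_def by (rule exI[of _ "mat 1"]) simp
  then show "\<one>\<^bsub>GL2\<^esub> \<in> carrier GL2"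
    by (simp add: GL2_def)
qed (simp_all add: GL2_def matrix_mul_assoc)

locale dihedral_root =
  fixes d :: nat and \<zeta> :: complex
  assumes d_ge_2: "2 \<le> d" and primitive: "primitive_root_of_unity d \<zeta>"
begin

definition \<mu> :: "complex set" where "\<mu> = {z. z ^ d = 1}"

definition W :: "mat2 set" where "W = dihedral \<zeta>"

lemma d_pos: "0 < d"
  using d_ge_2 by simp

lemma zeta_pow_d: "\<zeta> ^ d = 1"
  using primitive by (simp add: primitive_root_of_unity_def)

lemma mu_pow: "\<eta> \<in> \<mu> \<Longrightarrow> \<eta> ^ d = 1"
  by (simp add: \<mu>_def)

lemma mu_nonzero: "\<eta> \<in> \<mu> \<Longrightarrow> \<eta> \<noteq> 0"
  using d_pos by (auto simp: \<mu>_def power_0_left)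

lemma mu_norm: "\<eta> \<in> \<mu> \<Longrightarrow> norm \<eta> = 1"
  using d_pos power_eq_imp_eq_base[of "norm \<eta>" d 1] by (simp add: \<mu>_def flip: norm_power)

lemma mu_closed:
  "1 \<in> \<mu>" "\<zeta> \<in> \<mu>" "\<eta> \<in> \<mu> \<Longrightarrow> \<theta> \<in> \<mu> \<Longrightarrow> \<eta> * \<theta> \<in> \<mu>" "\<eta> \<in> \<mu> \<Longrightarrow> \<theta> \<in> \<mu> \<Longrightarrow> \<eta> / \<theta> \<in> \<mu>"
  "\<eta> \<in> \<mu> \<Longrightarrow> inverse \<eta> \<in> \<mu>" "\<eta> \<in> \<mu> \<Longrightarrow> \<eta> ^ n \<in> \<mu>"
proof -
  show "\<eta> ^ n \<in> \<mu>" if "\<eta> \<in> \<mu>" for \<eta>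
    using that power_mult[of \<eta> d n] power_mult[of \<eta> n d] by (simp add: \<mu>_def mult.commute)
qed (auto simp: \<mu>_def zeta_pow_d power_mult_distrib power_divide power_inverse)

lemma zeta_powers_inj: "inj_on (\<lambda>i. \<zeta> ^ i) {..<d}"
proof (rule linorder_inj_onI)
  fix i j assume ij: "i < j" "i \<in> {..<d}" "j \<in> {..<d}"
  then have "\<zeta> ^ (j - i) \<noteq> 1"
    using primitive by (auto simp: primitive_root_of_unity_def)
  moreover have "\<zeta> ^ j = \<zeta> ^ i * \<zeta> ^ (j - i)"
    using ij by (simp flip: power_add)
  ultimately show "\<zeta> ^ i \<noteq> \<zeta> ^ j"
    using mu_nonzero[OF mu_closed(2)] by auto
qed auto

text \<open>The d powers of \<zeta> are distinct, and the polynomial of degree d has no further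
  roots.\<close>

lemma mu_eq: "\<mu> = (\<lambda>i. \<zeta> ^ i) ` {..<d}"
  and finite_mu [simp]: "finite \<mu>"
proof -
  have fin: "finite \<mu>"
    unfolding \<mu>_def using d_ge_2 by (intro finite_roots_unity) simp
  have "card \<mu> \<le> d"
    unfolding \<mu>_def using d_ge_2 by (intro card_roots_unity) simp
  moreover have "card ((\<lambda>i. \<zeta> ^ i) ` {..<d}) = d"
    by (simp add: card_image zeta_powers_inj)
  moreover have "(\<lambda>i. \<zeta> ^ i) ` {..<d} \<subseteq> \<mu>"
    using mu_closed by auto
  ultimately show "\<mu> = (\<lambda>i. \<zeta> ^ i) ` {..<d}"
    using fin card_seteq[of \<mu> "(\<lambda>i. \<zeta> ^ i) ` {..<d}"] by simp
  show "finite \<mu>" by (fact fin)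
qed

lemma card_mu: "card \<mu> = d"
  by (simp add: mu_eq card_image zeta_powers_inj)

lemma sum_mu: "(\<Sum>i<d. F (\<zeta> ^ i)) = (\<Sum>\<eta>\<in>\<mu>. F \<eta>)"
  by (simp add: mu_eq sum.reindex zeta_powers_inj)

lemma sum_mu_mult: "\<kappa> \<in> \<mu> \<Longrightarrow> (\<Sum>\<eta>\<in>\<mu>. F (\<kappa> * \<eta>)) = (\<Sum>\<eta>\<in>\<mu>. F \<eta>)"
  by (rule sum.reindex_bij_witness[of _ "\<lambda>\<eta>. inverse \<kappa> * \<eta>" "\<lambda>\<eta>. \<kappa> * \<eta>"])
     (auto simp: mu_closed mu_nonzero)

lemma sum_mu_divide: "\<kappa> \<in> \<mu> \<Longrightarrow> (\<Sum>\<eta>\<in>\<mu>. F (\<kappa> / \<eta>)) = (\<Sum>\<eta>\<in>\<mu>. F \<eta>)"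
  by (rule sum.reindex_bij_witness[of _ "\<lambda>\<eta>. \<kappa> / \<eta>" "\<lambda>\<eta>. \<kappa> / \<eta>"])
     (auto simp: mu_closed mu_nonzero)

lemma sum_mu_inverse: "(\<Sum>\<eta>\<in>\<mu>. F (inverse \<eta>)) = (\<Sum>\<eta>\<in>\<mu>. F \<eta>)"
  using sum_mu_divide[of 1 F] by (simp add: mu_closed inverse_eq_divide)

lemma zeta_pow_eq_1_iff: "\<zeta> ^ n = 1 \<longleftrightarrow> d dvd n"
proof
  assume "\<zeta> ^ n = 1"
  moreover have "\<zeta> ^ n = (\<zeta> ^ d) ^ (n div d) * \<zeta> ^ (n mod d)"
    by (simp flip: power_mult power_add)
  ultimately have "\<zeta> ^ (n mod d) = 1"
    by (simp add: zeta_pow_d)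
  moreover have "n mod d < d"
    using d_pos by simp
  ultimately have "n mod d = 0"
    using primitive by (auto simp: primitive_root_of_unity_def)
  then show "d dvd n" by auto
qed (auto simp: power_mult zeta_pow_d)

lemma sum_mu_power: "(\<Sum>\<eta>\<in>\<mu>. \<eta> ^ n) = (if d dvd n then of_nat d else 0)"
proof (cases "d dvd n")
  case True
  then have "\<eta> ^ n = 1" if "\<eta> \<in> \<mu>" for \<eta>
    using that by (auto simp: power_mult mu_pow)
  with True show ?thesis
    by (simp add: card_mu)
next
  case False
  \<comment> \<open>Translation by \<zeta> permutes \<open>\<mu>\<close>, so the sum is unchanged by
    the factor \<open>\<zeta> ^ n\<close>, which differs from 1 here.\<close>
  have "(\<Sum>\<eta>\<in>\<mu>. \<eta> ^ n) = \<zeta> ^ n * (\<Sum>\<eta>\<in>\<mu>. \<eta> ^ n)"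
    using sum_mu_mult[of \<zeta> "\<lambda>\<eta>. \<eta> ^ n"] by (simp add: mu_closed power_mult_distrib sum_distrib_left)
  with False show ?thesis
    by (simp add: zeta_pow_eq_1_iff)
qed

text \<open>Orthogonality of the characters of \<open>\<mu>\<close>. The ratio is turned into a
  natural power because dividing by \<open>\<eta> ^ n\<close> is multiplying by
  \<open>\<eta> ^ ((d - 1) * n)\<close> on roots of unity.\<close>

lemma sum_mu_power_ratio:
  "(\<Sum>\<eta>\<in>\<mu>. \<eta> ^ m / \<eta> ^ n) = (if m mod d = n mod d then of_nat d else 0)"
proof -
  have eq: "\<eta> ^ m / \<eta> ^ n = \<eta> ^ (m + (d - 1) * n)" if "\<eta> \<in> \<mu>" for \<eta>
  proof -
    have "\<eta> ^ ((d - 1) * n) * \<eta> ^ n = \<eta> ^ (d * n)"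
      using d_pos by (simp add: diff_mult_distrib flip: power_add)
    also have "\<dots> = 1"
      using that by (simp add: power_mult mu_pow)
    finally show ?thesis
      using mu_nonzero[OF that] by (simp add: power_add field_simps)
  qed
  have "d dvd m + (d - 1) * n \<longleftrightarrow> m mod d = n mod d"
  proof -
    have "int (m + (d - 1) * n) = (int m - int n) + int d * int n"
      using d_pos by (cases d) (simp_all add: algebra_simps)
    then have "int d dvd int (m + (d - 1) * n) \<longleftrightarrow> int d dvd (int m - int n) + int d * int n"
      by (simp only:)
    also have "\<dots> \<longleftrightarrow> int d dvd int m - int n"
      by (rule dvd_add_left_iff) simp
    also have "\<dots> \<longleftrightarrow> int m mod int d = int n mod int d"
      by (simp add: mod_eq_dvd_iff)
    finally have "int d dvd int (m + (d - 1) * n) \<longleftrightarrow> int m mod int d = int n mod int d" .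
    then show ?thesis
      unfolding of_nat_dvd_iff by (simp flip: zmod_int)
  qed
  then show ?thesis
    using sum_mu_power[of "m + (d - 1) * n"] by (simp add: eq cong: sum.cong)
qed

lemma W_eq: "W = reflm ` \<mu> \<union> rotm ` \<mu>"
proof
  let ?D = "reflm ` \<mu> \<union> rotm ` \<mu>"
  have car: "?D \<subseteq> carrier GL2"
    by (auto simp: GL2_def invertible_refl_rot mu_nonzero)
  have gens: "refl_mat \<zeta> 0 \<in> ?D" "refl_mat \<zeta> 1 \<in> ?D"
    using mu_closed by (auto simp: refl_mat_eq)
  have inv_refl: "inv\<^bsub>GL2\<^esub> (reflm \<eta>) = reflm \<eta>" if "\<eta> \<in> \<mu>" for \<eta>
    using that by (intro group.inv_equality[OF group_GL2])
      (auto simp: GL2_def invertible_refl_rot mu_nonzero refl_rot_mult mat_1_eq_rotm)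
  show "W \<subseteq> ?D"
  proof
    fix w assume "w \<in> W"
    then have "w \<in> generate GL2 {refl_mat \<zeta> 0, refl_mat \<zeta> 1}"
      by (simp add: W_def dihedral_def)
    then show "w \<in> ?D"
    proof (induction rule: generate.induct)
      case one
      show ?case
        using mu_closed(1) by (auto simp: GL2_def mat_1_eq_rotm)
    next
      case (incl h)
      then show ?case using gens by auto
    next
      case (inv h)
      then consider "h = reflm 1" | "h = reflm \<zeta>"
        by (auto simp: refl_mat_eq)
      then show ?case
        using inv_refl[OF mu_closed(1)] inv_refl[OF mu_closed(2)] mu_closed(1,2) by cases simp_all
    next
      case (eng h1 h2)
      moreover have "h1 \<otimes>\<^bsub>GL2\<^esub> h2 = h1 ** h2"
        by (simp add: GL2_def)
      ultimately show ?case
        by (auto simp: refl_rot_mult mu_closed)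
    qed
  qed
  have W_mult: "g ** h \<in> W" if "g \<in> W" "h \<in> W" for g h
    using generate.eng[of g GL2 "{refl_mat \<zeta> 0, refl_mat \<zeta> 1}" h] that by (simp add: W_def dihedral_def GL2_def)
  have s: "reflm 1 \<in> W" "reflm \<zeta> \<in> W"
    using generate.incl[of _ "{refl_mat \<zeta> 0, refl_mat \<zeta> 1}" GL2] by (auto simp: W_def dihedral_def refl_mat_eq)
  have one: "rotm 1 \<in> W"
    using generate.one[of GL2 "{refl_mat \<zeta> 0, refl_mat \<zeta> 1}"] by (simp add: W_def dihedral_def GL2_def mat_1_eq_rotm)
  have rot: "rotm (\<zeta> ^ i) \<in> W" for i
  proof (induction i)
    case (Suc i)
    have "rotm (\<zeta> ^ Suc i) = (reflm \<zeta> ** reflm 1) ** rotm (\<zeta> ^ i)"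
      by (simp add: refl_rot_mult)
    then show ?case
      by (simp only: W_mult s Suc)
  qed (simp add: one)
  moreover have "reflm (\<zeta> ^ i) \<in> W" for i
  proof -
    have "reflm (\<zeta> ^ i) = rotm (\<zeta> ^ i) ** reflm 1"
      by (simp add: refl_rot_mult)
    then show ?thesis by (simp only: W_mult rot s)
  qed
  ultimately show "?D \<subseteq> W"
    by (auto simp: mu_eq)
qed

lemma W_cases [consumes 1, case_names refl rot]:
  assumes "w \<in> W"
  obtains \<eta> where "\<eta> \<in> \<mu>" "w = reflm \<eta>" | \<eta> where "\<eta> \<in> \<mu>" "w = rotm \<eta>"
  using assms by (auto simp: W_eq)

lemma W_refl: "\<eta> \<in> \<mu> \<Longrightarrow> reflm \<eta> \<in> W" and W_rot: "\<eta> \<in> \<mu> \<Longrightarrow> rotm \<eta> \<in> W"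
  by (auto simp: W_eq)

lemma finite_W [simp]: "finite W"
  by (simp add: W_eq)

lemma W_mult: "g \<in> W \<Longrightarrow> h \<in> W \<Longrightarrow> g ** h \<in> W"
  by (auto simp: W_eq refl_rot_mult mu_closed)

lemma W_one: "mat 1 \<in> W"
  using mu_closed(1) by (auto simp: W_eq mat_1_eq_rotm)

lemma W_invertible: "g \<in> W \<Longrightarrow> invertible g"
  by (auto simp: W_eq invertible_refl_rot mu_nonzero)

lemma gl_act_W_mult: "g \<in> W \<Longrightarrow> h \<in> W \<Longrightarrow> gl_act (g ** h) f = gl_act g (gl_act h f)"
  by (simp add: gl_act_mult W_invertible)

text \<open>Conjugating s_i by s_(i+1) gives s_(i+2), so the values at s_0 and s_1 spread in steps
  of two. The induction therefore carries two consecutive indices.\<close>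

lemma conj_invariant_const:
  assumes c: "conj_invariant d \<zeta> c" and ab: "c (refl_mat \<zeta> 0) = a" "c (refl_mat \<zeta> 1) = a" and "\<eta> \<in> \<mu>"
  shows "c (reflm \<eta>) = a"
proof -
  have "c (reflm (\<zeta> ^ i)) = a \<and> c (reflm (\<zeta> ^ Suc i)) = a" for i
  proof (induction i)
    case 0
    then show ?case using ab by (simp add: refl_mat_eq)
  next
    case (Suc i)
    let ?w = "reflm (\<zeta> ^ Suc i)" and ?r = "reflm (\<zeta> ^ i)"
    have mu: "\<zeta> ^ i \<in> \<mu>" "\<zeta> ^ Suc i \<in> \<mu>"
      using mu_closed(6)[OF mu_closed(2)] by (simp_all only:)
    have z: "\<zeta> \<noteq> 0"
      using mu_nonzero mu_closed(2) by simp
    have "?r \<in> reflections d \<zeta>"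
      using mu(1) unfolding mu_eq by (auto simp: reflections_def refl_mat_eq image_iff)
    moreover have "?w \<in> dihedral \<zeta>"
      using W_refl[OF mu(2)] by (simp add: W_def)
    ultimately have "c (?w ** ?r ** matrix_inv ?w) = c ?r"
      using c by (auto simp: conj_invariant_def)
    moreover have "?w ** ?r ** matrix_inv ?w = reflm (\<zeta> ^ Suc (Suc i))"
      using z by (simp add: matrix_inv_reflm refl_rot_mult)
    ultimately show ?case
      using Suc by simp
  qed
  with \<open>\<eta> \<in> \<mu>\<close> show ?thesis
    by (auto simp: mu_eq)
qed

end

section \<open>The smash product as a ring\<close>

lemma smash_mult_eq:
  "smash_mult F G = pext (\<lambda>u f. pext (\<lambda>v g. Poly_Mapping.single (u ** v) (f * gl_act u g)) G) F"
  by (simp add: smash_mult_def pext_def)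

lemma smash_mult_zero [simp]: "smash_mult 0 G = 0" "smash_mult F 0 = 0"
  by (simp_all add: smash_mult_eq pext_def)

lemma smash_mult_single [simp]:
  "smash_mult (Poly_Mapping.single u f) (Poly_Mapping.single v g) = Poly_Mapping.single (u ** v) (f * gl_act u g)"
proof -
  have "pext (\<lambda>v g. Poly_Mapping.single (u ** v) (f * gl_act u g)) (Poly_Mapping.single v g)
      = Poly_Mapping.single (u ** v) (f * gl_act u g)" for f
    by (rule pext_single) (simp add: gl_act_hom)
  moreover have "pext (\<lambda>v g. Poly_Mapping.single (u ** v) (0 * gl_act u g)) (Poly_Mapping.single v g) = 0"
    by (simp add: pext_def)
  ultimately show ?thesis
    unfolding smash_mult_eq by (subst pext_single) simp_all
qed

lemma smash_mult_distrib:
  "smash_mult (F + F') G = smash_mult F G + smash_mult F' G"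
  "smash_mult F (G + G') = smash_mult F G + smash_mult F G'"
proof -
  let ?g = "\<lambda>u f. pext (\<lambda>v g. Poly_Mapping.single (u ** v) (f * gl_act u g)) G"
  show "smash_mult (F + F') G = smash_mult F G + smash_mult F' G"
    unfolding smash_mult_eq
  proof (rule pext_add)
    fix u x y
    show "?g u (x + y) = ?g u x + ?g u y"
      by (simp add: pext_add_fun[symmetric] distrib_right single_add)
  qed (simp add: pext_def)
  have "pext (\<lambda>v g. Poly_Mapping.single (u ** v) (f * gl_act u g)) (G + G')
      = pext (\<lambda>v g. Poly_Mapping.single (u ** v) (f * gl_act u g)) G
      + pext (\<lambda>v g. Poly_Mapping.single (u ** v) (f * gl_act u g)) G'" for u f
    by (rule pext_add) (simp_all add: gl_act_hom distrib_left single_add)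
  then show "smash_mult F (G + G') = smash_mult F G + smash_mult F G'"
    unfolding smash_mult_eq by (simp add: pext_add_fun)
qed

lemma smash_mult_diff:
  "smash_mult (F - F') G = smash_mult F G - smash_mult F' G"
  "smash_mult F (G - G') = smash_mult F G - smash_mult F G'"
  using smash_mult_distrib(1)[of "F - F'" F' G] smash_mult_distrib(2)[of F "G - G'" G']
  by (simp_all add: algebra_simps)

lemma smash_mult_sum:
  "smash_mult (sum F A) G = (\<Sum>i\<in>A. smash_mult (F i) G)"
  "smash_mult H (sum F A) = (\<Sum>i\<in>A. smash_mult H (F i))"
  by (induction A rule: infinite_finite_induct) (auto simp: smash_mult_distrib)

lemma smash_poly_mult: "smash_mult (smash_poly f) (Poly_Mapping.single w g) = Poly_Mapping.single w (f * g)"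
  by (simp add: smash_poly_def)

lemma smash_comm_eq: "smash_comm u v = smash_poly (fvar u * fvar v - fvar v * fvar u)"
  by (simp add: smash_comm_def smash_poly_def single_diff)

context dihedral_root
begin

abbreviation S where "S \<equiv> smash \<zeta>"

lemma carrier_S: "F \<in> carrier S \<longleftrightarrow> Poly_Mapping.keys F \<subseteq> W"
  by (simp add: smash_def W_def)

lemma S_simps [simp]:
  "mult S = smash_mult" "add S = (+)" "\<zero>\<^bsub>S\<^esub> = 0" "\<one>\<^bsub>S\<^esub> = Poly_Mapping.single (mat 1) 1"
  by (simp_all add: smash_def)

lemma S_induct [consumes 1, case_names zero single add]:
  assumes "F \<in> carrier S"
    and "P 0" and "\<And>w f. w \<in> W \<Longrightarrow> P (Poly_Mapping.single w f)"
    and "\<And>F G. P F \<Longrightarrow> P G \<Longrightarrow> P (F + G)"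
  shows "P F"
  using assms poly_mapping_induct_keys[of F W P] by (simp add: carrier_S)

lemma S_single [simp]: "w \<in> W \<Longrightarrow> Poly_Mapping.single w f \<in> carrier S"
  by (simp add: carrier_S)

lemma S_poly [simp]: "smash_poly f \<in> carrier S"
  by (simp add: smash_poly_def W_one)

lemma S_zero [simp]: "0 \<in> carrier S"
  by (simp add: carrier_S)

lemma S_add: "F \<in> carrier S \<Longrightarrow> G \<in> carrier S \<Longrightarrow> F + G \<in> carrier S"
  using keys_add[of F G] by (auto simp: carrier_S)

lemma S_diff: "F \<in> carrier S \<Longrightarrow> G \<in> carrier S \<Longrightarrow> F - G \<in> carrier S"
  using keys_diff[of F G] by (auto simp: carrier_S)

lemma S_sum: "(\<And>i. i \<in> A \<Longrightarrow> F i \<in> carrier S) \<Longrightarrow> sum F A \<in> carrier S"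
  by (induction A rule: infinite_finite_induct) (auto simp: S_add)

lemma S_mult:
  assumes "F \<in> carrier S" "G \<in> carrier S"
  shows "smash_mult F G \<in> carrier S"
  using assms(1)
proof (induction F rule: S_induct)
  case (single w f)
  show ?case
    using assms(2) by (induction G rule: S_induct) (auto simp: smash_mult_distrib S_add W_mult single)
qed (auto simp: smash_mult_distrib S_add)

lemma smash_mult_assoc:
  assumes "F \<in> carrier S" "G \<in> carrier S" "H \<in> carrier S"
  shows "smash_mult (smash_mult F G) H = smash_mult F (smash_mult G H)"
  using assms(1)
proof (induction F rule: S_induct)
  case (single u f)
  show ?case
    using assms(2)
  proof (induction G rule: S_induct)
    case (single v g)
    show ?case
      using assms(3)
      by (induction H rule: S_induct)
         (simp_all add: smash_mult_distrib gl_act_W_mult \<open>u \<in> W\<close> \<open>v \<in> W\<close> gl_act_hom matrix_mul_assoc mult.assoc)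
  qed (simp_all add: smash_mult_distrib)
qed (simp_all add: smash_mult_distrib)

lemma smash_mult_one:
  assumes "F \<in> carrier S"
  shows "smash_mult (Poly_Mapping.single (mat 1) 1) F = F" "smash_mult F (Poly_Mapping.single (mat 1) 1) = F"
  using assms by (induction F rule: S_induct) (simp_all add: smash_mult_distrib gl_act_hom)

lemma ring_S: "ring S"
proof (rule ringI)
  show "abelian_group S"
  proof (rule abelian_groupI)
    fix F assume F: "F \<in> carrier S"
    show "\<exists>G\<in>carrier S. G \<oplus>\<^bsub>S\<^esub> F = \<zero>\<^bsub>S\<^esub>"
      using S_diff[OF S_zero F] by (intro bexI[of _ "- F"]) simp_all
  qed (simp_all add: S_add add.assoc add.commute)
  show "monoid S"
    by (rule monoidI) (simp_all add: S_mult smash_mult_assoc smash_mult_one W_one)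
qed (simp_all add: smash_mult_distrib)

end

section \<open>The defining relations and the ideal they generate\<close>

locale cherednik_param = dihedral_root +
  fixes c :: "mat2 \<Rightarrow> complex" and a :: complex
  assumes c_const: "\<eta> \<in> \<mu> \<Longrightarrow> c (reflm \<eta>) = a"
begin

definition J :: "smash_elt set" where "J = cherednik_ideal d \<zeta> c"

lemma refl_sum_eq:
  "refl_sum d \<zeta> c 1 = (\<Sum>\<eta>\<in>\<mu>. Poly_Mapping.single (reflm \<eta>) (pconst a))"
  "refl_sum d \<zeta> c \<zeta> = (\<Sum>\<eta>\<in>\<mu>. Poly_Mapping.single (reflm \<eta>) (pconst (a * \<eta>)))"
  "refl_sum d \<zeta> c (inverse \<zeta>) = (\<Sum>\<eta>\<in>\<mu>. Poly_Mapping.single (reflm \<eta>) (pconst (a * inverse \<eta>)))"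
proof -
  have c: "c (reflm (\<zeta> ^ i)) = a" for i
    by (rule c_const) (rule mu_closed(6)[OF mu_closed(2)])
  show "refl_sum d \<zeta> c 1 = (\<Sum>\<eta>\<in>\<mu>. Poly_Mapping.single (reflm \<eta>) (pconst a))"
    using sum_mu[of "\<lambda>\<eta>. Poly_Mapping.single (reflm \<eta>) (pconst a)"]
    by (simp add: refl_sum_def refl_mat_eq c)
  show "refl_sum d \<zeta> c \<zeta> = (\<Sum>\<eta>\<in>\<mu>. Poly_Mapping.single (reflm \<eta>) (pconst (a * \<eta>)))"
    using sum_mu[of "\<lambda>\<eta>. Poly_Mapping.single (reflm \<eta>) (pconst (a * \<eta>))"]
    by (simp add: refl_sum_def refl_mat_eq c)
  show "refl_sum d \<zeta> c (inverse \<zeta>) = (\<Sum>\<eta>\<in>\<mu>. Poly_Mapping.single (reflm \<eta>) (pconst (a * inverse \<eta>)))"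
    using sum_mu[of "\<lambda>\<eta>. Poly_Mapping.single (reflm \<eta>) (pconst (a * inverse \<eta>))"]
    by (simp add: refl_sum_def refl_mat_eq c power_inverse)
qed

lemma refl_sum_carrier: "(\<Sum>\<eta>\<in>\<mu>. Poly_Mapping.single (reflm \<eta>) (f \<eta>)) \<in> carrier S"
  by (intro S_sum) (simp add: W_refl)

lemma cherednik_rels_carrier: "cherednik_rels d \<zeta> c \<subseteq> carrier S"
  unfolding cherednik_rels_def refl_sum_eq smash_comm_eq
  using refl_sum_carrier by (auto intro!: S_add S_diff)

lemma ideal_J: "ideal J S"
  unfolding J_def cherednik_ideal_def
  by (rule ring.genideal_ideal[OF ring_S cherednik_rels_carrier])

lemma rels_in_J: "cherednik_rels d \<zeta> c \<subseteq> J"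
  unfolding J_def cherednik_ideal_def
  by (rule ring.genideal_self[OF ring_S cherednik_rels_carrier])

lemma J_carrier: "F \<in> J \<Longrightarrow> F \<in> carrier S"
  using ideal.Icarr[OF ideal_J] .

lemma J_mult:
  "F \<in> carrier S \<Longrightarrow> G \<in> J \<Longrightarrow> smash_mult F G \<in> J"
  "F \<in> carrier S \<Longrightarrow> G \<in> J \<Longrightarrow> smash_mult G F \<in> J"
  using ideal.I_l_closed[OF ideal_J, of G F] ideal.I_r_closed[OF ideal_J, of G F] by simp_all

lemma J_zero [simp]: "0 \<in> J"
  using additive_subgroup.zero_closed[OF ideal.axioms(1)[OF ideal_J]] by simp

lemma J_add: "F \<in> J \<Longrightarrow> G \<in> J \<Longrightarrow> F + G \<in> J"
  using additive_subgroup.a_closed[OF ideal.axioms(1)[OF ideal_J], of F G] by simp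

lemma J_uminus: "F \<in> J \<Longrightarrow> - F \<in> J"
proof -
  assume F: "F \<in> J"
  have "smash_mult (smash_poly (-1)) F = - F"
    using J_carrier[OF F] by (induction F rule: S_induct)
      (simp_all add: smash_poly_mult smash_mult_distrib single_uminus)
  then show ?thesis
    using J_mult(1)[OF S_poly[of "-1"] F] by simp
qed

text \<open>The factors \<open>h\<close>, \<open>k\<close> and the group element \<open>w\<close>
  place the relation in the middle of an arbitrary word, the form in which letters are sorted
  later.\<close>

lemma commuting_rel_in_J:
  assumes "w \<in> W" and "(u, v) = (Vx, Vy) \<or> (u, v) = (VX, VY)"
  shows "Poly_Mapping.single w (h * (fvar u * fvar v - fvar v * fvar u) * k) \<in> J"
proof -
  have "smash_comm u v \<in> J"
    using rels_in_J assms(2) by (auto simp: cherednik_rels_def)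
  then have "smash_mult (smash_poly h) (smash_mult (smash_comm u v) (Poly_Mapping.single w k)) \<in> J"
    using assms(1) by (intro J_mult) simp_all
  then show ?thesis
    by (simp add: smash_comm_eq smash_poly_mult mult.assoc)
qed

text \<open>The four mixed relations differ only in the coefficient of each reflection. Tabulating
  it lets the straightening of words treat them at once.\<close>

definition rel_coeff :: "vgen \<Rightarrow> vgen \<Rightarrow> complex \<Rightarrow> complex" where
  "rel_coeff u v \<eta> = a * (case (u, v) of (Vx, VX) \<Rightarrow> - 1 | (Vy, VY) \<Rightarrow> - 1 | (Vx, VY) \<Rightarrow> inverse \<eta> | (Vy, VX) \<Rightarrow> \<eta> | _ \<Rightarrow> 0)"

lemma mixed_rel_in_J:
  assumes "w \<in> W" and "u \<in> {Vx, Vy}" "v \<in> {VX, VY}"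
  shows "Poly_Mapping.single w ((fvar u * fvar v - fvar v * fvar u) * k)
      - (\<Sum>\<eta>\<in>\<mu>. Poly_Mapping.single (reflm \<eta> ** w) (pconst (rel_coeff u v \<eta>) * gl_act (reflm \<eta>) k)) \<in> J"
proof -
  have neg: "(\<Sum>\<eta>\<in>\<mu>. Poly_Mapping.single (reflm \<eta>) (pconst (- a))) = - (\<Sum>\<eta>\<in>\<mu>. Poly_Mapping.single (reflm \<eta>) (pconst a))"
    by (simp add: pconst_uminus single_uminus sum_negf)
  have "smash_comm u v - (\<Sum>\<eta>\<in>\<mu>. Poly_Mapping.single (reflm \<eta>) (pconst (rel_coeff u v \<eta>))) \<in> J"
    using rels_in_J assms(2,3) by (auto simp: cherednik_rels_def rel_coeff_def refl_sum_eq neg)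
  then have "smash_mult (smash_comm u v - (\<Sum>\<eta>\<in>\<mu>. Poly_Mapping.single (reflm \<eta>) (pconst (rel_coeff u v \<eta>))))
      (Poly_Mapping.single w k) \<in> J"
    using assms(1) by (intro J_mult) simp_all
  then show ?thesis
    by (simp add: smash_comm_eq smash_poly_mult smash_mult_diff smash_mult_sum)
qed

end

section \<open>The representation by Dunkl operators at \<open>t = 0\<close>\<close>

text \<open>Since the functions are arbitrary, division by a root that vanishes at no point and
  substitution of points lie in one ring of operators, with no localisation of polynomials.\<close>

typedef 'p lop = "{T :: ('p \<Rightarrow> complex) \<Rightarrow> 'p \<Rightarrow> complex.
    \<forall>z \<phi> \<psi>. T (\<lambda>x. z * \<phi> x + \<psi> x) = (\<lambda>x. z * T \<phi> x + T \<psi> x)}"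
  morphisms app Lop
  by (rule exI[of _ "\<lambda>\<phi>. \<phi>"]) simp

setup_lifting type_definition_lop

lemma app_linear: "app L (\<lambda>x. z * \<phi> x + \<psi> x) = (\<lambda>x. z * app L \<phi> x + app L \<psi> x)"
  using app[of L] by simp

lemma app_add: "app L (\<lambda>x. \<phi> x + \<psi> x) x = app L \<phi> x + app L \<psi> x"
  using app_linear[of L 1 \<phi> \<psi>] by (simp add: fun_eq_iff)

lemma app_zero: "app L (\<lambda>x. 0) x = 0"
  using app_add[of L "\<lambda>x. 0" "\<lambda>x. 0" x] by simp

lemma app_scale: "app L (\<lambda>x. z * \<phi> x) x = z * app L \<phi> x"
  using app_linear[of L z \<phi> "\<lambda>x. 0"] by (simp add: fun_eq_iff app_zero)

lemma app_minus: "app L (\<lambda>x. \<phi> x - \<psi> x) x = app L \<phi> x - app L \<psi> x"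
  using app_linear[of L "- 1" \<psi> \<phi>] by (simp add: fun_eq_iff)

lemma app_sum: "app L (\<lambda>x. \<Sum>i\<in>A. \<phi> i x) x = (\<Sum>i\<in>A. app L (\<phi> i) x)"
  by (induction A rule: infinite_finite_induct) (auto simp: app_zero app_add)

lemma lop_eqI: "(\<And>\<phi> x. app L \<phi> x = app M \<phi> x) \<Longrightarrow> L = M"
  by (metis app_inject ext)

instantiation lop :: (type) ring_1
begin

lift_definition zero_lop :: "'a lop" is "\<lambda>\<phi> x. 0" by simp
lift_definition one_lop :: "'a lop" is "\<lambda>\<phi>. \<phi>" by simp
lift_definition plus_lop :: "'a lop \<Rightarrow> 'a lop \<Rightarrow> 'a lop" is "\<lambda>L M \<phi> x. L \<phi> x + M \<phi> x"
  by (simp add: algebra_simps)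
lift_definition minus_lop :: "'a lop \<Rightarrow> 'a lop \<Rightarrow> 'a lop" is "\<lambda>L M \<phi> x. L \<phi> x - M \<phi> x"
  by (simp add: algebra_simps)
lift_definition uminus_lop :: "'a lop \<Rightarrow> 'a lop" is "\<lambda>L \<phi> x. - L \<phi> x"
  by (simp add: algebra_simps)
lift_definition times_lop :: "'a lop \<Rightarrow> 'a lop \<Rightarrow> 'a lop" is "\<lambda>L M \<phi>. L (M \<phi>)"
  by simp

instance
proof
  fix L M N :: "'a lop"
  show "L * (M + N) = L * M + L * N"
    by (rule lop_eqI) (simp add: times_lop.rep_eq plus_lop.rep_eq app_add)
  show "(0::'a lop) \<noteq> 1"
  proof
    assume "(0::'a lop) = 1"
    then have "app (0::'a lop) (\<lambda>x. 1) undefined = app 1 (\<lambda>x. 1) undefined"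
      by simp
    then show False
      by (simp add: zero_lop.rep_eq one_lop.rep_eq)
  qed
qed (rule lop_eqI; simp add: zero_lop.rep_eq one_lop.rep_eq plus_lop.rep_eq minus_lop.rep_eq
      uminus_lop.rep_eq times_lop.rep_eq)+

end

lemmas app_simps [simp] = zero_lop.rep_eq one_lop.rep_eq plus_lop.rep_eq minus_lop.rep_eq
  uminus_lop.rep_eq times_lop.rep_eq

lemma app_sum_lop [simp]: "app (sum L A) \<phi> x = (\<Sum>i\<in>A. app (L i) \<phi> x)"
  by (induction A rule: infinite_finite_induct) auto

lift_definition mulop :: "('p \<Rightarrow> complex) \<Rightarrow> 'p lop" is "\<lambda>f \<phi> x. f x * \<phi> x"
  by (simp add: algebra_simps)

lift_definition compop :: "('p \<Rightarrow> 'p) \<Rightarrow> 'p lop" is "\<lambda>h \<phi> x. \<phi> (h x)"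
  by simp

abbreviation scal :: "complex \<Rightarrow> 'p lop" where "scal z \<equiv> mulop (\<lambda>_. z)"

lemmas app_mulop [simp] = mulop.rep_eq
lemmas app_compop [simp] = compop.rep_eq

lemma mulop_inject [simp]: "mulop f = mulop g \<longleftrightarrow> f = g"
proof
  assume "mulop f = mulop g"
  then have "app (mulop f) (\<lambda>_. 1) = app (mulop g) (\<lambda>_. 1)"
    by simp
  then show "f = g"
    by (simp add: fun_eq_iff)
qed simp

lemma mulop_hom:
  "mulop (\<lambda>x. f x + g x) = mulop f + mulop g" "mulop (\<lambda>x. f x * g x) = mulop f * mulop g"
  "mulop (\<lambda>x. f x - g x) = mulop f - mulop g" "mulop (\<lambda>_. 0) = 0" "mulop (\<lambda>_. 1) = 1"
  by (auto intro!: lop_eqI simp: algebra_simps)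

lemma mulop_power: "mulop (\<lambda>x. f x ^ n) = mulop f ^ n"
  by (induction n) (auto simp: mulop_hom)

lemma mulop_commute: "mulop f * mulop g = mulop g * mulop f"
  by (auto intro!: lop_eqI)

lemma compop_mulop: "compop h * mulop f = mulop (\<lambda>x. f (h x)) * compop h"
  by (auto intro!: lop_eqI)

interpretation scal: scalar_map "scal :: complex \<Rightarrow> 'p lop"
  by standard (auto intro!: lop_eqI simp: algebra_simps app_scale)

lemma scal_commute: "scal z * L = L * scal z"
  by (rule scal.scalar_commute)

lemma scal_commute_left: "L * (scal z * M) = scal z * (L * M)"
  by (metis mult.assoc scal_commute)

text \<open>The condition \<open>norm u \<noteq> norm v\<close> keeps a point off all reflection lines and is stable under \<open>W\<close> and scaling.\<close>

typedef pt = "{(u::complex, v::complex, p::complex, r::complex). u \<noteq> 0 \<and> v \<noteq> 0 \<and> norm u \<noteq> norm v}"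
  by (rule exI[of _ "(1, 2, 0, 0)"]) simp

definition cu :: "pt \<Rightarrow> complex" where "cu z = fst (Rep_pt z)"
definition cv :: "pt \<Rightarrow> complex" where "cv z = fst (snd (Rep_pt z))"
definition cp :: "pt \<Rightarrow> complex" where "cp z = fst (snd (snd (Rep_pt z)))"
definition cr :: "pt \<Rightarrow> complex" where "cr z = snd (snd (snd (Rep_pt z)))"
definition mkpt :: "complex \<Rightarrow> complex \<Rightarrow> complex \<Rightarrow> complex \<Rightarrow> pt" where
  "mkpt u v p r = Abs_pt (u, v, p, r)"

lemma mkpt_coords:
  assumes "u \<noteq> 0" "v \<noteq> 0" "norm u \<noteq> norm v"
  shows "cu (mkpt u v p r) = u" "cv (mkpt u v p r) = v" "cp (mkpt u v p r) = p" "cr (mkpt u v p r) = r"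
  using assms by (simp_all add: cu_def cv_def cp_def cr_def mkpt_def Abs_pt_inverse)

lemma pt_nonzero [simp]: "cu z \<noteq> 0" "cv z \<noteq> 0"
  and pt_norm: "norm (cu z) \<noteq> norm (cv z)"
  using Rep_pt[of z] by (auto simp: cu_def cv_def split: prod.splits)

lemma pt_eqI:
  assumes "cu z = cu y" "cv z = cv y" "cp z = cp y" "cr z = cr y"
  shows "z = y"
  using assms by (simp add: cu_def cv_def cp_def cr_def prod_eq_iff flip: Rep_pt_inject)

text \<open>Scaling by 0 would leave the set of generic points, so the identity is put there as a
  default. Limits are taken over punctured neighbourhoods of 0 and do not see it.\<close>

definition sc :: "complex \<Rightarrow> pt \<Rightarrow> pt" where
  "sc t z = (if t = 0 then z else mkpt (t * cu z) (t * cv z) (t * cp z) (t * cr z))"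

lemma sc_coords:
  assumes "t \<noteq> 0"
  shows "cu (sc t z) = t * cu z" "cv (sc t z) = t * cv z" "cp (sc t z) = t * cp z" "cr (sc t z) = t * cr z"
  using assms mkpt_coords[of "t * cu z" "t * cv z"] pt_norm[of z]
  by (simp_all add: sc_def norm_mult)

lemma sc_inverse: "t \<noteq> 0 \<Longrightarrow> sc t (sc (inverse t) z) = z"
  by (intro pt_eqI) (simp_all add: sc_coords)

text \<open>The coordinates of the new point are the values at the old point of the transformed
  basis vectors. Points thus carry a right action, and substitution, \<open>trop\<close>, is
  multiplicative on W and conjugates multiplication by f into multiplication by the transform of
  f.\<close>

definition act :: "mat2 \<Rightarrow> pt \<Rightarrow> pt" where
  "act A z = (let B = matrix_inv A in
     mkpt (A $ 1 $ 1 * cu z + A $ 2 $ 1 * cv z) (A $ 1 $ 2 * cu z + A $ 2 $ 2 * cv z)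
       (B $ 1 $ 1 * cp z + B $ 1 $ 2 * cr z) (B $ 2 $ 1 * cp z + B $ 2 $ 2 * cr z))"

abbreviation trop :: "mat2 \<Rightarrow> pt lop" where "trop A \<equiv> compop (act A)"

definition refl_pt :: "complex \<Rightarrow> pt \<Rightarrow> pt" where
  "refl_pt \<eta> z = mkpt (cv z / \<eta>) (\<eta> * cu z) (\<eta> * cr z) (cp z / \<eta>)"

text \<open>The parameter is not confined to \<open>\<mu>\<close>: the half turn below uses a square
  root of \<zeta> whose d-th power is -1.\<close>

definition rot_pt :: "complex \<Rightarrow> pt \<Rightarrow> pt" where
  "rot_pt \<eta> z = mkpt (\<eta> * cu z) (cv z / \<eta>) (cp z / \<eta>) (\<eta> * cr z)"

lemma act_refl: "\<eta> \<noteq> 0 \<Longrightarrow> act (reflm \<eta>) z = refl_pt \<eta> z"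
  by (simp add: act_def refl_pt_def Let_def matrix_inv_reflm divide_simps)

lemma act_rot: "\<eta> \<noteq> 0 \<Longrightarrow> act (rotm \<eta>) z = rot_pt \<eta> z"
  by (simp add: act_def rot_pt_def Let_def matrix_inv_rotm divide_simps)

lemma refl_pt_coords:
  assumes "norm \<eta> = 1"
  shows "cu (refl_pt \<eta> z) = cv z / \<eta>" "cv (refl_pt \<eta> z) = \<eta> * cu z" "cp (refl_pt \<eta> z) = \<eta> * cr z" "cr (refl_pt \<eta> z) = cp z / \<eta>"
proof -
  have "\<eta> \<noteq> 0" using assms by auto
  then show "cu (refl_pt \<eta> z) = cv z / \<eta>" "cv (refl_pt \<eta> z) = \<eta> * cu z" "cp (refl_pt \<eta> z) = \<eta> * cr z" "cr (refl_pt \<eta> z) = cp z / \<eta>"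
    using mkpt_coords[of "cv z / \<eta>" "\<eta> * cu z"] pt_norm[of z] assms
    by (simp_all add: refl_pt_def norm_mult norm_divide)
qed

lemma rot_pt_coords:
  assumes "norm \<eta> = 1"
  shows "cu (rot_pt \<eta> z) = \<eta> * cu z" "cv (rot_pt \<eta> z) = cv z / \<eta>" "cp (rot_pt \<eta> z) = cp z / \<eta>" "cr (rot_pt \<eta> z) = \<eta> * cr z"
proof -
  have "\<eta> \<noteq> 0" using assms by auto
  then show "cu (rot_pt \<eta> z) = \<eta> * cu z" "cv (rot_pt \<eta> z) = cv z / \<eta>" "cp (rot_pt \<eta> z) = cp z / \<eta>" "cr (rot_pt \<eta> z) = \<eta> * cr z"
    using mkpt_coords[of "\<eta> * cu z" "cv z / \<eta>"] pt_norm[of z] assms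
    by (simp_all add: rot_pt_def norm_mult norm_divide)
qed

lemma refl_pt_rot_pt_comp:
  assumes "norm \<eta> = 1" "norm \<theta> = 1"
  shows "refl_pt \<theta> (refl_pt \<eta> z) = rot_pt (\<eta> / \<theta>) z" "refl_pt \<theta> (rot_pt \<eta> z) = refl_pt (\<eta> * \<theta>) z"
    "rot_pt \<theta> (refl_pt \<eta> z) = refl_pt (\<eta> / \<theta>) z" "rot_pt \<theta> (rot_pt \<eta> z) = rot_pt (\<eta> * \<theta>) z"
proof -
  have n: "norm (\<eta> / \<theta>) = 1" "norm (\<eta> * \<theta>) = 1"
    using assms by (simp_all add: norm_divide norm_mult)
  have z: "\<eta> \<noteq> 0" "\<theta> \<noteq> 0"
    using assms by auto
  show "refl_pt \<theta> (refl_pt \<eta> z) = rot_pt (\<eta> / \<theta>) z" "refl_pt \<theta> (rot_pt \<eta> z) = refl_pt (\<eta> * \<theta>) z"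
    "rot_pt \<theta> (refl_pt \<eta> z) = refl_pt (\<eta> / \<theta>) z" "rot_pt \<theta> (rot_pt \<eta> z) = rot_pt (\<eta> * \<theta>) z"
    using z by (auto intro!: pt_eqI simp: refl_pt_coords rot_pt_coords assms n divide_simps)
qed

context dihedral_root
begin

text \<open>This is the root x - s x of the reflection s = \<open>reflm \<eta>\<close>, seen as a
  function of the point. It is the denominator in the Dunkl operators.\<close>

definition al :: "complex \<Rightarrow> pt \<Rightarrow> complex" where
  "al \<eta> z = cu z - cv z / \<eta>"

lemma al_nonzero [simp]: "\<eta> \<in> \<mu> \<Longrightarrow> al \<eta> z \<noteq> 0"
  using pt_norm[of z] mu_norm[of \<eta>] by (auto simp: al_def norm_divide dest: arg_cong[of _ _ norm])

text \<open>Conjugation by the reflection at \<eta> takes the reflection at \<theta> to the one at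
  \<open>\<eta> * \<eta> / \<theta>\<close>, so it permutes the roots up to scalars.\<close>

lemma al_refl_pt: "\<eta> \<in> \<mu> \<Longrightarrow> \<theta> \<in> \<mu> \<Longrightarrow> al \<theta> (refl_pt \<eta> z) = - (\<eta> / \<theta>) * al (\<eta> * \<eta> / \<theta>) z"
  using mu_nonzero[of \<eta>] mu_nonzero[of \<theta>] by (simp add: al_def refl_pt_coords mu_norm divide_simps)

text \<open>The parameter \<open>b\<close> is independent of \<open>c\<close> because rescaling a point by \<open>t\<close> changes it to \<open>b / t\<^sup>2\<close>;
  for \<open>b = 0\<close> one obtains the symbols.\<close>

fun genop :: "complex \<Rightarrow> vgen \<Rightarrow> pt lop" where
  "genop b Vx = mulop cu"
| "genop b Vy = mulop cv"
| "genop b VX = mulop cp - scal b * (\<Sum>\<eta>\<in>\<mu>. mulop (\<lambda>z. 1 / al \<eta> z) * compop (refl_pt \<eta>))"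
| "genop b VY = mulop cr + scal b * (\<Sum>\<eta>\<in>\<mu>. mulop (\<lambda>z. inverse \<eta> / al \<eta> z) * compop (refl_pt \<eta>))"

lemma app_genop:
  "app (genop b VX) \<phi> z = cp z * \<phi> z - b * (\<Sum>\<eta>\<in>\<mu>. \<phi> (refl_pt \<eta> z) / al \<eta> z)"
  "app (genop b VY) \<phi> z = cr z * \<phi> z + b * (\<Sum>\<eta>\<in>\<mu>. inverse \<eta> * \<phi> (refl_pt \<eta> z) / al \<eta> z)"
  by simp_all

definition fop :: "complex \<Rightarrow> vgen free_alg \<Rightarrow> pt lop" where
  "fop b = fext scal (genop b)"

lemmas fop_hom = scal.fext_add[of "genop b" for b, folded fop_def] scal.fext_diff[of "genop b" for b, folded fop_def]
  scal.fext_mult[of "genop b" for b, folded fop_def] scal.fext_pconst[of "genop b" for b, folded fop_def]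
  scal.fext_one[of "genop b" for b, folded fop_def] scal.fext_zero[of "genop b" for b, folded fop_def]
  scal.fext_fvar[of "genop b" for b, folded fop_def] scal.fext_power[of "genop b" for b, folded fop_def]

lemma genop_refl:
  assumes \<eta>: "\<eta> \<in> \<mu>"
  shows "trop (reflm \<eta>) * genop b v = fop b (gl_act_gen (reflm \<eta>) v) * trop (reflm \<eta>)"
proof (rule lop_eqI)
  fix \<phi> z
  note simps = act_refl mu_nonzero[OF \<eta>] refl_pt_coords mu_norm[OF \<eta>] fop_hom matrix_inv_reflm
  \<comment> \<open>The sum is reindexed along the involution of \<open>\<mu>\<close> that
    conjugation by \<open>reflm \<eta>\<close> induces on the reflections.\<close>
  have re: "(\<Sum>\<theta>\<in>\<mu>. F \<theta>) = (\<Sum>\<theta>\<in>\<mu>. F (\<eta> * \<eta> / \<theta>))" for F :: "complex \<Rightarrow> complex"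
    using sum_mu_divide[of "\<eta> * \<eta>" F] \<eta> by (simp add: mu_closed)
  have comp: "refl_pt \<theta> (refl_pt \<eta> z) = refl_pt \<eta> (refl_pt (\<eta> * \<eta> / \<theta>) z)" "refl_pt (\<eta> * \<eta> / \<theta>) (refl_pt \<eta> z) = refl_pt \<eta> (refl_pt \<theta> z)"
    and al: "al (\<eta> * \<eta> / \<theta>) (refl_pt \<eta> z) = - (\<theta> / \<eta>) * al \<theta> z" if "\<theta> \<in> \<mu>" for \<theta>
    using that \<eta> mu_nonzero[OF \<eta>] mu_nonzero[OF that] al_refl_pt[OF \<eta>, of "\<eta> * \<eta> / \<theta>" z]
    by (simp_all add: refl_pt_rot_pt_comp mu_norm norm_mult norm_divide mu_closed)
  show "app (trop (reflm \<eta>) * genop b v) \<phi> z = app (fop b (gl_act_gen (reflm \<eta>) v) * trop (reflm \<eta>)) \<phi> z"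
  proof (cases v)
    case VX
    have "(\<Sum>\<theta>\<in>\<mu>. \<phi> (refl_pt \<theta> (refl_pt \<eta> z)) / al \<theta> (refl_pt \<eta> z)) = - \<eta> * (\<Sum>\<theta>\<in>\<mu>. inverse \<theta> * \<phi> (refl_pt \<eta> (refl_pt \<theta> z)) / al \<theta> z)"
      by (subst re, unfold sum_distrib_left, rule sum.cong[OF refl]) (simp add: comp al, simp add: field_simps)
    then have "app (trop (reflm \<eta>) * genop b v) \<phi> z
        = \<eta> * cr z * \<phi> (refl_pt \<eta> z) + b * (\<eta> * (\<Sum>\<theta>\<in>\<mu>. inverse \<theta> * \<phi> (refl_pt \<eta> (refl_pt \<theta> z)) / al \<theta> z))"
      using VX by (simp add: simps app_genop del: genop.simps)
    then show ?thesis
      using VX by (simp add: simps app_genop algebra_simps del: genop.simps)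
  next
    case VY
    have "(\<Sum>\<theta>\<in>\<mu>. inverse \<theta> * \<phi> (refl_pt \<theta> (refl_pt \<eta> z)) / al \<theta> (refl_pt \<eta> z)) = - inverse \<eta> * (\<Sum>\<theta>\<in>\<mu>. \<phi> (refl_pt \<eta> (refl_pt \<theta> z)) / al \<theta> z)"
      by (subst re, unfold sum_distrib_left, rule sum.cong[OF refl]) (use mu_nonzero[OF \<eta>] mu_nonzero in \<open>simp add: comp al, simp add: field_simps\<close>)
    then have "app (trop (reflm \<eta>) * genop b v) \<phi> z
        = inverse \<eta> * cp z * \<phi> (refl_pt \<eta> z) - b * (inverse \<eta> * (\<Sum>\<theta>\<in>\<mu>. \<phi> (refl_pt \<eta> (refl_pt \<theta> z)) / al \<theta> z))"
      using VY by (simp add: simps app_genop algebra_simps divide_inverse del: genop.simps)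
    then show ?thesis
      using VY by (simp add: simps app_genop algebra_simps divide_inverse del: genop.simps)
  qed (use mu_nonzero[OF \<eta>] in \<open>simp_all add: simps divide_simps\<close>)
qed

lemma act_mult:
  assumes "g \<in> W" "h \<in> W"
  shows "act (g ** h) z = act h (act g z)"
  using assms
  by (elim W_cases) (simp_all add: refl_rot_mult act_refl act_rot mu_nonzero mu_closed refl_pt_rot_pt_comp mu_norm)

lemma trop_mult: "g \<in> W \<Longrightarrow> h \<in> W \<Longrightarrow> trop (g ** h) = trop g * trop h"
  by (rule lop_eqI) (simp add: act_mult)

lemma act_one [simp]: "act (mat 1) z = z"
  by (intro pt_eqI) (simp_all add: mat_1_eq_rotm act_rot rot_pt_coords)

lemma trop_one [simp]: "trop (mat 1) = 1"
  by (rule lop_eqI) simp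

lemma fop_gl_act_refl:
  assumes "\<eta> \<in> \<mu>"
  shows "trop (reflm \<eta>) * fop b f = fop b (gl_act (reflm \<eta>) f) * trop (reflm \<eta>)"
proof (induction f rule: free_alg_induct)
  case (const_word ws z)
  have "trop (reflm \<eta>) * fop b (fword ws) = fop b (gl_act (reflm \<eta>) (fword ws)) * trop (reflm \<eta>)"
  proof (induction ws)
    case (Cons v ws)
    have "trop (reflm \<eta>) * fop b (fword (v # ws)) = (trop (reflm \<eta>) * genop b v) * fop b (fword ws)"
      by (simp add: fop_hom mult.assoc)
    also have "\<dots> = fop b (gl_act_gen (reflm \<eta>) v) * (trop (reflm \<eta>) * fop b (fword ws))"
      by (simp only: genop_refl[OF assms] mult.assoc)
    also have "\<dots> = fop b (gl_act (reflm \<eta>) (fword (v # ws))) * trop (reflm \<eta>)"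
      by (simp only: Cons) (simp add: gl_act_hom fop_hom mult.assoc)
    finally show ?case .
  qed (simp add: fop_hom gl_act_hom)
  then show ?case
    by (simp only: fop_hom gl_act_hom mult.assoc scal_commute_left)
qed (simp_all add: fop_hom gl_act_hom distrib_left distrib_right)

lemma fop_gl_act:
  assumes "w \<in> W"
  shows "trop w * fop b f = fop b (gl_act w f) * trop w"
  using assms
proof (cases rule: W_cases)
  case (rot \<eta>)
  have r: "w = reflm \<eta> ** reflm 1"
    using rot by (simp add: refl_rot_mult)
  have W1: "reflm \<eta> \<in> W" "reflm 1 \<in> W" and mu1: "1 \<in> \<mu>"
    using rot(1) mu_closed(1) by (simp_all add: W_refl)
  have "trop w * fop b f = trop (reflm \<eta>) * (trop (reflm 1) * fop b f)"
    by (simp only: r trop_mult[OF W1] mult.assoc)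
  also have "\<dots> = fop b (gl_act w f) * trop w"
    by (simp only: fop_gl_act_refl[OF mu1] mult.assoc[symmetric] fop_gl_act_refl[OF rot(1)])
       (simp only: mult.assoc r trop_mult[OF W1] gl_act_W_mult[OF W1])
  finally show ?thesis .
qed (simp add: fop_gl_act_refl)

definition sop :: "complex \<Rightarrow> smash_elt \<Rightarrow> pt lop" where
  "sop b = pext (\<lambda>w f. fop b f * trop w)"

lemma sop_single [simp]: "sop b (Poly_Mapping.single w f) = fop b f * trop w"
  unfolding sop_def by (rule pext_single) (simp add: fop_hom)

lemma sop_zero [simp]: "sop b 0 = 0"
  by (simp add: sop_def)

lemma sop_add: "sop b (F + G) = sop b F + sop b G"
  unfolding sop_def by (rule pext_add) (simp_all add: fop_hom distrib_right)

lemma sop_diff: "sop b (F - G) = sop b F - sop b G"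
  unfolding sop_def by (rule pext_diff) (simp_all add: fop_hom distrib_right)

lemma sop_sum: "sop b (sum F A) = (\<Sum>i\<in>A. sop b (F i))"
  by (induction A rule: infinite_finite_induct) (auto simp: sop_add)

lemma sop_smash_poly [simp]: "sop b (smash_poly f) = fop b f"
  by (simp add: smash_poly_def)

lemma sop_mult:
  assumes "F \<in> carrier S" "G \<in> carrier S"
  shows "sop b (smash_mult F G) = sop b F * sop b G"
  using assms(1)
proof (induction F rule: S_induct)
  case (single u f)
  show ?case
    using assms(2)
  proof (induction G rule: S_induct)
    case (single v g)
    have "sop b (smash_mult (Poly_Mapping.single u f) (Poly_Mapping.single v g)) = fop b f * (fop b (gl_act u g) * trop u) * trop v"
      by (simp add: fop_hom trop_mult \<open>u \<in> W\<close> \<open>v \<in> W\<close> mult.assoc)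
    then show ?case
      by (simp only: fop_gl_act[OF \<open>u \<in> W\<close>, symmetric] sop_single mult.assoc)
  qed (simp_all add: smash_mult_distrib sop_add distrib_left)
qed (simp_all add: smash_mult_distrib sop_add distrib_right)

lemma trop_refl: "\<eta> \<in> \<mu> \<Longrightarrow> trop (reflm \<eta>) = compop (refl_pt \<eta>)"
  by (rule lop_eqI) (simp add: act_refl mu_nonzero)

text \<open>Commuting multiplication by f with (1/\<alpha>) s gives ((f - s f)/\<alpha>) s. For f =
  u the quotient is 1, for f = v it is -\<eta>. This is what fixes the coefficients in
  \<open>genop\<close>.\<close>

lemma genop_mixed:
  "genop b Vx * genop b VX - genop b VX * genop b Vx = - scal b * (\<Sum>\<eta>\<in>\<mu>. compop (refl_pt \<eta>))"
  "genop b Vy * genop b VY - genop b VY * genop b Vy = - scal b * (\<Sum>\<eta>\<in>\<mu>. compop (refl_pt \<eta>))"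
  "genop b Vx * genop b VY - genop b VY * genop b Vx = scal b * (\<Sum>\<eta>\<in>\<mu>. scal (inverse \<eta>) * compop (refl_pt \<eta>))"
  "genop b Vy * genop b VX - genop b VX * genop b Vy = scal b * (\<Sum>\<eta>\<in>\<mu>. scal \<eta> * compop (refl_pt \<eta>))"
proof -
  have "app (genop b Vx * genop b VX - genop b VX * genop b Vx) \<phi> z = app (- scal b * (\<Sum>\<eta>\<in>\<mu>. compop (refl_pt \<eta>))) \<phi> z" for \<phi> z
  proof -
    have "cu z * \<phi> (refl_pt \<eta> z) / al \<eta> z - cu (refl_pt \<eta> z) * \<phi> (refl_pt \<eta> z) / al \<eta> z = \<phi> (refl_pt \<eta> z)" if "\<eta> \<in> \<mu>" for \<eta>
    proof -
      have "cu z - cu (refl_pt \<eta> z) = al \<eta> z"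
        by (simp add: refl_pt_coords mu_norm[OF that] al_def)
      moreover have "cu z * \<phi> (refl_pt \<eta> z) / al \<eta> z - cu (refl_pt \<eta> z) * \<phi> (refl_pt \<eta> z) / al \<eta> z
          = (cu z - cu (refl_pt \<eta> z)) * (\<phi> (refl_pt \<eta> z) / al \<eta> z)"
        by (simp add: left_diff_distrib diff_divide_distrib)
      ultimately show ?thesis
        using al_nonzero[OF that, of z] by simp
    qed
    then have "(\<Sum>\<eta>\<in>\<mu>. cu z * \<phi> (refl_pt \<eta> z) / al \<eta> z) - (\<Sum>\<eta>\<in>\<mu>. cu (refl_pt \<eta> z) * \<phi> (refl_pt \<eta> z) / al \<eta> z) = (\<Sum>\<eta>\<in>\<mu>. \<phi> (refl_pt \<eta> z))"
      by (simp add: sum_subtractf[symmetric])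
    then show ?thesis
      by (simp add: app_genop sum_distrib_left[symmetric] algebra_simps del: genop.simps(3))
         (simp add: algebra_simps sum_distrib_left)
  qed
  then show "genop b Vx * genop b VX - genop b VX * genop b Vx = - scal b * (\<Sum>\<eta>\<in>\<mu>. compop (refl_pt \<eta>))"
    by (rule lop_eqI)
next
  have "app (genop b Vy * genop b VY - genop b VY * genop b Vy) \<phi> z = app (- scal b * (\<Sum>\<eta>\<in>\<mu>. compop (refl_pt \<eta>))) \<phi> z" for \<phi> z
  proof -
    have "cv z * (inverse \<eta> * \<phi> (refl_pt \<eta> z) / al \<eta> z) - inverse \<eta> * (cv (refl_pt \<eta> z) * \<phi> (refl_pt \<eta> z)) / al \<eta> z = - \<phi> (refl_pt \<eta> z)" if "\<eta> \<in> \<mu>" for \<eta>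
    proof -
      have "cv z - cv (refl_pt \<eta> z) = - \<eta> * al \<eta> z"
        using mu_nonzero[OF that] by (simp add: refl_pt_coords mu_norm[OF that] al_def field_simps)
      moreover have "cv z * (inverse \<eta> * \<phi> (refl_pt \<eta> z) / al \<eta> z) - inverse \<eta> * (cv (refl_pt \<eta> z) * \<phi> (refl_pt \<eta> z)) / al \<eta> z
          = (cv z - cv (refl_pt \<eta> z)) * (inverse \<eta> * \<phi> (refl_pt \<eta> z) / al \<eta> z)"
        by (simp add: left_diff_distrib diff_divide_distrib)
      ultimately show ?thesis
        using al_nonzero[OF that, of z] mu_nonzero[OF that] by simp
    qed
    then have "(\<Sum>\<eta>\<in>\<mu>. cv z * (inverse \<eta> * \<phi> (refl_pt \<eta> z) / al \<eta> z)) - (\<Sum>\<eta>\<in>\<mu>. inverse \<eta> * (cv (refl_pt \<eta> z) * \<phi> (refl_pt \<eta> z)) / al \<eta> z) = - (\<Sum>\<eta>\<in>\<mu>. \<phi> (refl_pt \<eta> z))"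
      by (simp add: sum_subtractf[symmetric] sum_negf)
    then have "b * (cv z * (\<Sum>\<eta>\<in>\<mu>. inverse \<eta> * \<phi> (refl_pt \<eta> z) / al \<eta> z)) - b * (\<Sum>\<eta>\<in>\<mu>. inverse \<eta> * (cv (refl_pt \<eta> z) * \<phi> (refl_pt \<eta> z)) / al \<eta> z) = - b * (\<Sum>\<eta>\<in>\<mu>. \<phi> (refl_pt \<eta> z))"
      by (simp add: right_diff_distrib[symmetric] sum_distrib_left[of "cv z"])
    then show ?thesis
      by (simp add: app_genop algebra_simps del: genop.simps(4))
  qed
  then show "genop b Vy * genop b VY - genop b VY * genop b Vy = - scal b * (\<Sum>\<eta>\<in>\<mu>. compop (refl_pt \<eta>))"
    by (rule lop_eqI)
next
  have "app (genop b Vx * genop b VY - genop b VY * genop b Vx) \<phi> z = app (scal b * (\<Sum>\<eta>\<in>\<mu>. scal (inverse \<eta>) * compop (refl_pt \<eta>))) \<phi> z" for \<phi> z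
  proof -
    have "cu z * (inverse \<eta> * \<phi> (refl_pt \<eta> z) / al \<eta> z) - inverse \<eta> * (cu (refl_pt \<eta> z) * \<phi> (refl_pt \<eta> z)) / al \<eta> z = inverse \<eta> * \<phi> (refl_pt \<eta> z)" if "\<eta> \<in> \<mu>" for \<eta>
    proof -
      have "cu z - cu (refl_pt \<eta> z) = al \<eta> z"
        by (simp add: refl_pt_coords mu_norm[OF that] al_def)
      moreover have "cu z * (inverse \<eta> * \<phi> (refl_pt \<eta> z) / al \<eta> z) - inverse \<eta> * (cu (refl_pt \<eta> z) * \<phi> (refl_pt \<eta> z)) / al \<eta> z
          = (cu z - cu (refl_pt \<eta> z)) * (inverse \<eta> * \<phi> (refl_pt \<eta> z) / al \<eta> z)"
        by (simp add: left_diff_distrib diff_divide_distrib)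
      ultimately show ?thesis
        using al_nonzero[OF that, of z] by simp
    qed
    then have "(\<Sum>\<eta>\<in>\<mu>. cu z * (inverse \<eta> * \<phi> (refl_pt \<eta> z) / al \<eta> z)) - (\<Sum>\<eta>\<in>\<mu>. inverse \<eta> * (cu (refl_pt \<eta> z) * \<phi> (refl_pt \<eta> z)) / al \<eta> z) = (\<Sum>\<eta>\<in>\<mu>. inverse \<eta> * \<phi> (refl_pt \<eta> z))"
      by (simp add: sum_subtractf[symmetric])
    then have "b * (cu z * (\<Sum>\<eta>\<in>\<mu>. inverse \<eta> * \<phi> (refl_pt \<eta> z) / al \<eta> z)) - b * (\<Sum>\<eta>\<in>\<mu>. inverse \<eta> * (cu (refl_pt \<eta> z) * \<phi> (refl_pt \<eta> z)) / al \<eta> z) = b * (\<Sum>\<eta>\<in>\<mu>. inverse \<eta> * \<phi> (refl_pt \<eta> z))"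
      by (simp add: right_diff_distrib[symmetric] sum_distrib_left[of "cu z"])
    then show ?thesis
      by (simp add: app_genop algebra_simps del: genop.simps(4))
  qed
  then show "genop b Vx * genop b VY - genop b VY * genop b Vx = scal b * (\<Sum>\<eta>\<in>\<mu>. scal (inverse \<eta>) * compop (refl_pt \<eta>))"
    by (rule lop_eqI)
next
  have "app (genop b Vy * genop b VX - genop b VX * genop b Vy) \<phi> z = app (scal b * (\<Sum>\<eta>\<in>\<mu>. scal \<eta> * compop (refl_pt \<eta>))) \<phi> z" for \<phi> z
  proof -
    have "cv z * (\<phi> (refl_pt \<eta> z) / al \<eta> z) - cv (refl_pt \<eta> z) * \<phi> (refl_pt \<eta> z) / al \<eta> z = - (\<eta> * \<phi> (refl_pt \<eta> z))" if "\<eta> \<in> \<mu>" for \<eta>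
    proof -
      have "cv z - cv (refl_pt \<eta> z) = - \<eta> * al \<eta> z"
        using mu_nonzero[OF that] by (simp add: refl_pt_coords mu_norm[OF that] al_def field_simps)
      moreover have "cv z * (\<phi> (refl_pt \<eta> z) / al \<eta> z) - cv (refl_pt \<eta> z) * \<phi> (refl_pt \<eta> z) / al \<eta> z
          = (cv z - cv (refl_pt \<eta> z)) * (\<phi> (refl_pt \<eta> z) / al \<eta> z)"
        by (simp add: left_diff_distrib diff_divide_distrib)
      ultimately show ?thesis
        using al_nonzero[OF that, of z] by simp
    qed
    then have "(\<Sum>\<eta>\<in>\<mu>. cv z * (\<phi> (refl_pt \<eta> z) / al \<eta> z)) - (\<Sum>\<eta>\<in>\<mu>. cv (refl_pt \<eta> z) * \<phi> (refl_pt \<eta> z) / al \<eta> z) = - (\<Sum>\<eta>\<in>\<mu>. \<eta> * \<phi> (refl_pt \<eta> z))"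
      by (simp add: sum_subtractf[symmetric] sum_negf)
    then have "b * (cv z * (\<Sum>\<eta>\<in>\<mu>. \<phi> (refl_pt \<eta> z) / al \<eta> z)) - b * (\<Sum>\<eta>\<in>\<mu>. cv (refl_pt \<eta> z) * \<phi> (refl_pt \<eta> z) / al \<eta> z) = - b * (\<Sum>\<eta>\<in>\<mu>. \<eta> * \<phi> (refl_pt \<eta> z))"
      by (simp add: right_diff_distrib[symmetric] sum_distrib_left[of "cv z"])
    then show ?thesis
      by (simp add: app_genop algebra_simps del: genop.simps(3))
  qed
  then show "genop b Vy * genop b VX - genop b VX * genop b Vy = scal b * (\<Sum>\<eta>\<in>\<mu>. scal \<eta> * compop (refl_pt \<eta>))"
    by (rule lop_eqI)
qed

text \<open>The function by which Q = XY acts: its symbol and a correction quadratic in the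
  parameter. The sum gets a closed form in \<open>sum_al_squares\<close>.\<close>

definition Q_fun :: "complex \<Rightarrow> pt \<Rightarrow> complex" where
  "Q_fun b z = cp z * cr z + b ^ 2 * (\<Sum>\<eta>\<in>\<mu>. inverse \<eta> / al \<eta> z ^ 2)"

text \<open>Partial fractions: up to the factor \<open>cv z * (1 - inverse \<kappa>)\<close> each
  summand is the difference of the reciprocals of two roots, and reindexing by \<kappa> makes the
  two resulting sums equal.\<close>

lemma sum_al_shift:
  assumes "\<kappa> \<in> \<mu>" "\<kappa> \<noteq> 1"
  shows "(\<Sum>\<eta>\<in>\<mu>. inverse \<eta> / (al \<eta> z * al (\<eta> * \<kappa>) z)) = 0"
proof -
  have k: "\<kappa> \<noteq> 0" using mu_nonzero assms by auto
  have "cv z * (1 - inverse \<kappa>) * (inverse \<eta> / (al \<eta> z * al (\<eta> * \<kappa>) z)) = 1 / al \<eta> z - 1 / al (\<kappa> * \<eta>) z"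
    if "\<eta> \<in> \<mu>" for \<eta>
  proof -
    have "al (\<kappa> * \<eta>) z - al \<eta> z = cv z * (1 - inverse \<kappa>) * inverse \<eta>"
      using k mu_nonzero[OF that] by (simp add: al_def field_simps)
    moreover have "al \<eta> z \<noteq> 0" "al (\<kappa> * \<eta>) z \<noteq> 0"
      using that assms by (simp_all add: mu_closed)
    ultimately show ?thesis
      by (simp add: mult.commute[of \<eta>] diff_frac_eq)
  qed
  then have "cv z * (1 - inverse \<kappa>) * (\<Sum>\<eta>\<in>\<mu>. inverse \<eta> / (al \<eta> z * al (\<eta> * \<kappa>) z))
      = (\<Sum>\<eta>\<in>\<mu>. 1 / al \<eta> z) - (\<Sum>\<eta>\<in>\<mu>. 1 / al (\<kappa> * \<eta>) z)"
    by (simp add: sum_distrib_left sum_subtractf)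
  also have "\<dots> = 0"
    using sum_mu_mult[OF assms(1), of "\<lambda>\<eta>. 1 / al \<eta> z"] by simp
  finally show ?thesis
    using assms(2) k by (simp add: field_simps)
qed

text \<open>Only the identity component of the double sum over pairs of reflections survives.\<close>

lemma genop_XY:
  "genop b VX * genop b VY = mulop (Q_fun b)" "genop b VY * genop b VX = mulop (Q_fun b)"
proof -
  have dbl: "(\<Sum>\<eta>\<in>\<mu>. \<Sum>\<theta>\<in>\<mu>. G (\<eta> / \<theta>) * (inverse \<eta> / (al \<eta> z * al (\<eta> * \<eta> / \<theta>) z)))
      = G 1 * (\<Sum>\<eta>\<in>\<mu>. inverse \<eta> / al \<eta> z ^ 2)" for G z
  proof -
    have "(\<Sum>\<theta>\<in>\<mu>. G (\<eta> / \<theta>) * (inverse \<eta> / (al \<eta> z * al (\<eta> * \<eta> / \<theta>) z)))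
        = (\<Sum>\<kappa>\<in>\<mu>. G \<kappa> * (inverse \<eta> / (al \<eta> z * al (\<eta> * \<kappa>) z)))" if "\<eta> \<in> \<mu>" for \<eta>
      using sum_mu_divide[OF that, of "\<lambda>\<kappa>. G \<kappa> * (inverse \<eta> / (al \<eta> z * al (\<eta> * \<kappa>) z))"] by simp
    then have "(\<Sum>\<eta>\<in>\<mu>. \<Sum>\<theta>\<in>\<mu>. G (\<eta> / \<theta>) * (inverse \<eta> / (al \<eta> z * al (\<eta> * \<eta> / \<theta>) z)))
        = (\<Sum>\<eta>\<in>\<mu>. \<Sum>\<kappa>\<in>\<mu>. G \<kappa> * (inverse \<eta> / (al \<eta> z * al (\<eta> * \<kappa>) z)))"
      by (rule sum.cong[OF refl])
    also have "\<dots> = (\<Sum>\<kappa>\<in>\<mu>. G \<kappa> * (\<Sum>\<eta>\<in>\<mu>. inverse \<eta> / (al \<eta> z * al (\<eta> * \<kappa>) z)))"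
      by (subst sum.swap) (simp add: sum_distrib_left)
    also have "\<dots> = (\<Sum>\<kappa>\<in>\<mu>. if \<kappa> = 1 then G 1 * (\<Sum>\<eta>\<in>\<mu>. inverse \<eta> / al \<eta> z ^ 2) else 0)"
      by (intro sum.cong refl) (simp add: sum_al_shift power2_eq_square)
    also have "\<dots> = G 1 * (\<Sum>\<eta>\<in>\<mu>. inverse \<eta> / al \<eta> z ^ 2)"
      using mu_closed(1) by simp
    finally show ?thesis .
  qed
  have ro1: "rot_pt 1 z = z" for z
    by (intro pt_eqI) (simp_all add: rot_pt_coords)
  show "genop b VX * genop b VY = mulop (Q_fun b)"
  proof (rule lop_eqI)
    fix \<phi> z
    have lin: "(\<Sum>\<eta>\<in>\<mu>. cr (refl_pt \<eta> z) * \<phi> (refl_pt \<eta> z) / al \<eta> z) = cp z * (\<Sum>\<eta>\<in>\<mu>. inverse \<eta> * \<phi> (refl_pt \<eta> z) / al \<eta> z)"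
      unfolding sum_distrib_left by (intro sum.cong refl) (simp add: refl_pt_coords mu_norm field_simps)
    have "(\<Sum>\<eta>\<in>\<mu>. (\<Sum>\<theta>\<in>\<mu>. inverse \<theta> * \<phi> (refl_pt \<theta> (refl_pt \<eta> z)) / al \<theta> (refl_pt \<eta> z)) / al \<eta> z)
      = - (\<Sum>\<eta>\<in>\<mu>. \<Sum>\<theta>\<in>\<mu>. \<phi> (rot_pt (\<eta> / \<theta>) z) * (inverse \<eta> / (al \<eta> z * al (\<eta> * \<eta> / \<theta>) z)))"
      unfolding sum_divide_distrib sum_negf[symmetric]
      by (intro sum.cong refl) (simp add: refl_pt_rot_pt_comp mu_norm al_refl_pt mu_nonzero field_simps)
    also have "\<dots> = - \<phi> z * (\<Sum>\<eta>\<in>\<mu>. inverse \<eta> / al \<eta> z ^ 2)"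
      unfolding dbl[of "\<lambda>\<kappa>. \<phi> (rot_pt \<kappa> z)"] by (simp add: ro1)
    finally have quad: "(\<Sum>\<eta>\<in>\<mu>. (\<Sum>\<theta>\<in>\<mu>. inverse \<theta> * \<phi> (refl_pt \<theta> (refl_pt \<eta> z)) / al \<theta> (refl_pt \<eta> z)) / al \<eta> z)
      = - \<phi> z * (\<Sum>\<eta>\<in>\<mu>. inverse \<eta> / al \<eta> z ^ 2)" .
    have "app (genop b VX * genop b VY) \<phi> z
       = cp z * (cr z * \<phi> z + b * (\<Sum>\<eta>\<in>\<mu>. inverse \<eta> * \<phi> (refl_pt \<eta> z) / al \<eta> z))
       - b * ((\<Sum>\<eta>\<in>\<mu>. cr (refl_pt \<eta> z) * \<phi> (refl_pt \<eta> z) / al \<eta> z)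
          + b * (\<Sum>\<eta>\<in>\<mu>. (\<Sum>\<theta>\<in>\<mu>. inverse \<theta> * \<phi> (refl_pt \<theta> (refl_pt \<eta> z)) / al \<theta> (refl_pt \<eta> z)) / al \<eta> z))"
      unfolding times_lop.rep_eq app_genop
      by (simp add: sum.distrib[symmetric] sum_distrib_left add_divide_distrib mult.assoc)
    then show "app (genop b VX * genop b VY) \<phi> z = app (mulop (Q_fun b)) \<phi> z"
      unfolding lin quad by (simp add: Q_fun_def algebra_simps power2_eq_square)
  qed
  show "genop b VY * genop b VX = mulop (Q_fun b)"
  proof (rule lop_eqI)
    fix \<phi> z
    have lin: "(\<Sum>\<eta>\<in>\<mu>. inverse \<eta> * (cp (refl_pt \<eta> z) * \<phi> (refl_pt \<eta> z)) / al \<eta> z) = cr z * (\<Sum>\<eta>\<in>\<mu>. \<phi> (refl_pt \<eta> z) / al \<eta> z)"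
      unfolding sum_distrib_left by (intro sum.cong refl) (simp add: refl_pt_coords mu_norm mu_nonzero field_simps)
    have "(\<Sum>\<eta>\<in>\<mu>. inverse \<eta> * (\<Sum>\<theta>\<in>\<mu>. \<phi> (refl_pt \<theta> (refl_pt \<eta> z)) / al \<theta> (refl_pt \<eta> z)) / al \<eta> z)
      = - (\<Sum>\<eta>\<in>\<mu>. \<Sum>\<theta>\<in>\<mu>. inverse (\<eta> / \<theta>) * \<phi> (rot_pt (\<eta> / \<theta>) z) * (inverse \<eta> / (al \<eta> z * al (\<eta> * \<eta> / \<theta>) z)))"
      unfolding sum_divide_distrib sum_negf[symmetric] sum_distrib_left
      by (intro sum.cong refl) (simp add: refl_pt_rot_pt_comp mu_norm al_refl_pt mu_nonzero field_simps)
    also have "\<dots> = - \<phi> z * (\<Sum>\<eta>\<in>\<mu>. inverse \<eta> / al \<eta> z ^ 2)"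
      unfolding dbl[of "\<lambda>\<kappa>. inverse \<kappa> * \<phi> (rot_pt \<kappa> z)"] by (simp add: ro1)
    finally have quad: "(\<Sum>\<eta>\<in>\<mu>. inverse \<eta> * (\<Sum>\<theta>\<in>\<mu>. \<phi> (refl_pt \<theta> (refl_pt \<eta> z)) / al \<theta> (refl_pt \<eta> z)) / al \<eta> z)
      = - \<phi> z * (\<Sum>\<eta>\<in>\<mu>. inverse \<eta> / al \<eta> z ^ 2)" .
    have "app (genop b VY * genop b VX) \<phi> z
       = cr z * (cp z * \<phi> z - b * (\<Sum>\<eta>\<in>\<mu>. \<phi> (refl_pt \<eta> z) / al \<eta> z))
       + b * ((\<Sum>\<eta>\<in>\<mu>. inverse \<eta> * (cp (refl_pt \<eta> z) * \<phi> (refl_pt \<eta> z)) / al \<eta> z)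
          - b * (\<Sum>\<eta>\<in>\<mu>. inverse \<eta> * (\<Sum>\<theta>\<in>\<mu>. \<phi> (refl_pt \<theta> (refl_pt \<eta> z)) / al \<theta> (refl_pt \<eta> z)) / al \<eta> z))"
      unfolding times_lop.rep_eq app_genop right_diff_distrib diff_divide_distrib sum_subtractf
      by (simp add: sum_distrib_left mult_ac)
    then show "app (genop b VY * genop b VX) \<phi> z = app (mulop (Q_fun b)) \<phi> z"
      unfolding lin quad by (simp add: Q_fun_def algebra_simps power2_eq_square)
  qed
qed

end

context cherednik_param
begin

lemma sop_refl_sum:
  "sop a (\<Sum>\<eta>\<in>\<mu>. Poly_Mapping.single (reflm \<eta>) (pconst (a * f \<eta>))) = scal a * (\<Sum>\<eta>\<in>\<mu>. scal (f \<eta>) * compop (refl_pt \<eta>))"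
  by (simp add: sop_sum fop_hom trop_refl sum_distrib_left mult.assoc mulop_hom)

lemma sop_rels:
  assumes "F \<in> cherednik_rels d \<zeta> c"
  shows "sop a F = 0"
proof -
  have c: "sop a (smash_comm u v) = genop a u * genop a v - genop a v * genop a u" for u v
    by (simp add: smash_comm_eq fop_hom)
  note r = sop_refl_sum[of "\<lambda>\<eta>. \<eta>"] sop_refl_sum[of "\<lambda>\<eta>. inverse \<eta>"] sop_refl_sum[of "\<lambda>\<eta>. 1", simplified]
  have "sop a (smash_comm Vx Vy) = 0" "sop a (smash_comm VX VY) = 0"
    unfolding c genop_XY by (simp_all add: mulop_commute)
  then show ?thesis
    using assms unfolding cherednik_rels_def refl_sum_eq
    by (auto simp only: insert_iff empty_iff sop_add sop_diff c genop_mixed r mulop_hom(5))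
       simp_all
qed

lemma sop_J:
  assumes "F \<in> J"
  shows "sop a F = 0"
proof -
  let ?K = "{F \<in> carrier S. sop a F = 0}"
  have "ideal ?K S"
  proof (rule idealI[OF ring_S])
    show "subgroup ?K (add_monoid S)"
    proof (rule group.subgroupI)
      show "group (add_monoid S)"
        using abelian_group.a_group[OF ring.is_abelian_group[OF ring_S]] .
      fix F assume F: "F \<in> ?K"
      have "inv\<^bsub>add_monoid S\<^esub> F = - F"
        using F S_diff[OF S_zero, of F]
        by (intro group.inv_equality[OF abelian_group.a_group[OF ring.is_abelian_group[OF ring_S]]]) simp_all
      moreover have "sop a (- F) = 0"
        using sop_diff[of a 0 F] F by simp
      ultimately show "inv\<^bsub>add_monoid S\<^esub> F \<in> ?K"
        using F S_diff[OF S_zero, of F] by simp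
    qed (auto simp: sop_add S_add intro: exI[of _ 0])
  qed (simp_all add: sop_mult S_mult)
  moreover have "cherednik_rels d \<zeta> c \<subseteq> ?K"
    using cherednik_rels_carrier sop_rels by auto
  ultimately have "J \<subseteq> ?K"
    unfolding J_def cherednik_ideal_def by (rule ring.genideal_minimal[OF ring_S])
  with assms show ?thesis by auto
qed

end

section \<open>The PBW theorem\<close>

definition nmon :: "(vgen \<Rightarrow>\<^sub>0 nat) \<Rightarrow> vgen free_alg" where
  "nmon m = fvar Vx ^ Poly_Mapping.lookup m Vx * fvar Vy ^ Poly_Mapping.lookup m Vy *
    fvar VX ^ Poly_Mapping.lookup m VX * fvar VY ^ Poly_Mapping.lookup m VY"

lemma normal_order_eq: "normal_order = pext (\<lambda>m z. pconst z * nmon m)"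
  by (simp add: fun_eq_iff normal_order_def pext_def nmon_def)

lemma normal_order_hom:
  "normal_order 0 = 0" "normal_order (p + q) = normal_order p + normal_order q"
  "normal_order (p - q) = normal_order p - normal_order q"
  "normal_order (Poly_Mapping.single m z) = pconst z * nmon m"
  unfolding normal_order_eq
  by (simp_all add: pext_add pext_diff pconst_add distrib_right)

definition NP :: "(mat2 \<Rightarrow>\<^sub>0 vgen mpoly) \<Rightarrow> smash_elt" where
  "NP = pext (\<lambda>w p. Poly_Mapping.single w (normal_order p))"

lemma NP_hom:
  "NP 0 = 0" "NP (P + Q) = NP P + NP Q" "NP (P - Q) = NP P - NP Q"
  "NP (Poly_Mapping.single w p) = Poly_Mapping.single w (normal_order p)"
  unfolding NP_def by (simp_all add: pext_add pext_diff normal_order_hom single_add)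

lemma keys_NP: "Poly_Mapping.keys (NP P) \<subseteq> Poly_Mapping.keys P"
proof -
  have "Poly_Mapping.keys (NP P) \<subseteq> (\<Union>w\<in>Poly_Mapping.keys P.
      Poly_Mapping.keys (Poly_Mapping.single w (normal_order (Poly_Mapping.lookup P w))))"
    unfolding NP_def pext_def by (rule keys_sum)
  then show ?thesis
    by (auto split: if_splits)
qed

text \<open>A reflection sends each letter to a multiple of its partner. Words therefore go to
  multiples of words, and letters of V stay separated from letters of the dual space.\<close>

fun swv :: "vgen \<Rightarrow> vgen" where
  "swv Vx = Vy" | "swv Vy = Vx" | "swv VX = VY" | "swv VY = VX"

lemma gl_act_gen_refl:
  assumes "\<eta> \<noteq> 0"
  shows "\<exists>z. gl_act_gen (reflm \<eta>) v = pconst z * fvar (swv v)"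
  using assms by (cases v) (auto simp: matrix_inv_reflm)

lemma gl_act_refl_fword:
  assumes "\<eta> \<noteq> 0"
  shows "\<exists>z. gl_act (reflm \<eta>) (fword ws) = pconst z * fword (map swv ws)"
proof (induction ws)
  case Nil
  then show ?case by (auto simp: gl_act_hom intro!: exI[of _ 1])
next
  case (Cons v ws)
  then obtain z where z: "gl_act (reflm \<eta>) (fword ws) = pconst z * fword (map swv ws)"
    by auto
  obtain y where y: "gl_act_gen (reflm \<eta>) v = pconst y * fvar (swv v)"
    using gl_act_gen_refl[OF assms] by blast
  have "gl_act (reflm \<eta>) (fword (v # ws)) = pconst (y * z) * fword (map swv (v # ws))"
    by (simp add: gl_act_hom z y pconst_mult mult.assoc pconst_commute_left[of "fvar _"])
  then show ?case by blast
qed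

section \<open>Normally ordered monomials span\<close>

context cherednik_param
begin

definition pbw_span :: "smash_elt set" where
  "pbw_span = {F \<in> carrier S. \<exists>P\<in>pbw_source \<zeta>. F - NP P \<in> J}"

lemma pbw_source_iff: "P \<in> pbw_source \<zeta> \<longleftrightarrow> Poly_Mapping.keys P \<subseteq> W"
  by (simp add: pbw_source_def W_def)

lemma NP_carrier: "P \<in> pbw_source \<zeta> \<Longrightarrow> NP P \<in> carrier S"
  using keys_NP[of P] by (auto simp: pbw_source_iff carrier_S)

lemma pbw_source_zero: "0 \<in> pbw_source \<zeta>"
  and pbw_source_add: "P \<in> pbw_source \<zeta> \<Longrightarrow> Q \<in> pbw_source \<zeta> \<Longrightarrow> P + Q \<in> pbw_source \<zeta>"
  and pbw_source_diff: "P \<in> pbw_source \<zeta> \<Longrightarrow> Q \<in> pbw_source \<zeta> \<Longrightarrow> P - Q \<in> pbw_source \<zeta>"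
  using keys_add[of P Q] keys_diff[of P Q] by (auto simp: pbw_source_iff)

lemma span_J: "F \<in> J \<Longrightarrow> F \<in> pbw_span"
  using pbw_source_zero by (auto simp: pbw_span_def J_carrier NP_hom intro!: bexI[of _ 0])

lemma span_zero: "0 \<in> pbw_span"
  by (simp add: span_J)

lemma span_add:
  assumes "F \<in> pbw_span" "G \<in> pbw_span"
  shows "F + G \<in> pbw_span"
proof -
  obtain P Q where PQ: "P \<in> pbw_source \<zeta>" "F - NP P \<in> J" "Q \<in> pbw_source \<zeta>" "G - NP Q \<in> J"
    using assms by (auto simp: pbw_span_def)
  have "F + G - NP (P + Q) = (F - NP P) + (G - NP Q)"
    by (simp add: NP_hom)
  then have "F + G - NP (P + Q) \<in> J"
    using J_add PQ by metis
  with PQ assms show ?thesis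
    unfolding pbw_span_def by (auto simp: S_add intro: pbw_source_add)
qed

lemma span_sum: "(\<And>i. i \<in> A \<Longrightarrow> F i \<in> pbw_span) \<Longrightarrow> sum F A \<in> pbw_span"
  by (induction A rule: infinite_finite_induct) (auto simp: span_zero span_add)

lemma span_cong: "F - G \<in> J \<Longrightarrow> G \<in> pbw_span \<Longrightarrow> F \<in> pbw_span"
  using span_add[OF span_J, of "F - G" G] by simp

text \<open>A congruence on the free algebra for the relations that create no group elements, here
  [x,y] = 0 and [X,Y] = 0. Quantifying over both contexts and over W makes it compatible with
  products.\<close>

definition rel_cong :: "vgen free_alg \<Rightarrow> vgen free_alg \<Rightarrow> bool" where
  "rel_cong f g \<longleftrightarrow> (\<forall>w\<in>W. \<forall>h k. Poly_Mapping.single w (h * (f - g) * k) \<in> J)"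

lemma rel_cong_refl: "rel_cong f f"
  by (simp add: rel_cong_def)

lemma rel_cong_trans:
  assumes "rel_cong f g" "rel_cong g h"
  shows "rel_cong f h"
  unfolding rel_cong_def
proof safe
  fix w k l assume "w \<in> W"
  then have "Poly_Mapping.single w (k * (f - g) * l) + Poly_Mapping.single w (k * (g - h) * l) \<in> J"
    using assms by (intro J_add) (auto simp: rel_cong_def)
  moreover have "k * (f - g) * l + k * (g - h) * l = k * (f - h) * l"
    by (simp add: algebra_simps)
  ultimately show "Poly_Mapping.single w (k * (f - h) * l) \<in> J"
    by (simp flip: single_add)
qed

lemma rel_cong_context: "rel_cong f g \<Longrightarrow> rel_cong (h * f * k) (h * g * k)"
  unfolding rel_cong_def
proof safe
  fix w h' k' assume *: "\<forall>w\<in>W. \<forall>h k. Poly_Mapping.single w (h * (f - g) * k) \<in> J" "w \<in> W"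
  then have "Poly_Mapping.single w ((h' * h) * (f - g) * (k * k')) \<in> J" by blast
  then show "Poly_Mapping.single w (h' * (h * f * k - h * g * k) * k') \<in> J"
    by (simp add: algebra_simps)
qed

lemma rel_cong_mult:
  assumes "rel_cong f f'" "rel_cong g g'"
  shows "rel_cong (f * g) (f' * g')"
  using rel_cong_context[OF assms(1), of 1 g] rel_cong_context[OF assms(2), of f' 1]
  by (simp add: rel_cong_trans[where g = "f' * g"])

lemma rel_cong_commute:
  assumes "(u, v) = (Vx, Vy) \<or> (u, v) = (VX, VY)"
  shows "rel_cong (fvar v * fvar u) (fvar u * fvar v)"
  unfolding rel_cong_def
proof safe
  fix w h k assume "w \<in> W"
  then have "- Poly_Mapping.single w (h * (fvar u * fvar v - fvar v * fvar u) * k) \<in> J"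
    using commuting_rel_in_J assms by (intro J_uminus) blast
  then show "Poly_Mapping.single w (h * (fvar v * fvar u - fvar u * fvar v) * k) \<in> J"
    by (simp add: algebra_simps flip: single_uminus)
qed

lemma rel_cong_sort:
  assumes "(u, v) = (Vx, Vy) \<or> (u, v) = (VX, VY)" and "set ws \<subseteq> {u, v}"
  shows "\<exists>i j. rel_cong (fword ws) (fvar u ^ i * fvar v ^ j)"
  using assms(2)
proof (induction ws)
  case Nil
  show ?case by (rule exI[of _ 0], rule exI[of _ 0]) (simp add: rel_cong_refl)
next
  case (Cons x ws)
  then obtain i j where ij: "rel_cong (fword ws) (fvar u ^ i * fvar v ^ j)" by auto
  have step: "rel_cong (fvar x * fword ws) (fvar x * (fvar u ^ i * fvar v ^ j))"
    by (rule rel_cong_mult[OF rel_cong_refl ij])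
  have comm: "rel_cong (fvar v * fvar u ^ i) (fvar u ^ i * fvar v)"
  proof (induction i)
    case (Suc i)
    have "rel_cong (fvar v * fvar u * fvar u ^ i) (fvar u * fvar v * fvar u ^ i)"
      by (rule rel_cong_mult[OF rel_cong_commute[OF assms(1)] rel_cong_refl])
    moreover have "rel_cong (fvar u * (fvar v * fvar u ^ i)) (fvar u * (fvar u ^ i * fvar v))"
      by (rule rel_cong_mult[OF rel_cong_refl Suc])
    ultimately show ?case
      by (simp add: mult.assoc rel_cong_trans[where g = "fvar u * (fvar v * fvar u ^ i)"])
  qed (simp add: rel_cong_refl)
  show ?case
  proof (cases "x = u")
    case True
    with step show ?thesis
      by (intro exI[of _ "Suc i"] exI[of _ j]) (simp add: mult.assoc)
  next
    case False
    then have "x = v" using Cons.prems by auto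
    moreover have "rel_cong (fvar v * (fvar u ^ i * fvar v ^ j)) (fvar u ^ i * fvar v ^ Suc j)"
      using rel_cong_mult[OF comm rel_cong_refl, of "fvar v ^ j"] by (simp add: mult.assoc)
    ultimately show ?thesis
      using step rel_cong_trans by (intro exI[of _ i] exI[of _ "Suc j"]) auto
  qed
qed

lemma span_sorted_monomial:
  assumes "w \<in> W"
  shows "Poly_Mapping.single w (pconst z * (fvar Vx ^ i * fvar Vy ^ j * (fvar VX ^ k * fvar VY ^ l))) \<in> pbw_span"
proof -
  define m where "m = Poly_Mapping.single Vx i + Poly_Mapping.single Vy j + Poly_Mapping.single VX k + Poly_Mapping.single VY l"
  have "nmon m = fvar Vx ^ i * fvar Vy ^ j * (fvar VX ^ k * fvar VY ^ l)"
    by (simp add: nmon_def m_def lookup_add lookup_single mult.assoc)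
  then have "Poly_Mapping.single w (pconst z * (fvar Vx ^ i * fvar Vy ^ j * (fvar VX ^ k * fvar VY ^ l)))
      = NP (Poly_Mapping.single w (Poly_Mapping.single m z))"
    by (simp add: NP_hom normal_order_hom)
  moreover have "Poly_Mapping.single w (Poly_Mapping.single m z) \<in> pbw_source \<zeta>"
    using assms by (auto simp: pbw_source_iff)
  ultimately show ?thesis
    using NP_carrier unfolding pbw_span_def by (auto intro!: bexI[of _ "Poly_Mapping.single w (Poly_Mapping.single m z)"])
qed

lemma span_separated_word:
  assumes "w \<in> W" "set us \<subseteq> {Vx, Vy}" "set vs \<subseteq> {VX, VY}"
  shows "Poly_Mapping.single w (pconst z * (fword us * fword vs)) \<in> pbw_span"
proof -
  obtain i j k l where "rel_cong (fword us) (fvar Vx ^ i * fvar Vy ^ j)" "rel_cong (fword vs) (fvar VX ^ k * fvar VY ^ l)"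
    using rel_cong_sort[of Vx Vy us] rel_cong_sort[of VX VY vs] assms by auto
  then have "rel_cong (fword us * fword vs) (fvar Vx ^ i * fvar Vy ^ j * (fvar VX ^ k * fvar VY ^ l))"
    by (rule rel_cong_mult)
  then have "Poly_Mapping.single w (pconst z * (fword us * fword vs - fvar Vx ^ i * fvar Vy ^ j * (fvar VX ^ k * fvar VY ^ l)) * 1) \<in> J"
    using assms(1) unfolding rel_cong_def by blast
  then show ?thesis
    by (intro span_cong[OF _ span_sorted_monomial[OF assms(1)]]) (simp add: right_diff_distrib single_diff)
qed

lemma nmon_eq_words:
  "nmon m = fword (replicate (Poly_Mapping.lookup m Vx) Vx @ replicate (Poly_Mapping.lookup m Vy) Vy)
    * fword (replicate (Poly_Mapping.lookup m VX) VX @ replicate (Poly_Mapping.lookup m VY) VY)"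
proof -
  have "fword (replicate n v) = fvar v ^ n" for v :: vgen and n
    by (induction n) simp_all
  then show ?thesis
    by (simp add: nmon_def mult.assoc)
qed

lemma span_left_mult_word:
  assumes words: "\<And>w z us vs. w \<in> W \<Longrightarrow> set us \<subseteq> {Vx, Vy} \<Longrightarrow> set vs \<subseteq> {VX, VY} \<Longrightarrow>
      Poly_Mapping.single w (f * (pconst z * (fword us * fword vs))) \<in> pbw_span"
    and F: "F \<in> pbw_span"
  shows "smash_mult (smash_poly f) F \<in> pbw_span"
proof -
  obtain P where P: "P \<in> pbw_source \<zeta>" "F - NP P \<in> J"
    using F by (auto simp: pbw_span_def)
  have single: "Poly_Mapping.single w (f * normal_order p) \<in> pbw_span" if w: "w \<in> W" for w p
  proof (induction p rule: poly_mapping_induct)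
    case (single m z)
    show ?case
      unfolding normal_order_hom nmon_eq_words by (rule words[OF w]) auto
  qed (auto simp: normal_order_hom span_zero distrib_left single_add span_add)
  have "smash_mult (smash_poly f) (NP P) \<in> pbw_span"
    using P(1)[unfolded pbw_source_iff]
    by (induction P rule: poly_mapping_induct_keys)
       (auto simp: NP_hom smash_mult_distrib span_zero span_add smash_poly_mult single)
  moreover have "smash_mult (smash_poly f) F - smash_mult (smash_poly f) (NP P) \<in> J"
    using J_mult(1)[OF S_poly P(2)] by (simp add: smash_mult_diff)
  ultimately show ?thesis
    by (rule span_cong[rotated])
qed

lemma span_left_mult_V:
  assumes "u \<in> {Vx, Vy}" "F \<in> pbw_span"
  shows "smash_mult (smash_poly (fvar u)) F \<in> pbw_span"
proof (rule span_left_mult_word[OF _ assms(2)])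
  fix w z us vs assume "w \<in> W" "set us \<subseteq> {Vx, Vy}" "set vs \<subseteq> {VX, VY}"
  then show "Poly_Mapping.single w (fvar u * (pconst z * (fword us * fword vs))) \<in> pbw_span"
    using span_separated_word[of w "u # us" vs z] assms(1) by (simp add: pconst_commute_left mult.assoc)
qed

text \<open>Induction on the number of letters from V, using vu = uv - [u,v]. The induction
  hypothesis covers the first term. The commutator is a combination of reflections, which turn the
  remaining word into a multiple of a word separated in the same way.\<close>

lemma span_V_dual_word:
  assumes "w \<in> W" "v \<in> {VX, VY}" "set us \<subseteq> {Vx, Vy}" "set vs \<subseteq> {VX, VY}"
  shows "Poly_Mapping.single w (fvar v * (pconst z * (fword us * fword vs))) \<in> pbw_span"
  using assms(3)
proof (induction us)
  case Nil
  then show ?case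
    using span_separated_word[of w "[]" "v # vs" z] assms by (simp add: pconst_commute_left mult.assoc)
next
  case (Cons u us)
  let ?k = "pconst z * (fword us * fword vs)"
  let ?R = "\<Sum>\<eta>\<in>\<mu>. Poly_Mapping.single (reflm \<eta> ** w) (pconst (rel_coeff u v \<eta>) * gl_act (reflm \<eta>) ?k)"
  have u: "u \<in> {Vx, Vy}" using Cons.prems by auto
  have "smash_mult (smash_poly (fvar u)) (Poly_Mapping.single w (fvar v * ?k)) \<in> pbw_span"
    using Cons u by (intro span_left_mult_V) auto
  then have 1: "Poly_Mapping.single w (fvar u * (fvar v * ?k)) \<in> pbw_span"
    by (simp add: smash_poly_mult)
  have 2: "- ?R \<in> pbw_span"
    unfolding sum_negf[symmetric]
  proof (rule span_sum)
    fix \<eta> assume \<eta>: "\<eta> \<in> \<mu>"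
    obtain y y' where y: "gl_act (reflm \<eta>) (fword us) = pconst y * fword (map swv us)"
      "gl_act (reflm \<eta>) (fword vs) = pconst y' * fword (map swv vs)"
      using gl_act_refl_fword[OF mu_nonzero[OF \<eta>]] by metis
    have sw: "set (map swv us) \<subseteq> {Vx, Vy}" "set (map swv vs) \<subseteq> {VX, VY}"
      using Cons.prems assms(4) by auto
    have "- Poly_Mapping.single (reflm \<eta> ** w) (pconst (rel_coeff u v \<eta>) * gl_act (reflm \<eta>) ?k)
        = Poly_Mapping.single (reflm \<eta> ** w) (pconst (- rel_coeff u v \<eta> * z * y * y') * (fword (map swv us) * fword (map swv vs)))"
      by (simp add: gl_act_hom y pconst_mult pconst_uminus single_uminus mult.assoc pconst_commute_left[of "prod_list _"])
    also have "\<dots> \<in> pbw_span"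
      using span_separated_word[OF W_mult[OF W_refl[OF \<eta>] assms(1)] sw] .
    finally show "- Poly_Mapping.single (reflm \<eta> ** w) (pconst (rel_coeff u v \<eta>) * gl_act (reflm \<eta>) ?k) \<in> pbw_span" .
  qed
  have "- (Poly_Mapping.single w ((fvar u * fvar v - fvar v * fvar u) * ?k) - ?R) \<in> J"
    using mixed_rel_in_J[OF assms(1) u assms(2)] by (rule J_uminus)
  moreover have "fvar v * (pconst z * (fword (u # us) * fword vs)) = fvar v * fvar u * ?k"
    by (simp add: pconst_commute_left mult.assoc)
  ultimately have "Poly_Mapping.single w (fvar v * (pconst z * (fword (u # us) * fword vs)))
      - (Poly_Mapping.single w (fvar u * (fvar v * ?k)) + - ?R) \<in> J"
    by (simp add: left_diff_distrib single_diff mult.assoc algebra_simps)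
  then show ?case
    by (rule span_cong[OF _ span_add[OF 1 2]])
qed

lemma span_left_mult:
  assumes "F \<in> pbw_span"
  shows "smash_mult (smash_poly (fvar v)) F \<in> pbw_span"
proof (cases "v \<in> {Vx, Vy}")
  case False
  then have "v \<in> {VX, VY}" by (cases v) auto
  then show ?thesis
    by (intro span_left_mult_word[OF _ assms] span_V_dual_word)
qed (simp add: span_left_mult_V assms)

lemma span_all:
  assumes "F \<in> carrier S"
  shows "F \<in> pbw_span"
  using assms
proof (induction F rule: S_induct)
  case (single w f)
  show ?case
  proof (induction f rule: free_alg_induct)
    case (const_word ws z)
    show ?case
    proof (induction ws)
      case Nil
      then show ?case
        using span_separated_word[OF single, of "[]" "[]" z] by simp
    next
      case (Cons v ws)
      then show ?case
        using span_left_mult[OF Cons, of v] by (simp add: smash_poly_mult pconst_commute_left)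
    qed
  qed (simp_all add: span_zero single_add span_add)
qed (simp_all add: span_zero span_add)

end

lemma coeff_sums_vanish:
  fixes c x :: "'k \<Rightarrow> complex"
  assumes "finite K" "infinite A" "\<And>x. x \<in> A \<Longrightarrow> (\<Sum>k\<in>K. c k * x ^ e k) = 0"
  shows "(\<Sum>k\<in>{k\<in>K. e k = n}. c k) = 0"
proof -
  let ?p = "\<Sum>k\<in>K. monom (c k) (e k)"
  have "A \<subseteq> {x. poly ?p x = 0}"
    using assms(3) by (auto simp: poly_sum poly_monom)
  then have "infinite {x. poly ?p x = 0}"
    using assms(2) finite_subset by blast
  then have "?p = 0"
    using poly_roots_finite by blast
  then have "coeff ?p n = 0" by simp
  then show ?thesis
    using assms(1) by (simp add: coeff_sum sum.inter_filter)
qed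

text \<open>One variable is removed at a time. Fixing one exponent keeps all monomials that share
  it, which is why \<open>coeff_sums_vanish\<close> speaks of sums over fibres. The set for a
  variable may depend on the earlier ones: the norm of v must avoid that of u, and later the
  possible values of power sums depend on the products.\<close>

lemma four_variable_vanish:
  fixes c :: "'k \<Rightarrow> complex"
  assumes K: "finite K" and inf: "infinite A1" "\<And>x. x \<in> A1 \<Longrightarrow> infinite (A2 x)"
      "\<And>x y. x \<in> A1 \<Longrightarrow> y \<in> A2 x \<Longrightarrow> infinite (A3 x y)"
      "\<And>x y s. x \<in> A1 \<Longrightarrow> y \<in> A2 x \<Longrightarrow> s \<in> A3 x y \<Longrightarrow> infinite (A4 x y s)"
    and van: "\<And>x y s t. x \<in> A1 \<Longrightarrow> y \<in> A2 x \<Longrightarrow> s \<in> A3 x y \<Longrightarrow> t \<in> A4 x y s \<Longrightarrow>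
      (\<Sum>k\<in>K. c k * x ^ e1 k * y ^ e2 k * s ^ e3 k * t ^ e4 k) = 0"
    and inj: "\<And>k k'. k \<in> K \<Longrightarrow> k' \<in> K \<Longrightarrow> e1 k = e1 k' \<Longrightarrow> e2 k = e2 k' \<Longrightarrow> e3 k = e3 k' \<Longrightarrow> e4 k = e4 k' \<Longrightarrow> k = k'"
    and k0: "k0 \<in> K"
  shows "c k0 = 0"
proof -
  let ?K4 = "{k\<in>K. e4 k = e4 k0}"
  let ?K3 = "{k\<in>?K4. e3 k = e3 k0}"
  let ?K2 = "{k\<in>?K3. e2 k = e2 k0}"
  let ?K1 = "{k\<in>?K2. e1 k = e1 k0}"
  have 4: "(\<Sum>k\<in>?K4. c k * x ^ e1 k * y ^ e2 k * s ^ e3 k) = 0" if "x \<in> A1" "y \<in> A2 x" "s \<in> A3 x y" for x y s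
    by (rule coeff_sums_vanish[OF K inf(4)[OF that]]) (rule van[OF that])
  have 3: "(\<Sum>k\<in>?K3. c k * x ^ e1 k * y ^ e2 k) = 0" if "x \<in> A1" "y \<in> A2 x" for x y
    by (rule coeff_sums_vanish[OF _ inf(3)[OF that]]) (use K 4[OF that] in simp_all)
  have 2: "(\<Sum>k\<in>?K2. c k * x ^ e1 k) = 0" if "x \<in> A1" for x
    by (rule coeff_sums_vanish[OF _ inf(2)[OF that]]) (use K 3[OF that] in simp_all)
  have 1: "(\<Sum>k\<in>?K1. c k) = 0"
    by (rule coeff_sums_vanish[OF _ inf(1)]) (use K 2 in simp_all)
  have "?K1 = {k0}"
    using k0 inj by auto
  with 1 show ?thesis by simp
qed

definition mdeg :: "(vgen \<Rightarrow>\<^sub>0 nat) \<Rightarrow> nat" where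
  "mdeg m = Poly_Mapping.lookup m Vx + Poly_Mapping.lookup m Vy + Poly_Mapping.lookup m VX + Poly_Mapping.lookup m VY"

definition monval :: "(vgen \<Rightarrow>\<^sub>0 nat) \<Rightarrow> pt \<Rightarrow> complex" where
  "monval m z = cu z ^ Poly_Mapping.lookup m Vx * cv z ^ Poly_Mapping.lookup m Vy *
    cp z ^ Poly_Mapping.lookup m VX * cr z ^ Poly_Mapping.lookup m VY"

definition symbol_val :: "nat \<Rightarrow> vgen mpoly \<Rightarrow> pt \<Rightarrow> complex" where
  "symbol_val N p z = pext (\<lambda>m c. if mdeg m = N then c * monval m z else 0) p"

lemma vgen_mon_eqI:
  assumes "Poly_Mapping.lookup m Vx = Poly_Mapping.lookup m' Vx" "Poly_Mapping.lookup m Vy = Poly_Mapping.lookup m' Vy"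
    "Poly_Mapping.lookup m VX = Poly_Mapping.lookup m' VX" "Poly_Mapping.lookup m VY = Poly_Mapping.lookup m' VY"
  shows "m = m'"
proof (rule poly_mapping_eqI)
  fix k show "Poly_Mapping.lookup m k = Poly_Mapping.lookup m' k"
    using assms by (cases k) auto
qed

lemma infinite_norm_neq: "infinite {v :: complex. v \<noteq> 0 \<and> norm u \<noteq> norm v}" for u :: complex
proof -
  let ?f = "\<lambda>n::nat. of_real (norm u + 1 + n) :: complex"
  have pos: "0 < norm u + 1 + real n" for n
    using norm_ge_zero[of u] by linarith
  have norm: "norm (?f n) = norm u + 1 + n" for n
    unfolding norm_of_real using pos[of n] by simp
  have "?f n \<noteq> 0" for n
    using pos[of n] by (simp only: of_real_eq_0_iff)
  moreover have "norm u \<noteq> norm (?f n)" for n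
    unfolding norm by simp
  ultimately
  have sub: "range ?f \<subseteq> {v. v \<noteq> 0 \<and> norm u \<noteq> norm v}"
    by (intro image_subsetI CollectI conjI)
  have "inj ?f"
    by (rule injI) (simp only: of_real_eq_iff add_left_cancel of_nat_eq_iff)
  then have "infinite (range ?f)"
    by (rule range_inj_infinite)
  with sub show ?thesis
    by (rule infinite_super)
qed

lemma symbol_val_zero_imp:
  assumes "\<And>z. symbol_val N p z = 0" "mdeg m = N"
  shows "Poly_Mapping.lookup p m = 0"
proof (rule ccontr)
  assume nz: "Poly_Mapping.lookup p m \<noteq> 0"
  let ?K = "{m\<in>Poly_Mapping.keys p. mdeg m = N}"
  \<comment> \<open>The second condition repeats the first one and gives the set the shape treated
    by \<open>infinite_norm_neq\<close>.\<close>
  let ?A = "{v::complex. v \<noteq> 0 \<and> norm (0::complex) \<noteq> norm v}"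
  have "Poly_Mapping.lookup p m = 0"
  proof (rule four_variable_vanish[where K = ?K and ?A1.0 = ?A and ?A2.0 = "\<lambda>x. {v. v \<noteq> 0 \<and> norm x \<noteq> norm v}"
        and ?A3.0 = "\<lambda>_ _. UNIV" and ?A4.0 = "\<lambda>_ _ _. UNIV"
        and ?e1.0 = "\<lambda>m. Poly_Mapping.lookup m Vx" and ?e2.0 = "\<lambda>m. Poly_Mapping.lookup m Vy"
        and ?e3.0 = "\<lambda>m. Poly_Mapping.lookup m VX" and ?e4.0 = "\<lambda>m. Poly_Mapping.lookup m VY"])
    fix x y s t :: complex
    assume "x \<in> ?A" "y \<in> {v. v \<noteq> 0 \<and> norm x \<noteq> norm v}"
    then have c: "cu (mkpt x y s t) = x" "cv (mkpt x y s t) = y" "cp (mkpt x y s t) = s" "cr (mkpt x y s t) = t"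
      by (auto intro!: mkpt_coords)
    show "(\<Sum>m\<in>?K. Poly_Mapping.lookup p m * x ^ Poly_Mapping.lookup m Vx * y ^ Poly_Mapping.lookup m Vy *
        s ^ Poly_Mapping.lookup m VX * t ^ Poly_Mapping.lookup m VY) = 0"
      using assms(1)[of "mkpt x y s t"]
      by (simp add: symbol_val_def pext_def monval_def c sum.inter_filter mult.assoc cong: if_cong)
  next
    show "m \<in> ?K"
      using nz assms(2) by (simp add: in_keys_iff)
  next
    show "infinite ?A" by (rule infinite_norm_neq)
  next
    show "infinite (UNIV :: complex set)" by (rule infinite_UNIV_char_0)
  next
    show "infinite (UNIV :: complex set)" by (rule infinite_UNIV_char_0)
  next
    fix x :: complex
    show "infinite {v :: complex. v \<noteq> 0 \<and> norm x \<noteq> norm v}" by (rule infinite_norm_neq)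
  qed (simp, rule vgen_mon_eqI)
  with nz show False by simp
qed

lemma symbol_val_hom:
  "symbol_val N 0 z = 0" "symbol_val N (p + q) z = symbol_val N p z + symbol_val N q z"
  "symbol_val N (p - q) z = symbol_val N p z - symbol_val N q z"
  unfolding symbol_val_def by (simp_all add: pext_add pext_diff algebra_simps)

fun cval :: "vgen \<Rightarrow> pt \<Rightarrow> complex" where
  "cval Vx = cu" | "cval Vy = cv" | "cval VX = cp" | "cval VY = cr"

section \<open>Symbols as limits under rescaling\<close>

context dihedral_root
begin

lemma genop_0: "genop 0 v = mulop (cval v)"
  by (cases v) (simp_all add: mulop_hom)

text \<open>At parameter 0 all generators act by multiplication with coordinate functions, so a word
  acts by a function: its classical symbol.\<close>

definition cl :: "vgen free_alg \<Rightarrow> pt \<Rightarrow> complex" where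
  "cl f z = app (fop 0 f) (\<lambda>_. 1) z"

lemma fop_0: "fop 0 f = mulop (cl f)"
proof -
  have "\<exists>h. fop 0 f = mulop h"
  proof (induction f rule: free_alg_induct)
    case zero
    show ?case by (rule exI[of _ "\<lambda>_. 0"]) (simp add: fop_hom mulop_hom)
  next
    case (const_word ws c)
    have "\<exists>h. fop 0 (fword ws) = mulop h"
    proof (induction ws)
      case Nil
      show ?case by (rule exI[of _ "\<lambda>_. 1"]) (simp add: fop_hom mulop_hom)
    next
      case (Cons v ws)
      then obtain h where "fop 0 (fword ws) = mulop h" by blast
      then show ?case
        by (intro exI[of _ "\<lambda>z. cval v z * h z"]) (simp add: fop_hom genop_0 mulop_hom)
    qed
    then obtain h where "fop 0 (fword ws) = mulop h" by blast
    then show ?case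
      by (intro exI[of _ "\<lambda>z. c * h z"]) (simp add: fop_hom mulop_hom)
  next
    case (add f g)
    then obtain h k where "fop 0 f = mulop h" "fop 0 g = mulop k" by blast
    then show ?case
      by (intro exI[of _ "\<lambda>z. h z + k z"]) (simp add: fop_hom mulop_hom)
  qed
  then obtain h where "fop 0 f = mulop h" by blast
  then show ?thesis
    by (simp add: cl_def fun_eq_iff)
qed

lemma cl_hom:
  "cl (f + g) z = cl f z + cl g z" "cl (f - g) z = cl f z - cl g z" "cl (f * g) z = cl f z * cl g z"
  "cl 0 z = 0" "cl 1 z = 1" "cl (fvar v) z = cval v z" "cl (pconst c) z = c"
proof -
  have "mulop (cl (f + g)) = mulop (\<lambda>z. cl f z + cl g z)" "mulop (cl (f - g)) = mulop (\<lambda>z. cl f z - cl g z)"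
    "mulop (cl (f * g)) = mulop (\<lambda>z. cl f z * cl g z)"
    by (simp_all only: fop_0[symmetric] fop_hom mulop_hom)
  then show "cl (f + g) z = cl f z + cl g z" "cl (f - g) z = cl f z - cl g z" "cl (f * g) z = cl f z * cl g z"
    by (simp_all add: fun_eq_iff)
qed (simp_all add: cl_def fop_hom genop_0)

lemma cl_power: "cl (f ^ n) z = cl f z ^ n"
  by (induction n) (simp_all add: cl_hom)

lemma refl_pt_sc: "t \<noteq> 0 \<Longrightarrow> \<eta> \<in> \<mu> \<Longrightarrow> refl_pt \<eta> (sc t z) = sc t (refl_pt \<eta> z)"
  by (intro pt_eqI) (simp_all add: refl_pt_coords mu_norm sc_coords)

lemma rot_pt_sc: "t \<noteq> 0 \<Longrightarrow> \<eta> \<in> \<mu> \<Longrightarrow> rot_pt \<eta> (sc t z) = sc t (rot_pt \<eta> z)"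
  by (intro pt_eqI) (simp_all add: rot_pt_coords mu_norm sc_coords)

lemma act_sc: "t \<noteq> 0 \<Longrightarrow> w \<in> W \<Longrightarrow> act w (sc t z) = sc t (act w z)"
  by (erule W_cases) (simp_all add: act_refl act_rot mu_nonzero refl_pt_sc rot_pt_sc)

lemma al_sc: "t \<noteq> 0 \<Longrightarrow> al \<eta> (sc t z) = t * al \<eta> z"
  by (simp add: al_def sc_coords right_diff_distrib)

text \<open>A coordinate scales by t while the reciprocal of a root scales by 1/t. The discrepancy
  of \<open>t ^ 2\<close> is moved into the parameter.\<close>

lemma genop_sc:
  assumes t: "t \<noteq> 0"
  shows "compop (sc t) * genop b v = scal t * genop (b / t ^ 2) v * compop (sc t)"
proof (rule lop_eqI)
  fix \<phi> z
  have "(\<Sum>\<eta>\<in>\<mu>. \<phi> (refl_pt \<eta> (sc t z)) / al \<eta> (sc t z)) = inverse t * (\<Sum>\<eta>\<in>\<mu>. \<phi> (sc t (refl_pt \<eta> z)) / al \<eta> z)"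
    unfolding sum_distrib_left by (intro sum.cong refl) (simp add: t refl_pt_sc al_sc field_simps)
  moreover have "(\<Sum>\<eta>\<in>\<mu>. inverse \<eta> * \<phi> (refl_pt \<eta> (sc t z)) / al \<eta> (sc t z)) = inverse t * (\<Sum>\<eta>\<in>\<mu>. inverse \<eta> * \<phi> (sc t (refl_pt \<eta> z)) / al \<eta> z)"
    unfolding sum_distrib_left by (intro sum.cong refl) (simp add: t refl_pt_sc al_sc field_simps)
  ultimately show "app (compop (sc t) * genop b v) \<phi> z = app (scal t * genop (b / t ^ 2) v * compop (sc t)) \<phi> z"
    using t by (cases v) (simp_all add: app_genop sc_coords del: genop.simps(3,4), simp_all add: field_simps power2_eq_square)
qed

text \<open>Since scaling moves the parameter, homogeneity is a statement about the whole family of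
  representations and not about a single one.\<close>

definition homogeneous :: "nat \<Rightarrow> vgen free_alg \<Rightarrow> bool" where
  "homogeneous n f \<longleftrightarrow> (\<forall>b t. t \<noteq> 0 \<longrightarrow> compop (sc t) * fop b f = scal (t ^ n) * fop (b / t ^ 2) f * compop (sc t))"

lemma homogeneous_fvar: "homogeneous 1 (fvar v)"
  by (simp add: homogeneous_def fop_hom genop_sc)

lemma homogeneous_pconst: "homogeneous 0 (pconst z)"
  unfolding homogeneous_def by (simp add: fop_hom mulop_hom compop_mulop)

lemma homogeneous_one: "homogeneous 0 1"
  using homogeneous_pconst[of 1] by simp

lemma homogeneous_zero: "homogeneous n 0"
  by (simp add: homogeneous_def fop_hom)

lemma homogeneous_add: "homogeneous n f \<Longrightarrow> homogeneous n g \<Longrightarrow> homogeneous n (f + g)"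
  by (simp add: homogeneous_def fop_hom distrib_left distrib_right)

lemma homogeneous_diff: "homogeneous n f \<Longrightarrow> homogeneous n g \<Longrightarrow> homogeneous n (f - g)"
  by (simp add: homogeneous_def fop_hom left_diff_distrib right_diff_distrib)

lemma homogeneous_mult:
  assumes "homogeneous m f" "homogeneous n g"
  shows "homogeneous (m + n) (f * g)"
  unfolding homogeneous_def
proof (intro allI impI)
  fix b t :: complex assume t: "t \<noteq> 0"
  let ?b = "b / t ^ 2"
  have "compop (sc t) * fop b (f * g) = (compop (sc t) * fop b f) * fop b g"
    by (simp add: fop_hom mult.assoc)
  also have "\<dots> = scal (t ^ m) * fop ?b f * (compop (sc t) * fop b g)"
    using assms(1) t by (simp add: homogeneous_def mult.assoc)
  also have "\<dots> = scal (t ^ m) * (fop ?b f * scal (t ^ n)) * fop ?b g * compop (sc t)"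
    using assms(2) t by (simp add: homogeneous_def mult.assoc)
  also have "\<dots> = scal (t ^ (m + n)) * fop ?b (f * g) * compop (sc t)"
    by (simp add: scal_commute[of "t ^ n" "fop ?b f", symmetric] fop_hom power_add mulop_hom mult.assoc)
  finally show "compop (sc t) * fop b (f * g) = scal (t ^ (m + n)) * fop ?b (f * g) * compop (sc t)" .
qed

lemma homogeneous_power: "homogeneous m f \<Longrightarrow> homogeneous (n * m) (f ^ n)"
  by (induction n) (auto simp: homogeneous_one dest: homogeneous_mult)

lemma homogeneous_scale: "homogeneous n f \<Longrightarrow> homogeneous n (pconst z * f)"
  using homogeneous_mult[OF homogeneous_pconst] by fastforce

lemma homogeneous_nmon: "homogeneous (mdeg m) (nmon m)"
proof -
  have "homogeneous n (fvar v ^ n)" for n v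
    using homogeneous_power[OF homogeneous_fvar, of n v] by simp
  then show ?thesis
    unfolding nmon_def mdeg_def by (intro homogeneous_mult)
qed

lemma cl_nmon: "cl (nmon m) z = monval m z"
  by (simp add: nmon_def monval_def cl_hom cl_power)

text \<open>A letter X or Y contributes at most one factor of the parameter, so the value at a fixed
  point is a polynomial in it. This gives the limit at parameter 0 and is the basis of the later
  parity argument.\<close>

lemma fop_polynomial: "\<exists>q. \<forall>b. app (fop b f) \<phi> z = poly q b"
proof (induction f rule: free_alg_induct)
  case zero
  show ?case by (rule exI[of _ 0]) (simp add: fop_hom)
next
  case (add f g)
  then obtain p q where "\<forall>b. app (fop b f) \<phi> z = poly p b" "\<forall>b. app (fop b g) \<phi> z = poly q b" by blast
  then show ?case by (intro exI[of _ "p + q"]) (simp add: fop_hom)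
next
  case (const_word ws c)
  have "\<exists>q. \<forall>b. app (fop b (fword ws)) \<phi> z = poly q b" for z
  proof (induction ws arbitrary: z)
    case Nil
    show ?case by (rule exI[of _ "[:\<phi> z:]"]) (simp add: fop_hom)
  next
    case (Cons v ws)
    then obtain q where q: "\<And>z b. app (fop b (fword ws)) \<phi> z = poly (q z) b" by metis
    have "\<forall>b. app (fop b (fword (v # ws))) \<phi> z = poly (case v of Vx \<Rightarrow> smult (cu z) (q z) | Vy \<Rightarrow> smult (cv z) (q z)
        | VX \<Rightarrow> smult (cp z) (q z) - [:0, 1:] * (\<Sum>\<eta>\<in>\<mu>. smult (1 / al \<eta> z) (q (refl_pt \<eta> z)))
        | VY \<Rightarrow> smult (cr z) (q z) + [:0, 1:] * (\<Sum>\<eta>\<in>\<mu>. smult (inverse \<eta> / al \<eta> z) (q (refl_pt \<eta> z)))) b"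
      by (cases v) (simp_all add: fop_hom app_genop q poly_sum del: genop.simps(3,4))
    then show ?case by blast
  qed
  then obtain q where "\<And>b. app (fop b (fword ws)) \<phi> z = poly q b" by blast
  then show ?case by (intro exI[of _ "smult c q"]) (simp add: fop_hom)
qed

lemma fop_tendsto:
  "((\<lambda>\<epsilon>. app (fop (b * \<epsilon> ^ 2) f) \<phi> z) \<longlongrightarrow> cl f z * \<phi> z) (at 0)"
proof -
  obtain q where q: "\<And>b. app (fop b f) \<phi> z = poly q b"
    using fop_polynomial by blast
  have "isCont (\<lambda>\<epsilon>. poly q (b * \<epsilon> ^ 2)) 0"
    by (intro continuous_intros)
  then have "((\<lambda>\<epsilon>. poly q (b * \<epsilon> ^ 2)) \<longlongrightarrow> poly q 0) (at 0)"
    by (simp add: isCont_def)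
  moreover have "poly q 0 = cl f z * \<phi> z"
    by (simp add: q[symmetric] fop_0)
  ultimately show ?thesis
    by (simp add: q)
qed

text \<open>The operator conjugated by scaling and evaluated at a point. Times
  \<open>\<epsilon> ^ N\<close>, it tends to the degree N symbol when no higher degree
  occurs.\<close>

definition rescaled :: "pt lop \<Rightarrow> (pt \<Rightarrow> complex) \<Rightarrow> pt \<Rightarrow> complex \<Rightarrow> complex" where
  "rescaled L \<psi> z \<epsilon> = app L (\<lambda>y. \<psi> (sc \<epsilon> y)) (sc (inverse \<epsilon>) z)"

lemma rescaled_homogeneous:
  assumes "homogeneous n f" "w \<in> W" "\<epsilon> \<noteq> 0"
  shows "\<epsilon> ^ n * rescaled (fop b f * trop w) \<psi> z \<epsilon> = app (fop (b * \<epsilon> ^ 2) f) (\<lambda>y. \<psi> (act w y)) z"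
proof -
  let ?t = "inverse \<epsilon>"
  have "rescaled (fop b f * trop w) \<psi> z \<epsilon> = app ((compop (sc ?t) * fop b f) * (trop w * compop (sc \<epsilon>))) \<psi> z"
    by (simp add: rescaled_def)
  also have "\<dots> = app (scal (?t ^ n) * fop (b / ?t ^ 2) f * (compop (sc ?t) * (trop w * compop (sc \<epsilon>)))) \<psi> z"
    using assms by (simp add: homogeneous_def mult.assoc)
  also have "compop (sc ?t) * (trop w * compop (sc \<epsilon>)) = trop w"
    using assms sc_inverse[of \<epsilon>] by (intro lop_eqI) (simp add: act_sc)
  finally show ?thesis
    using assms(3) by (simp add: divide_inverse power_inverse)
qed

lemma lead_homogeneous:
  assumes "homogeneous n f" "w \<in> W" "n \<le> N"
  shows "((\<lambda>\<epsilon>. \<epsilon> ^ N * rescaled (fop b f * trop w) \<psi> z \<epsilon>) \<longlongrightarrow> (if n = N then cl f z * \<psi> (act w z) else 0)) (at 0)"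
proof -
  have "((\<lambda>\<epsilon>. \<epsilon> ^ (N - n) * app (fop (b * \<epsilon> ^ 2) f) (\<lambda>y. \<psi> (act w y)) z) \<longlongrightarrow> 0 ^ (N - n) * (cl f z * \<psi> (act w z))) (at 0)"
    by (intro tendsto_intros fop_tendsto)
  moreover have "\<forall>\<^sub>F \<epsilon> in at 0. \<epsilon> ^ (N - n) * app (fop (b * \<epsilon> ^ 2) f) (\<lambda>y. \<psi> (act w y)) z = \<epsilon> ^ N * rescaled (fop b f * trop w) \<psi> z \<epsilon>"
    unfolding eventually_at_filter
  proof (intro always_eventually allI impI)
    fix \<epsilon> :: complex assume "\<epsilon> \<noteq> 0"
    have "\<epsilon> ^ N = \<epsilon> ^ (N - n) * \<epsilon> ^ n"
      using assms(3) by (simp flip: power_add)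
    then show "\<epsilon> ^ (N - n) * app (fop (b * \<epsilon> ^ 2) f) (\<lambda>y. \<psi> (act w y)) z = \<epsilon> ^ N * rescaled (fop b f * trop w) \<psi> z \<epsilon>"
      using rescaled_homogeneous[OF assms(1,2) \<open>\<epsilon> \<noteq> 0\<close>, of b \<psi> z] by (simp add: mult.assoc)
  qed
  ultimately have "((\<lambda>\<epsilon>. \<epsilon> ^ N * rescaled (fop b f * trop w) \<psi> z \<epsilon>) \<longlongrightarrow> 0 ^ (N - n) * (cl f z * \<psi> (act w z))) (at 0)"
    by (rule Lim_transform_eventually)
  then show ?thesis
    using assms(3) by (cases "n = N") (simp_all add: power_0_left)
qed

lemma rescaled_hom:
  "rescaled (L + M) \<psi> z \<epsilon> = rescaled L \<psi> z \<epsilon> + rescaled M \<psi> z \<epsilon>" "rescaled 0 \<psi> z \<epsilon> = 0"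
  by (simp_all add: rescaled_def)

text \<open>The bound is strict so that degree below 0 means zero, and a descent on the degree can
  end there.\<close>

definition pdeg_lt :: "(mat2 \<Rightarrow>\<^sub>0 vgen mpoly) \<Rightarrow> nat \<Rightarrow> bool" where
  "pdeg_lt P N \<longleftrightarrow> (\<forall>w m. Poly_Mapping.lookup (Poly_Mapping.lookup P w) m \<noteq> 0 \<longrightarrow> mdeg m < N)"

lemma lead_single_poly:
  assumes "w \<in> W" "\<And>m. Poly_Mapping.lookup p m \<noteq> 0 \<Longrightarrow> mdeg m \<le> N"
  shows "((\<lambda>\<epsilon>. \<epsilon> ^ N * rescaled (fop b (normal_order p) * trop w) \<psi> z \<epsilon>) \<longlongrightarrow> symbol_val N p z * \<psi> (act w z)) (at 0)"
proof -
  have "Poly_Mapping.keys p \<subseteq> {m. mdeg m \<le> N}"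
    using assms(2) by (auto simp: in_keys_iff)
  then show ?thesis
  proof (induction p rule: poly_mapping_induct_keys)
    case zero
    show ?case by (simp add: normal_order_hom fop_hom rescaled_hom symbol_val_hom)
  next
    case (single m c)
    have "symbol_val N (Poly_Mapping.single m c) z * \<psi> (act w z) = (if mdeg m = N then cl (pconst c * nmon m) z * \<psi> (act w z) else 0)"
      by (simp add: symbol_val_def cl_hom cl_nmon)
    moreover have "mdeg m \<le> N" using single by simp
    ultimately show ?case
      using lead_homogeneous[OF homogeneous_scale[OF homogeneous_nmon] assms(1), of m N b c \<psi> z]
      by (simp only: normal_order_hom)
  next
    case (add p q)
    then show ?case
      using tendsto_add[OF add] by (simp add: normal_order_hom fop_hom rescaled_hom symbol_val_hom algebra_simps)
  qed
qed

lemma lead_NP: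
  assumes "Poly_Mapping.keys P \<subseteq> W" "pdeg_lt P (Suc N)"
  shows "((\<lambda>\<epsilon>. \<epsilon> ^ N * rescaled (sop b (NP P)) \<psi> z \<epsilon>) \<longlongrightarrow> (\<Sum>w\<in>W. symbol_val N (Poly_Mapping.lookup P w) z * \<psi> (act w z))) (at 0)"
proof -
  have NP: "NP P = (\<Sum>w\<in>W. Poly_Mapping.single w (normal_order (Poly_Mapping.lookup P w)))"
    unfolding NP_def by (rule pext_superset) (simp_all add: assms normal_order_hom)
  have res: "rescaled (sum L A) \<psi> z \<epsilon> = (\<Sum>i\<in>A. rescaled (L i) \<psi> z \<epsilon>)" for L \<epsilon> and A :: "mat2 set"
    by (induction A rule: infinite_finite_induct) (simp_all add: rescaled_hom)
  have "((\<lambda>\<epsilon>. \<Sum>w\<in>W. \<epsilon> ^ N * rescaled (fop b (normal_order (Poly_Mapping.lookup P w)) * trop w) \<psi> z \<epsilon>)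
      \<longlongrightarrow> (\<Sum>w\<in>W. symbol_val N (Poly_Mapping.lookup P w) z * \<psi> (act w z))) (at 0)"
    using assms(2) by (intro tendsto_sum lead_single_poly) (auto simp: pdeg_lt_def less_Suc_eq_le)
  then show ?thesis
    by (simp add: NP sop_sum res sum_distrib_left)
qed

text \<open>W acts freely, and the first two coordinates already separate the points of an orbit: a
  reflection exchanges the norms of u and v, a rotation keeps them.\<close>

lemma act_inject:
  assumes "g \<in> W" "h \<in> W" "cu (act g z) = cu (act h z)" "cv (act g z) = cv (act h z)"
  shows "g = h"
  using assms(1)
proof (cases rule: W_cases)
  case g: (refl \<eta>)
  show ?thesis
    using assms(2)
  proof (cases rule: W_cases)
    case (refl \<theta>)
    then show ?thesis
      using g assms(4) by (simp add: act_refl mu_nonzero refl_pt_coords mu_norm)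
  next
    case (rot \<theta>)
    then have "norm (cv z / \<eta>) = norm (\<theta> * cu z)"
      using g assms(3) by (simp add: act_refl act_rot mu_nonzero refl_pt_coords rot_pt_coords mu_norm)
    then show ?thesis
      using pt_norm[of z] g rot by (simp add: norm_mult norm_divide mu_norm)
  qed
next
  case g: (rot \<eta>)
  show ?thesis
    using assms(2)
  proof (cases rule: W_cases)
    case (rot \<theta>)
    then show ?thesis
      using g assms(3) by (simp add: act_rot mu_nonzero rot_pt_coords mu_norm)
  next
    case (refl \<theta>)
    then have "norm (cv z / \<theta>) = norm (\<eta> * cu z)"
      using g assms(3) by (simp add: act_refl act_rot mu_nonzero refl_pt_coords rot_pt_coords mu_norm)
    then show ?thesis
      using pt_norm[of z] g refl by (simp add: norm_mult norm_divide mu_norm)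
  qed
qed

text \<open>By freeness, testing with the indicator of one orbit point isolates the coefficient of
  one group element.\<close>

lemma sum_indicator_orbit:
  assumes "w \<in> W"
  shows "(\<Sum>g\<in>W. G g * (if act g z = act w z then 1 else 0)) = (G w :: complex)"
proof -
  have "(\<Sum>g\<in>W. G g * (if act g z = act w z then 1 else 0)) = (\<Sum>g\<in>W. if g = w then G w else 0)"
  proof (intro sum.cong refl)
    fix g assume "g \<in> W"
    then have "act g z = act w z \<longleftrightarrow> g = w"
      using act_inject[OF _ assms, of g z] by auto
    then show "G g * (if act g z = act w z then 1 else 0) = (if g = w then G w else 0)"
      by simp
  qed
  then show ?thesis
    using assms by simp
qed

lemma pdeg_lt_exists: "\<exists>N. pdeg_lt P N"
proof -
  let ?D = "\<Union>w\<in>Poly_Mapping.keys P. mdeg ` Poly_Mapping.keys (Poly_Mapping.lookup P w)"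
  have "finite ?D" by simp
  then obtain N where N: "\<forall>x\<in>?D. x < N"
    using finite_nat_set_iff_bounded by blast
  have "mdeg m < N" if "Poly_Mapping.lookup (Poly_Mapping.lookup P w) m \<noteq> 0" for w m
  proof -
    have "w \<in> Poly_Mapping.keys P" "m \<in> Poly_Mapping.keys (Poly_Mapping.lookup P w)"
      using that by (auto simp: in_keys_iff)
    then have "mdeg m \<in> ?D" by (intro UN_I imageI)
    with N show ?thesis by blast
  qed
  then show ?thesis
    unfolding pdeg_lt_def by (intro exI[of _ N] allI impI)
qed

lemma pdeg_lt_Suc:
  assumes "pdeg_lt P (Suc N)" "Poly_Mapping.keys P \<subseteq> W" "\<And>w z. w \<in> W \<Longrightarrow> symbol_val N (Poly_Mapping.lookup P w) z = 0"
  shows "pdeg_lt P N"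
  unfolding pdeg_lt_def
proof (intro allI impI)
  fix w m assume nz: "Poly_Mapping.lookup (Poly_Mapping.lookup P w) m \<noteq> 0"
  then have "w \<in> Poly_Mapping.keys P"
    by (auto simp: in_keys_iff)
  then have "w \<in> W"
    using assms(2) by blast
  have "mdeg m \<noteq> N"
    using nz symbol_val_zero_imp[OF assms(3)[OF \<open>w \<in> W\<close>]] by blast
  moreover have "mdeg m < Suc N"
    using nz assms(1) by (simp add: pdeg_lt_def)
  ultimately show "mdeg m < N" by simp
qed

lemma pdeg_lt_0:
  assumes "pdeg_lt P 0"
  shows "P = 0"
proof (rule poly_mapping_eqI)
  fix w
  show "Poly_Mapping.lookup P w = Poly_Mapping.lookup 0 w"
    using assms by (intro poly_mapping_eqI) (simp add: pdeg_lt_def)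
qed

lemma pdeg_lt_descend:
  assumes "Poly_Mapping.keys P \<subseteq> W"
    and "\<And>M w z. N \<le> M \<Longrightarrow> pdeg_lt P (Suc M) \<Longrightarrow> w \<in> W \<Longrightarrow> symbol_val M (Poly_Mapping.lookup P w) z = 0"
  shows "pdeg_lt P N"
proof -
  have "pdeg_lt P (N + k) \<Longrightarrow> pdeg_lt P N" for k
  proof (induction k)
    case (Suc k)
    have "pdeg_lt P (N + k)"
    proof (rule pdeg_lt_Suc[OF _ assms(1)])
      show "pdeg_lt P (Suc (N + k))" using Suc.prems by simp
      then show "symbol_val (N + k) (Poly_Mapping.lookup P w) z = 0" if "w \<in> W" for w z
        using that by (intro assms(2)) simp_all
    qed
    with Suc.IH show ?case .
  qed simp
  moreover obtain M where "pdeg_lt P M"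
    using pdeg_lt_exists by blast
  then have "pdeg_lt P (N + M)"
    unfolding pdeg_lt_def by (meson add.commute trans_less_add1 trans_less_add2)
  ultimately show ?thesis by blast
qed

text \<open>If the operator is zero, so is its leading term against every indicator. The top symbol
  of each group component then vanishes, and the degree descends to nothing.\<close>

lemma sop_NP_inj:
  assumes "Poly_Mapping.keys P \<subseteq> W" "sop b (NP P) = 0"
  shows "P = 0"
proof (rule pdeg_lt_0, rule pdeg_lt_descend[OF assms(1)])
  fix N w z assume "pdeg_lt P (Suc N)" "w \<in> W"
  then have "((\<lambda>\<epsilon>. 0) \<longlongrightarrow> symbol_val N (Poly_Mapping.lookup P w) z) (at (0::complex))"
    using lead_NP[OF assms(1), of N b "\<lambda>y. if y = act w z then 1 else 0" z]
    by (simp add: assms(2) rescaled_hom sum_indicator_orbit)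
  then show "symbol_val N (Poly_Mapping.lookup P w) z = 0"
    by (simp add: tendsto_const_iff)
qed

section \<open>Central elements as functions\<close>

definition commutes_all :: "complex \<Rightarrow> pt lop \<Rightarrow> bool" where
  "commutes_all b M \<longleftrightarrow> (\<forall>F\<in>carrier S. M * sop b F = sop b F * M)"

lemma commutes_allI:
  assumes gen: "\<And>v. M * genop b v = genop b v * M" and tr: "\<And>w. w \<in> W \<Longrightarrow> M * trop w = trop w * M"
  shows "commutes_all b M"
  unfolding commutes_all_def
proof
  fix F assume "F \<in> carrier S"
  then show "M * sop b F = sop b F * M"
  proof (induction F rule: S_induct)
    case (single w f)
    have "M * fop b f = fop b f * M"
    proof (induction f rule: free_alg_induct)
      case (const_word ws z)
      have "M * fop b (fword ws) = fop b (fword ws) * M"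
      proof (induction ws)
        case (Cons v ws)
        have "M * fop b (fword (v # ws)) = genop b v * (M * fop b (fword ws))"
          by (simp add: fop_hom gen[symmetric] mult.assoc[symmetric])
        then show ?case
          by (simp add: Cons fop_hom mult.assoc)
      qed (simp add: fop_hom)
      then show ?case
        by (simp only: fop_hom scal_commute_left[of M] mult.assoc)
    qed (simp_all add: fop_hom distrib_left distrib_right)
    then show ?case
      by (simp add: mult.assoc[symmetric]) (simp add: mult.assoc tr[OF single])
  qed (simp_all add: sop_add distrib_left distrib_right)
qed

definition inv_fun :: "(pt \<Rightarrow> complex) \<Rightarrow> bool" where
  "inv_fun f \<longleftrightarrow> (\<forall>w\<in>W. \<forall>z. f (act w z) = f z)"

lemma inv_fun_iff: "inv_fun f \<longleftrightarrow> (\<forall>\<eta>\<in>\<mu>. \<forall>z. f (refl_pt \<eta> z) = f z)"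
proof
  assume "inv_fun f"
  then show "\<forall>\<eta>\<in>\<mu>. \<forall>z. f (refl_pt \<eta> z) = f z"
    unfolding inv_fun_def by (auto simp flip: act_refl[OF mu_nonzero] intro: W_refl)
next
  assume inv: "\<forall>\<eta>\<in>\<mu>. \<forall>z. f (refl_pt \<eta> z) = f z"
  show "inv_fun f"
    unfolding inv_fun_def
  proof (intro ballI allI)
    fix w z assume "w \<in> W"
    then show "f (act w z) = f z"
    proof (cases rule: W_cases)
      case (rot \<eta>)
      have "rot_pt \<eta> z = refl_pt 1 (refl_pt \<eta> z)"
        using rot by (simp add: refl_pt_rot_pt_comp mu_norm)
      then have "f (rot_pt \<eta> z) = f z"
        using inv rot(1) mu_closed(1) by simp
      with rot show ?thesis
        by (simp add: act_rot mu_nonzero)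
    qed (simp add: inv act_refl mu_nonzero)
  qed
qed

lemma inv_fun_refl_pt: "inv_fun f \<Longrightarrow> \<eta> \<in> \<mu> \<Longrightarrow> f (refl_pt \<eta> z) = f z"
  by (simp add: inv_fun_iff)

lemma inv_fun_commutes:
  assumes "inv_fun f"
  shows "commutes_all b (mulop f)"
proof (rule commutes_allI)
  fix v
  have "(\<Sum>\<eta>\<in>\<mu>. g \<eta> * (f (refl_pt \<eta> z) * \<phi> (refl_pt \<eta> z)) / al \<eta> z) = f z * (\<Sum>\<eta>\<in>\<mu>. g \<eta> * \<phi> (refl_pt \<eta> z) / al \<eta> z)" for g \<phi> z
    unfolding sum_distrib_left by (intro sum.cong refl) (simp add: inv_fun_refl_pt[OF assms])
  from this[of "\<lambda>_. 1"] this[of inverse]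
  show "mulop f * genop b v = genop b v * mulop f"
    by (intro lop_eqI, cases v) (simp_all add: app_genop algebra_simps del: genop.simps(3,4))
next
  fix w assume "w \<in> W"
  then show "mulop f * trop w = trop w * mulop f"
    using assms by (intro lop_eqI) (simp add: inv_fun_def)
qed

text \<open>The value of the result at z depends only on the restriction to the orbit of z. On each
  orbit such an operator is a finite matrix.\<close>

definition local_op :: "pt lop \<Rightarrow> bool" where
  "local_op L \<longleftrightarrow> (\<forall>z \<phi>. (\<forall>w\<in>W. \<phi> (act w z) = 0) \<longrightarrow> app L \<phi> z = 0)"

lemma local_op_mult:
  assumes "local_op L" "local_op M"
  shows "local_op (L * M)"
  unfolding local_op_def
proof (intro allI impI)
  fix z and \<phi> :: "pt \<Rightarrow> complex" assume \<phi>: "\<forall>w\<in>W. \<phi> (act w z) = 0"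
  have "app M \<phi> (act w z) = 0" if "w \<in> W" for w
  proof -
    have "\<phi> (act g (act w z)) = 0" if "g \<in> W" for g
      using \<phi> W_mult[OF \<open>w \<in> W\<close> that] act_mult[OF \<open>w \<in> W\<close> that] by auto
    then show ?thesis
      using assms(2) by (simp add: local_op_def)
  qed
  then show "app (L * M) \<phi> z = 0"
    using assms(1) by (simp add: local_op_def)
qed

lemma local_op_add: "local_op L \<Longrightarrow> local_op M \<Longrightarrow> local_op (L + M)"
  by (simp add: local_op_def)

lemma local_op_mulop: "local_op (mulop f)"
  unfolding local_op_def
proof (intro allI impI)
  fix z and \<phi> :: "pt \<Rightarrow> complex" assume "\<forall>w\<in>W. \<phi> (act w z) = 0"
  then have "\<phi> (act (mat 1) z) = 0" using W_one by blast
  then show "app (mulop f) \<phi> z = 0" by simp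
qed

lemma local_op_genop: "local_op (genop b v)"
  unfolding local_op_def
proof (intro allI impI)
  fix z and \<phi> :: "pt \<Rightarrow> complex" assume 0: "\<forall>w\<in>W. \<phi> (act w z) = 0"
  have "\<phi> (act (mat 1) z) = 0" using 0 W_one by blast
  moreover have "\<phi> (refl_pt \<eta> z) = 0" if "\<eta> \<in> \<mu>" for \<eta>
    using 0 W_refl[OF that] act_refl[OF mu_nonzero[OF that], of z] by force
  ultimately show "app (genop b v) \<phi> z = 0"
    by (cases v) (simp_all add: app_genop del: genop.simps(3,4))
qed

lemma local_op_sop:
  assumes "F \<in> carrier S"
  shows "local_op (sop b F)"
  using assms
proof (induction F rule: S_induct)
  case zero
  show ?case by (simp add: local_op_def)
next
  case (single w f)
  have "local_op (trop w)"
    using single by (simp add: local_op_def)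
  moreover have "local_op (fop b f)"
  proof (induction f rule: free_alg_induct)
    case zero
    show ?case by (simp add: fop_hom local_op_def)
  next
    case (const_word ws z)
    have "local_op (fop b (fword ws))"
    proof (induction ws)
      case Nil
      show ?case
        using local_op_mulop[of "\<lambda>_. 1"] by (simp add: fop_hom mulop_hom)
    next
      case (Cons v ws)
      then show ?case by (simp add: fop_hom local_op_mult local_op_genop)
    qed
    then show ?case by (simp add: fop_hom local_op_mult local_op_mulop)
  next
    case (add f g)
    then show ?case by (simp add: fop_hom local_op_add)
  qed
  ultimately show ?case by (simp add: local_op_mult)
qed (simp add: sop_add local_op_add)

lemma act_eq_self:
  assumes "w \<in> W" "cu (act w z) = cu z" "cv (act w z) = cv z"
  shows "act w z = z"
  using act_inject[OF assms(1) W_one, of z] assms(2,3) by simp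

text \<open>An orbit point is determined by its \<open>(u, v)\<close> coordinates, so commuting with these two
  functions kills every off-diagonal matrix entry.\<close>

lemma local_commuting_is_mulop:
  assumes L: "local_op L" and u: "L * mulop cu = mulop cu * L" and v: "L * mulop cv = mulop cv * L"
  shows "L = mulop (app L (\<lambda>_. 1))"
proof (rule lop_eqI)
  fix \<phi> :: "pt \<Rightarrow> complex" and z
  let ?O = "(\<lambda>w. act w z) ` W - {z}"
  define \<psi> where "\<psi> = (\<lambda>y. \<phi> y - \<phi> z)"
  have fin: "finite ?O" by simp
  have point: "app L (\<lambda>x. c * (if x = y then 1 else 0)) z = 0" if y: "y \<in> ?O" for y c
  proof -
    let ?\<delta> = "\<lambda>x. if x = y then 1 else (0::complex)"
    have "app (L * mulop cu) ?\<delta> z = cu z * app L ?\<delta> z" "app (L * mulop cv) ?\<delta> z = cv z * app L ?\<delta> z"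
      by (simp_all add: u v)
    moreover have "(\<lambda>x. cu x * ?\<delta> x) = (\<lambda>x. cu y * ?\<delta> x)" "(\<lambda>x. cv x * ?\<delta> x) = (\<lambda>x. cv y * ?\<delta> x)"
      by auto
    ultimately have "cu y * app L ?\<delta> z = cu z * app L ?\<delta> z" "cv y * app L ?\<delta> z = cv z * app L ?\<delta> z"
      using app_scale[of L "cu y" ?\<delta> z] app_scale[of L "cv y" ?\<delta> z]
      by (simp_all only: times_lop.rep_eq app_mulop)
    moreover have "cu y \<noteq> cu z \<or> cv y \<noteq> cv z"
      using y act_eq_self by auto
    ultimately have "app L ?\<delta> z = 0" by auto
    then show ?thesis by (simp only: app_scale mult_zero_right)
  qed
  define \<rho> where "\<rho> = (\<lambda>x. \<psi> x - (\<Sum>y\<in>?O. \<psi> y * (if x = y then 1 else 0)))"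
  have "\<rho> (act w z) = 0" if "w \<in> W" for w
  proof (cases "act w z = z")
    case True
    moreover have "(\<Sum>y\<in>?O. \<psi> y * (if z = y then 1 else 0)) = 0"
      by (rule sum.neutral) auto
    ultimately show ?thesis by (simp only: \<rho>_def \<psi>_def) simp
  next
    case False
    then have "act w z \<in> ?O" using that by blast
    moreover have "(\<Sum>y\<in>?O. \<psi> y * (if act w z = y then 1 else 0)) = (\<Sum>y\<in>?O. if act w z = y then \<psi> (act w z) else 0)"
      by (intro sum.cong refl) simp
    ultimately show ?thesis
      unfolding \<rho>_def using sum.delta'[OF fin, of "act w z" "\<lambda>_. \<psi> (act w z)"] by (simp only: if_True diff_self)
  qed
  then have "app L \<rho> z = 0"
    using L by (simp add: local_op_def)
  then have "app L \<psi> z = (\<Sum>y\<in>?O. app L (\<lambda>x. \<psi> y * (if x = y then 1 else 0)) z)"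
    by (simp only: \<rho>_def app_minus app_sum right_minus_eq)
  also have "\<dots> = 0"
    by (rule sum.neutral) (use point in blast)
  finally have "app L \<phi> z - app L (\<lambda>_. \<phi> z * 1) z = 0"
    by (simp only: \<psi>_def app_minus mult_1_right)
  then show "app L \<phi> z = app (mulop (app L (\<lambda>_. 1))) \<phi> z"
    by (simp only: app_scale) simp
qed

lemma central_form:
  assumes "F \<in> carrier S" "commutes_all b (sop b F)"
  obtains f where "sop b F = mulop f" "inv_fun f"
proof -
  have "sop b F * mulop cu = mulop cu * sop b F" "sop b F * mulop cv = mulop cv * sop b F"
    using assms(2)[unfolded commutes_all_def, rule_format, of "smash_poly (fvar Vx)"]
      assms(2)[unfolded commutes_all_def, rule_format, of "smash_poly (fvar Vy)"]
    by (simp_all add: fop_hom)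
  then have f: "sop b F = mulop (app (sop b F) (\<lambda>_. 1))" (is "_ = mulop ?f")
    by (intro local_commuting_is_mulop local_op_sop assms)
  have "?f (act w z) = ?f z" if "w \<in> W" for w z
  proof -
    have "sop b F * trop w = trop w * sop b F"
      using assms(2)[unfolded commutes_all_def, rule_format, of "Poly_Mapping.single w 1"] that by (simp add: fop_hom)
    then have "app (sop b F * trop w) (\<lambda>_. 1) z = app (trop w * sop b F) (\<lambda>_. 1) z" by simp
    then show ?thesis by simp
  qed
  then have "inv_fun ?f" by (simp add: inv_fun_def)
  with f that show thesis by blast
qed

lemma rescaled_mulop: "\<epsilon> \<noteq> 0 \<Longrightarrow> rescaled (mulop f) \<psi> z \<epsilon> = f (sc (inverse \<epsilon>) z) * \<psi> z"
  using sc_inverse[of \<epsilon> z] by (simp add: rescaled_def)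

text \<open>A multiplication operator sees a test function only at z itself. The indicator of z thus
  gives the symbol of the identity component, while the indicator of any other orbit point shows
  that its group element has no leading term.\<close>

lemma central_lead:
  assumes P: "Poly_Mapping.keys P \<subseteq> W" "pdeg_lt P (Suc N)" and f: "sop b (NP P) = mulop f"
  shows "((\<lambda>\<epsilon>. \<epsilon> ^ N * f (sc (inverse \<epsilon>) z)) \<longlongrightarrow> symbol_val N (Poly_Mapping.lookup P (mat 1)) z) (at 0)"
    and "w \<in> W \<Longrightarrow> w \<noteq> mat 1 \<Longrightarrow> symbol_val N (Poly_Mapping.lookup P w) z = 0"
proof -
  have ev: "\<forall>\<^sub>F \<epsilon> in at 0. \<epsilon> ^ N * rescaled (sop b (NP P)) \<psi> z \<epsilon> = \<epsilon> ^ N * f (sc (inverse \<epsilon>) z) * \<psi> z" for \<psi>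
    unfolding eventually_at_filter by (intro always_eventually) (simp add: f rescaled_mulop)
  have lim: "((\<lambda>\<epsilon>. \<epsilon> ^ N * f (sc (inverse \<epsilon>) z) * \<psi> z) \<longlongrightarrow> (\<Sum>w\<in>W. symbol_val N (Poly_Mapping.lookup P w) z * \<psi> (act w z))) (at 0)" for \<psi>
    by (rule Lim_transform_eventually[OF lead_NP[OF P] ev])
  show "((\<lambda>\<epsilon>. \<epsilon> ^ N * f (sc (inverse \<epsilon>) z)) \<longlongrightarrow> symbol_val N (Poly_Mapping.lookup P (mat 1)) z) (at 0)"
    using lim[of "\<lambda>y. if y = act (mat 1) z then 1 else 0"]
    unfolding sum_indicator_orbit[OF W_one] by simp
  assume w: "w \<in> W" "w \<noteq> mat 1"
  then have "z \<noteq> act w z"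
    using act_inject[OF W_one, of w z] by auto
  then have "((\<lambda>\<epsilon>. 0) \<longlongrightarrow> symbol_val N (Poly_Mapping.lookup P w) z) (at (0::complex))"
    using lim[of "\<lambda>y. if y = act w z then 1 else 0"]
    unfolding sum_indicator_orbit[OF w(1)] by simp
  then show "symbol_val N (Poly_Mapping.lookup P w) z = 0"
    by (simp add: tendsto_const_iff)
qed

text \<open>The growth of the function under scaling bounds the degree of all group components,
  since those away from the identity have no leading term.\<close>

lemma central_degree_bound:
  assumes P: "Poly_Mapping.keys P \<subseteq> W" and f: "sop b (NP P) = mulop f"
    and lim: "\<And>M z. N \<le> M \<Longrightarrow> ((\<lambda>\<epsilon>. \<epsilon> ^ M * f (sc (inverse \<epsilon>) z)) \<longlongrightarrow> 0) (at 0)"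
  shows "pdeg_lt P N"
proof (rule pdeg_lt_descend[OF P])
  fix M w z assume M: "N \<le> M" "pdeg_lt P (Suc M)" "w \<in> W"
  show "symbol_val M (Poly_Mapping.lookup P w) z = 0"
  proof (cases "w = mat 1")
    case True
    then show ?thesis
      using tendsto_unique[OF _ central_lead(1)[OF P M(2) f] lim[OF M(1)]] by simp
  next
    case False
    then show ?thesis
      using central_lead(2)[OF P M(2) f M(3)] by simp
  qed
qed

text \<open>Injectivity of truncation on the center: the top degree can occur only in the identity
  component, so if this component is zero, there is no top degree.\<close>

lemma central_trunc_zero:
  assumes P: "Poly_Mapping.keys P \<subseteq> W" and f: "sop b (NP P) = mulop f" and "Poly_Mapping.lookup P (mat 1) = 0"
  shows "P = 0"
proof (rule pdeg_lt_0, rule pdeg_lt_descend[OF P])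
  fix M w z assume "pdeg_lt P (Suc M)" "w \<in> W"
  then show "symbol_val M (Poly_Mapping.lookup P w) z = 0"
    using central_lead(2)[OF P _ f, of M w z] assms(3) by (cases "w = mat 1") (auto simp: symbol_val_hom)
qed

end

section \<open>The Cherednik algebra as an algebra of operators\<close>

context cherednik_param
begin

text \<open>Faithfulness: modulo the ideal every element is normally ordered, and a normally ordered
  element that acts by zero is zero.\<close>

lemma sop_zero_iff: "F \<in> carrier S \<Longrightarrow> sop a F = 0 \<longleftrightarrow> F \<in> J"
proof
  assume F: "F \<in> carrier S" "sop a F = 0"
  then obtain P where P: "P \<in> pbw_source \<zeta>" "F - NP P \<in> J"
    using span_all[of F] by (auto simp: pbw_span_def)
  then have "sop a (NP P) = 0"
    using sop_J[OF P(2)] F by (simp add: sop_diff)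
  then have "P = 0"
    using P(1) sop_NP_inj by (simp add: pbw_source_iff)
  with P(2) show "F \<in> J" by (simp add: NP_hom)
qed (rule sop_J)

definition HH :: "pt lop set" where "HH = sop a ` carrier S"

text \<open>The kernel of \<open>sop a\<close> on the smash product is the ideal, so the cosets are
  exactly the nonempty fibres and an operator in \<open>HH\<close> names its coset.\<close>

definition opclass :: "pt lop \<Rightarrow> smash_elt set" where
  "opclass L = {F \<in> carrier S. sop a F = L}"

lemma cherednik_class_eq:
  assumes "F \<in> carrier S"
  shows "cherednik_class d \<zeta> c F = opclass (sop a F)"
proof -
  have "cherednik_class d \<zeta> c F = (\<Union>h\<in>J. {h + F})"
    by (simp add: cherednik_class_def a_r_coset_def' J_def)
  also have "\<dots> = opclass (sop a F)"
  proof
    show "(\<Union>h\<in>J. {h + F}) \<subseteq> opclass (sop a F)"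
      using assms by (auto simp: opclass_def J_carrier S_add sop_add sop_J)
    show "opclass (sop a F) \<subseteq> (\<Union>h\<in>J. {h + F})"
    proof
      fix G assume "G \<in> opclass (sop a F)"
      then have "G - F \<in> J"
        using assms sop_zero_iff[of "G - F"] by (auto simp: opclass_def S_diff sop_diff)
      then have "G - F + F \<in> (\<Union>h\<in>J. {h + F})" by blast
      then show "G \<in> (\<Union>h\<in>J. {h + F})" by simp
    qed
  qed
  finally show ?thesis .
qed

lemma opclass_inj: "L \<in> HH \<Longrightarrow> opclass L = opclass M \<Longrightarrow> L = M"
  by (auto simp: HH_def opclass_def)

lemma HH_mult: "L \<in> HH \<Longrightarrow> M \<in> HH \<Longrightarrow> L * M \<in> HH"
  unfolding HH_def by (auto simp: sop_mult[symmetric] S_mult intro!: imageI)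

lemma HH_add: "L \<in> HH \<Longrightarrow> M \<in> HH \<Longrightarrow> L + M \<in> HH"
  unfolding HH_def by (auto simp: sop_add[symmetric] S_add intro!: imageI)

lemma HH_fop: "fop a f \<in> HH"
  unfolding HH_def by (rule image_eqI[of _ _ "smash_poly f"]) simp_all

lemma carrier_cherednik: "carrier (cherednik d \<zeta> c) = opclass ` HH"
proof -
  have "carrier (cherednik d \<zeta> c) = (\<Union>F\<in>carrier S. {cherednik_class d \<zeta> c F})"
    by (simp add: cherednik_def FactRing_def A_RCOSETS_def' cherednik_class_def)
  also have "\<dots> = opclass ` HH"
    by (auto simp: cherednik_class_eq HH_def)
  finally show ?thesis .
qed

lemma cherednik_ops:
  assumes "L \<in> HH" "M \<in> HH"
  shows "opclass L \<otimes>\<^bsub>cherednik d \<zeta> c\<^esub> opclass M = opclass (L * M)"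
    and "opclass L \<oplus>\<^bsub>cherednik d \<zeta> c\<^esub> opclass M = opclass (L + M)"
proof -
  obtain F G where FG: "F \<in> carrier S" "G \<in> carrier S" "L = sop a F" "M = sop a G"
    using assms by (auto simp: HH_def)
  note J = ideal_J[unfolded J_def]
  have "cherednik_class d \<zeta> c F \<otimes>\<^bsub>cherednik d \<zeta> c\<^esub> cherednik_class d \<zeta> c G = cherednik_class d \<zeta> c (smash_mult F G)"
    using ideal.rcoset_mult_add[OF J FG(1,2)] by (simp add: cherednik_def FactRing_def cherednik_class_def)
  then show "opclass L \<otimes>\<^bsub>cherednik d \<zeta> c\<^esub> opclass M = opclass (L * M)"
    using FG by (simp add: cherednik_class_eq S_mult sop_mult)
  have "cherednik_class d \<zeta> c F \<oplus>\<^bsub>cherednik d \<zeta> c\<^esub> cherednik_class d \<zeta> c G = cherednik_class d \<zeta> c (F + G)"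
    using abelian_subgroup.a_rcos_sum[OF abelian_subgroupI3[OF ideal.axioms(1)[OF J] ring.is_abelian_group[OF ring_S]] FG(1,2)]
    by (simp add: cherednik_def FactRing_def cherednik_class_def)
  then show "opclass L \<oplus>\<^bsub>cherednik d \<zeta> c\<^esub> opclass M = opclass (L + M)"
    using FG by (simp add: cherednik_class_eq S_add sop_add)
qed

lemma cherednik_one_zero:
  "\<one>\<^bsub>cherednik d \<zeta> c\<^esub> = opclass 1" "\<zero>\<^bsub>cherednik d \<zeta> c\<^esub> = opclass 0"
proof -
  have "\<one>\<^bsub>cherednik d \<zeta> c\<^esub> = cherednik_class d \<zeta> c (Poly_Mapping.single (mat 1) 1)"
    by (simp add: cherednik_def FactRing_def cherednik_class_def)
  then show "\<one>\<^bsub>cherednik d \<zeta> c\<^esub> = opclass 1"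
    by (simp add: cherednik_class_eq W_one fop_hom)
  have "\<zero>\<^bsub>cherednik d \<zeta> c\<^esub> = J"
    by (simp add: cherednik_def FactRing_def J_def)
  also have "J = opclass 0"
    using sop_zero_iff J_carrier by (auto simp: opclass_def)
  finally show "\<zero>\<^bsub>cherednik d \<zeta> c\<^esub> = opclass 0" .
qed

definition ZH :: "pt lop set" where "ZH = {L \<in> HH. commutes_all a L}"

lemma ZH_form:
  assumes "L \<in> ZH"
  obtains f where "L = mulop f" "inv_fun f"
proof -
  obtain F where F: "F \<in> carrier S" "L = sop a F" "commutes_all a (sop a F)"
    using assms by (auto simp: ZH_def HH_def)
  obtain f where "sop a F = mulop f" "inv_fun f"
    using central_form[OF F(1,3)] .
  with F(2) that show thesis by simp
qed

lemma mulop_in_ZH: "mulop f \<in> HH \<Longrightarrow> inv_fun f \<Longrightarrow> mulop f \<in> ZH"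
  by (simp add: ZH_def inv_fun_commutes)

lemma carrier_center: "carrier (cherednik_center d \<zeta> c) = opclass ` ZH"
proof -
  let ?H = "cherednik d \<zeta> c"
  have iff: "(\<forall>h\<in>carrier ?H. opclass L \<otimes>\<^bsub>?H\<^esub> h = h \<otimes>\<^bsub>?H\<^esub> opclass L) \<longleftrightarrow> commutes_all a L" if L: "L \<in> HH" for L
  proof -
    have "(\<forall>h\<in>carrier ?H. opclass L \<otimes>\<^bsub>?H\<^esub> h = h \<otimes>\<^bsub>?H\<^esub> opclass L)
        \<longleftrightarrow> (\<forall>M\<in>HH. opclass (L * M) = opclass (M * L))"
      using L by (simp add: carrier_cherednik cherednik_ops)
    also have "\<dots> \<longleftrightarrow> (\<forall>M\<in>HH. L * M = M * L)"
    proof (intro ball_cong refl)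
      fix M assume "M \<in> HH"
      then show "opclass (L * M) = opclass (M * L) \<longleftrightarrow> L * M = M * L"
        using opclass_inj[OF HH_mult[OF L]] by auto
    qed
    finally show ?thesis
      by (simp add: commutes_all_def HH_def)
  qed
  have "carrier (cherednik_center d \<zeta> c) = {z \<in> carrier ?H. \<forall>h\<in>carrier ?H. z \<otimes>\<^bsub>?H\<^esub> h = h \<otimes>\<^bsub>?H\<^esub> z}"
    by (simp add: cherednik_center_def ring_center_def)
  also have "\<dots> = {z. \<exists>L\<in>HH. z = opclass L \<and> (\<forall>h\<in>carrier ?H. opclass L \<otimes>\<^bsub>?H\<^esub> h = h \<otimes>\<^bsub>?H\<^esub> opclass L)}"
    unfolding carrier_cherednik by blast
  also have "\<dots> = {z. \<exists>L\<in>HH. z = opclass L \<and> commutes_all a L}"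
    using iff by (intro Collect_cong bex_cong refl) simp
  also have "\<dots> = opclass ` ZH"
    unfolding ZH_def by blast
  finally show ?thesis .
qed

lemma pbw_eq: "P \<in> pbw_source \<zeta> \<Longrightarrow> pbw d \<zeta> c P = opclass (sop a (NP P))"
  using cherednik_class_eq[OF NP_carrier] by (simp add: pbw_def NP_def pext_def)

lemma HH_NP:
  assumes "L \<in> HH"
  obtains P where "P \<in> pbw_source \<zeta>" "sop a (NP P) = L"
proof -
  obtain F where F: "F \<in> carrier S" "L = sop a F"
    using assms by (auto simp: HH_def)
  then obtain P where P: "P \<in> pbw_source \<zeta>" "F - NP P \<in> J"
    using span_all[of F] by (auto simp: pbw_span_def)
  then have "sop a (NP P) = L"
    using sop_J[OF P(2)] F by (simp add: sop_diff)
  with P that show thesis by blast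
qed

lemma NP_in_HH: "P \<in> pbw_source \<zeta> \<Longrightarrow> sop a (NP P) \<in> HH"
  using NP_carrier by (auto simp: HH_def)

lemma sop_NP_eqD:
  assumes "P \<in> pbw_source \<zeta>" "Q \<in> pbw_source \<zeta>" "sop a (NP P) = sop a (NP Q)"
  shows "P = Q"
proof -
  have "sop a (NP (P - Q)) = 0"
    using assms(3) by (simp add: NP_hom sop_diff)
  then have "P - Q = 0"
    using pbw_source_diff[OF assms(1,2)] unfolding pbw_source_iff by (intro sop_NP_inj)
  then show ?thesis by simp
qed

lemma Trunc_eq:
  assumes "P \<in> pbw_source \<zeta>"
  shows "Trunc d \<zeta> c (opclass (sop a (NP P))) = Poly_Mapping.lookup P (mat 1)"
proof -
  have "inj_on (pbw d \<zeta> c) (pbw_source \<zeta>)"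
  proof (rule inj_onI)
    fix P Q assume PQ: "P \<in> pbw_source \<zeta>" "Q \<in> pbw_source \<zeta>" "pbw d \<zeta> c P = pbw d \<zeta> c Q"
    then show "P = Q"
      using opclass_inj[OF NP_in_HH[OF PQ(1)]] by (intro sop_NP_eqD) (simp_all add: pbw_eq)
  qed
  then have "the_inv_into (pbw_source \<zeta>) (pbw d \<zeta> c) (pbw d \<zeta> c P) = P"
    using assms by (rule the_inv_into_f_f)
  then have "the_inv_into (pbw_source \<zeta>) (pbw d \<zeta> c) (opclass (sop a (NP P))) = P"
    by (simp only: pbw_eq[OF assms])
  then show ?thesis by (simp add: Trunc_def)
qed

text \<open>This resolves the definite description: \<open>P\<close> provides existence, and
  injectivity of truncation on the center gives uniqueness.\<close>

lemma central_lift_eq: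
  assumes P: "P \<in> pbw_source \<zeta>" and L: "sop a (NP P) \<in> ZH" and p: "Poly_Mapping.lookup P (mat 1) = p"
  shows "central_lift d \<zeta> c p = opclass (sop a (NP P))"
  unfolding central_lift_def
proof (rule the_equality)
  show "opclass (sop a (NP P)) \<in> carrier (cherednik_center d \<zeta> c) \<and> Trunc d \<zeta> c (opclass (sop a (NP P))) = p"
    using assms by (simp add: carrier_center Trunc_eq)
next
  fix z assume z: "z \<in> carrier (cherednik_center d \<zeta> c) \<and> Trunc d \<zeta> c z = p"
  then obtain M where M: "M \<in> ZH" "z = opclass M"
    by (auto simp: carrier_center)
  then obtain Q where Q: "Q \<in> pbw_source \<zeta>" "sop a (NP Q) = M"
    using HH_NP[of M] by (auto simp: ZH_def)
  have "Poly_Mapping.lookup Q (mat 1) = p"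
    using z M Q Trunc_eq[OF Q(1)] by simp
  then have "Poly_Mapping.lookup (P - Q) (mat 1) = 0"
    using p by (simp add: lookup_minus)
  moreover obtain f where "sop a (NP P) = mulop f"
    using ZH_form[OF L] .
  moreover obtain g where "M = mulop g"
    using ZH_form[OF M(1)] .
  ultimately have "Poly_Mapping.lookup (P - Q) (mat 1) = 0" and "sop a (NP (P - Q)) = mulop (\<lambda>x. f x - g x)"
    by (simp_all add: NP_hom sop_diff Q mulop_hom)
  then have "P - Q = 0"
    using pbw_source_diff[OF P Q(1)] unfolding pbw_source_iff by (intro central_trunc_zero)
  then show "z = opclass (sop a (NP P))"
    using M Q by simp
qed

end

section \<open>The elements \<open>a\<^sub>j\<close>\<close>

text \<open>The sum of all words of length n with j letters \<open>B\<close> and the rest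
  \<open>A\<close>: the coefficient of \<open>t ^ j\<close> in the noncommutative expansion of (A +
  tB)^n.\<close>

fun wsum :: "nat \<Rightarrow> nat \<Rightarrow> 'r::ring_1 \<Rightarrow> 'r \<Rightarrow> 'r" where
  "wsum 0 j A B = (if j = 0 then 1 else 0)"
| "wsum (Suc n) 0 A B = A * wsum n 0 A B"
| "wsum (Suc n) (Suc j) A B = A * wsum n (Suc j) A B + B * wsum n j A B"

lemma wsum_0 [simp]: "wsum n 0 A B = A ^ n"
  by (induction n) auto

lemma wsum_gt: "n < j \<Longrightarrow> wsum n j A B = 0"
  by (induction n j A B rule: wsum.induct) auto

lemma power_eq_wsum:
  assumes t: "\<And>r. t * r = r * t"
  shows "(A + t * B) ^ n = (\<Sum>j\<le>n. t ^ j * wsum n j A B)"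
proof (induction n)
  case (Suc n)
  have tp: "t ^ j * r = r * t ^ j" for j r
    by (rule power_commuting_commutes) (rule t)
  have AB: "A * (t ^ j * r) = t ^ j * (A * r)" "t * B * (t ^ j * r) = t ^ Suc j * (B * r)" for j r
    by (metis mult.assoc tp) (metis mult.assoc tp power_Suc)
  have split: "(\<Sum>j\<le>Suc n. t ^ j * wsum n j A B) = (\<Sum>j\<le>n. t ^ j * wsum n j A B)"
    by (simp add: wsum_gt)
  have "(A + t * B) ^ Suc n = A * (\<Sum>j\<le>Suc n. t ^ j * wsum n j A B) + t * B * (\<Sum>j\<le>n. t ^ j * wsum n j A B)"
    unfolding split by (simp add: Suc distrib_right)
  also have "\<dots> = (\<Sum>j\<le>Suc n. t ^ j * (A * wsum n j A B)) + (\<Sum>j\<le>n. t ^ Suc j * (B * wsum n j A B))"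
    unfolding sum_distrib_left by (simp only: AB)
  also have "\<dots> = (\<Sum>j\<le>Suc n. t ^ j * wsum (Suc n) j A B)"
    unfolding sum.atMost_Suc_shift by (simp add: distrib_left sum.distrib)
  finally show ?case .
qed simp

text \<open>The Leibniz rule for the derivation that sends A to AZ - ZA.\<close>

lemma power_commutator_sum:
  fixes A Z :: "'r::ring_1"
  shows "A ^ n * Z - Z * A ^ n = (\<Sum>k<n. A ^ k * (A * Z - Z * A) * A ^ (n - Suc k))"
proof (induction n)
  case (Suc n)
  have "(\<Sum>k<n. A ^ k * (A * Z - Z * A) * A ^ (Suc n - Suc k)) = (\<Sum>k<n. A ^ k * (A * Z - Z * A) * A ^ (n - Suc k)) * A"
    unfolding sum_distrib_right
  proof (rule sum.cong[OF refl])
    fix k assume "k \<in> {..<n}"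
    then have "A ^ (Suc n - Suc k) = A ^ (n - Suc k) * A"
      by (simp add: Suc_diff_Suc flip: power_Suc2)
    then show "A ^ k * (A * Z - Z * A) * A ^ (Suc n - Suc k) = A ^ k * (A * Z - Z * A) * A ^ (n - Suc k) * A"
      by (simp add: mult.assoc)
  qed
  then have "(\<Sum>k<Suc n. A ^ k * (A * Z - Z * A) * A ^ (Suc n - Suc k)) = (A ^ n * Z - Z * A ^ n) * A + A ^ n * (A * Z - Z * A)"
    by (simp add: Suc)
  also have "\<dots> = A ^ Suc n * Z - Z * A ^ Suc n"
    by (simp add: algebra_simps power_Suc2 del: power_Suc)
  finally show ?case by simp
qed simp

text \<open>Applied to a function at a point, the sum is a complex polynomial in t with infinitely
  many zeros. Centrality of a generating function thus passes to its coefficients.\<close>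

lemma scal_power_sum_zero:
  assumes "\<And>t. (\<Sum>j\<le>n. scal (t ^ j) * M j) = 0" and "j \<le> n"
  shows "M j = 0"
proof (rule lop_eqI)
  fix \<phi> z
  have "(\<Sum>k\<in>{..n}. app (M k) \<phi> z * t ^ k) = 0" for t
    using arg_cong[OF assms(1)[of t], of "\<lambda>L. app L \<phi> z"] by (simp add: mult.commute)
  then have "(\<Sum>k\<in>{k \<in> {..n}. k = j}. app (M k) \<phi> z) = 0"
    by (intro coeff_sums_vanish[where A = UNIV]) (auto simp: infinite_UNIV_char_0)
  moreover have "{k \<in> {..n}. k = j} = {j}"
    using assms(2) by auto
  ultimately show "app (M j) \<phi> z = app 0 \<phi> z" by simp
qed

section \<open>Central elements from power sums\<close>

context dihedral_root
begin

lemma fop_wsum: "fop b (wsum n j f g) = wsum n j (fop b f) (fop b g)"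
  by (induction n j f g rule: wsum.induct) (auto simp: fop_hom)

lemma homogeneous_wsum: "homogeneous n (wsum n j (fvar u) (fvar v))"
proof (induction n j "fvar u" "fvar v" rule: wsum.induct)
  case (1 j)
  then show ?case by (simp add: homogeneous_one homogeneous_zero)
next
  case (2 n)
  then show ?case using homogeneous_mult[OF homogeneous_fvar 2] by simp
next
  case (3 n j)
  then show ?case
    using homogeneous_add[OF homogeneous_mult[OF homogeneous_fvar 3(1)] homogeneous_mult[OF homogeneous_fvar 3(2)]] by simp
qed

lemma cl_wsum: "cl (wsum n j f g) z = of_nat (n choose j) * cl f z ^ (n - j) * cl g z ^ j"
proof (induction n j f g rule: wsum.induct)
  case (3 n j f g)
  show ?case
  proof (cases "Suc j \<le> n")
    case True
    then have "cl f z * cl f z ^ (n - Suc j) = cl f z ^ (n - j)"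
      by (simp add: Suc_diff_Suc flip: power_Suc)
    with 3 show ?thesis
      by (simp add: cl_hom algebra_simps)
  next
    case False
    with 3 show ?thesis
      by (simp add: cl_hom wsum_gt algebra_simps)
  qed
qed (simp_all add: cl_hom)

lemma mu_pow_complement:
  assumes "\<eta> \<in> \<mu>" "k < d"
  shows "inverse \<eta> * inverse \<eta> ^ (d - Suc k) = \<eta> ^ k"
proof -
  have "\<eta> ^ Suc (d - Suc k) * \<eta> ^ k = \<eta> ^ d"
    using assms(2) by (simp only: power_add[symmetric]) simp
  then have "\<eta> ^ k = inverse (\<eta> ^ Suc (d - Suc k))"
    using mu_pow[OF assms(1)] mu_nonzero[OF assms(1)] by (simp add: field_simps)
  then show ?thesis
    by (simp add: power_inverse)
qed

lemma intertwine_power: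
  assumes "s * A = scal t * B * s"
  shows "s * A ^ n = scal (t ^ n) * B ^ n * s"
proof (induction n)
  case (Suc n)
  have "s * A ^ Suc n = (s * A) * A ^ n"
    by (simp add: mult.assoc)
  also have "\<dots> = scal t * B * (s * A ^ n)"
    by (simp add: assms mult.assoc)
  also have "\<dots> = scal t * (B * scal (t ^ n)) * B ^ n * s"
    by (simp add: Suc mult.assoc)
  also have "\<dots> = scal t * (scal (t ^ n) * B) * B ^ n * s"
    by (simp only: scal_commute)
  finally show ?case
    by (simp add: mulop_hom mult.assoc)
qed (simp add: mulop_hom)

text \<open>By the Leibniz rule the commutator of A^d with Z is a sum of terms A^k s A^(d-1-k).
  Moving the reflection s to the right turns the trailing A into B. The commutator of B^d gives the
  same terms with opposite sign and in reverse order of k. The abstract letters let one computation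
  serve for both Z = Y and Z = X.\<close>

lemma dihedral_power_sum_commutes:
  assumes AB: "A * B = B * A"
    and AZ: "A * Z - Z * A = scal b * (\<Sum>\<eta>\<in>\<mu>. scal (inverse \<eta>) * s \<eta>)"
    and BZ: "B * Z - Z * B = - scal b * (\<Sum>\<eta>\<in>\<mu>. s \<eta>)"
    and sA: "\<And>\<eta>. \<eta> \<in> \<mu> \<Longrightarrow> s \<eta> * A = scal (inverse \<eta>) * B * s \<eta>"
    and sB: "\<And>\<eta>. \<eta> \<in> \<mu> \<Longrightarrow> s \<eta> * B = scal \<eta> * A * s \<eta>"
  shows "(A ^ d + B ^ d) * Z = Z * (A ^ d + B ^ d)"
proof -
  have AB_pow: "A ^ k * B ^ l = B ^ l * A ^ k" for k l
    using power_commuting_commutes[OF power_commuting_commutes[OF AB, of k, symmetric], of l] by simp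
  let ?T = "\<lambda>k. scal b * (\<Sum>\<eta>\<in>\<mu>. scal (\<eta> ^ k) * (A ^ k * B ^ (d - Suc k) * s \<eta>))"
  have 1: "A ^ k * (A * Z - Z * A) * A ^ (d - Suc k) = ?T k" if k: "k < d" for k
  proof -
    have "A ^ k * (scal (inverse \<eta>) * s \<eta>) * A ^ (d - Suc k) = scal (\<eta> ^ k) * (A ^ k * B ^ (d - Suc k) * s \<eta>)" if "\<eta> \<in> \<mu>" for \<eta>
    proof -
      have "A ^ k * (scal (inverse \<eta>) * s \<eta>) * A ^ (d - Suc k) = scal (inverse \<eta>) * (A ^ k * (s \<eta> * A ^ (d - Suc k)))"
        by (simp only: scal_commute_left[of "A ^ k"] mult.assoc)
      also have "\<dots> = scal (inverse \<eta>) * (scal (inverse \<eta> ^ (d - Suc k)) * (A ^ k * (B ^ (d - Suc k) * s \<eta>)))"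
        by (simp only: intertwine_power[OF sA[OF that]] scal_commute_left[of "A ^ k"] mult.assoc)
      also have "\<dots> = scal (inverse \<eta> * inverse \<eta> ^ (d - Suc k)) * (A ^ k * (B ^ (d - Suc k) * s \<eta>))"
        by (simp only: mulop_hom mult.assoc)
      finally show ?thesis
        by (simp only: mu_pow_complement[OF that k] mult.assoc)
    qed
    then have "(\<Sum>\<eta>\<in>\<mu>. A ^ k * (scal (inverse \<eta>) * s \<eta>) * A ^ (d - Suc k)) = (\<Sum>\<eta>\<in>\<mu>. scal (\<eta> ^ k) * (A ^ k * B ^ (d - Suc k) * s \<eta>))"
      by (rule sum.cong[OF refl])
    moreover have "A ^ k * (scal b * (\<Sum>\<eta>\<in>\<mu>. scal (inverse \<eta>) * s \<eta>)) * A ^ (d - Suc k)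
        = scal b * (\<Sum>\<eta>\<in>\<mu>. A ^ k * (scal (inverse \<eta>) * s \<eta>) * A ^ (d - Suc k))"
      by (simp only: scal_commute_left[of "A ^ k"] mult.assoc sum_distrib_left sum_distrib_right)
    ultimately show ?thesis
      by (simp only: AZ)
  qed
  have 2: "B ^ k * (B * Z - Z * B) * B ^ (d - Suc k) = - ?T (d - Suc k)" if k: "k < d" for k
  proof -
    have dk: "d - Suc (d - Suc k) = k" using k by simp
    have "B ^ k * s \<eta> * B ^ (d - Suc k) = scal (\<eta> ^ (d - Suc k)) * (A ^ (d - Suc k) * B ^ k * s \<eta>)" if "\<eta> \<in> \<mu>" for \<eta>
    proof -
      have "B ^ k * s \<eta> * B ^ (d - Suc k) = B ^ k * (s \<eta> * B ^ (d - Suc k))"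
        by (simp only: mult.assoc)
      also have "\<dots> = scal (\<eta> ^ (d - Suc k)) * (B ^ k * (A ^ (d - Suc k) * s \<eta>))"
        by (simp only: intertwine_power[OF sB[OF that]] scal_commute_left[of "B ^ k"] mult.assoc)
      finally show ?thesis
        by (simp only: AB_pow mult.assoc[symmetric])
    qed
    then have "(\<Sum>\<eta>\<in>\<mu>. B ^ k * s \<eta> * B ^ (d - Suc k)) = (\<Sum>\<eta>\<in>\<mu>. scal (\<eta> ^ (d - Suc k)) * (A ^ (d - Suc k) * B ^ k * s \<eta>))"
      by (rule sum.cong[OF refl])
    moreover have "B ^ k * (scal b * (\<Sum>\<eta>\<in>\<mu>. s \<eta>)) * B ^ (d - Suc k) = scal b * (\<Sum>\<eta>\<in>\<mu>. B ^ k * s \<eta> * B ^ (d - Suc k))"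
      by (simp only: scal_commute_left[of "B ^ k"] mult.assoc sum_distrib_left sum_distrib_right)
    ultimately show ?thesis
      by (simp only: BZ dk) (simp only: mult_minus_left mult_minus_right)
  qed
  have "(A ^ d + B ^ d) * Z - Z * (A ^ d + B ^ d) = (A ^ d * Z - Z * A ^ d) + (B ^ d * Z - Z * B ^ d)"
    by (simp add: algebra_simps)
  also have "\<dots> = (\<Sum>k<d. ?T k) - (\<Sum>k<d. ?T (d - Suc k))"
    unfolding power_commutator_sum using 1 2 by (simp add: sum_negf)
  also have "\<dots> = 0"
    using sum.nat_diff_reindex[of ?T d] by simp
  finally show ?thesis by simp
qed

lemma compop_refl_pt_genop:
  assumes "\<eta> \<in> \<mu>"
  shows "compop (refl_pt \<eta>) * genop b Vx = scal (inverse \<eta>) * genop b Vy * compop (refl_pt \<eta>)"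
    "compop (refl_pt \<eta>) * genop b Vy = scal \<eta> * genop b Vx * compop (refl_pt \<eta>)"
    "compop (refl_pt \<eta>) * genop b VX = scal \<eta> * genop b VY * compop (refl_pt \<eta>)"
    "compop (refl_pt \<eta>) * genop b VY = scal (inverse \<eta>) * genop b VX * compop (refl_pt \<eta>)"
  using genop_refl[OF assms, of b Vx] genop_refl[OF assms, of b Vy] genop_refl[OF assms, of b VX] genop_refl[OF assms, of b VY]
  unfolding trop_refl[OF assms]
  by (simp_all add: fop_hom matrix_inv_reflm mu_nonzero[OF assms] mulop_hom del: genop.simps)

text \<open>The substitution \<open>x \<mapsto> x + t Y\<close>, \<open>y \<mapsto> y + t X\<close> preserves all defining relations, so it maps
  the central element \<open>x\<^sup>d + y\<^sup>d\<close> to a central element; its coefficients in \<open>t\<close> are central too.\<close>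

definition ax :: "complex \<Rightarrow> complex \<Rightarrow> pt lop" where "ax b t = genop b Vx + scal t * genop b VY"
definition ay :: "complex \<Rightarrow> complex \<Rightarrow> pt lop" where "ay b t = genop b Vy + scal t * genop b VX"

text \<open>The t-linear part of the commutator of x + tY and y + tX is [x,X] - [y,Y], which
  vanishes since both commutators are the same sum of reflections. The other relations only need
  that X and Y commute.\<close>

lemma ax_ay_props:
  shows "ax b t * ay b t = ay b t * ax b t"
    and "ax b t * genop b VY - genop b VY * ax b t = genop b Vx * genop b VY - genop b VY * genop b Vx"
    and "ay b t * genop b VX - genop b VX * ay b t = genop b Vy * genop b VX - genop b VX * genop b Vy"
    and "ax b t * genop b VX - genop b VX * ax b t = genop b Vx * genop b VX - genop b VX * genop b Vx"
    and "ay b t * genop b VY - genop b VY * ay b t = genop b Vy * genop b VY - genop b VY * genop b Vy"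
    and "\<eta> \<in> \<mu> \<Longrightarrow> compop (refl_pt \<eta>) * ax b t = scal (inverse \<eta>) * ay b t * compop (refl_pt \<eta>)"
    and "\<eta> \<in> \<mu> \<Longrightarrow> compop (refl_pt \<eta>) * ay b t = scal \<eta> * ax b t * compop (refl_pt \<eta>)"
proof -
  let ?x = "genop b Vx" and ?y = "genop b Vy" and ?X = "genop b VX" and ?Y = "genop b VY" and ?t = "scal t"
  have tc: "genop b v * (?t * M) = ?t * (genop b v * M)" "compop h * (?t * M) = ?t * (compop h * M)" for v h M
    by (rule scal_commute_left)+
  have XY: "?X * ?Y = ?Y * ?X" by (simp only: genop_XY)
  have xy: "?x * ?y = ?y * ?x" by (simp add: mulop_commute)
  have comm: "?x * ?X - ?X * ?x = ?y * ?Y - ?Y * ?y" by (simp only: genop_mixed)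
  have "ax b t * ay b t - ay b t * ax b t
      = (?x * ?y - ?y * ?x) + ?t * ((?x * ?X - ?X * ?x) - (?y * ?Y - ?Y * ?y)) + ?t * (?t * (?Y * ?X - ?X * ?Y))"
    unfolding ax_def ay_def
    by (simp only: distrib_left distrib_right right_diff_distrib mult.assoc tc) (simp add: algebra_simps del: genop.simps)
  then show "ax b t * ay b t = ay b t * ax b t"
    by (simp only: xy XY comm) simp
  have "?t * ?Y * ?Y = ?Y * (?t * ?Y)" "?t * ?X * ?X = ?X * (?t * ?X)" "?t * ?Y * ?X = ?X * (?t * ?Y)" "?t * ?X * ?Y = ?Y * (?t * ?X)"
    by (simp_all only: tc mult.assoc XY)
  then show "ax b t * ?Y - ?Y * ax b t = ?x * ?Y - ?Y * ?x" "ay b t * ?X - ?X * ay b t = ?y * ?X - ?X * ?y"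
    "ax b t * ?X - ?X * ax b t = ?x * ?X - ?X * ?x" "ay b t * ?Y - ?Y * ay b t = ?y * ?Y - ?Y * ?y"
    unfolding ax_def ay_def by (simp_all only: distrib_left distrib_right) (simp_all del: genop.simps)
  assume \<eta>: "\<eta> \<in> \<mu>"
  have sc: "scal s * (?t * L) = ?t * (scal s * L)" for s and L :: "pt lop"
    by (rule scal_commute_left)
  show "compop (refl_pt \<eta>) * ax b t = scal (inverse \<eta>) * ay b t * compop (refl_pt \<eta>)" "compop (refl_pt \<eta>) * ay b t = scal \<eta> * ax b t * compop (refl_pt \<eta>)"
    unfolding ax_def ay_def
    by (simp_all only: distrib_left distrib_right tc(2) compop_refl_pt_genop[OF \<eta>] mult.assoc sc)
qed

definition gt :: "complex \<Rightarrow> complex \<Rightarrow> pt lop" where "gt b t = ax b t ^ d + ay b t ^ d"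

lemma gt_commutes: "commutes_all b (gt b t)"
proof (rule commutes_allI)
  let ?x = "genop b Vx" and ?y = "genop b Vy" and ?X = "genop b VX" and ?Y = "genop b VY"
  note p = ax_ay_props[where b = b and t = t]
  have Y: "gt b t * ?Y = ?Y * gt b t"
    unfolding gt_def
    by (rule dihedral_power_sum_commutes[where b = b and s = "\<lambda>\<eta>. compop (refl_pt \<eta>)", OF p(1) _ _ p(6,7)])
       (simp_all only: p genop_mixed)
  \<comment> \<open>For X the roles of \<open>ax\<close> and \<open>ay\<close> are exchanged and the
    reflections are relabelled by the inverse root, which restores the hypotheses.\<close>
  have X: "ay b t ^ d * ?X + ax b t ^ d * ?X = ?X * ay b t ^ d + ?X * ax b t ^ d"
    unfolding distrib_right[symmetric] distrib_left[symmetric]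
  proof (rule dihedral_power_sum_commutes[where b = b and s = "\<lambda>\<eta>. compop (refl_pt (inverse \<eta>))"])
    show "ay b t * ?X - ?X * ay b t = scal b * (\<Sum>\<eta>\<in>\<mu>. scal (inverse \<eta>) * compop (refl_pt (inverse \<eta>)))"
      using sum_mu_inverse[of "\<lambda>\<eta>. scal \<eta> * compop (refl_pt \<eta>)"] by (simp only: p genop_mixed)
    show "ax b t * ?X - ?X * ax b t = - scal b * (\<Sum>\<eta>\<in>\<mu>. compop (refl_pt (inverse \<eta>)))"
      using sum_mu_inverse[of "\<lambda>\<eta>. compop (refl_pt \<eta>)"] by (simp only: p genop_mixed)
    fix \<eta> assume "\<eta> \<in> \<mu>"
    then show "compop (refl_pt (inverse \<eta>)) * ay b t = scal (inverse \<eta>) * ax b t * compop (refl_pt (inverse \<eta>))"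
      "compop (refl_pt (inverse \<eta>)) * ax b t = scal \<eta> * ay b t * compop (refl_pt (inverse \<eta>))"
      using p(6,7)[where \<eta> = "inverse \<eta>"] by (simp_all add: mu_closed)
  qed (simp only: p)
  then have X: "gt b t * ?X = ?X * gt b t"
    unfolding gt_def distrib_right distrib_left by (simp only: add.commute)
  have A: "gt b t * ax b t = ax b t * gt b t" and B: "gt b t * ay b t = ay b t * gt b t"
    unfolding gt_def distrib_right distrib_left
    by (simp_all only: power_commuting_commutes[of "ax b t" "ay b t"] power_commuting_commutes[of "ay b t" "ax b t"]
        p(1) power_commutes)
  \<comment> \<open>The letters x and y are recovered from \<open>ax\<close>, \<open>ay\<close>, X
    and Y, so commuting with these four suffices.\<close>
  have x: "?x = ax b t - scal t * ?Y" and y: "?y = ay b t - scal t * ?X"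
    by (simp_all add: ax_def ay_def del: genop.simps)
  fix v
  show "gt b t * genop b v = genop b v * gt b t"
  proof (cases v)
    case Vx
    show ?thesis
      unfolding Vx x right_diff_distrib left_diff_distrib
      by (simp only: A scal_commute_left[of "gt b t"] Y mult.assoc)
  next
    case Vy
    show ?thesis
      unfolding Vy y right_diff_distrib left_diff_distrib
      by (simp only: B scal_commute_left[of "gt b t"] X mult.assoc)
  qed (simp_all only: X Y)
next
  have refl: "gt b t * trop (reflm \<eta>) = trop (reflm \<eta>) * gt b t" if \<eta>: "\<eta> \<in> \<mu>" for \<eta>
  proof -
    have "\<eta> ^ d = 1" "inverse \<eta> ^ d = 1"
      using \<eta> mu_pow[OF \<eta>] by (simp_all add: power_inverse)
    then show ?thesis
      unfolding trop_refl[OF \<eta>] gt_def distrib_left distrib_right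
        intertwine_power[OF ax_ay_props(6)[OF \<eta>]] intertwine_power[OF ax_ay_props(7)[OF \<eta>]]
      by (simp add: mulop_hom add.commute)
  qed
  fix w assume "w \<in> W"
  then show "gt b t * trop w = trop w * gt b t"
  proof (cases rule: W_cases)
    case (rot \<eta>)
    have r: "w = reflm \<eta> ** reflm 1"
      using rot by (simp add: refl_rot_mult)
    have W1: "reflm \<eta> \<in> W" "reflm 1 \<in> W"
      using rot(1) mu_closed(1) by (simp_all add: W_refl)
    show ?thesis
      unfolding r trop_mult[OF W1]
      by (simp only: mult.assoc[symmetric] refl[OF rot(1)]) (simp only: mult.assoc refl[OF mu_closed(1)])
  qed (simp only: refl)
qed

definition Lsum :: "nat \<Rightarrow> vgen free_alg" where
  "Lsum j = wsum d j (fvar Vx) (fvar VY) + wsum d j (fvar Vy) (fvar VX)"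

lemma gt_eq: "gt b t = (\<Sum>j\<le>d. scal (t ^ j) * fop b (Lsum j))"
proof -
  have "scal t ^ j = (scal (t ^ j) :: pt lop)" for j
    by (simp add: mulop_power)
  then show ?thesis
    unfolding gt_def ax_def ay_def power_eq_wsum[OF scal_commute]
    by (simp add: Lsum_def fop_hom fop_wsum distrib_left sum.distrib del: genop.simps)
qed

lemma Lsum_commutes:
  assumes "j \<le> d"
  shows "commutes_all b (fop b (Lsum j))"
  unfolding commutes_all_def
proof
  fix F assume F: "F \<in> carrier S"
  let ?G = "sop b F"
  have "(\<Sum>j\<le>d. scal (t ^ j) * (fop b (Lsum j) * ?G - ?G * fop b (Lsum j))) = 0" for t
  proof -
    have "(\<Sum>j\<le>d. scal (t ^ j) * (fop b (Lsum j) * ?G - ?G * fop b (Lsum j))) = gt b t * ?G - ?G * gt b t"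
      unfolding gt_eq sum_distrib_left sum_distrib_right right_diff_distrib sum_subtractf
      by (simp only: mult.assoc scal_commute_left[of ?G])
    then show ?thesis
      using gt_commutes[of b t] F by (simp add: commutes_all_def)
  qed
  from scal_power_sum_zero[OF this assms] show "fop b (Lsum j) * ?G = ?G * fop b (Lsum j)" by simp
qed

text \<open>All words in one \<open>wsum\<close> have the same symbol, and there are as many of them
  as the binomial coefficient says. Dividing by it leaves the symbol x^(d-j) Y^j + y^(d-j)
  X^j.\<close>

definition a_word :: "nat \<Rightarrow> vgen free_alg" where
  "a_word j = pconst (inverse (of_nat (d choose j))) * Lsum j"

definition a_fun :: "complex \<Rightarrow> nat \<Rightarrow> pt \<Rightarrow> complex" where
  "a_fun b j = app (fop b (a_word j)) (\<lambda>_. 1)"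

lemma a_word_commutes:
  assumes "j \<le> d"
  shows "commutes_all b (fop b (a_word j))"
proof -
  have "fop b (a_word j) = scal (inverse (of_nat (d choose j))) * fop b (Lsum j)"
    by (simp add: a_word_def fop_hom)
  then show ?thesis
    using Lsum_commutes[OF assms, of b] unfolding commutes_all_def
    by (simp only: mult.assoc scal_commute_left[of "sop b _"]) simp
qed

lemma fop_a_word:
  assumes "j \<le> d"
  shows "fop b (a_word j) = mulop (a_fun b j)" "inv_fun (a_fun b j)"
proof -
  obtain f where f: "fop b (a_word j) = mulop f" "inv_fun f"
    using central_form[of "smash_poly (a_word j)" b] a_word_commutes[OF assms] by auto
  then have "a_fun b j = f" by (simp add: a_fun_def)
  with f show "fop b (a_word j) = mulop (a_fun b j)" "inv_fun (a_fun b j)" by simp_all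
qed

lemma homogeneous_a_word: "homogeneous d (a_word j)"
  unfolding a_word_def Lsum_def by (intro homogeneous_scale homogeneous_add homogeneous_wsum)

lemma cl_a_word: "j \<le> d \<Longrightarrow> cl (a_word j) z = cu z ^ (d - j) * cr z ^ j + cv z ^ (d - j) * cp z ^ j"
  by (simp add: a_word_def Lsum_def cl_hom cl_wsum distrib_left flip: mult.assoc)

lemma a_fun_0: "a_fun b 0 z = cu z ^ d + cv z ^ d"
proof -
  have "fop b (a_word 0) = mulop (\<lambda>z. cu z ^ d + cv z ^ d)"
    by (simp add: a_word_def Lsum_def fop_hom mulop_hom mulop_power)
  then show ?thesis by (simp add: a_fun_def)
qed

lemma refl_pt_neq: "\<eta> \<in> \<mu> \<Longrightarrow> refl_pt \<eta> z \<noteq> z"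
proof
  assume "\<eta> \<in> \<mu>" "refl_pt \<eta> z = z"
  then have "cu z = cv z / \<eta>"
    using refl_pt_coords(1)[OF mu_norm] by metis
  then have "norm (cu z) = norm (cv z)"
    using \<open>\<eta> \<in> \<mu>\<close> by (simp add: norm_divide mu_norm)
  then show False using pt_norm by blast
qed

text \<open>The function of a multiplication operator can be read off at z from the indicator of z.
  A word with a single letter Y or X contains at most one reflection, which moves z, so the Dunkl
  terms do not contribute. This gives a_1 without any correction.\<close>

lemma wsum_1_diagonal:
  defines "\<delta> z \<equiv> \<lambda>y. if y = z then 1 else (0::complex)"
  shows "app (fop b (wsum n 1 (fvar Vx) (fvar VY))) (\<delta> z) z = of_nat n * cu z ^ (n - 1) * cr z"
    "app (fop b (wsum n 1 (fvar Vy) (fvar VX))) (\<delta> z) z = of_nat n * cv z ^ (n - 1) * cp z"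
proof -
  have pow: "app (genop b Vx ^ n) \<phi> y = cu y ^ n * \<phi> y" "app (genop b Vy ^ n) \<phi> y = cv y ^ n * \<phi> y" for n \<phi> y
    by (simp_all flip: mulop_power)
  have Y: "app (genop b VY) (\<lambda>y. h y * \<delta> z y) z = h z * cr z" "app (genop b VX) (\<lambda>y. h y * \<delta> z y) z = h z * cp z" for h
    by (simp_all add: app_genop refl_pt_neq \<delta>_def del: genop.simps)
  show "app (fop b (wsum n 1 (fvar Vx) (fvar VY))) (\<delta> z) z = of_nat n * cu z ^ (n - 1) * cr z"
  proof (induction n)
    case (Suc n)
    have "app (fop b (wsum (Suc n) 1 (fvar Vx) (fvar VY))) (\<delta> z) z
        = cu z * app (fop b (wsum n 1 (fvar Vx) (fvar VY))) (\<delta> z) z + cu z ^ n * cr z"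
      using Y(1)[of "\<lambda>y. cu y ^ n"] by (simp add: fop_hom pow del: genop.simps(3,4)) (simp add: pow[unfolded genop.simps])
    then show ?case
      unfolding Suc by (cases n) (simp_all add: algebra_simps)
  qed (simp add: fop_hom)
  show "app (fop b (wsum n 1 (fvar Vy) (fvar VX))) (\<delta> z) z = of_nat n * cv z ^ (n - 1) * cp z"
  proof (induction n)
    case (Suc n)
    have "app (fop b (wsum (Suc n) 1 (fvar Vy) (fvar VX))) (\<delta> z) z
        = cv z * app (fop b (wsum n 1 (fvar Vy) (fvar VX))) (\<delta> z) z + cv z ^ n * cp z"
      using Y(2)[of "\<lambda>y. cv y ^ n"] by (simp add: fop_hom pow del: genop.simps(3,4)) (simp add: pow[unfolded genop.simps])
    then show ?case
      unfolding Suc by (cases n) (simp_all add: algebra_simps)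
  qed (simp add: fop_hom)
qed

lemma a_fun_1: "a_fun b 1 z = cu z ^ (d - 1) * cr z + cv z ^ (d - 1) * cp z"
proof -
  let ?\<delta> = "\<lambda>y. if y = z then 1 else (0::complex)"
  have "a_fun b 1 z = app (fop b (a_word 1)) ?\<delta> z"
    using fop_a_word(1)[of 1 b] d_ge_2 by simp
  also have "\<dots> = inverse (of_nat d) * (of_nat d * cu z ^ (d - 1) * cr z + of_nat d * cv z ^ (d - 1) * cp z)"
    using wsum_1_diagonal[of b d z] by (simp add: a_word_def Lsum_def fop_hom)
  also have "\<dots> = cu z ^ (d - 1) * cr z + cv z ^ (d - 1) * cp z"
    using d_pos by (simp add: field_simps)
  finally show ?thesis .
qed

text \<open>Writing Yy in place of yY absorbs the reflections of the Euler element: yY plus a times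
  the sum of the reflections is Yy.\<close>

definition eu_word :: "vgen free_alg" where "eu_word = fvar Vx * fvar VX + fvar VY * fvar Vy"

definition eu_fun :: "pt \<Rightarrow> complex" where "eu_fun z = cu z * cp z + cv z * cr z"

text \<open>The Dunkl terms of xX and of Yy cancel, since y pulled back along the reflection at
  \<eta> is \<eta> x. The Euler element acts by its symbol.\<close>

lemma fop_eu_word: "fop b eu_word = mulop eu_fun"
proof (rule lop_eqI)
  fix \<phi> z
  have "(\<Sum>\<eta>\<in>\<mu>. inverse \<eta> * (cv (refl_pt \<eta> z) * \<phi> (refl_pt \<eta> z)) / al \<eta> z) = cu z * (\<Sum>\<eta>\<in>\<mu>. \<phi> (refl_pt \<eta> z) / al \<eta> z)"
    unfolding sum_distrib_left by (intro sum.cong refl) (simp add: refl_pt_coords mu_norm mu_nonzero)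
  then show "app (fop b eu_word) \<phi> z = app (mulop eu_fun) \<phi> z"
    by (simp add: eu_word_def fop_hom app_genop eu_fun_def algebra_simps del: genop.simps(3,4))
qed

lemma inv_fun_eu_fun: "inv_fun eu_fun"
  by (auto simp: inv_fun_iff eu_fun_def refl_pt_coords mu_norm mu_nonzero)

lemma inv_fun_uv: "inv_fun (\<lambda>z. cu z * cv z)"
  by (auto simp: inv_fun_iff refl_pt_coords mu_norm mu_nonzero)

lemma inv_fun_Q_fun: "inv_fun (Q_fun b)"
  unfolding inv_fun_iff
proof (intro ballI allI)
  fix \<eta> z assume \<eta>: "\<eta> \<in> \<mu>"
  have "(\<Sum>\<theta>\<in>\<mu>. inverse \<theta> / al \<theta> (refl_pt \<eta> z) ^ 2) = (\<Sum>\<theta>\<in>\<mu>. inverse (\<eta> * \<eta> / \<theta>) / al (\<eta> * \<eta> / \<theta>) z ^ 2)"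
  proof (intro sum.cong refl)
    fix \<theta> assume \<theta>: "\<theta> \<in> \<mu>"
    show "inverse \<theta> / al \<theta> (refl_pt \<eta> z) ^ 2 = inverse (\<eta> * \<eta> / \<theta>) / al (\<eta> * \<eta> / \<theta>) z ^ 2"
      unfolding al_refl_pt[OF \<eta> \<theta>] using mu_nonzero[OF \<eta>] mu_nonzero[OF \<theta>]
      by (simp add: power_mult_distrib power_divide power2_eq_square divide_simps)
  qed
  also have "\<dots> = (\<Sum>\<theta>\<in>\<mu>. inverse \<theta> / al \<theta> z ^ 2)"
    using \<eta> sum_mu_divide[of "\<eta> * \<eta>" "\<lambda>\<theta>. inverse \<theta> / al \<theta> z ^ 2"] by (simp add: mu_closed)
  finally show "Q_fun b (refl_pt \<eta> z) = Q_fun b z"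
    by (simp add: Q_fun_def refl_pt_coords mu_norm[OF \<eta>] mu_nonzero[OF \<eta>])
qed

text \<open>The d-th power of a square root of \<zeta> is 1 or -1. If it is 1, then d is odd because
  \<zeta> is primitive, and the other square root has d-th power -1.\<close>

lemma half_root_exists: "\<exists>\<xi>. \<xi> ^ 2 = \<zeta> \<and> \<xi> ^ d = -1"
proof -
  let ?s = "csqrt \<zeta>"
  have "(?s ^ d) ^ 2 = 1"
    using power_mult[of ?s d 2] power_mult[of ?s 2 d] by (simp add: mult.commute[of d] zeta_pow_d)
  then have "?s ^ d = 1 \<or> ?s ^ d = -1"
    by (simp add: power2_eq_1_iff)
  then show ?thesis
  proof
    assume s: "?s ^ d = 1"
    have "odd d"
    proof
      assume "even d"
      then obtain k where k: "d = 2 * k" by blast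
      then have "\<zeta> ^ k = 1"
        using s by (simp add: power_mult)
      then show False
        using k d_ge_2 zeta_pow_eq_1_iff[of k] by (auto dest: dvd_imp_le)
    qed
    with s show ?thesis
      by (intro exI[of _ "- ?s"]) simp
  qed (auto intro!: exI[of _ ?s])
qed

section \<open>The linear relations\<close>

definition \<xi> :: complex where "\<xi> = (SOME \<xi>. \<xi> ^ 2 = \<zeta> \<and> \<xi> ^ d = -1)"

lemma xi_props: "\<xi> ^ 2 = \<zeta>" "\<xi> ^ d = -1" "norm \<xi> = 1" "\<xi> \<noteq> 0"
proof -
  show *: "\<xi> ^ 2 = \<zeta>" "\<xi> ^ d = -1"
    using someI_ex[OF half_root_exists] by (simp_all add: \<xi>_def)
  have "norm \<xi> ^ d = 1"
    by (simp add: *(2) flip: norm_power)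
  then show "norm \<xi> = 1"
    using power_eq_imp_eq_base[of "norm \<xi>" d 1] d_pos by simp
  then show "\<xi> \<noteq> 0" by auto
qed

lemma xi_square: "\<xi> * \<xi> = \<zeta>"
  using xi_props(1) by (simp add: power2_eq_square)

text \<open>If a power of \<xi> with exponent k is -1, then \<open>\<zeta> ^ k = 1\<close> and d
  divides k. Below d this leaves k = 0, where the power is 1. This places the eigenvalue -1 of the
  half turn in degrees at least d.\<close>

lemma xi_odd:
  assumes "m + n < d"
  shows "\<xi> ^ m \<noteq> - (\<xi> ^ n)"
proof
  assume eq: "\<xi> ^ m = - (\<xi> ^ n)"
  have aux: False if "\<xi> ^ k = -1" "k < d" for k
  proof -
    have "\<zeta> ^ k = (\<xi> ^ k) ^ 2"
      using power_mult_distrib[of \<xi> \<xi> k] by (simp only: xi_square power2_eq_square)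
    then have "d dvd k"
      using that zeta_pow_eq_1_iff by simp
    then have "k = 0" using that(2) by (auto dest: dvd_imp_le)
    with that show False by simp
  qed
  have nz: "\<xi> ^ k \<noteq> 0" for k using xi_props(4) by simp
  show False
  proof (cases "n \<le> m")
    case True
    then have "\<xi> ^ n * \<xi> ^ (m - n) = \<xi> ^ n * -1"
      using eq by (simp flip: power_add)
    then have "\<xi> ^ (m - n) = -1"
      using nz[of n] mult_left_cancel[of "\<xi> ^ n" "\<xi> ^ (m - n)" "-1"] by simp
    moreover have "m - n < d" using assms by linarith
    ultimately show False by (rule aux)
  next
    case False
    then have "\<xi> ^ m * \<xi> ^ (n - m) = \<xi> ^ n"
      by (simp flip: power_add)
    then have "\<xi> ^ m * \<xi> ^ (n - m) = \<xi> ^ m * -1"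
      using eq by simp
    then have "\<xi> ^ (n - m) = -1"
      using nz[of m] mult_left_cancel[of "\<xi> ^ m" "\<xi> ^ (n - m)" "-1"] by simp
    moreover have "n - m < d" using assms by linarith
    ultimately show False by (rule aux)
  qed
qed

text \<open>Conjugation by \<open>half_turn\<close> realises the diagram automorphism \<open>s\<^sub>i \<mapsto> s\<^sub>i\<^sub>+\<^sub>1\<close>, which exists since the
  two parameters agree.  The elements of odd weight vanish in low degree.\<close>

definition half_turn :: "pt lop" where "half_turn = compop (rot_pt \<xi>)"

lemma refl_pt_rot_pt_xi: "\<eta> \<in> \<mu> \<Longrightarrow> refl_pt \<eta> (rot_pt \<xi> z) = rot_pt \<xi> (refl_pt (\<zeta> * \<eta>) z)"
proof -
  assume \<eta>: "\<eta> \<in> \<mu>"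
  have "norm (\<zeta> * \<eta>) = 1" using \<eta> by (simp add: mu_norm mu_closed)
  moreover have "\<zeta> * \<eta> / \<xi> = \<xi> * \<eta>"
  proof -
    have "\<xi> * \<xi> * \<eta> / \<xi> = \<xi> * \<eta>"
      using xi_props(4) by simp
    then show ?thesis by (simp only: xi_square)
  qed
  ultimately show ?thesis
    using \<eta> xi_props by (simp add: refl_pt_rot_pt_comp mu_norm)
qed

lemma al_rot_pt_xi:
  assumes "\<eta> \<in> \<mu>"
  shows "al \<eta> (rot_pt \<xi> z) = \<xi> * al (\<zeta> * \<eta>) z"
proof -
  have "\<xi> / (\<zeta> * \<eta>) = 1 / (\<xi> * \<eta>)"
  proof -
    have "\<xi> / (\<xi> * \<xi> * \<eta>) = 1 / (\<xi> * \<eta>)"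
      using xi_props(4) by simp
    then show ?thesis by (simp only: xi_square)
  qed
  then have "cv z * (\<xi> / (\<zeta> * \<eta>)) = cv z * (1 / (\<xi> * \<eta>))"
    by (simp only:)
  then have "\<xi> * (cv z / (\<zeta> * \<eta>)) = cv z / (\<xi> * \<eta>)"
    by (simp only: times_divide_eq_right mult_1_right mult.commute[of "cv z" \<xi>])
  then show ?thesis
    by (simp add: al_def rot_pt_coords xi_props right_diff_distrib)
qed

fun twist_weight :: "vgen \<Rightarrow> complex" where
  "twist_weight Vx = \<xi>" | "twist_weight Vy = inverse \<xi>" | "twist_weight VX = inverse \<xi>" | "twist_weight VY = \<xi>"

lemma genop_half_turn: "half_turn * genop b v = scal (twist_weight v) * genop b v * half_turn"
proof (rule lop_eqI)
  fix \<phi> z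
  have "(\<Sum>\<eta>\<in>\<mu>. \<phi> (refl_pt \<eta> (rot_pt \<xi> z)) / al \<eta> (rot_pt \<xi> z)) = (\<Sum>\<eta>\<in>\<mu>. inverse \<xi> * (\<phi> (rot_pt \<xi> (refl_pt (\<zeta> * \<eta>) z)) / al (\<zeta> * \<eta>) z))"
    by (intro sum.cong refl) (simp add: refl_pt_rot_pt_xi al_rot_pt_xi divide_inverse)
  also have "\<dots> = inverse \<xi> * (\<Sum>\<eta>\<in>\<mu>. \<phi> (rot_pt \<xi> (refl_pt \<eta> z)) / al \<eta> z)"
    using sum_mu_mult[OF mu_closed(2), of "\<lambda>\<eta>. \<phi> (rot_pt \<xi> (refl_pt \<eta> z)) / al \<eta> z"]
    by (simp only: sum_distrib_left[symmetric])
  finally have X: "(\<Sum>\<eta>\<in>\<mu>. \<phi> (refl_pt \<eta> (rot_pt \<xi> z)) / al \<eta> (rot_pt \<xi> z)) = inverse \<xi> * (\<Sum>\<eta>\<in>\<mu>. \<phi> (rot_pt \<xi> (refl_pt \<eta> z)) / al \<eta> z)" .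
  have "(\<Sum>\<eta>\<in>\<mu>. inverse \<eta> * \<phi> (refl_pt \<eta> (rot_pt \<xi> z)) / al \<eta> (rot_pt \<xi> z)) = (\<Sum>\<eta>\<in>\<mu>. \<xi> * (inverse (\<zeta> * \<eta>) * \<phi> (rot_pt \<xi> (refl_pt (\<zeta> * \<eta>) z)) / al (\<zeta> * \<eta>) z))"
  proof (intro sum.cong refl)
    fix \<eta> assume \<eta>: "\<eta> \<in> \<mu>"
    have "inverse \<eta> * inverse \<xi> = \<xi> * inverse (\<zeta> * \<eta>)"
    proof -
      have "inverse \<eta> * inverse \<xi> = \<xi> * inverse (\<xi> * \<xi> * \<eta>)"
        using xi_props(4) mu_nonzero[OF \<eta>] by (simp add: field_simps)
      then show ?thesis by (simp only: xi_square)
    qed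
    then have "inverse \<eta> * inverse \<xi> * (\<phi> (rot_pt \<xi> (refl_pt (\<zeta> * \<eta>) z)) / al (\<zeta> * \<eta>) z)
        = \<xi> * inverse (\<zeta> * \<eta>) * (\<phi> (rot_pt \<xi> (refl_pt (\<zeta> * \<eta>) z)) / al (\<zeta> * \<eta>) z)"
      by (simp only:)
    then show "inverse \<eta> * \<phi> (refl_pt \<eta> (rot_pt \<xi> z)) / al \<eta> (rot_pt \<xi> z) = \<xi> * (inverse (\<zeta> * \<eta>) * \<phi> (rot_pt \<xi> (refl_pt (\<zeta> * \<eta>) z)) / al (\<zeta> * \<eta>) z)"
      unfolding refl_pt_rot_pt_xi[OF \<eta>] al_rot_pt_xi[OF \<eta>] by (simp only: divide_inverse inverse_mult_distrib[of \<xi>] mult_ac)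
  qed
  also have "\<dots> = \<xi> * (\<Sum>\<eta>\<in>\<mu>. inverse \<eta> * \<phi> (rot_pt \<xi> (refl_pt \<eta> z)) / al \<eta> z)"
    using sum_mu_mult[OF mu_closed(2), of "\<lambda>\<eta>. inverse \<eta> * \<phi> (rot_pt \<xi> (refl_pt \<eta> z)) / al \<eta> z"]
    by (simp only: sum_distrib_left[symmetric])
  finally have Y: "(\<Sum>\<eta>\<in>\<mu>. inverse \<eta> * \<phi> (refl_pt \<eta> (rot_pt \<xi> z)) / al \<eta> (rot_pt \<xi> z)) = \<xi> * (\<Sum>\<eta>\<in>\<mu>. inverse \<eta> * \<phi> (rot_pt \<xi> (refl_pt \<eta> z)) / al \<eta> z)" .
  show "app (half_turn * genop b v) \<phi> z = app (scal (twist_weight v) * genop b v * half_turn) \<phi> z"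
    using X Y by (cases v) (simp_all add: half_turn_def app_genop rot_pt_coords xi_props divide_inverse algebra_simps del: genop.simps(3,4))
qed

definition twist_hom :: "complex \<Rightarrow> vgen free_alg \<Rightarrow> bool" where
  "twist_hom t f \<longleftrightarrow> (\<forall>b. half_turn * fop b f = scal t * fop b f * half_turn)"

lemma twist_hom_fvar: "twist_hom (twist_weight v) (fvar v)"
  unfolding twist_hom_def fop_hom using genop_half_turn by blast

lemma twist_hom_pconst: "twist_hom 1 (pconst z)"
  by (simp add: twist_hom_def fop_hom half_turn_def compop_mulop mulop_hom)

lemma twist_hom_add: "twist_hom t f \<Longrightarrow> twist_hom t g \<Longrightarrow> twist_hom t (f + g)"
  by (simp add: twist_hom_def fop_hom distrib_left distrib_right)

lemma twist_hom_diff: "twist_hom t f \<Longrightarrow> twist_hom t g \<Longrightarrow> twist_hom t (f - g)"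
  by (simp add: twist_hom_def fop_hom left_diff_distrib right_diff_distrib)

lemma twist_hom_mult:
  assumes "twist_hom s f" "twist_hom t g"
  shows "twist_hom (s * t) (f * g)"
  unfolding twist_hom_def
proof
  fix b
  have "half_turn * fop b (f * g) = (half_turn * fop b f) * fop b g"
    by (simp add: fop_hom mult.assoc)
  also have "\<dots> = scal s * fop b f * (half_turn * fop b g)"
    using assms(1) by (simp add: twist_hom_def mult.assoc)
  also have "\<dots> = scal s * (fop b f * scal t) * fop b g * half_turn"
    using assms(2) by (simp add: twist_hom_def mult.assoc)
  also have "\<dots> = scal (s * t) * fop b (f * g) * half_turn"
    by (simp only: scal_commute[of t "fop b f", symmetric] fop_hom mulop_hom mult.assoc)
  finally show "half_turn * fop b (f * g) = scal (s * t) * fop b (f * g) * half_turn" .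
qed

lemma twist_hom_power: "twist_hom t f \<Longrightarrow> twist_hom (t ^ n) (f ^ n)"
proof (induction n)
  case 0
  then show ?case using twist_hom_pconst[of 1] by simp
qed (auto dest: twist_hom_mult)

lemma twist_hom_scale: "twist_hom t f \<Longrightarrow> twist_hom t (pconst z * f)"
  using twist_hom_mult[OF twist_hom_pconst] by fastforce

lemma twist_hom_zero: "twist_hom t 0"
  by (simp add: twist_hom_def fop_hom)

lemma twist_hom_minus_oneD:
  assumes "twist_hom (-1) f"
  shows "half_turn * fop b f = - fop b f * half_turn"
proof -
  have "scal (-1) = (- 1 :: pt lop)"
    by (rule lop_eqI) simp
  then show ?thesis
    using assms by (simp add: twist_hom_def)
qed

lemma twist_hom_wsum:
  assumes "twist_weight u = twist_weight v"
  shows "twist_hom (twist_weight u ^ n) (wsum n j (fvar u) (fvar v))"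
proof (induction n j "fvar u" "fvar v" rule: wsum.induct)
  case (1 j)
  then show ?case using twist_hom_pconst[of 1] by (simp add: twist_hom_zero)
next
  case (2 n)
  then show ?case using twist_hom_mult[OF twist_hom_fvar 2] by simp
next
  case (3 n j)
  have "twist_hom (twist_weight u * twist_weight u ^ n) (fvar v * wsum n j (fvar u) (fvar v))"
    using twist_hom_mult[OF twist_hom_fvar[of v] 3(2)] assms by simp
  then show ?case
    using twist_hom_add[OF twist_hom_mult[OF twist_hom_fvar 3(1)]] by simp
qed

text \<open>The d letters of each word all have weight \<xi>, or all have its inverse, so the sign
  is that of \<open>\<xi> ^ d\<close>.\<close>

lemma twist_hom_a_word: "twist_hom (-1) (a_word j)"
proof -
  have "twist_hom (-1) (wsum d j (fvar Vx) (fvar VY))" "twist_hom (-1) (wsum d j (fvar Vy) (fvar VX))"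
    using twist_hom_wsum[of Vx VY d j] twist_hom_wsum[of Vy VX d j] xi_props by (simp_all add: power_inverse)
  then show ?thesis
    unfolding a_word_def Lsum_def by (intro twist_hom_scale twist_hom_add)
qed

definition mon_twist :: "(vgen \<Rightarrow>\<^sub>0 nat) \<Rightarrow> complex" where
  "mon_twist m = twist_weight Vx ^ Poly_Mapping.lookup m Vx * twist_weight Vy ^ Poly_Mapping.lookup m Vy *
     twist_weight VX ^ Poly_Mapping.lookup m VX * twist_weight VY ^ Poly_Mapping.lookup m VY"

lemma twist_hom_nmon: "twist_hom (mon_twist m) (nmon m)"
  unfolding mon_twist_def nmon_def by (intro twist_hom_mult twist_hom_power twist_hom_fvar)

lemma mon_twist_odd: "mdeg m < d \<Longrightarrow> mon_twist m \<noteq> -1"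
proof
  assume m: "mdeg m < d" "mon_twist m = -1"
  let ?A = "Poly_Mapping.lookup m Vx + Poly_Mapping.lookup m VY"
  let ?B = "Poly_Mapping.lookup m Vy + Poly_Mapping.lookup m VX"
  have "mon_twist m = \<xi> ^ ?A * inverse (\<xi> ^ ?B)"
    by (simp add: mon_twist_def power_add power_inverse)
  then have "\<xi> ^ ?A = - (\<xi> ^ ?B)"
    using m(2) xi_props(4) by (simp add: field_simps)
  then show False
    using xi_odd[of ?A ?B] m(1) by (simp add: mdeg_def)
qed

lemma half_turn_trop:
  assumes "w \<in> W"
  obtains w' where "w' \<in> W" "half_turn * trop w = trop w' * half_turn" "w' = mat 1 \<longleftrightarrow> w = mat 1"
  using assms
proof (cases rule: W_cases)
  case (refl \<eta>)
  have z\<eta>: "\<zeta> * \<eta> \<in> \<mu>" using refl mu_closed by simp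
  have "half_turn * trop w = trop (reflm (\<zeta> * \<eta>)) * half_turn"
    by (rule lop_eqI) (simp add: half_turn_def refl act_refl mu_nonzero[OF refl(1)] act_refl[OF mu_nonzero[OF z\<eta>]] refl_pt_rot_pt_xi)
  moreover have "w \<noteq> mat 1" "reflm (\<zeta> * \<eta>) \<noteq> mat 1"
    by (simp_all add: refl(2) mat_1_eq_rotm reflm_neq_rotm)
  ultimately show thesis
    using that[OF W_refl[OF z\<eta>]] by blast
next
  case (rot \<eta>)
  have "half_turn * trop w = trop w * half_turn"
    using rot by (intro lop_eqI) (simp add: half_turn_def act_rot mu_nonzero refl_pt_rot_pt_comp mu_norm xi_props mult.commute)
  then show thesis
    using that assms by blast
qed

text \<open>Conjugation by the half turn permutes the group components and keeps the identity
  component, on which it multiplies each monomial by its weight. Hence it can be compared with the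
  truncation.\<close>

lemma twist_NP:
  assumes "Poly_Mapping.keys P \<subseteq> W"
  shows "\<exists>P'. Poly_Mapping.keys P' \<subseteq> W \<and> half_turn * sop b (NP P) = sop b (NP P') * half_turn \<and>
    (\<forall>m. Poly_Mapping.lookup (Poly_Mapping.lookup P' (mat 1)) m = mon_twist m * Poly_Mapping.lookup (Poly_Mapping.lookup P (mat 1)) m)"
  using assms
proof (induction P rule: poly_mapping_induct_keys)
  case zero
  show ?case by (rule exI[of _ 0]) (simp add: NP_hom)
next
  case (single w p)
  show ?case
  proof (induction p rule: poly_mapping_induct)
    case zero
    show ?case by (rule exI[of _ 0]) (simp add: NP_hom)
  next
    case (single m z)
    obtain w' where w': "w' \<in> W" "half_turn * trop w = trop w' * half_turn" "w' = mat 1 \<longleftrightarrow> w = mat 1"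
      using half_turn_trop[OF \<open>w \<in> W\<close>] .
    have t: "half_turn * fop b (pconst z * nmon m) = scal (mon_twist m) * fop b (pconst z * nmon m) * half_turn"
      using twist_hom_scale[OF twist_hom_nmon] by (simp add: twist_hom_def)
    have "half_turn * sop b (NP (Poly_Mapping.single w (Poly_Mapping.single m z)))
        = scal (mon_twist m) * fop b (pconst z * nmon m) * (half_turn * trop w)"
      by (simp add: NP_hom normal_order_hom mult.assoc[symmetric] t)
    also have "\<dots> = sop b (NP (Poly_Mapping.single w' (Poly_Mapping.single m (mon_twist m * z)))) * half_turn"
      by (simp add: w' NP_hom normal_order_hom fop_hom mulop_hom mult.assoc)
    finally show ?case
      using w'(1,3)
      by (intro exI[of _ "Poly_Mapping.single w' (Poly_Mapping.single m (mon_twist m * z))"])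
         (auto simp: lookup_single when_def)
  next
    case (add p q)
    then obtain P' Q' where "Poly_Mapping.keys P' \<subseteq> W" "half_turn * sop b (NP (Poly_Mapping.single w p)) = sop b (NP P') * half_turn"
      "\<And>m. Poly_Mapping.lookup (Poly_Mapping.lookup P' (mat 1)) m = mon_twist m * Poly_Mapping.lookup (Poly_Mapping.lookup (Poly_Mapping.single w p) (mat 1)) m"
      "Poly_Mapping.keys Q' \<subseteq> W" "half_turn * sop b (NP (Poly_Mapping.single w q)) = sop b (NP Q') * half_turn"
      "\<And>m. Poly_Mapping.lookup (Poly_Mapping.lookup Q' (mat 1)) m = mon_twist m * Poly_Mapping.lookup (Poly_Mapping.lookup (Poly_Mapping.single w q) (mat 1)) m"
      by blast
    then show ?case
      using keys_add[of P' Q']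
      by (intro exI[of _ "P' + Q'"]) (auto simp: single_add NP_hom sop_add lookup_add distrib_left distrib_right)
  qed
next
  case (add P Q)
  then obtain P' Q' where "Poly_Mapping.keys P' \<subseteq> W" "half_turn * sop b (NP P) = sop b (NP P') * half_turn"
    "\<And>m. Poly_Mapping.lookup (Poly_Mapping.lookup P' (mat 1)) m = mon_twist m * Poly_Mapping.lookup (Poly_Mapping.lookup P (mat 1)) m"
    "Poly_Mapping.keys Q' \<subseteq> W" "half_turn * sop b (NP Q) = sop b (NP Q') * half_turn"
    "\<And>m. Poly_Mapping.lookup (Poly_Mapping.lookup Q' (mat 1)) m = mon_twist m * Poly_Mapping.lookup (Poly_Mapping.lookup Q (mat 1)) m"
    by blast
  then show ?case
    using keys_add[of P' Q']
    by (intro exI[of _ "P' + Q'"]) (auto simp: NP_hom sop_add lookup_add distrib_left distrib_right)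
qed

lemma half_turn_right_cancel:
  assumes "L * half_turn = M * half_turn"
  shows "L = M"
proof -
  have "half_turn * compop (rot_pt (inverse \<xi>)) = 1"
  proof (rule lop_eqI)
    fix \<phi> z
    have "rot_pt (inverse \<xi>) (rot_pt \<xi> z) = z"
      using xi_props by (intro pt_eqI) (simp_all add: rot_pt_coords norm_inverse)
    then show "app (half_turn * compop (rot_pt (inverse \<xi>))) \<phi> z = app 1 \<phi> z"
      by (simp add: half_turn_def)
  qed
  then show ?thesis
    using arg_cong[OF assms, of "\<lambda>L. L * compop (rot_pt (inverse \<xi>))"] by (simp add: mult.assoc)
qed

text \<open>By uniqueness of normal forms the identity component of an odd element satisfies (weight
  + 1) times coefficient = 0, and in degree below d no weight is -1.\<close>

lemma twist_odd_low_degree: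
  assumes P: "Poly_Mapping.keys P \<subseteq> W" and odd: "half_turn * sop b (NP P) = - sop b (NP P) * half_turn" and m: "mdeg m < d"
  shows "Poly_Mapping.lookup (Poly_Mapping.lookup P (mat 1)) m = 0"
proof -
  obtain P' where P': "Poly_Mapping.keys P' \<subseteq> W" "half_turn * sop b (NP P) = sop b (NP P') * half_turn"
    "\<And>m. Poly_Mapping.lookup (Poly_Mapping.lookup P' (mat 1)) m = mon_twist m * Poly_Mapping.lookup (Poly_Mapping.lookup P (mat 1)) m"
    using twist_NP[OF P] by blast
  have "sop b (NP P') = - sop b (NP P)"
    by (rule half_turn_right_cancel) (simp only: P'(2)[symmetric] odd)
  then have "sop b (NP (P' + P)) = 0"
    by (simp add: NP_hom sop_add)
  moreover have "Poly_Mapping.keys (P' + P) \<subseteq> W"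
    using P P'(1) keys_add[of P' P] by blast
  ultimately have "P' + P = 0"
    by (intro sop_NP_inj)
  then have "Poly_Mapping.lookup (Poly_Mapping.lookup (P' + P) (mat 1)) m = 0" by simp
  then have "(mon_twist m + 1) * Poly_Mapping.lookup (Poly_Mapping.lookup P (mat 1)) m = 0"
    by (simp add: lookup_add P'(3) distrib_right)
  then show ?thesis
    using mon_twist_odd[OF m] by (simp add: eq_neg_iff_add_eq_0)
qed

lemma homogeneous_mulop_eq:
  assumes "homogeneous n f" "fop b f = mulop g" "\<epsilon> \<noteq> 0"
  shows "\<epsilon> ^ n * g (sc (inverse \<epsilon>) z) = app (fop (b * \<epsilon> ^ 2) f) (\<lambda>_. 1) z"
  using rescaled_homogeneous[OF assms(1) W_one assms(3), of b "\<lambda>_. 1" z] by (simp add: assms(2) rescaled_mulop assms(3))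

lemma homogeneous_mulop_lim:
  assumes "homogeneous n f" "fop b f = mulop g" "n \<le> N"
  shows "((\<lambda>\<epsilon>. \<epsilon> ^ N * g (sc (inverse \<epsilon>) z)) \<longlongrightarrow> (if n = N then cl f z else 0)) (at 0)"
proof -
  have "\<forall>\<^sub>F \<epsilon> in at 0. \<epsilon> ^ N * rescaled (fop b f * trop (mat 1)) (\<lambda>_. 1) z \<epsilon> = \<epsilon> ^ N * g (sc (inverse \<epsilon>) z)"
    unfolding eventually_at_filter by (intro always_eventually) (simp add: assms(2) rescaled_mulop)
  from Lim_transform_eventually[OF lead_homogeneous[OF assms(1) W_one assms(3)] this] show ?thesis
    by (cases "n = N") simp_all
qed

text \<open>Every reflection negates \<open>D\<close>, so multiplication by it changes the sign of
  the Dunkl part and leaves the rest. This is the twist by the sign character.\<close>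

lemma genop_sign:
  defines "D \<equiv> \<lambda>z. cu z ^ d - cv z ^ d"
  shows "mulop D * genop b v = genop (- b) v * mulop D"
proof (rule lop_eqI)
  fix \<phi> z
  have D: "D (refl_pt \<eta> z) = - D z" if "\<eta> \<in> \<mu>" for \<eta>
    using that by (simp add: D_def refl_pt_coords mu_norm power_divide power_mult_distrib mu_pow)
  have X: "(\<Sum>\<eta>\<in>\<mu>. D (refl_pt \<eta> z) * \<phi> (refl_pt \<eta> z) / al \<eta> z) = - D z * (\<Sum>\<eta>\<in>\<mu>. \<phi> (refl_pt \<eta> z) / al \<eta> z)"
    unfolding sum_distrib_left by (intro sum.cong refl) (simp add: D)
  have Y: "(\<Sum>\<eta>\<in>\<mu>. inverse \<eta> * (D (refl_pt \<eta> z) * \<phi> (refl_pt \<eta> z)) / al \<eta> z) = - D z * (\<Sum>\<eta>\<in>\<mu>. inverse \<eta> * \<phi> (refl_pt \<eta> z) / al \<eta> z)"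
    unfolding sum_distrib_left by (intro sum.cong refl) (simp add: D)
  show "app (mulop D * genop b v) \<phi> z = app (genop (- b) v * mulop D) \<phi> z"
    by (cases v) (simp_all add: app_genop X Y del: genop.simps(3,4), simp_all add: algebra_simps)
qed

lemma fop_sign:
  defines "D \<equiv> \<lambda>z. cu z ^ d - cv z ^ d"
  shows "mulop D * fop b f = fop (- b) f * mulop D"
proof (induction f rule: free_alg_induct)
  case (const_word ws z)
  have "mulop D * fop b (fword ws) = fop (- b) (fword ws) * mulop D"
  proof (induction ws)
    case (Cons v ws)
    have "mulop D * fop b (fword (v # ws)) = (mulop D * genop b v) * fop b (fword ws)"
      by (simp add: fop_hom mult.assoc)
    also have "\<dots> = genop (- b) v * (mulop D * fop b (fword ws))"
      unfolding D_def genop_sign by (simp add: mult.assoc)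
    also have "\<dots> = fop (- b) (fword (v # ws)) * mulop D"
      by (simp add: Cons fop_hom mult.assoc)
    finally show ?case .
  qed (simp add: fop_hom)
  then show ?case
    by (simp only: fop_hom scal_commute_left[of "mulop D"] mult.assoc)
qed (simp_all add: fop_hom distrib_left distrib_right)

lemma D_nonzero: "cu z ^ d - cv z ^ d \<noteq> 0"
proof
  assume "cu z ^ d - cv z ^ d = 0"
  then have "norm (cu z) ^ d = norm (cv z) ^ d"
    by (simp flip: norm_power)
  then have "norm (cu z) = norm (cv z)"
    using power_eq_imp_eq_base[of "norm (cu z)" d "norm (cv z)"] d_pos by simp
  then show False using pt_norm by blast
qed

text \<open>The conjugation that changes the sign of the parameter acts trivially on multiplication
  operators.\<close>

lemma fop_even:
  assumes "\<And>b. fop b f = mulop (g b)"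
  shows "g (- b) = g b"
proof
  fix z
  have "app (mulop (\<lambda>z. cu z ^ d - cv z ^ d) * fop b f) (\<lambda>_. 1) z = app (fop (- b) f * mulop (\<lambda>z. cu z ^ d - cv z ^ d)) (\<lambda>_. 1) z"
    by (simp only: fop_sign)
  then show "g (- b) z = g b z"
    using D_nonzero[of z] by (simp add: assms)
qed

text \<open>An even polynomial without constant term has no linear term either, which gains one more
  factor \<open>\<epsilon> ^ 2\<close>.\<close>

lemma even_polynomial_lim:
  fixes q :: "complex poly"
  assumes even: "\<And>b. poly q (- b) = poly q b" and zero: "poly q 0 = 0"
  shows "((\<lambda>\<epsilon>. poly q (b * \<epsilon> ^ 2) / \<epsilon> ^ 2) \<longlongrightarrow> 0) (at 0)"
proof -
  obtain r where r: "q = pCons 0 r"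
    using zero by (cases q) simp
  have neg: "poly (r + pcompose r [:0, -1:]) b = 0" if "b \<noteq> 0" for b
  proof -
    have "b * poly r b = b * (- poly r (- b))"
      using even[of b] by (simp add: r)
    then have "poly r b = - poly r (- b)"
      by (simp only: mult_left_cancel[OF that])
    then show ?thesis by (simp add: poly_pcompose)
  qed
  have "infinite (UNIV - {0 :: complex})"
    by (simp add: infinite_UNIV_char_0)
  moreover have "UNIV - {0} \<subseteq> {b. poly (r + pcompose r [:0, -1:]) b = 0}"
    using neg by blast
  ultimately have "infinite {b. poly (r + pcompose r [:0, -1:]) b = 0}"
    using infinite_super by blast
  then have "r + pcompose r [:0, -1:] = 0"
    using poly_roots_finite by blast
  then have "poly (r + pcompose r [:0, -1:]) 0 = 0"
    by (simp only: poly_0)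
  then have r0: "poly r 0 = 0"
    by (simp add: poly_pcompose)
  have "isCont (\<lambda>\<epsilon>. b * poly r (b * \<epsilon> ^ 2)) 0"
    by (intro continuous_intros)
  then have lim: "((\<lambda>\<epsilon>. b * poly r (b * \<epsilon> ^ 2)) \<longlongrightarrow> 0) (at 0)"
    by (simp add: isCont_def r0)
  have "\<forall>\<^sub>F \<epsilon> in at 0. b * poly r (b * \<epsilon> ^ 2) = poly q (b * \<epsilon> ^ 2) / \<epsilon> ^ 2"
    unfolding eventually_at_filter by (intro always_eventually allI impI) (simp add: r)
  with lim show ?thesis
    by (rule Lim_transform_eventually)
qed

definition rec_word :: "nat \<Rightarrow> vgen free_alg" where
  "rec_word i = eu_word * a_word i - fvar Vx * fvar Vy * a_word (Suc i) - fvar VX * fvar VY * a_word (i - 1)"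

definition rec_fun :: "complex \<Rightarrow> nat \<Rightarrow> pt \<Rightarrow> complex" where
  "rec_fun b i z = eu_fun z * a_fun b i z - cu z * cv z * a_fun b (Suc i) z - Q_fun b z * a_fun b (i - 1) z"

lemma homogeneous_quad: "homogeneous 2 (fvar u * fvar v)"
  using homogeneous_mult[OF homogeneous_fvar homogeneous_fvar] by (simp add: numeral_2_eq_2)

lemma homogeneous_eu_word: "homogeneous 2 eu_word"
  unfolding eu_word_def by (intro homogeneous_add homogeneous_quad)

lemma homogeneous_rec_word: "homogeneous (2 + d) (rec_word i)"
  unfolding rec_word_def by (intro homogeneous_diff homogeneous_mult homogeneous_eu_word homogeneous_quad homogeneous_a_word)

lemma twist_hom_quad: "twist_weight u * twist_weight v = 1 \<Longrightarrow> twist_hom 1 (fvar u * fvar v)"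
  using twist_hom_mult[OF twist_hom_fvar twist_hom_fvar, of u v] by simp

lemma twist_hom_rec_word: "twist_hom (-1) (rec_word i)"
proof -
  have "twist_hom 1 eu_word" "twist_hom 1 (fvar Vx * fvar Vy)" "twist_hom 1 (fvar VX * fvar VY)"
    unfolding eu_word_def using xi_props by (auto intro!: twist_hom_add twist_hom_quad)
  then have "twist_hom (1 * -1) (rec_word i)"
    unfolding rec_word_def by (intro twist_hom_diff twist_hom_mult twist_hom_a_word)
  then show ?thesis by simp
qed

lemma fop_xy: "fop b (fvar Vx * fvar Vy) = mulop (\<lambda>z. cu z * cv z)"
  by (simp add: fop_hom mulop_hom)

lemma fop_XY: "fop b (fvar VX * fvar VY) = mulop (Q_fun b)"
  unfolding fop_hom genop_XY ..

lemma fop_rec_word: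
  assumes "1 \<le> i" "i < d"
  shows "fop b (rec_word i) = mulop (rec_fun b i)"
proof -
  have "fop b (rec_word i) = mulop eu_fun * mulop (a_fun b i) - mulop (\<lambda>z. cu z * cv z) * mulop (a_fun b (Suc i)) - mulop (Q_fun b) * mulop (a_fun b (i - 1))"
    unfolding rec_word_def fop_hom(2) fop_hom(3)[of b _ "a_word _"] fop_xy fop_XY fop_eu_word
    using assms by (simp add: fop_a_word)
  also have "\<dots> = mulop (rec_fun b i)"
    by (intro lop_eqI) (simp add: rec_fun_def algebra_simps)
  finally show ?thesis .
qed

lemma cl_rec_word:
  assumes "1 \<le> i" "i < d"
  shows "cl (rec_word i) z = 0"
proof -
  obtain k where k: "i = Suc k" using assms(1) by (cases i) auto
  obtain l where l: "d = Suc (Suc k + l)" using assms(2) unfolding k by (metis less_iff_Suc_add)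
  have "d - k = Suc (Suc l)" "d - Suc k = Suc l" "d - Suc (Suc k) = l" "Suc (Suc k) \<le> d" "Suc k \<le> d" "k \<le> d"
    using l by simp_all
  then show ?thesis
    by (simp add: rec_word_def eu_word_def cl_hom cl_a_word k algebra_simps)
qed

end

context cherednik_param
begin

lemma recurrence_vanishes:
  assumes i: "1 \<le> i" "i < d"
  shows "rec_fun a i z = 0"
proof -
  note fop = fop_rec_word[OF i]
  have "fop a (rec_word i) \<in> HH" by (rule HH_fop)
  then obtain P where P: "P \<in> pbw_source \<zeta>" "sop a (NP P) = fop a (rec_word i)"
    using HH_NP by blast
  then have keys: "Poly_Mapping.keys P \<subseteq> W" and f: "sop a (NP P) = mulop (rec_fun a i)"
    by (simp_all add: pbw_source_iff fop)
  \<comment> \<open>The weight of \<open>rec_word\<close> is d + 2. The factor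
    \<open>\<epsilon> ^ 2\<close> gained from evenness brings the bound down to d, which is the
    range of \<open>twist_odd_low_degree\<close>.\<close>
  have "pdeg_lt P d"
  proof (rule central_degree_bound[OF keys f])
    fix M z assume M: "d \<le> M"
    obtain q where q: "\<And>b. app (fop b (rec_word i)) (\<lambda>_. 1) z = poly q b"
      using fop_polynomial by blast
    have qr: "poly q b = rec_fun b i z" for b
      unfolding q[symmetric] fop by simp
    have "rec_fun (- b) i = rec_fun b i" for b
      by (rule fop_even[OF fop])
    then have even: "poly q (- b) = poly q b" for b
      unfolding qr by simp
    have zero: "poly q 0 = 0"
      unfolding q[symmetric] using cl_rec_word[OF i, of z] by (simp only: cl_def)
    have 1: "((\<lambda>\<epsilon>. \<epsilon> ^ (M - d) * (poly q (a * \<epsilon> ^ 2) / \<epsilon> ^ 2)) \<longlongrightarrow> 0 ^ (M - d) * 0) (at 0)"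
      by (rule tendsto_mult[OF tendsto_power[OF tendsto_ident_at] even_polynomial_lim[OF even zero]])
    have 2: "\<forall>\<^sub>F \<epsilon> in at 0. \<epsilon> ^ (M - d) * (poly q (a * \<epsilon> ^ 2) / \<epsilon> ^ 2) = \<epsilon> ^ M * rec_fun a i (sc (inverse \<epsilon>) z)"
      unfolding eventually_at_filter
    proof (intro always_eventually allI impI)
      fix \<epsilon> :: complex assume \<epsilon>: "\<epsilon> \<noteq> 0"
      have "poly q (a * \<epsilon> ^ 2) = \<epsilon> ^ 2 * (\<epsilon> ^ d * rec_fun a i (sc (inverse \<epsilon>) z))"
        using homogeneous_mulop_eq[OF homogeneous_rec_word fop \<epsilon>, where b = a and z = z] by (simp add: q power_add power2_eq_square mult.assoc)
      moreover have "\<epsilon> ^ M = \<epsilon> ^ (M - d) * \<epsilon> ^ d"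
        using M by (simp flip: power_add)
      ultimately show "\<epsilon> ^ (M - d) * (poly q (a * \<epsilon> ^ 2) / \<epsilon> ^ 2) = \<epsilon> ^ M * rec_fun a i (sc (inverse \<epsilon>) z)"
        using \<epsilon> by simp
    qed
    from Lim_transform_eventually[OF 1 2]
    show "((\<lambda>\<epsilon>. \<epsilon> ^ M * rec_fun a i (sc (inverse \<epsilon>) z)) \<longlongrightarrow> 0) (at 0)"
      by simp
  qed
  then have lt: "Poly_Mapping.lookup (Poly_Mapping.lookup P (mat 1)) m \<noteq> 0 \<Longrightarrow> mdeg m < d" for m
    by (simp add: pdeg_lt_def)
  have odd: "half_turn * sop a (NP P) = - sop a (NP P) * half_turn"
    unfolding P(2) by (rule twist_hom_minus_oneD[OF twist_hom_rec_word])
  have "Poly_Mapping.lookup (Poly_Mapping.lookup P (mat 1)) m = 0" for m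
  proof (rule ccontr)
    assume nz: "Poly_Mapping.lookup (Poly_Mapping.lookup P (mat 1)) m \<noteq> 0"
    from twist_odd_low_degree[OF keys odd lt[OF nz]] nz show False by simp
  qed
  then have "Poly_Mapping.lookup P (mat 1) = 0"
    by (intro poly_mapping_eqI) simp
  then have "P = 0"
    by (rule central_trunc_zero[OF keys f])
  then have "mulop (rec_fun a i) = mulop (\<lambda>_. 0)"
    unfolding f[symmetric] mulop_hom by (simp add: NP_hom)
  then have "rec_fun a i = (\<lambda>_. 0)" by (simp only: mulop_inject)
  then show ?thesis by simp
qed

text \<open>The truncation has no terms above degree d by growth, the right terms in degree d by its
  symbol, and none below because the element is odd for the half turn.\<close>

lemma central_lift_a:
  assumes j: "j \<le> d"
  shows "central_lift d \<zeta> c (pvar Vx ^ (d - j) * pvar VY ^ j + pvar Vy ^ (d - j) * pvar VX ^ j) = opclass (mulop (a_fun a j))"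
    (is "central_lift d \<zeta> c ?p = _")
proof -
  note fop = fop_a_word(1)[OF j]
  have "fop a (a_word j) \<in> HH" by (rule HH_fop)
  then obtain P where P: "P \<in> pbw_source \<zeta>" "sop a (NP P) = fop a (a_word j)"
    using HH_NP by blast
  then have keys: "Poly_Mapping.keys P \<subseteq> W" and f: "sop a (NP P) = mulop (a_fun a j)"
    by (simp_all add: pbw_source_iff fop)
  have lt: "pdeg_lt P (Suc d)"
  proof (rule central_degree_bound[OF keys f])
    fix M z assume "Suc d \<le> M"
    then show "((\<lambda>\<epsilon>. \<epsilon> ^ M * a_fun a j (sc (inverse \<epsilon>) z)) \<longlongrightarrow> 0) (at 0)"
      using homogeneous_mulop_lim[OF homogeneous_a_word fop, where b = a and N = M and z = z] by simp
  qed
  have top: "symbol_val d (Poly_Mapping.lookup P (mat 1)) z = cu z ^ (d - j) * cr z ^ j + cv z ^ (d - j) * cp z ^ j" for z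
    using tendsto_unique[OF _ central_lead(1)[OF keys lt f] homogeneous_mulop_lim[OF homogeneous_a_word fop, where b = a and N = d and z = z]] j
    by (simp add: cl_a_word)
  have odd: "half_turn * sop a (NP P) = - sop a (NP P) * half_turn"
    unfolding P(2) by (rule twist_hom_minus_oneD[OF twist_hom_a_word])
  define m1 where "m1 = Poly_Mapping.single Vx (d - j) + Poly_Mapping.single VY j"
  define m2 where "m2 = Poly_Mapping.single Vy (d - j) + Poly_Mapping.single VX j"
  have pow: "pvar v ^ n = Poly_Mapping.single (Poly_Mapping.single v n) 1" for v :: vgen and n
    by (induction n) (simp_all add: pvar_def mult_single flip: single_add)
  have p: "?p = Poly_Mapping.single m1 1 + Poly_Mapping.single m2 1"
    by (simp add: pow mult_single m1_def m2_def)
  have deg: "mdeg m1 = d" "mdeg m2 = d"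
    using j by (simp_all add: mdeg_def m1_def m2_def lookup_add lookup_single)
  have "symbol_val d ?p z = cu z ^ (d - j) * cr z ^ j + cv z ^ (d - j) * cp z ^ j" for z
    unfolding p symbol_val_hom
    by (simp add: symbol_val_def deg) (simp add: monval_def m1_def m2_def lookup_add lookup_single)
  then have "symbol_val d (Poly_Mapping.lookup P (mat 1) - ?p) z = 0" for z
    by (simp add: symbol_val_hom top)
  then have 1: "Poly_Mapping.lookup (Poly_Mapping.lookup P (mat 1) - ?p) m = 0" if "mdeg m = d" for m
    using symbol_val_zero_imp that by blast
  have "Poly_Mapping.lookup (Poly_Mapping.lookup P (mat 1) - ?p) m = 0" for m
  proof (cases "mdeg m = d")
    case False
    then have "Poly_Mapping.lookup ?p m = 0"
      using deg by (auto simp: p lookup_add lookup_single when_def)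
    moreover have "Poly_Mapping.lookup (Poly_Mapping.lookup P (mat 1)) m = 0"
    proof (cases "mdeg m < d")
      case True
      then show ?thesis by (rule twist_odd_low_degree[OF keys odd])
    next
      case ge: False
      then have "\<not> mdeg m < Suc d" using False by simp
      then show ?thesis using lt by (auto simp: pdeg_lt_def)
    qed
    ultimately show ?thesis by (simp add: lookup_minus)
  qed (rule 1)
  then have "Poly_Mapping.lookup P (mat 1) - ?p = 0"
    by (intro poly_mapping_eqI) simp
  then have "Poly_Mapping.lookup P (mat 1) = ?p" by simp
  moreover have "sop a (NP P) \<in> ZH"
    unfolding P(2) ZH_def using a_word_commutes[OF j] by (simp add: HH_fop)
  ultimately show ?thesis
    using central_lift_eq[OF P(1)] f by simp
qed

text \<open>The preimage under the PBW map can be written down here. Its reflection terms lie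
  outside the identity component and do not affect the truncation.\<close>

lemma central_lift_eu:
  "central_lift d \<zeta> c (pvar Vx * pvar VX + pvar Vy * pvar VY) = opclass (mulop eu_fun)"
proof -
  define P where "P = Poly_Mapping.single (mat 1) (pvar Vx * pvar VX + pvar Vy * pvar VY)
    + (\<Sum>\<eta>\<in>\<mu>. Poly_Mapping.single (reflm \<eta>) (pconst a))"
  have nz: "reflm \<eta> \<noteq> mat 1" for \<eta>
    by (simp add: mat_1_eq_rotm reflm_neq_rotm)
  have keys: "Poly_Mapping.keys P \<subseteq> W"
    unfolding pbw_source_iff[symmetric] P_def
  proof (rule pbw_source_add)
    show "Poly_Mapping.single (mat 1) (pvar Vx * pvar VX + pvar Vy * pvar VY) \<in> pbw_source \<zeta>"
      by (simp add: pbw_source_iff W_one)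
    have "sum f A \<in> pbw_source \<zeta>" if "\<And>\<eta>. \<eta> \<in> A \<Longrightarrow> f \<eta> \<in> pbw_source \<zeta>" for f and A :: "complex set"
      using that by (induction A rule: infinite_finite_induct) (simp_all add: pbw_source_zero pbw_source_add)
    then show "(\<Sum>\<eta>\<in>\<mu>. Poly_Mapping.single (reflm \<eta>) (pconst a)) \<in> pbw_source \<zeta>"
      by (simp add: pbw_source_iff W_refl)
  qed
  have trunc: "Poly_Mapping.lookup P (mat 1) = pvar Vx * pvar VX + pvar Vy * pvar VY"
    by (simp add: P_def lookup_add lookup_sum lookup_single nz)
  have no: "normal_order (pvar Vx * pvar VX) = fvar Vx * fvar VX" "normal_order (pvar Vy * pvar VY) = fvar Vy * fvar VY"
    "normal_order (pconst a) = pconst a"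
    by (simp_all add: pvar_def pconst_def mult_single normal_order_hom nmon_def lookup_add lookup_single)
  have NPs: "NP (sum f A) = (\<Sum>i\<in>A. NP (f i))" for f and A :: "complex set"
    by (induction A rule: infinite_finite_induct) (simp_all add: NP_hom)
  have "sop a (NP P) = genop a Vx * genop a VX + genop a Vy * genop a VY + scal a * (\<Sum>\<eta>\<in>\<mu>. compop (refl_pt \<eta>))"
    by (simp add: P_def NP_hom NPs sop_add sop_sum normal_order_hom no fop_hom trop_refl sum_distrib_left del: genop.simps)
  also have "\<dots> = genop a Vx * genop a VX + genop a VY * genop a Vy"
    using genop_mixed(2)[of a] by (simp add: algebra_simps del: genop.simps)
  also have "\<dots> = mulop eu_fun"
    using fop_eu_word[of a] by (simp add: eu_word_def fop_hom del: genop.simps)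
  finally have L: "sop a (NP P) = mulop eu_fun" .
  have "mulop eu_fun \<in> ZH"
    using HH_fop[of eu_word] by (intro mulop_in_ZH inv_fun_eu_fun) (simp add: fop_eu_word)
  then show ?thesis
    using central_lift_eq[of P] keys trunc L by (simp add: pbw_source_iff)
qed

end

section \<open>The quadratic relations\<close>

definition mon_ev :: "('v \<Rightarrow> complex) \<Rightarrow> ('v \<Rightarrow>\<^sub>0 nat) \<Rightarrow> complex" where
  "mon_ev f m = (\<Prod>v\<in>Poly_Mapping.keys m. f v ^ Poly_Mapping.lookup m v)"

definition ev :: "('v \<Rightarrow> complex) \<Rightarrow> 'v mpoly \<Rightarrow> complex" where
  "ev f = pext (\<lambda>m c. c * mon_ev f m)"

lemma mon_ev_superset:
  "finite A \<Longrightarrow> Poly_Mapping.keys m \<subseteq> A \<Longrightarrow> mon_ev f m = (\<Prod>v\<in>A. f v ^ Poly_Mapping.lookup m v)"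
  unfolding mon_ev_def by (intro prod.mono_neutral_left) (auto simp: in_keys_iff)

lemma mon_ev_add: "mon_ev f (m + n) = mon_ev f m * mon_ev f n"
proof -
  let ?A = "Poly_Mapping.keys m \<union> Poly_Mapping.keys n"
  have "mon_ev f (m + n) = (\<Prod>v\<in>?A. f v ^ Poly_Mapping.lookup (m + n) v)"
    by (intro mon_ev_superset keys_add) simp
  also have "\<dots> = mon_ev f m * mon_ev f n"
    by (simp add: mon_ev_superset[of ?A m] mon_ev_superset[of ?A n] lookup_add power_add prod.distrib)
  finally show ?thesis .
qed

lemma mon_ev_single [simp]: "mon_ev f (Poly_Mapping.single v n) = f v ^ n"
  by (simp add: mon_ev_def)

lemma mon_ev_zero [simp]: "mon_ev f 0 = 1"
  by (simp add: mon_ev_def)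

lemma ev_hom:
  "ev f 0 = 0" "ev f (p + q) = ev f p + ev f q" "ev f (p - q) = ev f p - ev f q" "ev f (p * q) = ev f p * ev f q"
  "ev f (pconst z) = z" "ev f (pvar v) = f v" "ev f 1 = 1" "ev f (Poly_Mapping.single m z) = z * mon_ev f m"
proof -
  show "ev f (p * q) = ev f p * ev f q"
    unfolding ev_def by (rule pext_mult) (simp_all add: mon_ev_add algebra_simps)
  show pc: "ev f (pconst z) = z" for z
    by (simp add: ev_def pconst_def)
  show "ev f 1 = 1"
    using pc[of 1] by simp
qed (simp_all add: ev_def pext_add pext_diff algebra_simps pvar_def)

lemma ev_power: "ev f (p ^ n) = ev f p ^ n"
  by (induction n) (simp_all add: ev_hom)

lemma ev_numeral: "ev f (numeral n) = numeral n"
  unfolding pconst_numeral[symmetric] by (rule ev_hom)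

lemma ev_sum: "ev f (sum p A) = (\<Sum>i\<in>A. ev f (p i))"
  by (induction A rule: infinite_finite_induct) (simp_all add: ev_hom)

lemma ev_Psi: "ev f (Psi n p q r) = Psi n (ev f p) (ev f q) (ev f r)"
  by (induction n p q r rule: Psi.induct) (simp_all add: ev_hom)

abbreviation mcarrier :: "'v set \<Rightarrow> 'v mpoly set" where
  "mcarrier V \<equiv> carrier (mpoly_ring V)"

lemma mpoly_ring_simps [simp]:
  "mult (mpoly_ring V) = (*)" "add (mpoly_ring V) = (+)" "\<zero>\<^bsub>mpoly_ring V\<^esub> = 0" "\<one>\<^bsub>mpoly_ring V\<^esub> = 1"
  by (simp_all add: mpoly_ring_def)

lemma mcarrier_iff: "p \<in> mcarrier V \<longleftrightarrow> Poly_Mapping.keys p \<subseteq> {m. Poly_Mapping.keys m \<subseteq> V}"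
  by (auto simp: mpoly_ring_def)

lemma mcarrier_add: "p \<in> mcarrier V \<Longrightarrow> q \<in> mcarrier V \<Longrightarrow> p + q \<in> mcarrier V"
  using keys_add[of p q] by (auto simp: mcarrier_iff)

lemma mcarrier_diff: "p \<in> mcarrier V \<Longrightarrow> q \<in> mcarrier V \<Longrightarrow> p - q \<in> mcarrier V"
  using keys_diff[of p q] by (auto simp: mcarrier_iff)

lemma mcarrier_zero: "0 \<in> mcarrier V"
  by (simp add: mcarrier_iff)

lemma mcarrier_pconst: "pconst z \<in> mcarrier V"
  by (auto simp: mcarrier_iff pconst_def)

lemma mcarrier_one: "1 \<in> mcarrier V"
  using mcarrier_pconst[of 1] by simp

lemma mcarrier_pvar: "v \<in> V \<Longrightarrow> pvar v \<in> mcarrier V"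
  by (auto simp: mcarrier_iff pvar_def)

lemma mcarrier_mult:
  assumes "p \<in> mcarrier V" "q \<in> mcarrier V"
  shows "p * q \<in> mcarrier V"
  unfolding mcarrier_iff
proof
  fix m assume "m \<in> Poly_Mapping.keys (p * q)"
  then obtain k l where kl: "m = k + l" "k \<in> Poly_Mapping.keys p" "l \<in> Poly_Mapping.keys q"
    using keys_mult[of p q] by auto
  then show "m \<in> {m. Poly_Mapping.keys m \<subseteq> V}"
    using assms keys_add[of k l] unfolding mcarrier_iff by blast
qed

lemma mcarrier_power: "p \<in> mcarrier V \<Longrightarrow> p ^ n \<in> mcarrier V"
  by (induction n) (auto simp: mcarrier_one mcarrier_mult)

lemma mcarrier_sum: "(\<And>i. i \<in> A \<Longrightarrow> p i \<in> mcarrier V) \<Longrightarrow> sum p A \<in> mcarrier V"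
  by (induction A rule: infinite_finite_induct) (auto simp: mcarrier_zero mcarrier_add)

lemma mcarrier_numeral: "numeral n \<in> mcarrier V"
  unfolding pconst_numeral[symmetric] by (rule mcarrier_pconst)

lemma mcarrier_Psi: "p \<in> mcarrier V \<Longrightarrow> q \<in> mcarrier V \<Longrightarrow> r \<in> mcarrier V \<Longrightarrow> Psi n p q r \<in> mcarrier V"
  by (induction n p q r rule: Psi.induct) (simp_all add: mcarrier_one mcarrier_mult mcarrier_diff)

lemmas mcarrier_intros = mcarrier_add mcarrier_diff mcarrier_zero mcarrier_pconst mcarrier_one mcarrier_pvar
  mcarrier_mult mcarrier_power mcarrier_sum mcarrier_numeral mcarrier_Psi

lemma single_mon_eq_prod:
  "Poly_Mapping.single m (1::complex) = (\<Prod>v\<in>Poly_Mapping.keys m. pvar v ^ Poly_Mapping.lookup m v)"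
proof -
  have pw: "pvar v ^ n = Poly_Mapping.single (Poly_Mapping.single v n) (1::complex)" for v :: 'a and n
    by (induction n) (simp_all add: pvar_def mult_single flip: single_add)
  have "(\<Prod>v\<in>A. Poly_Mapping.single (Poly_Mapping.single v (Poly_Mapping.lookup m v)) (1::complex))
      = Poly_Mapping.single (\<Sum>v\<in>A. Poly_Mapping.single v (Poly_Mapping.lookup m v)) 1" for A
    by (induction A rule: infinite_finite_induct) (simp_all add: mult_single)
  then show ?thesis
    using poly_mapping_sum_single[of m] by (simp add: pw)
qed

lemma mpoly_induct [consumes 1, case_names const add mult_var]:
  assumes "p \<in> mcarrier V"
    and const: "\<And>z. P (pconst z)"
    and add: "\<And>p q. P p \<Longrightarrow> P q \<Longrightarrow> P (p + q)"
    and var: "\<And>p v. P p \<Longrightarrow> v \<in> V \<Longrightarrow> P (pvar v * p)"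
  shows "P p"
proof -
  have pow: "P (pvar v ^ n * p)" if "v \<in> V" "P p" for v n p
    using that by (induction n) (auto simp: mult.assoc var)
  have prod: "A \<subseteq> V \<Longrightarrow> P ((\<Prod>v\<in>A. pvar v ^ e v) * pconst z)" if "finite A" for A e z
    using that by (induction A rule: finite_induct) (auto simp: const mult.assoc intro: pow)
  show ?thesis
    using assms(1)[unfolded mcarrier_iff]
  proof (induction p rule: poly_mapping_induct_keys)
    case zero
    show ?case using const[of 0] by simp
  next
    case (single m z)
    have "Poly_Mapping.single m z = Poly_Mapping.single m 1 * pconst z"
      by (simp add: pconst_def mult_single)
    then show ?case
      using prod[of "Poly_Mapping.keys m" "Poly_Mapping.lookup m" z] single by (simp add: single_mon_eq_prod)
  qed (rule add)
qed

lemma ring_mpoly: "ring (mpoly_ring V)"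
proof (rule ringI)
  show "abelian_group (mpoly_ring V)"
  proof (rule abelian_groupI)
    fix p assume p: "p \<in> mcarrier V"
    show "\<exists>q\<in>mcarrier V. q \<oplus>\<^bsub>mpoly_ring V\<^esub> p = \<zero>\<^bsub>mpoly_ring V\<^esub>"
      using mcarrier_diff[OF mcarrier_zero p] by (intro bexI[of _ "- p"]) simp_all
  qed (simp_all add: mcarrier_add mcarrier_zero add.assoc add.commute)
  show "monoid (mpoly_ring V)"
    by (rule monoidI) (simp_all add: mcarrier_mult mcarrier_one mult.assoc)
qed (simp_all add: distrib_left distrib_right)

lemma mpoly_idealI:
  assumes sub: "I \<subseteq> mcarrier V" and zero: "0 \<in> I"
    and add: "\<And>p q. p \<in> I \<Longrightarrow> q \<in> I \<Longrightarrow> p + q \<in> I"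
    and mult: "\<And>p q. p \<in> I \<Longrightarrow> q \<in> mcarrier V \<Longrightarrow> q * p \<in> I"
  shows "ideal I (mpoly_ring V)"
proof (rule idealI[OF ring_mpoly])
  have grp: "group (add_monoid (mpoly_ring V))"
    using abelian_group.a_group[OF ring.is_abelian_group[OF ring_mpoly]] .
  show "subgroup I (add_monoid (mpoly_ring V))"
  proof (rule group.subgroupI[OF grp])
    fix p assume p: "p \<in> I"
    have "pconst (-1) * p \<in> I"
      by (rule mult[OF p mcarrier_pconst])
    then have "- p \<in> I" by (simp add: pconst_uminus)
    moreover have "inv\<^bsub>add_monoid (mpoly_ring V)\<^esub> p = - p"
      using p sub \<open>- p \<in> I\<close> by (intro group.inv_equality[OF grp]) auto
    ultimately show "inv\<^bsub>add_monoid (mpoly_ring V)\<^esub> p \<in> I" by simp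
  qed (use sub zero add in auto)
next
  fix p q assume pq: "p \<in> I" "q \<in> mcarrier V"
  then have "q * p \<in> I" by (rule mult)
  then show "q \<otimes>\<^bsub>mpoly_ring V\<^esub> p \<in> I" "p \<otimes>\<^bsub>mpoly_ring V\<^esub> q \<in> I"
    by (simp_all add: mult.commute)
qed

text \<open>At a generic point q is nonzero and may be cancelled. By the linear relations, q times
  the difference with both indices raised is Q times the old one. With only the upper index moving,
  the differences satisfy the three-term recurrence of \<Psi>, up to powers of q.\<close>

lemma quadratic_from_recurrence:
  fixes A :: "nat \<Rightarrow> complex"
  assumes q: "q \<noteq> 0"
    and rec: "\<And>i. 1 \<le> i \<Longrightarrow> i < d \<Longrightarrow> e * A i = q * A (Suc i) + Q * A (i - 1)"
    and base: "A 0 * A 2 - A 1 ^ 2 = K * q ^ (d - 2)"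
    and d: "2 \<le> d" and ij: "1 \<le> i" "i \<le> j" "j \<le> d - 1"
  shows "A (i - 1) * A (j + 1) - A i * A j = K * q ^ (d - j - 1) * Q ^ (i - 1) * Psi (j - i) e q Q"
proof -
  have diag: "A i * A (i + 2) - A (Suc i) * A (Suc i) = K * q ^ (d - i - 2) * Q ^ i" if "i + 2 \<le> d" for i
    using that
  proof (induction i)
    case 0
    then show ?case using base by (simp add: power2_eq_square numeral_2_eq_2)
  next
    case (Suc i)
    have r: "q * A (Suc (Suc (Suc i))) = e * A (Suc (Suc i)) - Q * A (Suc i)" "q * A (Suc (Suc i)) = e * A (Suc i) - Q * A i"
      using rec[of "Suc (Suc i)"] rec[of "Suc i"] Suc.prems by simp_all
    have "q * (A (Suc i) * A (Suc i + 2) - A (Suc (Suc i)) * A (Suc (Suc i)))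
        = A (Suc i) * (q * A (Suc (Suc (Suc i)))) - A (Suc (Suc i)) * (q * A (Suc (Suc i)))"
      by (simp add: algebra_simps)
    also have "\<dots> = Q * (A i * A (i + 2) - A (Suc i) * A (Suc i))"
      unfolding r by (simp add: algebra_simps)
    also have "\<dots> = Q * (K * (q * q ^ (d - Suc i - 2)) * Q ^ i)"
      using Suc by (simp add: Suc_diff_Suc flip: power_Suc)
    also have "\<dots> = q * (K * q ^ (d - Suc i - 2) * Q ^ Suc i)"
      by (simp add: algebra_simps)
    finally show ?case
      by (simp only: mult_left_cancel[OF q])
  qed
  have gen: "A k * A (k + n + 2) - A (Suc k) * A (Suc k + n) = K * q ^ (d - (k + n) - 2) * Q ^ k * Psi n e q Q"
    if "k + n + 2 \<le> d" for k n
    using that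
  proof (induction n rule: induct_nat_012)
    case 0
    then show ?case using diag[of k] by simp
  next
    case 1
    have r: "q * A (Suc (Suc (Suc k))) = e * A (Suc (Suc k)) - Q * A (Suc k)" "q * A (Suc (Suc k)) = e * A (Suc k) - Q * A k"
      using rec[of "Suc (Suc k)"] rec[of "Suc k"] 1 by simp_all
    have "q * (A k * A (k + Suc 0 + 2) - A (Suc k) * A (Suc k + Suc 0)) = A k * (q * A (Suc (Suc (Suc k)))) - A (Suc k) * (q * A (Suc (Suc k)))"
      by (simp add: algebra_simps)
    also have "\<dots> = e * (A k * A (k + 2) - A (Suc k) * A (Suc k))"
      unfolding r by (simp add: algebra_simps)
    also have "\<dots> = e * (K * (q * q ^ (d - (k + Suc 0) - 2)) * Q ^ k)"
      using 1 diag[of k] by (simp add: Suc_diff_Suc flip: power_Suc)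
    also have "\<dots> = q * (K * q ^ (d - (k + Suc 0) - 2) * Q ^ k * Psi (Suc 0) e q Q)"
      by (simp add: algebra_simps)
    finally show ?case
      by (simp only: mult_left_cancel[OF q])
  next
    case (ge2 n)
    let ?D = "\<lambda>n. A k * A (k + n + 2) - A (Suc k) * A (Suc k + n)"
    have r: "q * A (k + Suc (Suc n) + 2) = e * A (k + Suc n + 2) - Q * A (k + n + 2)"
      "q * A (Suc k + Suc (Suc n)) = e * A (Suc k + Suc n) - Q * A (Suc k + n)"
      using rec[of "k + Suc n + 2"] rec[of "Suc k + Suc n"] ge2.prems by simp_all
    have "q * ?D (Suc (Suc n)) = A k * (q * A (k + Suc (Suc n) + 2)) - A (Suc k) * (q * A (Suc k + Suc (Suc n)))"
      by (simp add: algebra_simps)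
    also have "\<dots> = e * ?D (Suc n) - Q * ?D n"
      unfolding r by (simp add: algebra_simps)
    also have "?D (Suc n) = K * (q * q ^ (d - (k + Suc (Suc n)) - 2)) * Q ^ k * Psi (Suc n) e q Q"
      using ge2 by (simp add: Suc_diff_Suc flip: power_Suc)
    also have "?D n = K * (q * (q * q ^ (d - (k + Suc (Suc n)) - 2))) * Q ^ k * Psi n e q Q"
    proof -
      have "d - (k + n) - 2 = Suc (Suc (d - (k + Suc (Suc n)) - 2))"
        using ge2.prems by simp
      then show ?thesis using ge2 by simp
    qed
    finally have "q * ?D (Suc (Suc n)) = q * (K * q ^ (d - (k + Suc (Suc n)) - 2) * Q ^ k * Psi (Suc (Suc n)) e q Q)"
      by (simp add: algebra_simps)
    then show ?case
      by (simp only: mult_left_cancel[OF q])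
  qed
  obtain k n where "i = Suc k" "j = Suc k + n"
    using ij by (metis One_nat_def Suc_le_D le_Suc_ex)
  then show ?thesis
    using gen[of k n] ij d by (simp add: algebra_simps)
qed

text \<open>Here \<open>U\<close>, \<open>V\<close> and \<open>X\<close> stand for u^(d-1), v^(d-1)
  and (uv)^(d-2), \<open>S\<close> for the correction of Q and \<open>c\<close> for d^2 a^2. Once
  the linear relation eliminates a_2, the only further input is the closed form of
  \<open>S\<close>.\<close>

lemma recurrence_base_identity:
  fixes u v p r U V c :: complex
  assumes S: "S * (u * U - v * V) ^ 2 = c * (U * V)" and q: "u * v \<noteq> 0"
    and A2: "u * v * A2 = (u * p + v * r) * (U * r + V * p) - (p * r + S) * (u * U + v * V)"
    and X: "u * v * X = U * V"
  shows "(u * U + v * V) * A2 - (U * r + V * p) ^ 2 = ((u * p + v * r) ^ 2 - 4 * (u * v) * (p * r + S) - c) * X"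
proof -
  have "(u * v) * ((u * U + v * V) * A2 - (U * r + V * p) ^ 2)
      = (u * U + v * V) * (u * v * A2) - u * v * (U * r + V * p) ^ 2"
    by (simp add: algebra_simps)
  also have "\<dots> = ((u * p + v * r) ^ 2 - 4 * (u * v) * (p * r + S)) * (U * V) - S * (u * U - v * V) ^ 2"
    unfolding A2 by (simp add: algebra_simps power2_eq_square)
  also have "\<dots> = (u * v) * (((u * p + v * r) ^ 2 - 4 * (u * v) * (p * r + S) - c) * X)"
    unfolding S by (simp add: algebra_simps flip: X)
  finally show ?thesis
    by (simp only: mult_left_cancel[OF q])
qed

context dihedral_root
begin

text \<open>Dividing u^d - v^d by the root at \<eta> gives a geometric sum in v/\<eta>. In the sum
  over \<eta> of its squares divided by \<eta>, orthogonality keeps the pairs with k + l = d - 1.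
  There are d of them, each counted d times, hence the square of d.\<close>

lemma sum_al_squares:
  "(\<Sum>\<eta>\<in>\<mu>. inverse \<eta> / al \<eta> z ^ 2) * (cu z ^ d - cv z ^ d) ^ 2 = of_nat d ^ 2 * (cu z ^ (d - 1) * cv z ^ (d - 1))"
proof -
  let ?u = "cu z" and ?v = "cv z" and ?D = "cu z ^ d - cv z ^ d"
  have "inverse \<eta> / al \<eta> z ^ 2 * ?D ^ 2 = (\<Sum>k<d. \<Sum>l<d. ?u ^ (d - Suc k) * ?v ^ k * (?u ^ (d - Suc l) * ?v ^ l) * inverse \<eta> ^ (k + l + 1))"
    if \<eta>: "\<eta> \<in> \<mu>" for \<eta>
  proof -
    have "?D = ?u ^ d - (?v / \<eta>) ^ d"
      using mu_pow[OF \<eta>] by (simp add: power_divide)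
    also have "\<dots> = al \<eta> z * (\<Sum>k<d. ?u ^ (d - Suc k) * (?v / \<eta>) ^ k)"
    proof -
      define T where "T = (\<Sum>k<d. ?u ^ (d - Suc k) * (?v / \<eta>) ^ k)"
      have "(?v / \<eta>) ^ d - ?u ^ d = (?v / \<eta> - ?u) * T"
        unfolding T_def by (rule power_diff_sumr2)
      then show ?thesis
        unfolding T_def[symmetric] al_def by (simp add: algebra_simps)
    qed
    finally have "?D / al \<eta> z = (\<Sum>k<d. ?u ^ (d - Suc k) * (?v ^ k * inverse \<eta> ^ k))"
      using al_nonzero[OF \<eta>, of z] by (simp add: field_simps power_mult_distrib)
    then have "inverse \<eta> * (?D / al \<eta> z) ^ 2 = inverse \<eta> * (\<Sum>k<d. \<Sum>l<d. ?u ^ (d - Suc k) * (?v ^ k * inverse \<eta> ^ k) * (?u ^ (d - Suc l) * (?v ^ l * inverse \<eta> ^ l)))"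
      by (simp only: power2_eq_square sum_product)
    then show ?thesis
      by (simp add: sum_distrib_left power_add power_divide mult_ac)
  qed
  then have "(\<Sum>\<eta>\<in>\<mu>. inverse \<eta> / al \<eta> z ^ 2) * ?D ^ 2
      = (\<Sum>\<eta>\<in>\<mu>. \<Sum>k<d. \<Sum>l<d. ?u ^ (d - Suc k) * ?v ^ k * (?u ^ (d - Suc l) * ?v ^ l) * inverse \<eta> ^ (k + l + 1))"
    unfolding sum_distrib_right by (intro sum.cong refl)
  also have "\<dots> = (\<Sum>k<d. \<Sum>l<d. \<Sum>\<eta>\<in>\<mu>. ?u ^ (d - Suc k) * ?v ^ k * (?u ^ (d - Suc l) * ?v ^ l) * inverse \<eta> ^ (k + l + 1))"
    by (subst sum.swap, intro sum.cong refl, rule sum.swap)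
  also have "\<dots> = (\<Sum>k<d. \<Sum>l<d. if l = d - Suc k then of_nat d * (?u ^ (d - 1) * ?v ^ (d - 1)) else 0)"
  proof (intro sum.cong refl)
    fix k l assume kl: "k \<in> {..<d}" "l \<in> {..<d}"
    \<comment> \<open>The number lies strictly between 0 and 2 d, so the only multiple of d it can
      be is d.\<close>
    have dvd: "d dvd k + l + 1 \<longleftrightarrow> l = d - Suc k"
    proof
      assume "d dvd k + l + 1"
      then obtain m where m: "k + l + 1 = d * m" by blast
      have "m = 1"
      proof (rule ccontr)
        assume "m \<noteq> 1"
        then consider "m = 0" | "2 \<le> m" by linarith
        then show False
        proof cases
          case 2
          then have "d * 2 \<le> k + l + 1"
            unfolding m by (rule mult_le_mono2)
          then show False using kl by simp
        qed (use m in simp)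
      qed
      then show "l = d - Suc k" using m by simp
    qed (use kl in simp)
    have "(\<Sum>\<eta>\<in>\<mu>. inverse \<eta> ^ (k + l + 1)) = (if l = d - Suc k then of_nat d else 0)"
      using sum_mu_inverse[of "\<lambda>\<eta>. \<eta> ^ (k + l + 1)"] sum_mu_power[of "k + l + 1"] dvd by simp
    moreover have "?u ^ (d - Suc k) * ?v ^ k * (?u ^ (d - Suc l) * ?v ^ l) = ?u ^ (d - 1) * ?v ^ (d - 1)" if "l = d - Suc k"
    proof -
      have "?u ^ (d - Suc k) * ?u ^ (d - Suc l) = ?u ^ (d - 1)" "?v ^ k * ?v ^ l = ?v ^ (d - 1)"
        using that kl by (simp_all flip: power_add)
      then show ?thesis by (metis mult.assoc mult.left_commute)
    qed
    ultimately show "(\<Sum>\<eta>\<in>\<mu>. ?u ^ (d - Suc k) * ?v ^ k * (?u ^ (d - Suc l) * ?v ^ l) * inverse \<eta> ^ (k + l + 1))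
        = (if l = d - Suc k then of_nat d * (?u ^ (d - 1) * ?v ^ (d - 1)) else 0)"
      by (simp add: sum_distrib_left[symmetric])
  qed
  also have "\<dots> = of_nat d ^ 2 * (?u ^ (d - 1) * ?v ^ (d - 1))"
    by (simp add: power2_eq_square d_pos)
  finally show ?thesis .
qed

fun gen_fun :: "complex \<Rightarrow> pt \<Rightarrow> zgen \<Rightarrow> complex" where
  "gen_fun b z Gq = cu z * cv z" | "gen_fun b z GQ = Q_fun b z" | "gen_fun b z Geu = eu_fun z" | "gen_fun b z (Ga j) = a_fun b j z"

lemma gen_fun_fop: "v \<in> zgens d \<Longrightarrow> \<exists>f. fop b f = mulop (\<lambda>z. gen_fun b z v)"
proof (cases v)
  case Gq
  then show ?thesis
    by (intro exI[of _ "fvar Vx * fvar Vy"]) (simp add: fop_xy)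
next
  case GQ
  have "mulop (\<lambda>z. Q_fun b z) = mulop (Q_fun b)" ..
  with GQ show ?thesis
    by (intro exI[of _ "fvar VX * fvar VY"]) (simp add: fop_XY)
next
  case Geu
  then show ?thesis
    by (intro exI[of _ eu_word]) (simp add: fop_eu_word)
next
  case (Ga j)
  moreover assume "v \<in> zgens d"
  ultimately show ?thesis
    by (intro exI[of _ "a_word j"]) (auto simp: fop_a_word zgens_def)
qed

lemma gen_fun_inv: "v \<in> zgens d \<Longrightarrow> inv_fun (\<lambda>z. gen_fun b z v)"
  using inv_fun_uv inv_fun_Q_fun inv_fun_eu_fun fop_a_word by (cases v) (auto simp: zgens_def)

lemma inv_fun_ev: "p \<in> mcarrier (zgens d) \<Longrightarrow> inv_fun (\<lambda>z. ev (gen_fun b z) p)"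
proof (induction p rule: mpoly_induct)
  case (mult_var p v)
  then show ?case using gen_fun_inv[of v b] by (simp add: inv_fun_def ev_hom)
qed (simp_all add: inv_fun_def ev_hom)

lemma center_rels_carrier: "center_rels d a \<subseteq> mcarrier (zgens d)"
  unfolding center_rels_def using d_ge_2
  by (auto intro!: mcarrier_intros simp: zgens_def)

end

section \<open>The relations in the center and the map from the polynomial ring\<close>

context cherednik_param
begin

lemma recurrence:
  assumes "1 \<le> i" "i < d"
  shows "eu_fun z * a_fun a i z = cu z * cv z * a_fun a (Suc i) z + Q_fun a z * a_fun a (i - 1) z"
  using recurrence_vanishes[OF assms, of z] by (simp add: rec_fun_def algebra_simps)

lemma quadratic_base:
  "a_fun a 0 z * a_fun a 2 z - a_fun a 1 z ^ 2
    = (eu_fun z ^ 2 - 4 * (cu z * cv z) * Q_fun a z - of_nat d ^ 2 * a ^ 2) * (cu z * cv z) ^ (d - 2)"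
proof -
  let ?S = "a ^ 2 * (\<Sum>\<eta>\<in>\<mu>. inverse \<eta> / al \<eta> z ^ 2)"
  let ?U = "cu z ^ (d - 1)" and ?V = "cv z ^ (d - 1)"
  have pw: "x ^ d = x * x ^ (d - 1)" for x :: complex
    using d_pos by (simp flip: power_Suc)
  have Q: "Q_fun a z = cp z * cr z + ?S" by (simp add: Q_fun_def)
  have S: "?S * (cu z * ?U - cv z * ?V) ^ 2 = of_nat d ^ 2 * a ^ 2 * (?U * ?V)"
    using sum_al_squares[of z] by (simp add: pw mult.assoc)
  have a0: "a_fun a 0 z = cu z * ?U + cv z * ?V"
    by (simp add: a_fun_0 pw)
  have a1: "a_fun a 1 z = ?U * cr z + ?V * cp z" by (rule a_fun_1)
  have "cu z * cv z * a_fun a 2 z = eu_fun z * a_fun a 1 z - Q_fun a z * a_fun a 0 z"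
    using recurrence[of 1 z] d_ge_2 by (simp add: numeral_2_eq_2)
  then have A2: "cu z * cv z * a_fun a 2 z = (cu z * cp z + cv z * cr z) * (?U * cr z + ?V * cp z) - (cp z * cr z + ?S) * (cu z * ?U + cv z * ?V)"
    by (simp only: a0 a1 Q eu_fun_def)
  have "d - 1 = Suc (d - 2)" using d_ge_2 by simp
  then have X: "cu z * cv z * (cu z * cv z) ^ (d - 2) = ?U * ?V"
    by (simp add: power_mult_distrib)
  show ?thesis
    unfolding a0 a1 Q eu_fun_def by (rule recurrence_base_identity[OF S _ A2 X]) simp
qed

lemma quadratic_relation:
  assumes "1 \<le> i" "i \<le> j" "j \<le> d - 1"
  shows "a_fun a (i - 1) z * a_fun a (j + 1) z - a_fun a i z * a_fun a j z
    = (eu_fun z ^ 2 - 4 * (cu z * cv z) * Q_fun a z - of_nat d ^ 2 * a ^ 2) * (cu z * cv z) ^ (d - j - 1) * Q_fun a z ^ (i - 1)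
      * Psi (j - i) (eu_fun z) (cu z * cv z) (Q_fun a z)"
  by (rule quadratic_from_recurrence[OF _ recurrence quadratic_base d_ge_2 assms]) simp_all

lemma center_rels_vanish:
  assumes "p \<in> center_rels d a"
  shows "ev (gen_fun a z) p = 0"
  using assms unfolding center_rels_def
proof (elim UnE CollectE exE conjE)
  fix i assume "p = pvar Geu * pvar (Ga i) - (pvar Gq * pvar (Ga (i + 1)) + pvar GQ * pvar (Ga (i - 1)))" "1 \<le> i" "i \<le> d - 1"
  then show ?thesis
    using recurrence[of i z] d_ge_2 by (simp add: ev_hom)
next
  fix i j
  assume p: "p = pvar (Ga (i - 1)) * pvar (Ga (j + 1)) - pvar (Ga i) * pvar (Ga j)
      - (pvar Geu ^ 2 - 4 * pvar Gq * pvar GQ - pconst (of_nat d ^ 2 * a ^ 2))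
        * pvar Gq ^ (d - j - 1) * pvar GQ ^ (i - 1) * Psi (j - i) (pvar Geu) (pvar Gq) (pvar GQ)"
    and ij: "1 \<le> i" "i \<le> j" "j \<le> d - 1"
  show ?thesis
    unfolding p ev_hom ev_power ev_numeral ev_Psi gen_fun.simps using quadratic_relation[OF ij, of z]
    by (simp add: mult.assoc)
qed

definition rel_ideal :: "zgen mpoly set" where
  "rel_ideal = Idl\<^bsub>mpoly_ring (zgens d)\<^esub> (center_rels d a)"

lemma ideal_rel_ideal: "ideal rel_ideal (mpoly_ring (zgens d))"
  unfolding rel_ideal_def by (rule ring.genideal_ideal[OF ring_mpoly center_rels_carrier])

lemma rel_ideal_vanish: "p \<in> rel_ideal \<Longrightarrow> p \<in> mcarrier (zgens d) \<and> (\<forall>z. ev (gen_fun a z) p = 0)"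
proof -
  let ?I = "{p \<in> mcarrier (zgens d). \<forall>z. ev (gen_fun a z) p = 0}"
  have "ideal ?I (mpoly_ring (zgens d))"
    by (rule mpoly_idealI) (auto intro!: mcarrier_intros simp: ev_hom)
  moreover have "center_rels d a \<subseteq> ?I"
    using center_rels_carrier center_rels_vanish by blast
  ultimately have "rel_ideal \<subseteq> ?I"
    unfolding rel_ideal_def by (rule ring.genideal_minimal[OF ring_mpoly])
  then show "p \<in> rel_ideal \<Longrightarrow> p \<in> mcarrier (zgens d) \<and> (\<forall>z. ev (gen_fun a z) p = 0)"
    by blast
qed

definition center_map :: "zgen mpoly \<Rightarrow> smash_elt set" where
  "center_map p = opclass (mulop (\<lambda>z. ev (gen_fun a z) p))"

lemma ev_in_ZH:
  assumes "p \<in> mcarrier (zgens d)"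
  shows "mulop (\<lambda>z. ev (gen_fun a z) p) \<in> ZH"
proof (rule mulop_in_ZH[OF _ inv_fun_ev[OF assms]])
  show "mulop (\<lambda>z. ev (gen_fun a z) p) \<in> HH"
    using assms
  proof (induction p rule: mpoly_induct)
    case (const z)
    have "scal z = fop a (pconst z)"
      by (simp add: fop_hom)
    then show ?case using HH_fop[of "pconst z"] by (simp add: ev_hom)
  next
    case (add p q)
    then show ?case by (simp add: ev_hom mulop_hom(1) HH_add)
  next
    case (mult_var p v)
    obtain f where "fop a f = mulop (\<lambda>z. gen_fun a z v)"
      using gen_fun_fop[OF mult_var(2)] by blast
    then have "mulop (\<lambda>z. gen_fun a z v) \<in> HH"
      using HH_fop[of f] by simp
    then show ?case
      using mult_var(1) by (simp add: ev_hom mulop_hom(2) HH_mult)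
  qed
qed

lemma ZH_HH: "L \<in> ZH \<Longrightarrow> L \<in> HH"
  by (simp add: ZH_def)

lemma center_map_hom: "center_map \<in> ring_hom (mpoly_ring (zgens d)) (cherednik_center d \<zeta> c)"
proof (rule ring_hom_memI)
  let ?C = "cherednik_center d \<zeta> c"
  have ops: "mult ?C = mult (cherednik d \<zeta> c)" "add ?C = add (cherednik d \<zeta> c)" "one ?C = one (cherednik d \<zeta> c)"
    by (simp_all add: cherednik_center_def ring_center_def)
  fix p q assume p: "p \<in> mcarrier (zgens d)" and q: "q \<in> mcarrier (zgens d)"
  note H = ZH_HH[OF ev_in_ZH[OF p]] ZH_HH[OF ev_in_ZH[OF q]]
  show "center_map (p \<otimes>\<^bsub>mpoly_ring (zgens d)\<^esub> q) = center_map p \<otimes>\<^bsub>?C\<^esub> center_map q"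
    unfolding ops center_map_def cherednik_ops(1)[OF H] by (simp add: ev_hom mulop_hom(2))
  show "center_map (p \<oplus>\<^bsub>mpoly_ring (zgens d)\<^esub> q) = center_map p \<oplus>\<^bsub>?C\<^esub> center_map q"
    unfolding ops center_map_def cherednik_ops(2)[OF H] by (simp add: ev_hom mulop_hom(1))
next
  fix p assume "p \<in> mcarrier (zgens d)"
  then show "center_map p \<in> carrier (cherednik_center d \<zeta> c)"
    using ev_in_ZH by (simp add: center_map_def carrier_center)
next
  show "center_map \<one>\<^bsub>mpoly_ring (zgens d)\<^esub> = \<one>\<^bsub>cherednik_center d \<zeta> c\<^esub>"
    using cherednik_one_zero(1) by (simp add: center_map_def ev_hom mulop_hom(5) cherednik_center_def ring_center_def)
qed

lemma center_map_scalar: "center_map (pconst z) = cherednik_scalar d \<zeta> c z"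
  by (simp add: center_map_def ev_hom cherednik_scalar_def cherednik_class_eq fop_hom)

lemma center_map_gen: "v \<in> zgens d \<Longrightarrow> center_map (pvar v) = zgen_val d \<zeta> c v"
proof (cases v)
  case Gq
  then show ?thesis
    by (simp add: center_map_def ev_hom cherednik_class_eq fop_xy)
next
  case GQ
  have "(\<lambda>z. Q_fun a z) = Q_fun a" by (rule ext) simp
  with GQ show ?thesis
    by (simp add: center_map_def ev_hom cherednik_class_eq fop_XY)
next
  case Geu
  have "(\<lambda>z. eu_fun z) = eu_fun" by (rule ext) simp
  with Geu show ?thesis
    by (simp add: center_map_def ev_hom central_lift_eu)
next
  case (Ga j)
  assume "v \<in> zgens d"
  then have "j \<le> d" using Ga by (auto simp: zgens_def)
  with Ga show ?thesis
    by (simp add: center_map_def ev_hom central_lift_a)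
qed

lemma kernel_center_map:
  "a_kernel (mpoly_ring (zgens d)) (cherednik_center d \<zeta> c) center_map
    = {p \<in> mcarrier (zgens d). \<forall>z. ev (gen_fun a z) p = 0}"
proof -
  have zero: "\<zero>\<^bsub>cherednik_center d \<zeta> c\<^esub> = opclass 0"
    using cherednik_one_zero(2) by (simp add: cherednik_center_def ring_center_def)
  have "center_map p = opclass 0 \<longleftrightarrow> (\<forall>z. ev (gen_fun a z) p = 0)" if "p \<in> mcarrier (zgens d)" for p
  proof
    assume "center_map p = opclass 0"
    then have "mulop (\<lambda>z. ev (gen_fun a z) p) = 0"
      unfolding center_map_def by (rule opclass_inj[OF ZH_HH[OF ev_in_ZH[OF that]]])
    then have "mulop (\<lambda>z. ev (gen_fun a z) p) = mulop (\<lambda>_. 0)"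
      by (simp only: mulop_hom(4))
    then show "\<forall>z. ev (gen_fun a z) p = 0"
      unfolding mulop_inject by metis
  next
    assume "\<forall>z. ev (gen_fun a z) p = 0"
    then have "(\<lambda>z. ev (gen_fun a z) p) = (\<lambda>_. 0)" by auto
    then show "center_map p = opclass 0"
      by (simp add: center_map_def mulop_hom(4))
  qed
  then show ?thesis
    unfolding a_kernel_def' zero by blast
qed

section \<open>Generators of the center\<close>

text \<open>The symbol of weight M is allowed to be zero, so subtracting a function with the same
  symbol stays within the notion and lowers the order.\<close>

definition sc_limit :: "nat \<Rightarrow> (pt \<Rightarrow> complex) \<Rightarrow> (pt \<Rightarrow> complex) \<Rightarrow> bool" where
  "sc_limit M f h \<longleftrightarrow> (\<forall>z. ((\<lambda>\<epsilon>. \<epsilon> ^ M * f (sc (inverse \<epsilon>) z)) \<longlongrightarrow> h z) (at 0))"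

lemma sc_limit_mult: "sc_limit M f h \<Longrightarrow> sc_limit N g k \<Longrightarrow> sc_limit (M + N) (\<lambda>z. f z * g z) (\<lambda>z. h z * k z)"
  unfolding sc_limit_def
proof
  fix z assume lim: "\<forall>z. ((\<lambda>\<epsilon>. \<epsilon> ^ M * f (sc (inverse \<epsilon>) z)) \<longlongrightarrow> h z) (at 0)"
    "\<forall>z. ((\<lambda>\<epsilon>. \<epsilon> ^ N * g (sc (inverse \<epsilon>) z)) \<longlongrightarrow> k z) (at 0)"
  have "((\<lambda>\<epsilon>. (\<epsilon> ^ M * f (sc (inverse \<epsilon>) z)) * (\<epsilon> ^ N * g (sc (inverse \<epsilon>) z))) \<longlongrightarrow> h z * k z) (at 0)"
    using lim by (intro tendsto_mult) auto
  then show "((\<lambda>\<epsilon>. \<epsilon> ^ (M + N) * (f (sc (inverse \<epsilon>) z) * g (sc (inverse \<epsilon>) z))) \<longlongrightarrow> h z * k z) (at 0)"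
    by (simp add: power_add mult_ac)
qed

lemma sc_limit_add: "sc_limit M f h \<Longrightarrow> sc_limit M g k \<Longrightarrow> sc_limit M (\<lambda>z. f z + g z) (\<lambda>z. h z + k z)"
  unfolding sc_limit_def by (auto simp: distrib_left intro: tendsto_add)

lemma sc_limit_diff: "sc_limit M f h \<Longrightarrow> sc_limit M g k \<Longrightarrow> sc_limit M (\<lambda>z. f z - g z) (\<lambda>z. h z - k z)"
  unfolding sc_limit_def by (auto simp: right_diff_distrib intro: tendsto_diff)

lemma sc_limit_const: "sc_limit 0 (\<lambda>_. z) (\<lambda>_. z)"
  by (simp add: sc_limit_def)

lemma sc_limit_zero: "sc_limit M (\<lambda>_. 0) (\<lambda>_. 0)"
  by (simp add: sc_limit_def)

lemma sc_limit_homogeneous: "homogeneous n f \<Longrightarrow> fop b f = mulop g \<Longrightarrow> sc_limit n g (cl f)"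
  unfolding sc_limit_def using homogeneous_mulop_lim[of n f b g n] by simp

lemma sc_limit_shift:
  assumes "sc_limit M f (\<lambda>_. 0)" "M \<le> N"
  shows "sc_limit N f (\<lambda>_. 0)"
proof -
  have "sc_limit (N - M) (\<lambda>_. 1) (\<lambda>_. 0 ^ (N - M))"
    unfolding sc_limit_def by (auto intro!: tendsto_eq_intros)
  from sc_limit_mult[OF this assms(1)] show ?thesis
    using assms(2) by simp
qed

lemma sc_limit_gen:
  "sc_limit 2 (\<lambda>z. cu z * cv z) (\<lambda>z. cu z * cv z)"
  "sc_limit 2 (Q_fun b) (\<lambda>z. cp z * cr z)"
  "sc_limit 2 eu_fun eu_fun"
  "j \<le> d \<Longrightarrow> sc_limit d (a_fun b j) (\<lambda>z. cu z ^ (d - j) * cr z ^ j + cv z ^ (d - j) * cp z ^ j)"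
proof -
  have "cl (fvar Vx * fvar Vy) = (\<lambda>z. cu z * cv z)" "cl (fvar VX * fvar VY) = (\<lambda>z. cp z * cr z)" "cl eu_word = eu_fun"
    by (auto simp: cl_hom eu_word_def eu_fun_def)
  then show "sc_limit 2 (\<lambda>z. cu z * cv z) (\<lambda>z. cu z * cv z)" "sc_limit 2 (Q_fun b) (\<lambda>z. cp z * cr z)" "sc_limit 2 eu_fun eu_fun"
    using sc_limit_homogeneous[OF homogeneous_quad fop_xy] sc_limit_homogeneous[OF homogeneous_quad fop_XY, of b] sc_limit_homogeneous[OF homogeneous_eu_word fop_eu_word]
    by simp_all
  assume j: "j \<le> d"
  then have "cl (a_word j) = (\<lambda>z. cu z ^ (d - j) * cr z ^ j + cv z ^ (d - j) * cp z ^ j)"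
    by (auto simp: cl_a_word)
  then show "sc_limit d (a_fun b j) (\<lambda>z. cu z ^ (d - j) * cr z ^ j + cv z ^ (d - j) * cp z ^ j)"
    using sc_limit_homogeneous[OF homogeneous_a_word fop_a_word(1)[OF j], of b] by simp
qed

definition symbol_of :: "nat \<Rightarrow> (pt \<Rightarrow> complex) \<Rightarrow> bool" where
  "symbol_of M h \<longleftrightarrow> (\<exists>G\<in>mcarrier (zgens d). sc_limit M (\<lambda>z. ev (gen_fun a z) G) h)"

lemma symbol_mult: "symbol_of M h \<Longrightarrow> symbol_of N k \<Longrightarrow> symbol_of (M + N) (\<lambda>z. h z * k z)"
  unfolding symbol_of_def
proof (elim bexE)
  fix G H assume "G \<in> mcarrier (zgens d)" "sc_limit M (\<lambda>z. ev (gen_fun a z) G) h" "H \<in> mcarrier (zgens d)" "sc_limit N (\<lambda>z. ev (gen_fun a z) H) k"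
  then show "\<exists>G\<in>mcarrier (zgens d). sc_limit (M + N) (\<lambda>z. ev (gen_fun a z) G) (\<lambda>z. h z * k z)"
    using sc_limit_mult by (intro bexI[of _ "G * H"]) (auto simp: ev_hom mcarrier_mult)
qed

lemma symbol_add: "symbol_of M h \<Longrightarrow> symbol_of M k \<Longrightarrow> symbol_of M (\<lambda>z. h z + k z)"
  unfolding symbol_of_def
proof (elim bexE)
  fix G H assume "G \<in> mcarrier (zgens d)" "sc_limit M (\<lambda>z. ev (gen_fun a z) G) h" "H \<in> mcarrier (zgens d)" "sc_limit M (\<lambda>z. ev (gen_fun a z) H) k"
  then show "\<exists>G\<in>mcarrier (zgens d). sc_limit M (\<lambda>z. ev (gen_fun a z) G) (\<lambda>z. h z + k z)"
    using sc_limit_add by (intro bexI[of _ "G + H"]) (auto simp: ev_hom mcarrier_add)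
qed

lemma symbol_const: "symbol_of 0 (\<lambda>_. z)"
  unfolding symbol_of_def by (intro bexI[of _ "pconst z"]) (simp_all add: ev_hom sc_limit_const mcarrier_pconst)

lemma symbol_zero: "symbol_of M (\<lambda>_. 0)"
  unfolding symbol_of_def by (intro bexI[of _ 0]) (simp_all add: ev_hom sc_limit_zero mcarrier_zero)

lemma symbol_scale: "symbol_of M h \<Longrightarrow> symbol_of M (\<lambda>z. y * h z)"
  using symbol_mult[OF symbol_const, of M h y] by simp

lemma symbol_diff: "symbol_of M h \<Longrightarrow> symbol_of M k \<Longrightarrow> symbol_of M (\<lambda>z. h z - k z)"
  using symbol_add[OF _ symbol_scale[of M k "-1"], of h] by simp

lemma symbol_sum: "(\<And>i. i \<in> A \<Longrightarrow> symbol_of M (h i)) \<Longrightarrow> symbol_of M (\<lambda>z. \<Sum>i\<in>A. h i z)"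
  by (induction A rule: infinite_finite_induct) (auto simp: symbol_zero symbol_add)

lemma symbol_gen:
  "symbol_of 2 (\<lambda>z. cu z * cv z)" "symbol_of 2 (\<lambda>z. cp z * cr z)" "symbol_of 2 eu_fun"
  "j \<le> d \<Longrightarrow> symbol_of d (\<lambda>z. cu z ^ (d - j) * cr z ^ j + cv z ^ (d - j) * cp z ^ j)"
proof -
  have g: "symbol_of M h" if "v \<in> zgens d" "sc_limit M (\<lambda>z. gen_fun a z v) h" for M h v
    unfolding symbol_of_def using that by (intro bexI[of _ "pvar v"]) (simp_all add: ev_hom mcarrier_pvar)
  show "symbol_of 2 (\<lambda>z. cu z * cv z)"
    by (rule g[of Gq]) (simp_all add: zgens_def sc_limit_gen)
  show "symbol_of 2 (\<lambda>z. cp z * cr z)"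
    by (rule g[of GQ]) (simp_all add: zgens_def sc_limit_gen)
  show "symbol_of 2 eu_fun"
    by (rule g[of Geu]) (simp_all add: zgens_def sc_limit_gen)
  show "symbol_of d (\<lambda>z. cu z ^ (d - j) * cr z ^ j + cv z ^ (d - j) * cp z ^ j)" if "j \<le> d"
    by (rule g[of "Ga j"]) (use that in \<open>simp_all add: zgens_def sc_limit_gen\<close>)
qed

section \<open>Invariant polynomials as symbols of the generators\<close>

definition mon_fun :: "nat \<Rightarrow> nat \<Rightarrow> nat \<Rightarrow> nat \<Rightarrow> pt \<Rightarrow> complex" where
  "mon_fun i j k l z = cu z ^ i * cv z ^ j * cp z ^ k * cr z ^ l"

definition orbit_sum :: "nat \<Rightarrow> nat \<Rightarrow> nat \<Rightarrow> nat \<Rightarrow> pt \<Rightarrow> complex" where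
  "orbit_sum i j k l z = mon_fun i j k l z + mon_fun j i l k z"

lemma orbit_sum_swap: "orbit_sum i j k l = orbit_sum j i l k"
  by (auto simp: orbit_sum_def)

text \<open>The rotation by \<zeta> multiplies the monomial by the ratio of the two sides, so
  balance is invariance under rotations. The second half of an orbit sum is the image under the
  reflection \<open>reflm 1\<close>.\<close>

abbreviation balanced :: "nat \<Rightarrow> nat \<Rightarrow> nat \<Rightarrow> nat \<Rightarrow> bool" where
  "balanced i j k l \<equiv> \<zeta> ^ (i + l) = \<zeta> ^ (j + k)"

lemma zeta_nonzero: "\<zeta> \<noteq> 0"
  by (rule mu_nonzero[OF mu_closed(2)])

text \<open>Multiplying out \<open>(m + s m) (m' + s m')\<close> expresses the orbit sum of \<open>m m'\<close> through
  orbit sums of smaller degree and the orbit sum of \<open>m (s m')\<close>.\<close>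

lemma symbol_mixed_orbit_sum:
  assumes IH: "\<And>i j k l. i + j + k + l < n \<Longrightarrow> balanced i j k l \<Longrightarrow> symbol_of (i + j + k + l) (orbit_sum i j k l)"
    and n: "i + j + k + l = n" and bal: "balanced i j k l" and mixed: "0 < i \<or> 0 < l" "0 < j \<or> 0 < k"
  shows "symbol_of n (orbit_sum i j k l)"
proof -
  have A: "symbol_of n (orbit_sum i j k l)" if n: "i + j + k + l = n" and bal: "balanced i j k l" and "0 < i" "0 < j" for i j k l
  proof -
    obtain i' j' where ij: "i = Suc i'" "j = Suc j'"
      using \<open>0 < i\<close> \<open>0 < j\<close> by (auto dest!: gr0_implies_Suc)
    then have "balanced i' j' k l"
      using bal zeta_nonzero by simp
    then have "symbol_of (i' + j' + k + l) (orbit_sum i' j' k l)"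
      using n ij by (intro IH) simp_all
    then have "symbol_of (2 + (i' + j' + k + l)) (\<lambda>z. cu z * cv z * orbit_sum i' j' k l z)"
      by (rule symbol_mult[OF symbol_gen(1)])
    moreover have "(\<lambda>z. cu z * cv z * orbit_sum i' j' k l z) = orbit_sum i j k l"
      by (auto simp: orbit_sum_def mon_fun_def ij algebra_simps)
    ultimately show ?thesis
      using n ij by (simp add: algebra_simps)
  qed
  have B: "symbol_of n (orbit_sum i j k l)" if n: "i + j + k + l = n" and bal: "balanced i j k l" and "0 < k" "0 < l" for i j k l
  proof -
    obtain k' l' where kl: "k = Suc k'" "l = Suc l'"
      using \<open>0 < k\<close> \<open>0 < l\<close> by (auto dest!: gr0_implies_Suc)
    then have "balanced i j k' l'"
      using bal zeta_nonzero by simp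
    then have "symbol_of (i + j + k' + l') (orbit_sum i j k' l')"
      using n kl by (intro IH) simp_all
    then have "symbol_of (2 + (i + j + k' + l')) (\<lambda>z. cp z * cr z * orbit_sum i j k' l' z)"
      by (rule symbol_mult[OF symbol_gen(2)])
    moreover have "(\<lambda>z. cp z * cr z * orbit_sum i j k' l' z) = orbit_sum i j k l"
      by (auto simp: orbit_sum_def mon_fun_def kl algebra_simps)
    ultimately show ?thesis
      using n kl by (simp add: algebra_simps)
  qed
  have C: "symbol_of n (orbit_sum i j k l)" if n: "i + j + k + l = n" and bal: "balanced i j k l" and "0 < i" "0 < k" for i j k l
  proof -
    obtain i' k' where ik: "i = Suc i'" "k = Suc k'"
      using \<open>0 < i\<close> \<open>0 < k\<close> by (auto dest!: gr0_implies_Suc)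
    show ?thesis
    proof (cases "i' = 0 \<and> k' = 0 \<and> j = 0 \<and> l = 0")
      case True
      then have "n = 2" "orbit_sum i j k l = eu_fun"
        using n ik by (auto simp: orbit_sum_def mon_fun_def eu_fun_def)
      then show ?thesis
        using symbol_gen(3) by simp
    next
      case False
      have bal': "balanced i' j k' l"
        using bal ik zeta_nonzero by simp
      have "symbol_of (i' + j + k' + l) (orbit_sum i' j k' l)"
        using n ik by (intro IH bal') simp
      then have 1: "symbol_of (2 + (i' + j + k' + l)) (\<lambda>z. eu_fun z * orbit_sum i' j k' l z)"
        by (rule symbol_mult[OF symbol_gen(3)])
      have n': "2 + (i' + j + k' + l) = n"
        using n ik by simp
      have C_step: "symbol_of n (orbit_sum i j k l)" if "symbol_of n (orbit_sum i' (Suc j) k' (Suc l))"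
      proof -
        have "symbol_of n (\<lambda>z. eu_fun z * orbit_sum i' j k' l z - orbit_sum i' (Suc j) k' (Suc l) z)"
          using 1 that unfolding n' by (rule symbol_diff)
        moreover have "(\<lambda>z. eu_fun z * orbit_sum i' j k' l z - orbit_sum i' (Suc j) k' (Suc l) z) = orbit_sum i j k l"
          by (rule ext) (simp add: orbit_sum_def mon_fun_def eu_fun_def ik, simp add: algebra_simps)
        ultimately show ?thesis by simp
      qed
      have b: "balanced i' (Suc j) k' (Suc l)" and m: "i' + Suc j + k' + Suc l = n"
        using bal' n' by simp_all
      consider "0 < i'" | "0 < k'" | "0 < j" | "0 < l" using False by blast
      then show ?thesis
      proof cases
        case 1
        from A[OF m b 1] have "symbol_of n (orbit_sum i' (Suc j) k' (Suc l))" by simp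
        then show ?thesis by (rule C_step)
      next
        case 2
        from B[OF m b 2] have "symbol_of n (orbit_sum i' (Suc j) k' (Suc l))" by simp
        then show ?thesis by (rule C_step)
      next
        case 3
        show ?thesis by (rule A[OF n bal \<open>0 < i\<close> 3])
      next
        case 4
        show ?thesis by (rule B[OF n bal \<open>0 < k\<close> 4])
      qed
    qed
  qed
  have D: "symbol_of n (orbit_sum i j k l)" if "0 < j" "0 < l"
  proof -
    have "j + i + l + k = n" using n by simp
    from C[OF this bal[symmetric] that] show ?thesis
      by (simp only: orbit_sum_swap[of i j k l])
  qed
  consider "0 < i" "0 < j" | "0 < i" "0 < k" | "0 < l" "0 < j" | "0 < l" "0 < k"
    using mixed by blast
  then show ?thesis
  proof cases
    case 1
    then show ?thesis by (rule A[OF n bal])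
  next
    case 2
    then show ?thesis by (rule C[OF n bal])
  next
    case 3
    then show ?thesis by (intro D)
  next
    case 4
    then show ?thesis by (intro B[OF n bal])
  qed
qed

text \<open>For a monomial in x and Y alone, balance forces its degree to be a multiple of d. From
  degree 2 d on, a factor of degree exactly d is split off. It is half of the symbol of some a_l,
  and the cross term of the product is a mixed orbit sum.\<close>

lemma symbol_orbit_sum: "balanced i j k l \<Longrightarrow> symbol_of (i + j + k + l) (orbit_sum i j k l)"
proof (induction "i + j + k + l" arbitrary: i j k l rule: less_induct)
  case less
  have pure: "symbol_of (i + l) (orbit_sum i 0 0 l)" if n: "i + l = n" and bal: "balanced i 0 0 l"
    and IH: "\<And>i' j' k' l'. i' + j' + k' + l' < n \<Longrightarrow> balanced i' j' k' l' \<Longrightarrow> symbol_of (i' + j' + k' + l') (orbit_sum i' j' k' l')"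
    for i l n
  proof -
    have "d dvd i + l"
      using bal by (simp add: zeta_pow_eq_1_iff)
    then obtain e where e: "i + l = d * e" by blast
    consider "e = 0" | "e = 1" | "2 \<le> e" by linarith
    then show ?thesis
    proof cases
      case 1
      then have "orbit_sum i 0 0 l = (\<lambda>_. 2)" "i + l = 0"
        using e by (auto simp: orbit_sum_def mon_fun_def)
      then show ?thesis using symbol_const by simp
    next
      case 2
      then have il: "i = d - l" "l \<le> d" "i + l = d" using e by auto
      have "orbit_sum i 0 0 l = (\<lambda>z. cu z ^ (d - l) * cr z ^ l + cv z ^ (d - l) * cp z ^ l)"
        by (auto simp: orbit_sum_def mon_fun_def il(1))
      then show ?thesis
        using symbol_gen(4)[OF il(2)] il(3) by simp
    next
      case 3
      then have "d * 2 \<le> i + l" unfolding e by (rule mult_le_mono2)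
      \<comment> \<open>The factor takes as many x as it can and is filled up with Y to degree
        d.\<close>
      define i' where "i' = min i d"
      define l' where "l' = d - i'"
      have il': "i' \<le> i" "l' \<le> l" "i' + l' = d" "i' + l' \<le> i + l" "d \<le> (i - i') + (l - l')" "i' = d - l'" "l' \<le> d"
        using \<open>d * 2 \<le> i + l\<close> by (auto simp: i'_def l'_def min_def)
      have split: "(i - i') + (l - l') = i + l - d" "d \<le> i + l"
        using il' by simp_all
      have "\<zeta> ^ (i - i' + (l - l')) * \<zeta> ^ d = \<zeta> ^ (i + l)"
        unfolding split(1) using split(2) by (simp flip: power_add)
      then have z1: "\<zeta> ^ (i - i' + (l - l')) = 1"
        using bal by (simp add: zeta_pow_d)
      have bal1: "balanced (i - i') 0 0 (l - l')"
        using z1 by simp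
      have "symbol_of ((i - i') + 0 + 0 + (l - l')) (orbit_sum (i - i') 0 0 (l - l'))"
        using il' n d_pos by (intro IH bal1) simp
      then have "symbol_of (d + ((i - i') + 0 + 0 + (l - l'))) (\<lambda>z. (cu z ^ (d - l') * cr z ^ l' + cv z ^ (d - l') * cp z ^ l') * orbit_sum (i - i') 0 0 (l - l') z)"
        by (rule symbol_mult[OF symbol_gen(4)[OF il'(7)]])
      moreover have "d + ((i - i') + 0 + 0 + (l - l')) = n"
        using il' n by simp
      ultimately have 1: "symbol_of n (\<lambda>z. (cu z ^ (d - l') * cr z ^ l' + cv z ^ (d - l') * cp z ^ l') * orbit_sum (i - i') 0 0 (l - l') z)"
        by (simp only:)
      have bal2: "balanced (i - i') i' l' (l - l')"
        using z1 il'(3) by (simp add: zeta_pow_d)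
      have sum: "(i - i') + i' + l' + (l - l') = n"
        using il' n by simp
      have "symbol_of n (orbit_sum (i - i') i' l' (l - l'))"
        by (rule symbol_mixed_orbit_sum[OF IH sum bal2]) (use il' d_pos in auto)
      then have 2: "symbol_of n (\<lambda>z. (cu z ^ (d - l') * cr z ^ l' + cv z ^ (d - l') * cp z ^ l') * orbit_sum (i - i') 0 0 (l - l') z - orbit_sum (i - i') i' l' (l - l') z)"
        by (rule symbol_diff[OF 1])
      have "orbit_sum i 0 0 l z = (cu z ^ (d - l') * cr z ^ l' + cv z ^ (d - l') * cp z ^ l') * orbit_sum (i - i') 0 0 (l - l') z - orbit_sum (i - i') i' l' (l - l') z" for z
      proof -
        have p: "x ^ i = x ^ i' * x ^ (i - i')" "x ^ l = x ^ l' * x ^ (l - l')" for x :: complex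
          using il' by (simp_all flip: power_add)
        show ?thesis
          unfolding il'(6)[symmetric] by (simp add: orbit_sum_def mon_fun_def p algebra_simps)
      qed
      then have "orbit_sum i 0 0 l = (\<lambda>z. (cu z ^ (d - l') * cr z ^ l' + cv z ^ (d - l') * cp z ^ l') * orbit_sum (i - i') 0 0 (l - l') z - orbit_sum (i - i') i' l' (l - l') z)"
        by (rule ext)
      with 2 n show ?thesis by simp
    qed
  qed
  consider (mixed) "0 < i \<or> 0 < l" "0 < j \<or> 0 < k" | (il) "j = 0" "k = 0" | (jk) "i = 0" "l = 0"
    by blast
  then show ?case
  proof cases
    case mixed
    show ?thesis
      by (rule symbol_mixed_orbit_sum[OF less.hyps refl less.prems mixed])
  next
    case il
    have "symbol_of (i + l) (orbit_sum i 0 0 l)"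
      using less.prems il by (intro pure[OF refl] less.hyps) simp_all
    with il show ?thesis by simp
  next
    case jk
    have "symbol_of (j + k) (orbit_sum j 0 0 k)"
      using less.prems jk by (intro pure[OF refl] less.hyps) simp_all
    with jk show ?thesis
      using orbit_sum_swap[of i j k l] by simp
  qed
qed

lemma monval_rot_pt:
  assumes "\<eta> \<in> \<mu>"
  shows "monval m (rot_pt \<eta> z) = \<eta> ^ (Poly_Mapping.lookup m Vx + Poly_Mapping.lookup m VY)
    / \<eta> ^ (Poly_Mapping.lookup m Vy + Poly_Mapping.lookup m VX) * monval m z"
  by (simp add: monval_def rot_pt_coords mu_norm[OF assms] power_mult_distrib power_divide power_add)

lemma zeta_pow_cong: "m mod d = n mod d \<Longrightarrow> \<zeta> ^ m = \<zeta> ^ n"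
proof -
  have "\<zeta> ^ k = \<zeta> ^ (k mod d)" for k
  proof -
    have "\<zeta> ^ (d * (k div d) + k mod d) = \<zeta> ^ (k mod d)"
      unfolding power_add power_mult by (simp add: zeta_pow_d)
    then show ?thesis
      by (simp only: mult_div_mod_eq)
  qed
  then show "m mod d = n mod d \<Longrightarrow> \<zeta> ^ m = \<zeta> ^ n" by metis
qed

text \<open>Averaging over the rotations keeps the balanced monomials, and averaging with one
  reflection pairs them into orbit sums.\<close>

lemma invariant_symbol:
  assumes inv: "inv_fun (symbol_val M p)"
  shows "symbol_of M (symbol_val M p)"
proof -
  let ?A = "\<lambda>m. Poly_Mapping.lookup m Vx + Poly_Mapping.lookup m VY"
  let ?B = "\<lambda>m. Poly_Mapping.lookup m Vy + Poly_Mapping.lookup m VX"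
  let ?K = "{m \<in> Poly_Mapping.keys p. mdeg m = M}"
  let ?T = "{m \<in> ?K. ?A m mod d = ?B m mod d}"
  let ?c = "Poly_Mapping.lookup p"
  have h: "symbol_val M p z = (\<Sum>m\<in>?K. ?c m * monval m z)" for z
    by (simp add: symbol_val_def pext_def sum.inter_filter)
  have "of_nat d * symbol_val M p z = (\<Sum>m\<in>?T. of_nat d * (?c m * monval m z))" for z
  proof -
    have "of_nat d * symbol_val M p z = (\<Sum>\<eta>\<in>\<mu>. symbol_val M p (rot_pt \<eta> z))"
    proof -
      have "symbol_val M p (rot_pt \<eta> z) = symbol_val M p z" if "\<eta> \<in> \<mu>" for \<eta>
        using inv W_rot[OF that] act_rot[OF mu_nonzero[OF that], of z] unfolding inv_fun_def by metis
      then show ?thesis by (simp add: card_mu)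
    qed
    also have "\<dots> = (\<Sum>m\<in>?K. ?c m * monval m z * (\<Sum>\<eta>\<in>\<mu>. \<eta> ^ ?A m / \<eta> ^ ?B m))"
      unfolding h sum_distrib_left by (subst sum.swap) (intro sum.cong refl, simp add: monval_rot_pt)
    also have "\<dots> = (\<Sum>m\<in>?K. if ?A m mod d = ?B m mod d then of_nat d * (?c m * monval m z) else 0)"
      by (intro sum.cong refl) (simp only: sum_mu_power_ratio, simp)
    also have "\<dots> = (\<Sum>m\<in>?T. of_nat d * (?c m * monval m z))"
      by (rule sum.inter_filter[symmetric]) simp
    finally show ?thesis .
  qed
  then have hT: "symbol_val M p z = (\<Sum>m\<in>?T. ?c m * monval m z)" for z
    using d_pos by (simp add: sum_distrib_left[symmetric])
  have "symbol_val M p z = (\<Sum>m\<in>?T. ?c m / 2 * orbit_sum (Poly_Mapping.lookup m Vx) (Poly_Mapping.lookup m Vy) (Poly_Mapping.lookup m VX) (Poly_Mapping.lookup m VY) z)" for z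
  proof -
    have "symbol_val M p (refl_pt 1 z) = symbol_val M p z"
      using inv mu_closed(1) by (rule inv_fun_refl_pt)
    then have "symbol_val M p z = symbol_val M p z / 2 + symbol_val M p (refl_pt 1 z) / 2" by simp
    also have "\<dots> = (\<Sum>m\<in>?T. ?c m / 2 * (monval m z + monval m (refl_pt 1 z)))"
      unfolding hT by (simp add: sum_divide_distrib distrib_left sum.distrib)
    finally show ?thesis
      by (simp add: orbit_sum_def mon_fun_def monval_def refl_pt_coords mult_ac)
  qed
  moreover have "symbol_of M (\<lambda>z. \<Sum>m\<in>?T. ?c m / 2 * orbit_sum (Poly_Mapping.lookup m Vx) (Poly_Mapping.lookup m Vy) (Poly_Mapping.lookup m VX) (Poly_Mapping.lookup m VY) z)"
  proof (intro symbol_sum symbol_scale)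
    fix m assume m: "m \<in> ?T"
    then have "\<zeta> ^ ?A m = \<zeta> ^ ?B m" by (intro zeta_pow_cong) simp
    from symbol_orbit_sum[OF this] m
    show "symbol_of M (orbit_sum (Poly_Mapping.lookup m Vx) (Poly_Mapping.lookup m Vy) (Poly_Mapping.lookup m VX) (Poly_Mapping.lookup m VY))"
      by (simp add: mdeg_def)
  qed
  ultimately show ?thesis by presburger
qed

text \<open>Induction on the strict degree bound: a polynomial in the generators with the same top
  symbol is subtracted, and the growth of the difference is smaller.\<close>

lemma central_in_image:
  assumes "P \<in> pbw_source \<zeta>" "sop a (NP P) = mulop f" "inv_fun f" "pdeg_lt P M"
  shows "\<exists>G\<in>mcarrier (zgens d). \<forall>z. f z = ev (gen_fun a z) G"
  using assms
proof (induction M arbitrary: P f)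
  case 0
  then have "P = 0" by (intro pdeg_lt_0)
  then have "mulop f = mulop (\<lambda>_. 0)"
    unfolding "0.prems"(2)[symmetric] mulop_hom by (simp add: NP_hom)
  then have "f = (\<lambda>_. 0)" by (simp only: mulop_inject)
  then show ?case
    by (intro bexI[of _ 0]) (simp_all add: ev_hom mcarrier_zero)
next
  case (Suc M)
  have keys: "Poly_Mapping.keys P \<subseteq> W" using Suc.prems(1) by (simp add: pbw_source_iff)
  let ?h = "symbol_val M (Poly_Mapping.lookup P (mat 1))"
  have lim: "sc_limit M f ?h"
    unfolding sc_limit_def using central_lead(1)[OF keys Suc.prems(4,2)] by blast
  \<comment> \<open>Scaling commutes with W, so the symbol inherits invariance as a limit of
    invariant functions.\<close>
  have "?h (act w z) = ?h z" if "w \<in> W" for w z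
  proof -
    have "\<forall>\<^sub>F \<epsilon> in at 0. \<epsilon> ^ M * f (sc (inverse \<epsilon>) (act w z)) = \<epsilon> ^ M * f (sc (inverse \<epsilon>) z)"
      unfolding eventually_at_filter
    proof (intro always_eventually allI impI)
      fix \<epsilon> :: complex assume "\<epsilon> \<noteq> 0"
      then have "sc (inverse \<epsilon>) (act w z) = act w (sc (inverse \<epsilon>) z)"
        using act_sc[of "inverse \<epsilon>" w z] that by simp
      then show "\<epsilon> ^ M * f (sc (inverse \<epsilon>) (act w z)) = \<epsilon> ^ M * f (sc (inverse \<epsilon>) z)"
        using Suc.prems(3) that by (simp add: inv_fun_def)
    qed
    moreover have "((\<lambda>\<epsilon>. \<epsilon> ^ M * f (sc (inverse \<epsilon>) (act w z))) \<longlongrightarrow> ?h (act w z)) (at 0)"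
      using lim by (simp add: sc_limit_def)
    ultimately have 1: "((\<lambda>\<epsilon>. \<epsilon> ^ M * f (sc (inverse \<epsilon>) z)) \<longlongrightarrow> ?h (act w z)) (at 0)"
      by (rule Lim_transform_eventually[rotated])
    have 2: "((\<lambda>\<epsilon>. \<epsilon> ^ M * f (sc (inverse \<epsilon>) z)) \<longlongrightarrow> ?h z) (at 0)"
      using lim by (simp add: sc_limit_def)
    show ?thesis
      by (rule tendsto_unique[OF _ 1 2]) simp
  qed
  then have "inv_fun ?h" by (simp add: inv_fun_def)
  then obtain G where G: "G \<in> mcarrier (zgens d)" "sc_limit M (\<lambda>z. ev (gen_fun a z) G) ?h"
    using invariant_symbol by (auto simp: symbol_of_def)
  let ?g = "\<lambda>z. ev (gen_fun a z) G"
  let ?f = "\<lambda>z. f z - ?g z"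
  have gZ: "mulop ?g \<in> ZH" by (rule ev_in_ZH[OF G(1)])
  obtain Q where Q: "Q \<in> pbw_source \<zeta>" "sop a (NP Q) = mulop ?g"
    using HH_NP[OF ZH_HH[OF gZ]] .
  let ?P = "P - Q"
  have P: "?P \<in> pbw_source \<zeta>" "sop a (NP ?P) = mulop ?f"
    using pbw_source_diff[OF Suc.prems(1) Q(1)] by (simp_all add: NP_hom sop_diff Suc.prems(2) Q(2) mulop_hom(3))
  have "sc_limit M ?f (\<lambda>z. ?h z - ?h z)"
    by (rule sc_limit_diff[OF lim G(2)])
  then have "sc_limit M ?f (\<lambda>_. 0)" by simp
  then have lim0: "((\<lambda>\<epsilon>. \<epsilon> ^ N * ?f (sc (inverse \<epsilon>) z)) \<longlongrightarrow> 0) (at 0)" if "M \<le> N" for N z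
    using sc_limit_shift[OF _ that, of ?f] by (simp add: sc_limit_def)
  have lt: "pdeg_lt ?P M"
    by (rule central_degree_bound[OF P(1)[unfolded pbw_source_iff] P(2) lim0])
  have "inv_fun ?f"
    using Suc.prems(3) inv_fun_ev[OF G(1), of a] by (simp add: inv_fun_def)
  from Suc.IH[OF P this lt] obtain G' where "G' \<in> mcarrier (zgens d)" "\<forall>z. ?f z = ev (gen_fun a z) G'"
    by blast
  then show ?case
    using G(1) by (intro bexI[of _ "G + G'"]) (auto simp: ev_hom mcarrier_add algebra_simps)
qed

lemma center_map_surj: "center_map ` mcarrier (zgens d) = carrier (cherednik_center d \<zeta> c)"
proof
  show "center_map ` mcarrier (zgens d) \<subseteq> carrier (cherednik_center d \<zeta> c)"
    using ev_in_ZH by (auto simp: carrier_center center_map_def)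
  show "carrier (cherednik_center d \<zeta> c) \<subseteq> center_map ` mcarrier (zgens d)"
    unfolding carrier_center
  proof (rule image_subsetI)
    fix L assume L: "L \<in> ZH"
    obtain f where f: "L = mulop f" "inv_fun f"
      using ZH_form[OF L] .
    obtain P where P: "P \<in> pbw_source \<zeta>" "sop a (NP P) = L"
      using HH_NP[OF ZH_HH[OF L]] .
    obtain M where "pdeg_lt P M"
      using pdeg_lt_exists by blast
    from central_in_image[OF P(1) _ f(2) this] P(2) f(1)
    obtain G where G: "G \<in> mcarrier (zgens d)" "\<forall>z. f z = ev (gen_fun a z) G"
      by auto
    have "f = (\<lambda>z. ev (gen_fun a z) G)"
      using G(2) by (intro ext) simp
    then have "opclass L = center_map G"
      by (simp only: f(1) center_map_def)
    with G(1) show "opclass L \<in> center_map ` mcarrier (zgens d)" by blast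
  qed
qed

end

section \<open>Independence of the normal forms\<close>

text \<open>The Lucas polynomials: power sums of two quantities in terms of their sum t and their
  product s.\<close>

fun Luc :: "nat \<Rightarrow> 'r::comm_ring_1 \<Rightarrow> 'r \<Rightarrow> 'r" where
  "Luc 0 t s = 2"
| "Luc (Suc 0) t s = t"
| "Luc (Suc (Suc n)) t s = t * Luc (Suc n) t s - s * Luc n t s"

lemma Luc_sum: "Luc n (x + y) (x * y) = x ^ n + y ^ n" for x :: "'r::comm_ring_1"
  by (induction n "x + y" "x * y" rule: Luc.induct) (simp_all add: algebra_simps)

text \<open>With t = x + y and qr = xy, (x - y) \<Psi>_n is x^(n+1) - y^(n+1). Multiplying once more
  by x - y gives x^(n+2) + y^(n+2) - xy (x^n + y^n).\<close>

lemma Psi_discriminant: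
  "(t ^ 2 - 4 * (q * r)) * Psi n t q r = Luc (Suc (Suc n)) t (q * r) - q * r * Luc n t (q * r)"
proof (induction n t q r rule: Psi.induct)
  case (1 t q r)
  show ?case by (simp add: algebra_simps power2_eq_square)
next
  case (2 t q r)
  show ?case by (simp add: algebra_simps power2_eq_square)
next
  case (3 n t q r)
  have "(t ^ 2 - 4 * (q * r)) * Psi (Suc (Suc n)) t q r
      = t * ((t ^ 2 - 4 * (q * r)) * Psi (Suc n) t q r) - q * r * ((t ^ 2 - 4 * (q * r)) * Psi n t q r)"
    by (simp add: algebra_simps)
  also have "\<dots> = Luc (Suc (Suc (Suc (Suc n)))) t (q * r) - q * r * Luc (Suc (Suc n)) t (q * r)"
    unfolding 3 by (simp add: algebra_simps)
  finally show ?case .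
qed

text \<open>In the geometric sum the two outer terms form a power sum, and the inner terms share the
  factor xy.\<close>

lemma Psi_Suc_Suc: "Psi (Suc (Suc n)) t q r = Luc (Suc (Suc n)) t (q * r) + q * r * Psi n t q r"
proof (induction n t q r rule: Psi.induct)
  case (3 n t q r)
  let ?s = "q * r"
  have "Psi (Suc (Suc (Suc (Suc n)))) t q r = t * Psi (Suc (Suc (Suc n))) t q r - ?s * Psi (Suc (Suc n)) t q r"
    by simp
  also have "\<dots> = t * (Luc (Suc (Suc (Suc n))) t ?s + ?s * Psi (Suc n) t q r) - ?s * (Luc (Suc (Suc n)) t ?s + ?s * Psi n t q r)"
    by (simp only: 3)
  also have "\<dots> = (t * Luc (Suc (Suc (Suc n))) t ?s - ?s * Luc (Suc (Suc n)) t ?s) + ?s * (t * Psi (Suc n) t q r - ?s * Psi n t q r)"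
    by (simp only: ring_distribs mult_ac add_ac diff_diff_eq2 diff_add_eq add_diff_eq diff_diff_eq)
  also have "\<dots> = Luc (Suc (Suc (Suc (Suc n)))) t ?s + ?s * Psi (Suc (Suc n)) t q r"
    by simp
  finally show ?case .
qed (simp_all add: algebra_simps)

lemma ev_Luc: "ev f (Luc n p q) = Luc n (ev f p) (ev f q)"
  by (induction n p q rule: Luc.induct) (simp_all add: ev_hom ev_numeral)

text \<open>Each value is taken at roots of a nonzero polynomial of degree 2 d only, while there are
  infinitely many admissible u. These values form the sets over which the third and fourth variable
  of \<open>four_variable_vanish\<close> range.\<close>

lemma infinite_power_sums:
  fixes x :: complex
  assumes x: "x \<noteq> 0" and d: "0 < d"
  shows "infinite {u ^ d + (x / u) ^ d | u. u \<noteq> 0 \<and> norm u \<noteq> norm (x / u)}"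
proof
  let ?U = "{u. u \<noteq> 0 \<and> norm u \<noteq> norm (x / u)}" and ?g = "\<lambda>u. u ^ d + (x / u) ^ d"
  assume "finite {u ^ d + (x / u) ^ d | u. u \<noteq> 0 \<and> norm u \<noteq> norm (x / u)}"
  moreover have "?g ` ?U = {u ^ d + (x / u) ^ d | u. u \<noteq> 0 \<and> norm u \<noteq> norm (x / u)}"
    by blast
  ultimately have fin: "finite (?g ` ?U)" by simp
  let ?f = "\<lambda>n::nat. of_real (norm x + 1 + n) :: complex"
  have pos: "0 < norm x + 1 + real n" for n
    using norm_ge_zero[of x] by linarith
  have nf: "norm (?f n) = norm x + 1 + n" for n
    unfolding norm_of_real using pos[of n] by simp
  have "?f n \<in> ?U" for n
  proof -
    have "?f n \<noteq> 0"
      using pos[of n] by (simp only: of_real_eq_0_iff)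
    moreover have "norm (x / ?f n) < norm (?f n)"
    proof -
      have "norm (x / ?f n) = norm x / (norm x + 1 + n)"
        by (simp only: norm_divide nf)
      also have "\<dots> < 1"
        using pos[of n] by (simp add: divide_less_eq)
      also have "1 \<le> norm x + 1 + n" by simp
      finally show ?thesis by (simp only: nf)
    qed
    ultimately show ?thesis by simp
  qed
  then have sub: "range ?f \<subseteq> ?U" by (intro image_subsetI)
  have "inj ?f"
    by (rule injI) (simp only: of_real_eq_iff add_left_cancel of_nat_eq_iff)
  then have "infinite (range ?f)"
    by (rule range_inj_infinite)
  with sub have "infinite ?U"
    by (rule infinite_super)
  then obtain u0 where "infinite {u \<in> ?U. ?g u = ?g u0}"
    using pigeonhole_infinite[OF _ fin] by auto
  moreover let ?p = "monom 1 (2 * d) - monom (?g u0) d + [:x ^ d:]"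
  have "{u \<in> ?U. ?g u = ?g u0} \<subseteq> {u. poly ?p u = 0}"
  proof
    fix u assume u: "u \<in> {u \<in> ?U. ?g u = ?g u0}"
    then have "u ^ d * ?g u = u ^ d * ?g u0" by simp
    moreover have "u ^ d * (x / u) ^ d = x ^ d"
      using u by (simp flip: power_mult_distrib)
    moreover have "u ^ (2 * d) = u ^ d * u ^ d"
      by (simp only: mult_2 power_add)
    ultimately show "u \<in> {u. poly ?p u = 0}"
      by (simp add: poly_monom algebra_simps)
  qed
  ultimately have "infinite {u. poly ?p u = 0}"
    using infinite_super by blast
  then have "?p = 0"
    using poly_roots_finite by blast
  then have "coeff ?p 0 = 0" by (simp only: coeff_0)
  then show False
    using x d by simp
qed

section \<open>Fourier modes on a fibre of the invariants\<close>

context dihedral_root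
begin

text \<open>The hypothesis at \<eta> is divided by \<open>\<eta> ^ k\<close> and summed over
  \<open>\<mu>\<close>, and \<sigma> records which terms survive by orthogonality.\<close>

lemma fourier_mode:
  assumes H: "\<And>\<eta>. \<eta> \<in> \<mu> \<Longrightarrow> (\<Sum>g\<le>d. P g * ((u * (p / \<eta>)) ^ g + (v * (\<eta> * r)) ^ g))
      + (\<Sum>i\<in>{1..<d}. R i * (u ^ (d - i) * (\<eta> * r) ^ i + v ^ (d - i) * (p / \<eta>) ^ i)) = 0"
  defines "\<sigma> m n \<equiv> (if m mod d = n mod d then of_nat d else (0::complex))"
  shows "(\<Sum>g\<le>d. P g * (u * p) ^ g * \<sigma> 0 (g + k)) + (\<Sum>g\<le>d. P g * (v * r) ^ g * \<sigma> g k)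
    + (\<Sum>i\<in>{1..<d}. R i * (u ^ (d - i) * r ^ i) * \<sigma> i k) + (\<Sum>i\<in>{1..<d}. R i * (v ^ (d - i) * p ^ i) * \<sigma> 0 (i + k)) = 0"
proof -
  have \<sigma>: "\<sigma> m n = (\<Sum>\<eta>\<in>\<mu>. \<eta> ^ m / \<eta> ^ n)" for m n
    unfolding \<sigma>_def by (rule sum_mu_power_ratio[symmetric])
  have "0 = (\<Sum>\<eta>\<in>\<mu>. ((\<Sum>g\<le>d. P g * ((u * (p / \<eta>)) ^ g + (v * (\<eta> * r)) ^ g))
      + (\<Sum>i\<in>{1..<d}. R i * (u ^ (d - i) * (\<eta> * r) ^ i + v ^ (d - i) * (p / \<eta>) ^ i))) / \<eta> ^ k)"
    by (rule sum.neutral[symmetric], intro ballI) (simp only: H div_0)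
  also have "\<dots> = (\<Sum>\<eta>\<in>\<mu>. (\<Sum>g\<le>d. P g * (u * p) ^ g * (\<eta> ^ 0 / \<eta> ^ (g + k))) + (\<Sum>g\<le>d. P g * (v * r) ^ g * (\<eta> ^ g / \<eta> ^ k))
      + (\<Sum>i\<in>{1..<d}. R i * (u ^ (d - i) * r ^ i) * (\<eta> ^ i / \<eta> ^ k)) + (\<Sum>i\<in>{1..<d}. R i * (v ^ (d - i) * p ^ i) * (\<eta> ^ 0 / \<eta> ^ (i + k))))"
  proof (rule sum.cong[OF refl])
    fix \<eta> assume "\<eta> \<in> \<mu>"
    have 1: "P g * ((u * (p / \<eta>)) ^ g + (v * (\<eta> * r)) ^ g) / \<eta> ^ k = P g * (u * p) ^ g * (\<eta> ^ 0 / \<eta> ^ (g + k)) + P g * (v * r) ^ g * (\<eta> ^ g / \<eta> ^ k)" for g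
      by (simp add: power_mult_distrib power_divide power_add add_divide_distrib distrib_left)
    have 2: "R i * (u ^ (d - i) * (\<eta> * r) ^ i + v ^ (d - i) * (p / \<eta>) ^ i) / \<eta> ^ k
        = R i * (u ^ (d - i) * r ^ i) * (\<eta> ^ i / \<eta> ^ k) + R i * (v ^ (d - i) * p ^ i) * (\<eta> ^ 0 / \<eta> ^ (i + k))" for i
      by (simp add: power_mult_distrib power_divide power_add add_divide_distrib distrib_left)
    show "((\<Sum>g\<le>d. P g * ((u * (p / \<eta>)) ^ g + (v * (\<eta> * r)) ^ g))
      + (\<Sum>i\<in>{1..<d}. R i * (u ^ (d - i) * (\<eta> * r) ^ i + v ^ (d - i) * (p / \<eta>) ^ i))) / \<eta> ^ k
      = (\<Sum>g\<le>d. P g * (u * p) ^ g * (\<eta> ^ 0 / \<eta> ^ (g + k))) + (\<Sum>g\<le>d. P g * (v * r) ^ g * (\<eta> ^ g / \<eta> ^ k))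
      + (\<Sum>i\<in>{1..<d}. R i * (u ^ (d - i) * r ^ i) * (\<eta> ^ i / \<eta> ^ k)) + (\<Sum>i\<in>{1..<d}. R i * (v ^ (d - i) * p ^ i) * (\<eta> ^ 0 / \<eta> ^ (i + k)))"
      unfolding add_divide_distrib sum_divide_distrib 1 2 sum.distrib by (simp only: add.assoc)
  qed
  also have "\<dots> = (\<Sum>g\<le>d. P g * (u * p) ^ g * \<sigma> 0 (g + k)) + (\<Sum>g\<le>d. P g * (v * r) ^ g * \<sigma> g k)
    + (\<Sum>i\<in>{1..<d}. R i * (u ^ (d - i) * r ^ i) * \<sigma> i k) + (\<Sum>i\<in>{1..<d}. R i * (v ^ (d - i) * p ^ i) * \<sigma> 0 (i + k))"
    unfolding \<sigma> sum.distrib sum_distrib_left by (simp only: sum.swap[of _ \<mu>])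
  finally show ?thesis by simp
qed

text \<open>The range g \<le> d contains both 0 and d, so mode 0 receives two power sums and every
  other mode only one from each side.\<close>

lemma mod_d_eq:
  assumes "k < d"
  shows "g \<le> d \<Longrightarrow> 0 mod d = (g + k) mod d \<longleftrightarrow> (if k = 0 then g = 0 \<or> g = d else g = d - k)"
    and "g \<le> d \<Longrightarrow> g mod d = k mod d \<longleftrightarrow> (if k = 0 then g = 0 \<or> g = d else g = k)"
proof -
  show "g mod d = k mod d \<longleftrightarrow> (if k = 0 then g = 0 \<or> g = d else g = k)" if "g \<le> d"
    using assms that by (cases "g = d") auto
  show "0 mod d = (g + k) mod d \<longleftrightarrow> (if k = 0 then g = 0 \<or> g = d else g = d - k)" if "g \<le> d"
  proof (cases "g + k < d")
    case True
    then show ?thesis using that assms by auto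
  next
    case False
    then have "(g + k) mod d = (g + k - d) mod d"
      by (simp add: le_mod_geq)
    then show ?thesis
      using False assms that d_pos by (cases "g + k - d = d") auto
  qed
qed

text \<open>In mode k survive the powers of vr with exponent k and of up with exponent d - k, and
  one half each of the symbols of a_k and a_(d-k). Sorted by powers of r and p, this is one linear
  equation in two unknown brackets.\<close>

lemma fourier_mode_inner:
  assumes H: "\<And>\<eta>. \<eta> \<in> \<mu> \<Longrightarrow> (\<Sum>g\<le>d. P g * ((u * (p / \<eta>)) ^ g + (v * (\<eta> * r)) ^ g))
      + (\<Sum>i\<in>{1..<d}. R i * (u ^ (d - i) * (\<eta> * r) ^ i + v ^ (d - i) * (p / \<eta>) ^ i)) = (0::complex)"
    and k: "1 \<le> k" "k < d"
  shows "(P k * v ^ k + R k * u ^ (d - k)) * r ^ k + (P (d - k) * u ^ (d - k) + R (d - k) * v ^ k) * p ^ (d - k) = 0"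
proof -
  have k': "k \<noteq> 0" "k \<le> d" "d - k \<le> d" "d - k \<in> {1..<d}" "k \<in> {1..<d}" "d - (d - k) = k"
    using k by auto
  have 1: "(\<Sum>g\<le>d. P g * (u * p) ^ g * (if 0 mod d = (g + k) mod d then of_nat d else 0)) = (\<Sum>g\<le>d. if g = d - k then of_nat d * (P g * (u * p) ^ g) else 0)"
    using mod_d_eq(1)[OF k(2)] k' by (intro sum.cong refl) simp
  have 2: "(\<Sum>g\<le>d. P g * (v * r) ^ g * (if g mod d = k mod d then of_nat d else 0)) = (\<Sum>g\<le>d. if g = k then of_nat d * (P g * (v * r) ^ g) else 0)"
    using mod_d_eq(2)[OF k(2)] k' by (intro sum.cong refl) simp
  have 3: "(\<Sum>i\<in>{1..<d}. R i * (u ^ (d - i) * r ^ i) * (if i mod d = k mod d then of_nat d else 0)) = (\<Sum>i\<in>{1..<d}. if i = k then of_nat d * (R i * (u ^ (d - i) * r ^ i)) else 0)"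
    using mod_d_eq(2)[OF k(2)] k' by (intro sum.cong refl) simp
  have 4: "(\<Sum>i\<in>{1..<d}. R i * (v ^ (d - i) * p ^ i) * (if 0 mod d = (i + k) mod d then of_nat d else 0)) = (\<Sum>i\<in>{1..<d}. if i = d - k then of_nat d * (R i * (v ^ (d - i) * p ^ i)) else 0)"
    using mod_d_eq(1)[OF k(2)] k' by (intro sum.cong refl) simp
  have "of_nat d * (P (d - k) * (u * p) ^ (d - k)) + of_nat d * (P k * (v * r) ^ k) + of_nat d * (R k * (u ^ (d - k) * r ^ k))
      + of_nat d * (R (d - k) * (v ^ k * p ^ (d - k))) = 0"
    using fourier_mode[OF H, where k = k] k'(2,3,4,5) unfolding 1 2 3 4 by (simp add: k'(6))
  then have "of_nat d * ((P k * v ^ k + R k * u ^ (d - k)) * r ^ k + (P (d - k) * u ^ (d - k) + R (d - k) * v ^ k) * p ^ (d - k)) = 0"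
    by (simp add: algebra_simps power_mult_distrib)
  then show ?thesis
    using d_pos by (simp only: mult_eq_0_iff of_nat_eq_0_iff) simp
qed

lemma fourier_mode_zero:
  assumes H: "\<And>\<eta>. \<eta> \<in> \<mu> \<Longrightarrow> (\<Sum>g\<le>d. P g * ((u * (p / \<eta>)) ^ g + (v * (\<eta> * r)) ^ g))
      + (\<Sum>i\<in>{1..<d}. R i * (u ^ (d - i) * (\<eta> * r) ^ i + v ^ (d - i) * (p / \<eta>) ^ i)) = (0::complex)"
  shows "2 * P 0 + P d * ((u * p) ^ d + (v * r) ^ d) = 0"
proof -
  have split: "(\<Sum>g\<le>d. if g = 0 \<or> g = d then f g else 0) = f 0 + f d" for f :: "nat \<Rightarrow> complex"
  proof -
    have "(\<Sum>g\<le>d. if g = 0 \<or> g = d then f g else 0) = (\<Sum>g\<in>{0, d}. f g)"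
      by (rule sum.mono_neutral_cong_right) auto
    then show ?thesis using d_pos by simp
  qed
  have 1: "(\<Sum>g\<le>d. P g * (u * p) ^ g * (if 0 mod d = (g + 0) mod d then of_nat d else 0)) = (\<Sum>g\<le>d. if g = 0 \<or> g = d then of_nat d * (P g * (u * p) ^ g) else 0)"
    using mod_d_eq(1)[OF d_pos] by (intro sum.cong refl) simp
  have 2: "(\<Sum>g\<le>d. P g * (v * r) ^ g * (if g mod d = 0 mod d then of_nat d else 0)) = (\<Sum>g\<le>d. if g = 0 \<or> g = d then of_nat d * (P g * (v * r) ^ g) else 0)"
    using mod_d_eq(2)[OF d_pos] by (intro sum.cong refl) simp
  have 3: "(\<Sum>i\<in>{1..<d}. R i * (u ^ (d - i) * r ^ i) * (if i mod d = 0 mod d then of_nat d else 0)) = 0"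
    "(\<Sum>i\<in>{1..<d}. R i * (v ^ (d - i) * p ^ i) * (if 0 mod d = (i + 0) mod d then of_nat d else 0)) = 0"
    by (intro sum.neutral ballI; simp)+
  have "of_nat d * (2 * P 0 + P d * ((u * p) ^ d + (v * r) ^ d)) = 0"
    using fourier_mode[OF H, where k = 0] unfolding 1 2 3 split by (simp add: algebra_simps)
  then show ?thesis
    using d_pos by (simp only: mult_eq_0_iff of_nat_eq_0_iff) simp
qed

lemma two_by_two:
  fixes X Y :: complex
  assumes "X * b + Y * c = 0" "X * e + Y * f = 0" "b * f \<noteq> e * c"
  shows "X = 0" "Y = 0"
proof -
  have "X * (b * f - e * c) = f * (X * b + Y * c) - c * (X * e + Y * f)" "Y * (b * f - e * c) = b * (X * e + Y * f) - e * (X * b + Y * c)"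
    by (simp_all add: algebra_simps)
  then have "X * (b * f - e * c) = 0" "Y * (b * f - e * c) = 0"
    by (simp_all only: assms mult_zero_right diff_self)
  then show "X = 0" "Y = 0"
    using assms(3) by simp_all
qed

text \<open>Replacing \<open>(p, r)\<close> by \<open>(p / \<eta>, \<eta> r)\<close> does not change the coefficients, which depend only on invariants.  A
  Fourier mode of the resulting identity in \<open>\<eta>\<close> involves the indices \<open>k\<close> and \<open>d - k\<close> only, and swapping
  \<open>u, v\<close> or \<open>p, r\<close> gives enough such equations.\<close>

lemma classical_fiber_independent:
  fixes P R :: "nat \<Rightarrow> complex"
  defines "Z u v p r \<equiv> (\<Sum>g\<le>d. P g * ((u * p) ^ g + (v * r) ^ g)) + (\<Sum>i\<in>{1..<d}. R i * (u ^ (d - i) * r ^ i + v ^ (d - i) * p ^ i))"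
  assumes H: "\<And>\<eta>. \<eta> \<in> \<mu> \<Longrightarrow> Z u v (p / \<eta>) (\<eta> * r) = 0" "\<And>\<eta>. \<eta> \<in> \<mu> \<Longrightarrow> Z u v (r / \<eta>) (\<eta> * p) = 0"
      "\<And>\<eta>. \<eta> \<in> \<mu> \<Longrightarrow> Z v u (p / \<eta>) (\<eta> * r) = 0" "\<And>\<eta>. \<eta> \<in> \<mu> \<Longrightarrow> Z v u (r / \<eta>) (\<eta> * p) = 0"
    and ne: "u ^ d \<noteq> v ^ d" "p ^ d \<noteq> r ^ d"
  shows "\<And>g. g \<le> d \<Longrightarrow> P g = 0" "\<And>i. 1 \<le> i \<Longrightarrow> i < d \<Longrightarrow> R i = 0"
proof -
  note H' = H[unfolded Z_def]
  have inner: "P k = 0 \<and> R k = 0" if k: "1 \<le> k" "k < d" for k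
  proof -
    have pw: "x ^ k * x ^ (d - k) = x ^ d" "x ^ (d - k) * x ^ k = x ^ d" for x :: complex
      using k by (simp_all flip: power_add)
    have det: "r ^ k * r ^ (d - k) \<noteq> p ^ k * p ^ (d - k)"
      unfolding pw by (rule ne(2)[symmetric])
    have e: "P k * v ^ k + R k * u ^ (d - k) = 0" "P k * u ^ k + R k * v ^ (d - k) = 0"
      by (rule two_by_two(1)[OF fourier_mode_inner[OF H'(1) k] fourier_mode_inner[OF H'(2) k] det], assumption+,
          rule two_by_two(1)[OF fourier_mode_inner[OF H'(3) k] fourier_mode_inner[OF H'(4) k] det], assumption+)
    have "v ^ k * v ^ (d - k) \<noteq> u ^ k * u ^ (d - k)"
      unfolding pw by (rule ne(1)[symmetric])
    from two_by_two[OF e this] show ?thesis by (rule conjI)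
  qed
  have "2 * P 0 + P d * ((u * p) ^ d + (v * r) ^ d) = 0" "2 * P 0 + P d * ((u * r) ^ d + (v * p) ^ d) = 0"
    by (rule fourier_mode_zero[OF H'(1)], assumption, rule fourier_mode_zero[OF H'(2)], assumption)
  then have eqs: "P 0 * 2 + P d * ((u * p) ^ d + (v * r) ^ d) = 0" "P 0 * 2 + P d * ((u * r) ^ d + (v * p) ^ d) = 0"
    by (simp_all only: mult.commute[of 2])
  have ne': "2 * ((u * r) ^ d + (v * p) ^ d) \<noteq> 2 * ((u * p) ^ d + (v * r) ^ d)"
  proof -
    have "(u * p) ^ d + (v * r) ^ d - ((u * r) ^ d + (v * p) ^ d) = (u ^ d - v ^ d) * (p ^ d - r ^ d)"
      by (simp add: power_mult_distrib algebra_simps)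
    also have "\<dots> \<noteq> 0" using ne by simp
    finally have "(u * r) ^ d + (v * p) ^ d \<noteq> (u * p) ^ d + (v * r) ^ d"
      by (simp only: right_minus_eq not_sym)
    then show ?thesis
      by (subst mult_left_cancel) simp_all
  qed
  have "P 0 = 0" "P d = 0"
    by (rule two_by_two(1)[OF eqs ne'], rule two_by_two(2)[OF eqs ne'])
  then show "P g = 0" if "g \<le> d" for g
  proof (cases "g = 0 \<or> g = d")
    case False
    then show ?thesis using inner[of g] that by simp
  qed (use \<open>P 0 = 0\<close> \<open>P d = 0\<close> in blast)
  show "R i = 0" if "1 \<le> i" "i < d" for i
    using inner that by blast
qed

text \<open>The d + 1 power sums, \<open>Inl\<close>, and the d - 1 inner a_i, \<open>Inr\<close>,
  make up the 2 d base elements. The outer a_0 and a_d belong to the coefficients.\<close>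

definition valid_base :: "nat + nat \<Rightarrow> bool" where
  "valid_base b \<longleftrightarrow> (case b of Inl g \<Rightarrow> g \<le> d | Inr i \<Rightarrow> 1 \<le> i \<and> i < d)"

definition base_cl :: "nat + nat \<Rightarrow> pt \<Rightarrow> complex" where
  "base_cl b z = (case b of Inl g \<Rightarrow> (cu z * cp z) ^ g + (cv z * cr z) ^ g
    | Inr i \<Rightarrow> cu z ^ (d - i) * cr z ^ i + cv z ^ (d - i) * cp z ^ i)"

type_synonym nf_index = "nat \<times> nat \<times> nat \<times> nat \<times> (nat + nat)"

fun nf_cl :: "nf_index \<Rightarrow> pt \<Rightarrow> complex" where
  "nf_cl (i, j, m, n, b) z = (cu z * cv z) ^ i * (cp z * cr z) ^ j * (cu z ^ d + cv z ^ d) ^ m * (cr z ^ d + cp z ^ d) ^ n * base_cl b z"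

fun nf_base :: "nf_index \<Rightarrow> nat + nat" where "nf_base (i, j, m, n, b) = b"

text \<open>Fix the values of uv, pr, u^d + v^d and p^d + r^d. Independence on the fibre kills the
  coefficient of each base element. As these four values range over enough choices, each such
  coefficient vanishes as a polynomial.\<close>

lemma nf_cl_independent:
  fixes c :: "nf_index \<Rightarrow> complex"
  assumes K: "finite K" "\<And>k. k \<in> K \<Longrightarrow> valid_base (nf_base k)" and van: "\<And>z. (\<Sum>k\<in>K. c k * nf_cl k z) = 0" and k0: "k0 \<in> K"
  shows "c k0 = 0"
proof -
  define e1 e2 e3 e4 :: "nf_index \<Rightarrow> nat" where e_def: "e1 = fst" "e2 = fst \<circ> snd" "e3 = fst \<circ> snd \<circ> snd" "e4 = fst \<circ> snd \<circ> snd \<circ> snd"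
  have nf: "nf_cl k z = (cu z * cv z) ^ e1 k * (cp z * cr z) ^ e2 k * (cu z ^ d + cv z ^ d) ^ e3 k * (cr z ^ d + cp z ^ d) ^ e4 k * base_cl (nf_base k) z" for k z
    by (cases k) (simp add: e_def)
  define F where "F b x y s t = (\<Sum>k\<in>{k\<in>K. nf_base k = b}. c k * x ^ e1 k * y ^ e2 k * s ^ e3 k * t ^ e4 k)" for b x y s t
  define T where "T x = {u ^ d + (x / u) ^ d | u. u \<noteq> 0 \<and> norm u \<noteq> norm (x / u)}" for x :: complex
  let ?B = "Inl ` {..d} \<union> Inr ` {1..<d}"
  have Fsum: "(\<Sum>b\<in>?B. F b (cu z * cv z) (cp z * cr z) (cu z ^ d + cv z ^ d) (cr z ^ d + cp z ^ d) * base_cl b z) = 0" for z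
  proof -
    have "(\<Sum>b\<in>?B. F b (cu z * cv z) (cp z * cr z) (cu z ^ d + cv z ^ d) (cr z ^ d + cp z ^ d) * base_cl b z)
        = (\<Sum>b\<in>?B. \<Sum>k\<in>{k\<in>K. nf_base k = b}. c k * nf_cl k z)"
      unfolding F_def sum_distrib_right by (intro sum.cong refl) (simp add: nf mult_ac)
    also have "\<dots> = (\<Sum>k\<in>K. c k * nf_cl k z)"
    proof (rule sum.group)
      show "nf_base ` K \<subseteq> ?B"
      proof (rule image_subsetI)
        fix k assume "k \<in> K"
        then have "valid_base (nf_base k)" by (rule K(2))
        then show "nf_base k \<in> ?B"
          by (cases "nf_base k") (auto simp: valid_base_def)
      qed
    qed (simp_all add: K(1))
    finally show ?thesis using van by simp
  qed
  have Bsum: "(\<Sum>b\<in>?B. G b) = (\<Sum>g\<le>d. G (Inl g)) + (\<Sum>i\<in>{1..<d}. G (Inr i))" for G :: "nat + nat \<Rightarrow> complex"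
    by (subst sum.union_disjoint) (auto simp: sum.reindex)
  have vb: "valid_base (nf_base k0)" by (rule K(2)[OF k0])
  show ?thesis
  proof (rule four_variable_vanish[where K = "{k\<in>K. nf_base k = nf_base k0}" and ?A1.0 = "UNIV - {0}" and ?A2.0 = "\<lambda>_. UNIV - {0}"
        and ?A3.0 = "\<lambda>x _. T x" and ?A4.0 = "\<lambda>_ y _. T y" and ?e1.0 = e1 and ?e2.0 = e2 and ?e3.0 = e3 and ?e4.0 = e4])
    show "infinite (UNIV - {0 :: complex})" by (simp add: infinite_UNIV_char_0)
    show "infinite (UNIV - {0 :: complex})" by (simp add: infinite_UNIV_char_0)
    show "infinite (T x)" if "x \<in> UNIV - {0}" for x
      unfolding T_def using infinite_power_sums[of x d] that d_pos by simp
    show "infinite (T y)" if "y \<in> UNIV - {0}" for y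
      unfolding T_def using infinite_power_sums[of y d] that d_pos by simp
    show "k = k'" if "k \<in> {k\<in>K. nf_base k = nf_base k0}" "k' \<in> {k\<in>K. nf_base k = nf_base k0}" "e1 k = e1 k'" "e2 k = e2 k'" "e3 k = e3 k'" "e4 k = e4 k'" for k k'
      using that by (cases k; cases k') (simp add: e_def)
    show "k0 \<in> {k\<in>K. nf_base k = nf_base k0}" using k0 by simp
    show "finite {k\<in>K. nf_base k = nf_base k0}" using K(1) by simp
  next
    fix x y s t :: complex
    assume x: "x \<in> UNIV - {0}" and y: "y \<in> UNIV - {0}" and s: "s \<in> T x" and t: "t \<in> T y"
    obtain u where u: "s = u ^ d + (x / u) ^ d" "u \<noteq> 0" "norm u \<noteq> norm (x / u)" using s by (auto simp: T_def)
    obtain p where p: "t = p ^ d + (y / p) ^ d" "p \<noteq> 0" "norm p \<noteq> norm (y / p)" using t by (auto simp: T_def)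
    define v r where "v = x / u" and "r = y / p"
    have uv: "u \<noteq> 0" "v \<noteq> 0" "norm u \<noteq> norm v" "u * v = x" "s = u ^ d + v ^ d"
      using u x by (auto simp: v_def)
    have pr: "p * r = y" "t = p ^ d + r ^ d" "p \<noteq> 0" "r \<noteq> 0" "norm p \<noteq> norm r"
      using p y by (auto simp: r_def)
    let ?P = "\<lambda>g. F (Inl g) x y s t" and ?R = "\<lambda>i. F (Inr i) x y s t"
    \<comment> \<open>The coefficients depend only on the four invariants, so the equation holds at
      every point with the same invariants. Rotated and swapped points supply the hypotheses of the
      fibre argument.\<close>
    have Z: "(\<Sum>g\<le>d. ?P g * ((u' * p') ^ g + (v' * r') ^ g)) + (\<Sum>i\<in>{1..<d}. ?R i * (u' ^ (d - i) * r' ^ i + v' ^ (d - i) * p' ^ i)) = 0"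
      if "u' \<noteq> 0" "v' \<noteq> 0" "norm u' \<noteq> norm v'" "u' * v' = x" "p' * r' = y" "u' ^ d + v' ^ d = s" "r' ^ d + p' ^ d = t" for u' v' p' r'
    proof -
      note c = mkpt_coords[OF that(1,2,3), of p' r']
      show ?thesis
        using Fsum[of "mkpt u' v' p' r'"] unfolding Bsum base_cl_def c that by simp
    qed
    have ne: "u ^ d \<noteq> v ^ d" "p ^ d \<noteq> r ^ d"
    proof -
      have "norm x = norm y" if "x ^ d = y ^ d" for x y :: complex
      proof -
        have "norm x ^ d = norm y ^ d" using that by (simp flip: norm_power)
        then show ?thesis
          using power_eq_imp_eq_base[of "norm x" d "norm y"] d_pos by simp
      qed
      then show "u ^ d \<noteq> v ^ d" "p ^ d \<noteq> r ^ d" using uv(3) pr(5) by blast+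
    qed
    have e: "(a / \<eta>) * (\<eta> * b) = a * b" "(\<eta> * b) ^ d + (a / \<eta>) ^ d = b ^ d + a ^ d" if "\<eta> \<in> \<mu>" for a b \<eta>
      using that mu_nonzero[OF that] mu_pow[OF that] by (simp_all add: power_mult_distrib power_divide)
    have P0: "?P g = 0" if "g \<le> d" for g
      using that uv pr ne
      by (intro classical_fiber_independent(1)[where P = ?P and R = ?R and u = u and v = v and p = p and r = r] Z;
          simp add: e mu_nonzero mult.commute add.commute)
    have R0: "?R i = 0" if "1 \<le> i" "i < d" for i
      using that uv pr ne
      by (intro classical_fiber_independent(2)[where P = ?P and R = ?R and u = u and v = v and p = p and r = r] Z;
          simp add: e mu_nonzero mult.commute add.commute)
    have "F (nf_base k0) x y s t = 0"
    proof (cases "nf_base k0")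
      case (Inl g)
      then show ?thesis using vb P0[of g] by (simp add: valid_base_def)
    next
      case (Inr i)
      then show ?thesis using vb R0[of i] by (simp add: valid_base_def)
    qed
    then show "(\<Sum>k\<in>{k\<in>K. nf_base k = nf_base k0}. c k * x ^ e1 k * y ^ e2 k * s ^ e3 k * t ^ e4 k) = 0"
      by (simp add: F_def)
  qed
qed

end

section \<open>The kernel of the presentation\<close>

context cherednik_param
begin

section \<open>Reduction to normal forms modulo the relations\<close>

lemma rel_ideal_add: "p \<in> rel_ideal \<Longrightarrow> q \<in> rel_ideal \<Longrightarrow> p + q \<in> rel_ideal"
  using additive_subgroup.a_closed[OF ideal.axioms(1)[OF ideal_rel_ideal], of p q] by simp

lemma rel_ideal_mult: "p \<in> rel_ideal \<Longrightarrow> q \<in> mcarrier (zgens d) \<Longrightarrow> q * p \<in> rel_ideal"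
  using ideal.I_l_closed[OF ideal_rel_ideal, of p q] by simp

lemma rel_ideal_gen: "p \<in> center_rels d a \<Longrightarrow> p \<in> rel_ideal"
  unfolding rel_ideal_def using ring.genideal_self[OF ring_mpoly center_rels_carrier] by blast

lemma rel_ideal_linear:
  "1 \<le> i \<Longrightarrow> i < d \<Longrightarrow> pvar Geu * pvar (Ga i) - (pvar Gq * pvar (Ga (i + 1)) + pvar GQ * pvar (Ga (i - 1))) \<in> rel_ideal"
  by (rule rel_ideal_gen, unfold center_rels_def, rule UnI1, rule CollectI, rule exI[of _ i]) simp

lemma rel_ideal_quadratic:
  "1 \<le> i \<Longrightarrow> i \<le> j \<Longrightarrow> j < d \<Longrightarrow> (pvar (Ga (i - 1)) * pvar (Ga (j + 1)) - pvar (Ga i) * pvar (Ga j))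
      - (pvar Geu ^ 2 - 4 * pvar Gq * pvar GQ - pconst (of_nat d ^ 2 * a ^ 2))
        * pvar Gq ^ (d - j - 1) * pvar GQ ^ (i - 1) * Psi (j - i) (pvar Geu) (pvar Gq) (pvar GQ) \<in> rel_ideal"
  by (rule rel_ideal_gen, unfold center_rels_def, rule UnI2, rule CollectI, rule exI[of _ i], rule exI[of _ j]) simp

abbreviation L :: "nat \<Rightarrow> zgen mpoly" where
  "L n \<equiv> Luc n (pvar Geu) (pvar Gq * pvar GQ)"

abbreviation psi :: "nat \<Rightarrow> zgen mpoly" where
  "psi n \<equiv> Psi n (pvar Geu) (pvar Gq) (pvar GQ)"

fun base_poly :: "nat + nat \<Rightarrow> zgen mpoly" where
  "base_poly (Inl g) = L g" | "base_poly (Inr i) = pvar (Ga i)"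

fun nf_poly :: "nf_index \<Rightarrow> zgen mpoly" where
  "nf_poly (i, j, m, n, b) = pvar Gq ^ i * pvar GQ ^ j * pvar (Ga 0) ^ m * pvar (Ga d) ^ n * base_poly b"

text \<open>The base elements are power sums in \<open>xX\<close>, \<open>yY\<close> rather than powers of \<open>eu\<close> so that each symbol has
  only two Fourier modes.\<close>

inductive_set nf_span :: "zgen mpoly set" where
  ideal: "p \<in> rel_ideal \<Longrightarrow> p \<in> nf_span"
| normal: "valid_base b \<Longrightarrow> pconst y * nf_poly (i, j, m, n, b) \<in> nf_span"
| add: "p \<in> nf_span \<Longrightarrow> q \<in> nf_span \<Longrightarrow> p + q \<in> nf_span"

lemma nf_span_scal: "p \<in> nf_span \<Longrightarrow> pconst y * p \<in> nf_span"
proof (induction rule: nf_span.induct)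
  case (ideal p)
  then show ?case by (intro nf_span.ideal rel_ideal_mult mcarrier_pconst)
next
  case (normal b z i j m n)
  then show ?case unfolding pconst_collect by (rule nf_span.normal)
next
  case (add p q)
  then show ?case unfolding distrib_left by (intro nf_span.add)
qed

lemma nf_span_diff: "p \<in> nf_span \<Longrightarrow> q \<in> nf_span \<Longrightarrow> p - q \<in> nf_span"
  using nf_span.add[of p "pconst (-1) * q"] nf_span_scal[of q "-1"] by (simp add: pconst_uminus)

lemma nf_span_cong: "q - p \<in> rel_ideal \<Longrightarrow> p \<in> nf_span \<Longrightarrow> q \<in> nf_span"
  using nf_span.add[OF nf_span.ideal, of "q - p" p] by simp

lemma nf_span_gen:
  assumes "v \<in> {Gq, GQ, Ga 0, Ga d}" "p \<in> nf_span"
  shows "pvar v * p \<in> nf_span"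
  using assms(2)
proof (induction rule: nf_span.induct)
  case (ideal p)
  have "v \<in> zgens d" using assms(1) by (auto simp: zgens_def)
  with ideal show ?case by (intro nf_span.ideal rel_ideal_mult mcarrier_pvar)
next
  case (normal b y i j m n)
  note * = nf_span.normal[OF normal, of y]
  consider "v = Gq" | "v = GQ" | "v = Ga 0" | "v = Ga d" using assms(1) by blast
  then show ?case
  proof cases
    case 1 then show ?thesis using *[of "Suc i" j m n] by (simp add: mult_ac)
  next
    case 2 then show ?thesis using *[of i "Suc j" m n] by (simp add: mult_ac)
  next
    case 3 then show ?thesis using *[of i j "Suc m" n] by (simp add: mult_ac)
  next
    case 4 then show ?thesis using *[of i j m "Suc n"] by (simp add: mult_ac)
  qed
next
  case (add p q)
  then show ?case unfolding distrib_left by (intro nf_span.add)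
qed

lemma nf_span_pow:
  assumes "v \<in> {Gq, GQ, Ga 0, Ga d}" "p \<in> nf_span"
  shows "pvar v ^ n * p \<in> nf_span"
  by (induction n) (use assms nf_span_gen[OF assms(1)] in \<open>simp_all add: mult.assoc\<close>)

lemma nf_span_base: "valid_base b \<Longrightarrow> base_poly b \<in> nf_span"
  using nf_span.normal[of b 1 0 0 0 0] by simp

text \<open>Up to the ideal the span is a module over the polynomials in q, Q, a_0 and a_d, so
  closure under multiplication is tested on base elements.\<close>

lemma nf_span_mult:
  assumes "r \<in> mcarrier (zgens d)" "\<And>b. valid_base b \<Longrightarrow> r * base_poly b \<in> nf_span" "p \<in> nf_span"
  shows "r * p \<in> nf_span"
  using assms(3)
proof (induction rule: nf_span.induct)
  case (ideal p)
  with assms(1) show ?case by (intro nf_span.ideal rel_ideal_mult)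
next
  case (normal b y i j m n)
  have "r * (pconst y * nf_poly (i, j, m, n, b))
      = pconst y * (pvar Gq ^ i * (pvar GQ ^ j * (pvar (Ga 0) ^ m * (pvar (Ga d) ^ n * (r * base_poly b)))))"
    by (simp only: nf_poly.simps mult_ac)
  also have "\<dots> \<in> nf_span"
    by (intro nf_span_scal nf_span_pow assms(2)[OF normal]) simp_all
  finally show ?case .
next
  case (add p q)
  then show ?case unfolding distrib_left by (intro nf_span.add)
qed

lemma nf_span_qQ: "p \<in> nf_span \<Longrightarrow> pvar Gq * pvar GQ * p \<in> nf_span"
  unfolding mult.assoc by (intro nf_span_gen) simp_all

lemma nf_span_Luc: "n \<le> d \<Longrightarrow> L n \<in> nf_span"
  using nf_span_base[of "Inl n"] by (simp add: valid_base_def)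

lemma nf_span_one: "1 \<in> nf_span"
proof -
  \<comment> \<open>\<open>L 0\<close> is the constant 2, so the unit is half of a base
    element.\<close>
  have "pconst (1 / 2) * L 0 = pconst (1 / 2) * pconst 2"
    by (simp only: pconst_numeral Luc.simps)
  also have "\<dots> = 1" by (simp flip: pconst_mult)
  finally show ?thesis
    using nf_span_scal[OF nf_span_Luc[of 0], of "1 / 2"] by simp
qed

lemma nf_span_Psi: "n \<le> d \<Longrightarrow> psi n \<in> nf_span"
proof (induction n rule: less_induct)
  case (less n)
  consider "n = 0" | "n = 1" | k where "n = Suc (Suc k)"
    by (metis One_nat_def not0_implies_Suc)
  then show ?case
  proof cases
    case 1
    then show ?thesis by (simp add: nf_span_one)
  next
    case 2
    then show ?thesis using nf_span_Luc[of 1] less.prems by simp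
  next
    case 3
    have "L n + pvar Gq * pvar GQ * psi k \<in> nf_span"
      using 3 less.prems by (intro nf_span.add nf_span_qQ nf_span_Luc less.IH) simp_all
    then show ?thesis
      unfolding 3 Psi_Suc_Suc .
  qed
qed

lemma discriminant_Psi:
  "(pvar Geu ^ 2 - 4 * pvar Gq * pvar GQ - pconst z) * psi n = L (Suc (Suc n)) - pvar Gq * pvar GQ * L n - pconst z * psi n"
  unfolding left_diff_distrib[of _ "pconst z"] mult.assoc[of 4] Psi_discriminant ..

text \<open>This is the factor on the right of the quadratic relations. The bound keeps the highest
  power sum, of index n + 2, among the base elements.\<close>

lemma nf_span_discriminant:
  "n + 2 \<le> d \<Longrightarrow> (pvar Geu ^ 2 - 4 * pvar Gq * pvar GQ - pconst z) * psi n \<in> nf_span"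
  unfolding discriminant_Psi
  by (intro nf_span_diff nf_span_Luc nf_span_qQ nf_span_scal nf_span_Psi) simp_all

lemma nf_span_a:
  assumes "j \<le> d"
  shows "pvar (Ga j) \<in> nf_span"
proof -
  consider "j = 0" | "j = d" | "1 \<le> j" "j < d" using assms by linarith
  then show ?thesis
  proof cases
    case 1
    then show ?thesis using nf_span_gen[OF _ nf_span_one, of "Ga 0"] by simp
  next
    case 2
    then show ?thesis using nf_span_gen[OF _ nf_span_one, of "Ga d"] by simp
  next
    case 3
    then show ?thesis using nf_span_base[of "Inr j"] by (simp add: valid_base_def)
  qed
qed

text \<open>A quadratic relation moves the two indices apart by one each. The process stops when one
  of them is 0 or d, where the factor is a coefficient.\<close>

lemma nf_span_a_a_le: "i \<le> j \<Longrightarrow> j \<le> d \<Longrightarrow> pvar (Ga i) * pvar (Ga j) \<in> nf_span"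
proof (induction i arbitrary: j)
  case 0
  then show ?case by (intro nf_span_gen nf_span_a) simp_all
next
  case (Suc i)
  show ?case
  proof (cases "j = d")
    case True
    then have "pvar (Ga d) * pvar (Ga (Suc i)) \<in> nf_span"
      using Suc.prems by (intro nf_span_gen nf_span_a) simp_all
    then show ?thesis using True by (simp only: mult.commute)
  next
    case False
    let ?D = "pvar Geu ^ 2 - 4 * pvar Gq * pvar GQ - pconst (of_nat d ^ 2 * a ^ 2)"
    let ?w = "pvar Gq ^ (d - j - 1) * (pvar GQ ^ i * (?D * psi (j - Suc i)))"
    have "pvar (Ga i) * pvar (Ga (j + 1)) - pvar (Ga (Suc i)) * pvar (Ga j) - ?D * pvar Gq ^ (d - j - 1) * pvar GQ ^ i * psi (j - Suc i) \<in> rel_ideal"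
      using rel_ideal_quadratic[of "Suc i" j] Suc.prems False by simp
    then have "pconst (- 1) * (pvar (Ga i) * pvar (Ga (j + 1)) - pvar (Ga (Suc i)) * pvar (Ga j) - ?D * pvar Gq ^ (d - j - 1) * pvar GQ ^ i * psi (j - Suc i)) \<in> rel_ideal"
      by (rule rel_ideal_mult[OF _ mcarrier_pconst])
    moreover have "?D * pvar Gq ^ (d - j - 1) * pvar GQ ^ i * psi (j - Suc i) = ?w"
      by (simp only: mult_ac)
    ultimately have "pvar (Ga (Suc i)) * pvar (Ga j) - (pvar (Ga i) * pvar (Ga (j + 1)) - ?w) \<in> rel_ideal"
      by (simp only: pconst_uminus pconst_1 mult_minus1 minus_diff_eq diff_diff_eq2) (simp only: add_ac diff_conv_add_uminus minus_add_distrib minus_minus)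
    moreover have "pvar (Ga i) * pvar (Ga (j + 1)) - ?w \<in> nf_span"
      using Suc.prems False by (intro nf_span_diff Suc.IH nf_span_pow nf_span_discriminant) simp_all
    ultimately show ?thesis by (rule nf_span_cong)
  qed
qed

lemma nf_span_a_a: "i \<le> d \<Longrightarrow> j \<le> d \<Longrightarrow> pvar (Ga i) * pvar (Ga j) \<in> nf_span"
  using nf_span_a_a_le[of i j] nf_span_a_a_le[of j i] by (cases "i \<le> j") (simp_all add: mult.commute)

lemma nf_span_eu_Luc:
  assumes "n < d"
  shows "pvar Geu * L n \<in> nf_span"
proof (cases n)
  case 0
  have "L 1 + L 1 \<in> nf_span"
    using assms by (intro nf_span.add nf_span_Luc) simp_all
  then show ?thesis unfolding 0 Luc.simps mult_2_right by simp
next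
  case (Suc k)
  have "L (Suc (Suc k)) + pvar Gq * pvar GQ * L k \<in> nf_span"
    using assms Suc by (intro nf_span.add nf_span_Luc nf_span_qQ) simp_all
  then show ?thesis using Suc by simp
qed

lemma nf_span_eu_Psi:
  assumes "n < d"
  shows "pvar Geu * psi n \<in> nf_span"
proof (cases n)
  case 0
  then show ?thesis using nf_span_Luc[of 1] assms by simp
next
  case (Suc k)
  have "psi (Suc (Suc k)) + pvar Gq * pvar GQ * psi k \<in> nf_span"
    using assms Suc by (intro nf_span.add nf_span_Psi nf_span_qQ) simp_all
  then show ?thesis using Suc by simp
qed

text \<open>The power \<open>L d\<close> is traded for \<open>a\<^sub>0 a\<^sub>d - a\<^sub>1 a\<^bsub>d-1\<^esub>\<close> by the quadratic relation with \<open>i = 1\<close>, \<open>j = d - 1\<close>.\<close>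

lemma nf_span_eu_Luc_d: "pvar Geu * L d \<in> nf_span"
proof -
  obtain n where n: "d = Suc (Suc n)"
    using d_ge_2 by (metis Suc_le_D numeral_2_eq_2 Suc_le_mono)
  let ?z = "of_nat d ^ 2 * a ^ 2" and ?qQ = "pvar Gq * pvar GQ" and ?e = "pvar Geu"
  let ?r1 = "pvar (Ga 0) * pvar (Ga d) - pvar (Ga 1) * pvar (Ga (d - 1)) - (L d - ?qQ * L n - pconst ?z * psi n)"
  let ?r2 = "?e * pvar (Ga 1) - (pvar Gq * pvar (Ga 2) + pvar GQ * pvar (Ga 0))"
  have "?r1 \<in> rel_ideal"
    using rel_ideal_quadratic[of 1 "d - 1"] unfolding n discriminant_Psi[symmetric] by simp
  moreover have "?r2 \<in> rel_ideal"
    using rel_ideal_linear[of 1] d_ge_2 by (simp add: numeral_2_eq_2)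
  ultimately have r: "pconst (- 1) * (?e * ?r1 + pvar (Ga (d - 1)) * ?r2) \<in> rel_ideal"
    by (intro rel_ideal_mult rel_ideal_add mcarrier_pconst mcarrier_pvar) (simp_all add: zgens_def)
  define w where "w = pvar (Ga 0) * (pvar (Ga d) * ?e) - (pvar Gq * (pvar (Ga 2) * pvar (Ga (d - 1))) + pvar GQ * (pvar (Ga 0) * pvar (Ga (d - 1))))
      + (?qQ * (?e * L n) + pconst ?z * (?e * psi n))"
  have e: "?e \<in> nf_span"
    using nf_span_Luc[of 1] d_ge_2 by simp
  have "w \<in> nf_span"
    unfolding w_def using n
    by (intro nf_span.add nf_span_diff nf_span_qQ nf_span_scal nf_span_eu_Luc nf_span_eu_Psi nf_span_gen[OF _ nf_span_a_a]
        nf_span_gen[OF _ nf_span_gen[OF _ e]]) simp_all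
  moreover have "?e * L d - w = pconst (- 1) * (?e * ?r1 + pvar (Ga (d - 1)) * ?r2)"
  proof -
    have "e * l - (a0 * (ad * e) - (q * (a2 * b) + r * (a0 * b)) + (s * (e * m) + k * (e * p)))
        = - (e * (a0 * ad - a1 * b - (l - s * m - k * p)) + b * (e * a1 - (q * a2 + r * a0)))"
      for e l a0 ad q a2 b r s m k p a1 :: "zgen mpoly"
      by (simp add: algebra_simps)
    then show ?thesis
      unfolding w_def pconst_uminus pconst_1 mult_minus1 .
  qed
  ultimately show ?thesis
    using r by (intro nf_span_cong[of "?e * L d" w]) simp_all
qed

lemma nf_span_eu: "p \<in> nf_span \<Longrightarrow> pvar Geu * p \<in> nf_span"
proof (rule nf_span_mult)
  show "pvar Geu \<in> mcarrier (zgens d)"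
    by (rule mcarrier_pvar) (simp add: zgens_def)
  fix b assume b: "valid_base b"
  show "pvar Geu * base_poly b \<in> nf_span"
  proof (cases b)
    case (Inl g)
    then show ?thesis
      using b nf_span_eu_Luc[of g] nf_span_eu_Luc_d by (cases "g = d") (simp_all add: valid_base_def)
  next
    case (Inr i)
    then have i: "1 \<le> i" "i < d" using b by (simp_all add: valid_base_def)
    have "pvar Gq * pvar (Ga (i + 1)) + pvar GQ * pvar (Ga (i - 1)) \<in> nf_span"
      using i by (intro nf_span.add nf_span_gen nf_span_a) simp_all
    then show ?thesis
      unfolding Inr base_poly.simps by (rule nf_span_cong[OF rel_ideal_linear[OF i]])
  qed
qed

lemma nf_span_Luc_mult: "p \<in> nf_span \<Longrightarrow> L g * p \<in> nf_span"
proof (induction g rule: less_induct)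
  case (less g)
  consider "g = 0" | "g = 1" | k where "g = Suc (Suc k)"
    by (metis One_nat_def not0_implies_Suc)
  then show ?case
  proof cases
    case 1
    show ?thesis unfolding 1 Luc.simps mult_2 by (rule nf_span.add[OF less.prems less.prems])
  next
    case 2
    then show ?thesis using nf_span_eu[OF less.prems] by simp
  next
    case 3
    have "pvar Geu * (L (Suc k) * p) - pvar Gq * pvar GQ * (L k * p) \<in> nf_span"
      using 3 less.prems by (intro nf_span_diff nf_span_eu nf_span_qQ less.IH) simp_all
    then show ?thesis
      unfolding 3 by (simp add: left_diff_distrib mult.assoc)
  qed
qed

lemma nf_span_a_mult:
  assumes i: "i \<le> d"
  shows "p \<in> nf_span \<Longrightarrow> pvar (Ga i) * p \<in> nf_span"
proof (rule nf_span_mult)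
  show "pvar (Ga i) \<in> mcarrier (zgens d)"
    using i by (intro mcarrier_pvar) (simp add: zgens_def)
  fix b assume b: "valid_base b"
  show "pvar (Ga i) * base_poly b \<in> nf_span"
  proof (cases b)
    case (Inl g)
    then show ?thesis
      using nf_span_Luc_mult[OF nf_span_a[OF i], of g] by (simp add: mult.commute)
  next
    case (Inr j)
    then show ?thesis
      using nf_span_a_a[OF i, of j] b by (simp add: valid_base_def)
  qed
qed

lemma nf_span_UNIV: "p \<in> mcarrier (zgens d) \<Longrightarrow> p \<in> nf_span"
proof (induction p rule: mpoly_induct)
  case (const z)
  show ?case using nf_span_scal[OF nf_span_one, of z] by simp
next
  case (add p q)
  then show ?case by (rule nf_span.add)
next
  case (mult_var p v)
  consider "v = Gq" | "v = GQ" | "v = Geu" | i where "v = Ga i" "i \<le> d"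
    using mult_var(2) by (auto simp: zgens_def)
  then show ?case
    by cases (simp_all add: mult_var(1) nf_span_gen nf_span_eu nf_span_a_mult)
qed

text \<open>Collecting the normal forms in a finitely supported function merges equal indices, as a
  statement on linear independence requires.\<close>

lemma nf_span_extract:
  "p \<in> nf_span \<Longrightarrow> \<exists>w. (\<forall>k\<in>Poly_Mapping.keys w. valid_base (nf_base k)) \<and> p - pext (\<lambda>k y. pconst y * nf_poly k) w \<in> rel_ideal"
proof (induction rule: nf_span.induct)
  case (ideal p)
  then show ?case by (intro exI[of _ 0]) simp
next
  case (normal b y i j m n)
  have "(0 :: zgen mpoly) \<in> rel_ideal"
    using additive_subgroup.zero_closed[OF ideal.axioms(1)[OF ideal_rel_ideal]] by simp
  with normal show ?case by (intro exI[of _ "Poly_Mapping.single (i, j, m, n, b) y"]) simp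
next
  case (add p q)
  let ?E = "pext (\<lambda>k y. pconst y * nf_poly k)"
  obtain v w where v: "\<forall>k\<in>Poly_Mapping.keys v. valid_base (nf_base k)" "p - ?E v \<in> rel_ideal"
    and w: "\<forall>k\<in>Poly_Mapping.keys w. valid_base (nf_base k)" "q - ?E w \<in> rel_ideal"
    using add.IH by blast
  have "?E (v + w) = ?E v + ?E w"
    by (rule pext_add) (simp_all add: pconst_add distrib_right)
  then have "p + q - ?E (v + w) = (p - ?E v) + (q - ?E w)" by simp
  then have "p + q - ?E (v + w) \<in> rel_ideal"
    using rel_ideal_add[OF v(2) w(2)] by (simp only:)
  moreover have "\<forall>k\<in>Poly_Mapping.keys (v + w). valid_base (nf_base k)"
    using v(1) w(1) keys_add[of v w] by blast
  ultimately show ?case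
    by blast
qed

section \<open>Symbols of the normal forms and the kernel\<close>

lemma sc_limit_power: "sc_limit M f h \<Longrightarrow> sc_limit (M * n) (\<lambda>z. f z ^ n) (\<lambda>z. h z ^ n)"
  using sc_limit_const[of 1] by (induction n) (simp_all add: sc_limit_mult)

lemma sc_limit_Luc:
  "sc_limit (2 * n) (\<lambda>z. Luc n (eu_fun z) (cu z * cv z * Q_fun a z)) (\<lambda>z. (cu z * cp z) ^ n + (cv z * cr z) ^ n)"
proof -
  let ?f = "\<lambda>n z. Luc n (eu_fun z) (cu z * cv z * Q_fun a z)" and ?h = "\<lambda>n z. Luc n (eu_fun z) (cu z * cv z * (cp z * cr z))"
  have "sc_limit (2 * n) (?f n) (?h n)"
  proof (induction n rule: less_induct)
    case (less n)
    consider "n = 0" | "n = 1" | k where "n = Suc (Suc k)"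
      by (metis One_nat_def not0_implies_Suc)
    then show ?case
    proof cases
      case 1
      then show ?thesis using sc_limit_const[of 2] by simp
    next
      case 2
      then show ?thesis using sc_limit_gen(3) by simp
    next
      case 3
      have wt: "2 + 2 * Suc k = 2 * Suc (Suc k)" "2 + 2 + 2 * k = 2 * Suc (Suc k)"
        by simp_all
      have e: "sc_limit (2 + 2 * Suc k) (\<lambda>z. eu_fun z * ?f (Suc k) z) (\<lambda>z. eu_fun z * ?h (Suc k) z)"
        using 3 by (intro sc_limit_mult sc_limit_gen(3) less.IH) simp
      have q: "sc_limit (2 + 2 + 2 * k) (\<lambda>z. cu z * cv z * Q_fun a z * ?f k z) (\<lambda>z. cu z * cv z * (cp z * cr z) * ?h k z)"
        using 3 by (intro sc_limit_mult sc_limit_gen(1,2) less.IH) simp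
      show ?thesis
        unfolding 3 Luc.simps by (rule sc_limit_diff[OF e[unfolded wt] q[unfolded wt]])
    qed
  qed
  moreover have "?h n z = (cu z * cp z) ^ n + (cv z * cr z) ^ n" for z
    using Luc_sum[of n "cu z * cp z" "cv z * cr z"] by (simp add: eu_fun_def mult_ac)
  ultimately show ?thesis by simp
qed

fun nf_wt :: "nf_index \<Rightarrow> nat" where
  "nf_wt (i, j, m, n, b) = 2 * i + 2 * j + d * m + d * n + (case b of Inl g \<Rightarrow> 2 * g | Inr i \<Rightarrow> d)"

lemma sc_limit_nf:
  assumes "valid_base (nf_base k)"
  shows "sc_limit (nf_wt k) (\<lambda>z. ev (gen_fun a z) (nf_poly k)) (nf_cl k)"
proof -
  obtain i j m n b where k: "k = (i, j, m, n, b)" by (cases k)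
  have b: "sc_limit (case b of Inl g \<Rightarrow> 2 * g | Inr i \<Rightarrow> d) (\<lambda>z. ev (gen_fun a z) (base_poly b)) (base_cl b)"
  proof (cases b)
    case (Inl g)
    then show ?thesis
      using sc_limit_Luc[of g] by (simp add: ev_Luc ev_hom base_cl_def[abs_def])
  next
    case (Inr i)
    then show ?thesis
      using sc_limit_gen(4)[of i a] assms by (simp add: k ev_hom base_cl_def[abs_def] valid_base_def)
  qed
  have "sc_limit d (a_fun a 0) (\<lambda>z. cu z ^ d + cv z ^ d)" "sc_limit d (a_fun a d) (\<lambda>z. cr z ^ d + cp z ^ d)"
    using sc_limit_gen(4)[of 0 a] sc_limit_gen(4)[of d a] by simp_all
  then have "sc_limit (2 * i + 2 * j + d * m + d * n + (case b of Inl g \<Rightarrow> 2 * g | Inr i \<Rightarrow> d))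
    (\<lambda>z. (cu z * cv z) ^ i * Q_fun a z ^ j * a_fun a 0 z ^ m * a_fun a d z ^ n * ev (gen_fun a z) (base_poly b))
    (\<lambda>z. (cu z * cv z) ^ i * (cp z * cr z) ^ j * (cu z ^ d + cv z ^ d) ^ m * (cr z ^ d + cp z ^ d) ^ n * base_cl b z)"
    by (intro sc_limit_mult sc_limit_power sc_limit_gen(1,2) b)
  moreover have "nf_cl k = (\<lambda>z. (cu z * cv z) ^ i * (cp z * cr z) ^ j * (cu z ^ d + cv z ^ d) ^ m * (cr z ^ d + cp z ^ d) ^ n * base_cl b z)"
    by (rule ext) (simp add: k)
  ultimately show ?thesis
    by (simp only: k nf_wt.simps nf_poly.simps ev_hom ev_power gen_fun.simps)
qed

lemma sc_limit_sum:
  "(\<And>k. k \<in> K \<Longrightarrow> sc_limit N (f k) (h k)) \<Longrightarrow> sc_limit N (\<lambda>z. \<Sum>k\<in>K. f k z) (\<lambda>z. \<Sum>k\<in>K. h k z)"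
  by (induction K rule: infinite_finite_induct) (simp_all add: sc_limit_zero sc_limit_add)

lemma sc_limit_vanish: "sc_limit N (\<lambda>_. 0) h \<Longrightarrow> h z = 0"
  unfolding sc_limit_def using tendsto_unique[OF at_neq_bot tendsto_const] by fastforce

text \<open>In a vanishing combination the symbols of the terms of maximal weight cancel among
  themselves, and independence of the classical normal forms makes their coefficients zero.\<close>

lemma nf_poly_independent:
  assumes valid: "\<And>k. k \<in> Poly_Mapping.keys w \<Longrightarrow> valid_base (nf_base k)"
    and van: "\<And>z. (\<Sum>k\<in>Poly_Mapping.keys w. Poly_Mapping.lookup w k * ev (gen_fun a z) (nf_poly k)) = 0"
  shows "w = 0"
proof (rule ccontr)
  let ?K = "Poly_Mapping.keys w" and ?w = "Poly_Mapping.lookup w"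
  assume "w \<noteq> 0"
  then have ne: "?K \<noteq> {}" by simp
  define N where "N = Max (nf_wt ` ?K)"
  have "N \<in> nf_wt ` ?K"
    unfolding N_def using ne by (intro Max_in) simp_all
  then obtain k0 where k0: "k0 \<in> ?K" "nf_wt k0 = N" by blast
  have "sc_limit N (\<lambda>z. \<Sum>k\<in>?K. ?w k * ev (gen_fun a z) (nf_poly k)) (\<lambda>z. \<Sum>k\<in>?K. if nf_wt k = N then ?w k * nf_cl k z else 0)"
  proof (rule sc_limit_sum)
    fix k assume k: "k \<in> ?K"
    have le: "nf_wt k \<le> N" unfolding N_def using k by simp
    have "sc_limit (0 + nf_wt k) (\<lambda>z. ?w k * ev (gen_fun a z) (nf_poly k)) (\<lambda>z. ?w k * nf_cl k z)"
      by (rule sc_limit_mult[OF sc_limit_const sc_limit_nf[OF valid[OF k]]])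
    then have lim: "sc_limit (nf_wt k) (\<lambda>z. ?w k * ev (gen_fun a z) (nf_poly k)) (\<lambda>z. ?w k * nf_cl k z)"
      by simp
    show "sc_limit N (\<lambda>z. ?w k * ev (gen_fun a z) (nf_poly k)) (\<lambda>z. if nf_wt k = N then ?w k * nf_cl k z else 0)"
    proof (cases "nf_wt k = N")
      case True
      then show ?thesis using lim by simp
    next
      case False
      have "sc_limit (N - nf_wt k) (\<lambda>_. 1) (\<lambda>_. 0 ^ (N - nf_wt k))"
        unfolding sc_limit_def by (auto intro!: tendsto_eq_intros)
      from sc_limit_mult[OF this lim] show ?thesis
        using le False by (simp add: power_0_left)
    qed
  qed
  then have "(\<Sum>k\<in>?K. if nf_wt k = N then ?w k * nf_cl k z else 0) = 0" for z
    unfolding van by (rule sc_limit_vanish)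
  then have "(\<Sum>k\<in>{k\<in>?K. nf_wt k = N}. ?w k * nf_cl k z) = 0" for z
    by (simp add: sum.inter_filter)
  then have "?w k0 = 0"
    using k0 valid by (intro nf_cl_independent[of "{k\<in>?K. nf_wt k = N}" ?w]) simp_all
  with k0 show False by (simp add: in_keys_iff)
qed

lemma kernel_eq_rel_ideal:
  "a_kernel (mpoly_ring (zgens d)) (cherednik_center d \<zeta> c) center_map = rel_ideal"
proof -
  have "p \<in> rel_ideal" if p: "p \<in> mcarrier (zgens d)" and van: "\<And>z. ev (gen_fun a z) p = 0" for p
  proof -
    let ?E = "pext (\<lambda>k y. pconst y * nf_poly k)"
    obtain w where w: "\<forall>k\<in>Poly_Mapping.keys w. valid_base (nf_base k)" "p - ?E w \<in> rel_ideal"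
      using nf_span_extract[OF nf_span_UNIV[OF p]] by blast
    have "(\<Sum>k\<in>Poly_Mapping.keys w. Poly_Mapping.lookup w k * ev (gen_fun a z) (nf_poly k)) = 0" for z
    proof -
      have "ev (gen_fun a z) (p - ?E w) = 0" using rel_ideal_vanish[OF w(2)] by blast
      then show ?thesis
        by (simp add: ev_hom van pext_def ev_sum)
    qed
    then have "w = 0"
      using w(1) by (intro nf_poly_independent) auto
    with w(2) show ?thesis by simp
  qed
  then show ?thesis
    unfolding kernel_center_map using rel_ideal_vanish by blast
qed

lemma presentation:
  "admits_presentation (cherednik_center d \<zeta> c) (cherednik_scalar d \<zeta> c) (zgens d) (zgen_val d \<zeta> c) (center_rels d a)"
  unfolding admits_presentation_def
  by (intro bexI[OF _ center_map_hom] conjI allI ballI center_map_scalar center_map_gen center_map_surj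
      kernel_eq_rel_ideal[unfolded rel_ideal_def])

end

theorem theorem2p9:
  fixes d :: nat and \<zeta> a b :: complex and c :: "complex^2^2 \<Rightarrow> complex"
  assumes "2 \<le> d"
    and "primitive_root_of_unity d \<zeta>"
    and "conj_invariant d \<zeta> c"
    and "a = c (refl_mat \<zeta> 0)"
    and "b = c (refl_mat \<zeta> 1)"
    and "a = b"
  shows "admits_presentation (cherednik_center d \<zeta> c) (cherednik_scalar d \<zeta> c)
           (zgens d) (zgen_val d \<zeta> c) (center_rels d a)"
proof -
  interpret dihedral_root d \<zeta>
    by standard fact+
  interpret cherednik_param d \<zeta> c a
    by standard (rule conj_invariant_const, use assms in simp_all)
  show ?thesis by (rule presentation)
qed

end
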